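(* Let $\Omega$ be the three-dimensional flat torus with a tetrahedral mesh $\mathcal T_h$, and let $X_h^0,X_h^1,X_h^2,X_h^3$, $\mathcal C^0\otimes\mathbb V$, $\mathcal C^1$, $\mathcal C_1$, $\mathcal C_0\otimes\mathbb V$ and $J_h^0,\dots,J_h^3$ be as defined in the context. The maps $$J_h^0:X_h^0\to \mathcal C^0\otimes\mathbb V,\quad J_h^1:X_h^1\to\mathcal C^1,\quad J_h^2:X_h^2\to\mathcal C_1,\quad J_h^3:X_h^3\to\mathcal C_0\otimes\mathbb V$$ are isomorphisms. Define linear maps $\mathsf r_0,\mathsf r_1,\mathsf r_2$ by requiring $$\mathsf r_0J_h^0u=J_h^1\varepsilon u \ \ \forall u\in X_h^0,\qquad \mathsf r_1J_h^1u=J_h^2\operatorname{inc}u\ \ \forall u\in X_h^1,\qquad \mathsf r_2J_h^2u=J_h^3\operatorname{div}u\ \ \forall u\in X_h^2 .$$ Then $$\mathcal C^0\otimes\mathbb V\xrightarrow{\mathsf r_0}\mathcal C^1\xrightarrow{\mathsf r_1}\mathcal C_1\xrightarrow{\mathsf r_2}\mathcal C_0\otimes\mathbb V$$ is a complex, isomorphic via the maps $J_h^k$ to Christiansen's complex $X_h^0\xrightarrow{\varepsilon}X_h^1\xrightarrow{\operatorname{inc}}X_h^2\xrightarrow{\operatorname{div}}X_h^3$. The maps are given explicitly by $$\mathsf r_0(L\,y^* )=\sum_{e=[x,y]\in\Delta_1}(L\cdot t_e)\,e^*\qquad (y\in\Delta_0,\ L\in\mathbb V),$$ equivalently $\langle\mathsf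 r_0(L\,y^* ),e\rangle=L\cdot t_e\,\big(\lambda_y(z)-\lambda_y(x)\big)$ for $e=[x,z]$; $$\mathsf r_1 e^*=\sum_{g\in\mathfrak B(e)}[\![\psi_e]\!]_g\; g\qquad(e\in\Delta_1),$$ equivalently $\langle g^*,\mathsf r_1e^*\rangle=[\![\psi_e]\!]_g$; and $$\mathsf r_2 e=t_e\,(z-x)\qquad (e=[x,z]\in\Delta_1),$$ where $t_e(z-x)$ denotes the vector-valued $0$-chain $t_e\,z-t_e\,x$.
   Context: Setting. $\Omega$ is the three-dimensional flat torus (the unit cube with opposite faces glued), and $\mathcal T_h$ is a tetrahedral mesh of the cube whose faces match under the gluing, so that it is a valid simplicial complex of the torus. $\Delta_\ell$ is the set of $\ell$-dimensional simplices of $\mathcal T_h$, and $\Delta_\ell(T)$ the set of $\ell$-dimensional subsimplices of a simplex $T$. Simplices $[x_0,\dots,x_k]$ are oriented: permuting two vertices gives the negative simplex. For an edge $e=[x,z]$, $t_e$ is the unit tangent vector pointing from $x$ to $z$. $\mathbb V=\mathbb R^3$ and $\mathbb S$ is the space of symmetric $3\times3$ real matrices. $(\cdot,\cdot)$ is the $L^2(\Omega)$ inner product of vector or matrix fields. $P^k(T)$ is the space of polynomials of degree at most $k$ on $T$. Operators. $\varepsilon=\operatorname{sym}\operatorname{grad}$. For matrix fields $\operatorname{curl}$ and $\operatorname{div}$ act row-wise, and $\operatorname{inc}u=\operatorname{curl}\big((\operatorname{curl}u)^T\big)$. Christiansen's discrete spaces. - $X_h^0=\{v\in C(\Omega)\otimes\mathbb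 V: v|_T\in P^1(T)\otimes\mathbb V\ \forall T\in\mathcal T_h\}$. - $X_h^1=\{m\in L^2(\Omega)\otimes\mathbb S: m|_T\in P^0(T)\otimes\mathbb S\ \forall T\in\mathcal T_h,\ \int_e t_e^Tm\,t_e \text{ is single-valued } \forall e\in\Delta_1\}$. - $X_h^2=\{\sum_{e}a_e\,t_et_e^T\delta_e: a_e\in\mathbb R\}$, where $\langle\delta_e,v\rangle=\int_e v$ and $\langle\sum_e a_et_et_e^T\delta_e,m\rangle=\sum_e a_e\int_e t_e^Tm\,t_e$ for $m\in C^\infty(\Omega)\otimes\mathbb S$; the same formula is used to pair with $m\in X_h^1$. - $X_h^3=\{\sum_{y}a_y\delta_y: a_y\in\mathbb V\}$, where $\langle\delta_y,v\rangle=v(y)$ and $\langle\sum_y a_y\delta_y,u\rangle=\sum_y a_y\cdot u(y)$ for $u\in C^\infty(\Omega)\otimes\mathbb V$; the same formula is used to pair with $u\in X_h^0$. Operators on the distributional part. For $u\in X_h^1$, $\operatorname{inc}u$ is the distribution $\langle\operatorname{inc}u,v\rangle=(u,\operatorname{inc}v)$ for all $v\in C^\infty(\Omega)\otimes\mathbb S$; Christiansen's result, as recalled in the source, is $\operatorname{inc}u=\sum_{e\in\Delta_1}[\![u]\!]_e\,t_et_e^T\delta_e$, where $$[\![u]\!]_e=\sum_{F\in\Delta_2,\ e\in\Delta_1(F)}m_{eF}^T\,[\![u]\!]_{eF}\,n_{eF}.$$ Here $m_{eF}$ is the unit vector tangent to $F$, perpendicular to $t_e$, pointing into $F$; $n_{eF}$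 is perpendicular to $F$ with $t_e\times m_{eF}=n_{eF}$ and $t_e\times n_{eF}=-m_{eF}$; and if $T_1,T_2$ are the two tetrahedra sharing $F$ and $n_{eF}$ points into $T_1$ (out of $T_2$), then $[\![u]\!]_{eF}=u|_{T_1}-u|_{T_2}$. On $X_h^2$, $\operatorname{div}$ is given by $\operatorname{div}(t_et_e^T\delta_e)=t_e(\delta_z-\delta_x)$ for $e=[x,z]\in\Delta_1$. Basis functions. For $y\in\Delta_0$, $\lambda_y$ is the continuous piecewise linear function on $\mathcal T_h$ with $\lambda_y(y)=1$ and $\lambda_y(z)=0$ for every other vertex $z$. For $e\in\Delta_1$, $\psi_e$ is the unique element of $X_h^1$ with $\int_g t_g^T\psi_e t_g=1$ if $g=e$ and $=0$ if $g\in\Delta_1$, $g\neq\pm e$. Chains and co-chains. $\mathcal C_1=\{\sum_{\sigma\in\Delta_1}a_\sigma\sigma:a_\sigma\in\mathbb R\}$ and $\mathcal C^1$ is the space of linear functionals on $\mathcal C_1$; for $\sigma\in\Delta_1$, $\sigma^*\in\mathcal C^1$ satisfies $\langle\sigma^*,\sigma\rangle=1$ and $\langle\sigma^*,\tau\rangle=0$ if $\tau\in\Delta_1$ is not a permutation of $\sigma$. $\mathcal C_0\otimes\mathbb V$ is the space of vector-valued $0$-chains $\sum_{z\in\Delta_0}b_z\,z$ with $b_z\in\mathbb V$, and $\mathcal C^0\otimes\mathbb V$ is the space of vector-valued $0$-co-chains $\sum_{y\in\Delta_0}c_y\,y^*$ with $c_y\in\mathbb V$, with $\langle\sum_y c_yy^*,\sum_z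 b_zz\rangle=\sum_y c_y\cdot b_y$. The maps $J_h^k$ are defined by: - $\langle J_h^0u,L\,y\rangle=L\cdot u(y)$ for $u\in X_h^0$, $y\in\Delta_0$, $L\in\mathbb V$; - $\langle J_h^1u,e\rangle=\int_et_e^Tu\,t_e$ for $u\in X_h^1$, $e\in\Delta_1$; - $\langle e^*,J_h^2w\rangle=\langle w,\psi_e\rangle$ for $w\in X_h^2$, $e\in\Delta_1$; - $\langle L\,y^*,J_h^3u\rangle=\langle u,L\lambda_y\rangle$ for $u\in X_h^3$, $y\in\Delta_0$, $L\in\mathbb V$. $\mathfrak B(e)$ is the set of edges $g\in\Delta_1$ such that some tetrahedron of $\mathcal T_h$ has both $e$ and $g$ as edges.
   Formalization: With the stated conventions the distributional inc is minus the jump formula; both are covered: the r_1 formulas hold as printed for the jump formula and with a factor -1 for the distributional inc. Δ_1 has one orientation per edge; in r_0 the sum is over all edges at y with t_e towards y. *)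

theory Defs
  imports "HOL-Analysis.Analysis" "HOL-Library.Function_Algebras"
begin

section \<open>Vector spaces of functions\<close>

text \<open>All spaces below are subspaces of function spaces, with the pointwise operations of
  \<^theory>\<open>HOL-Library.Function_Algebras\<close>, or of the space of classes of fields defined below.\<close>

instantiation "fun" :: (type, real_vector) real_vector
begin

definition scaleR_fun :: "real \<Rightarrow> ('a \<Rightarrow> 'b) \<Rightarrow> 'a \<Rightarrow> 'b"
  where "scaleR_fun c f = (\<lambda>x. c *\<^sub>R f x)"

instance
  by standard (auto simp: scaleR_fun_def plus_fun_def fun_eq_iff scaleR_add_right scaleR_add_left)

end

definition linear_on :: "'a::real_vector set \<Rightarrow> ('a \<Rightarrow> 'b::real_vector) \<Rightarrow> bool"
  where "linear_on V f \<longleftrightarrow>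
    (\<forall>x\<in>V. \<forall>y\<in>V. f (x + y) = f x + f y) \<and> (\<forall>c. \<forall>x\<in>V. f (c *\<^sub>R x) = c *\<^sub>R f x)"

definition lin_iso ::
    "'a::real_vector set \<Rightarrow> 'b::real_vector set \<Rightarrow> ('a \<Rightarrow> 'b) \<Rightarrow> bool"
  where "lin_iso V W f \<longleftrightarrow> subspace V \<and> subspace W \<and> linear_on V f \<and> bij_betw f V W"

definition four_complex ::
    "'a::real_vector set \<Rightarrow> ('a \<Rightarrow> 'b::real_vector) \<Rightarrow> 'b set \<Rightarrow> ('b \<Rightarrow> 'c::real_vector) \<Rightarrow> 'c set
      \<Rightarrow> ('c \<Rightarrow> 'd::real_vector) \<Rightarrow> 'd set \<Rightarrow> bool"
  where "four_complex A0 d0 A1 d1 A2 d2 A3 \<longleftrightarrow>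
    subspace A0 \<and> subspace A1 \<and> subspace A2 \<and> subspace A3 \<and>
    linear_on A0 d0 \<and> linear_on A1 d1 \<and> linear_on A2 d2 \<and>
    d0 ` A0 \<subseteq> A1 \<and> d1 ` A1 \<subseteq> A2 \<and> d2 ` A2 \<subseteq> A3 \<and>
    (\<forall>x\<in>A0. d1 (d0 x) = 0) \<and> (\<forall>x\<in>A1. d2 (d1 x) = 0)"

section \<open>The flat torus and its meshes\<close>

type_synonym pt = "real^3"
type_synonym mat3 = "real^3^3"

text \<open>The torus is the quotient of the space by the integer lattice. A point of the torus is
  represented by its unique lift in the half-open unit cube; functions on the torus are periodic
  functions on the space.\<close>

definition int_lattice :: "pt set"
  where "int_lattice = {k. \<forall>i. k $ i \<in> \<int>}"

definition torus_pt :: "pt \<Rightarrow> pt"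
  where "torus_pt x = (\<chi> i. frac (x $ i))"

definition periodic :: "(pt \<Rightarrow> 'a) \<Rightarrow> bool"
  where "periodic f \<longleftrightarrow> (\<forall>k\<in>int_lattice. \<forall>x. f (x + k) = f x)"

definition cube :: "pt set"
  where "cube = cbox 0 1"

definition vertices_of :: "pt set \<Rightarrow> pt set"
  where "vertices_of S = {v. v extreme_point_of S}"

text \<open>A mesh is given by its closed tetrahedra in the closed cube. The third-last condition is the
  matching of the faces under the gluing. The last two say that the image in the torus is a
  simplicial complex: a tetrahedron has four distinct vertices in the torus, and simplices
  of the torus are determined by their vertex sets.\<close>

definition torus_mesh :: "pt set set \<Rightarrow> bool"
  where "torus_mesh K \<longleftrightarrow>
    triangulation K \<and> (\<forall>T\<in>K. 3 simplex T) \<and> \<Union>K = cube \<and>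
    (\<forall>i F. 2 simplex F \<and> F \<subseteq> {x. x $ i = 0} \<longrightarrow>
       ((\<exists>T\<in>K. F face_of T) \<longleftrightarrow> (\<exists>T\<in>K. ((+) (axis i 1) ` F) face_of T))) \<and>
    (\<forall>T\<in>K. inj_on torus_pt (vertices_of T)) \<and>
    (\<forall>T\<in>K. \<forall>T'\<in>K. \<forall>S S'. S face_of T \<and> S' face_of T' \<and>
       torus_pt ` vertices_of S = torus_pt ` vertices_of S' \<longrightarrow> (\<exists>k\<in>int_lattice. S' = (+) k ` S))"

text \<open>The lifts to the space of the tetrahedra of the torus, and of their subsimplices.\<close>

definition tets :: "pt set set \<Rightarrow> pt set set"
  where "tets K = {(+) k ` T | k T. k \<in> int_lattice \<and> T \<in> K}"

definition subsimps :: "pt set set \<Rightarrow> int \<Rightarrow> pt set set"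
  where "subsimps K l = {S. l simplex S \<and> (\<exists>T\<in>tets K. S face_of T)}"

definition mesh_vertices :: "pt set set \<Rightarrow> pt set"
  where "mesh_vertices K = {y. {y} \<in> subsimps K 0 \<and> torus_pt y = y}"

text \<open>An oriented edge \<open>[x,z]\<close> of the torus is represented by its lift \<open>(x, z)\<close> whose initial
  point lies in the half-open unit cube; the end point \<open>z\<close> need not lie there.\<close>

type_synonym edge = "pt \<times> pt"

definition edges :: "pt set set \<Rightarrow> edge set"
  where "edges K = {(x, z). x \<noteq> z \<and> closed_segment x z \<in> subsimps K 1 \<and> torus_pt x = x}"

definition rev_edge :: "edge \<Rightarrow> edge"
  where "rev_edge = (\<lambda>(x, z). (torus_pt z, torus_pt z + (x - z)))"

definition tail :: "edge \<Rightarrow> pt"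
  where "tail e = fst e"

definition head :: "edge \<Rightarrow> pt"
  where "head e = torus_pt (snd e)"

definition seg :: "edge \<Rightarrow> pt set"
  where "seg e = closed_segment (fst e) (snd e)"

definition tangent :: "edge \<Rightarrow> pt"
  where "tangent e = sgn (snd e - fst e)"

text \<open>The set of oriented edges \<open>\<Delta>\<^sub>1\<close> indexing bases and sums contains every edge of the mesh with
  exactly one of its two orientations.\<close>

definition orientation :: "pt set set \<Rightarrow> edge set \<Rightarrow> bool"
  where "orientation K E \<longleftrightarrow> E \<subseteq> edges K \<and> (\<forall>e\<in>edges K. e \<in> E \<longleftrightarrow> rev_edge e \<notin> E)"

definition patch :: "pt set set \<Rightarrow> edge set \<Rightarrow> edge \<Rightarrow> edge set"
  where "patch K E e = {g \<in> E. \<exists>T\<in>K.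
    (\<exists>k\<in>int_lattice. ((+) k ` seg e) face_of T) \<and> (\<exists>k\<in>int_lattice. ((+) k ` seg g) face_of T)}"

definition edge_integral :: "edge \<Rightarrow> (pt \<Rightarrow> real) \<Rightarrow> real"
  where "edge_integral e f = norm (snd e - fst e) *
    integral {0..1} (\<lambda>s. f (fst e + s *\<^sub>R (snd e - fst e)))"

section \<open>Square-integrable fields on the torus\<close>

text \<open>Fields on the torus modulo equality almost everywhere; the boundary of the cube is a
  null set.\<close>

quotient_type (overloaded) 'a field_class = "pt \<Rightarrow> 'a::real_vector" /
  "\<lambda>f g. AE x in lebesgue. x \<in> cube \<longrightarrow> f x = g x"
proof (rule equivpI)
  show "reflp (\<lambda>f g :: pt \<Rightarrow> 'a. AE x in lebesgue. x \<in> cube \<longrightarrow> f x = g x)"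
    by (simp add: reflp_def)
  show "symp (\<lambda>f g :: pt \<Rightarrow> 'a. AE x in lebesgue. x \<in> cube \<longrightarrow> f x = g x)"
    by (simp add: symp_def eq_commute)
  show "transp (\<lambda>f g :: pt \<Rightarrow> 'a. AE x in lebesgue. x \<in> cube \<longrightarrow> f x = g x)"
  proof (rule transpI)
    fix f g h :: "pt \<Rightarrow> 'a"
    assume "AE x in lebesgue. x \<in> cube \<longrightarrow> f x = g x" "AE x in lebesgue. x \<in> cube \<longrightarrow> g x = h x"
    then show "AE x in lebesgue. x \<in> cube \<longrightarrow> f x = h x"
      by eventually_elim simp
  qed
qed

instantiation field_class :: (real_vector) real_vector
begin

lift_definition zero_field_class :: "'a field_class" is "\<lambda>x. 0" .

lift_definition plus_field_class :: "'a field_class \<Rightarrow> 'a field_class \<Rightarrow> 'a field_class"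
  is "\<lambda>f g x. f x + g x"
  by (erule (1) eventually_elim2) simp

lift_definition minus_field_class :: "'a field_class \<Rightarrow> 'a field_class \<Rightarrow> 'a field_class"
  is "\<lambda>f g x. f x - g x"
  by (erule (1) eventually_elim2) simp

lift_definition uminus_field_class :: "'a field_class \<Rightarrow> 'a field_class"
  is "\<lambda>f x. - f x"
  by (erule eventually_mono) simp

lift_definition scaleR_field_class :: "real \<Rightarrow> 'a field_class \<Rightarrow> 'a field_class"
  is "\<lambda>c f x. c *\<^sub>R f x"
  by (erule eventually_mono) simp

instance
proof
  fix a b c :: "'a field_class" and r s :: real
  show "a + b + c = a + (b + c)" by transfer (simp add: add.assoc)
  show "a + b = b + a" by transfer (simp add: add.commute)
  show "0 + a = a" by transfer simp
  show "- a + a = 0" by transfer simp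
  show "a - b = a + - b" by transfer simp
  show "r *\<^sub>R (a + b) = r *\<^sub>R a + r *\<^sub>R b" by transfer (simp add: scaleR_add_right)
  show "(r + s) *\<^sub>R a = r *\<^sub>R a + s *\<^sub>R a" by transfer (simp add: scaleR_add_left)
  show "r *\<^sub>R s *\<^sub>R a = (r * s) *\<^sub>R a" by transfer simp
  show "1 *\<^sub>R a = a" by transfer simp
qed

end

lift_definition class_of :: "(pt \<Rightarrow> 'a::real_vector) \<Rightarrow> 'a field_class" is "\<lambda>f. f" .

definition L2_fields :: "'a::euclidean_space field_class set"
  where "L2_fields = {class_of f | f. f \<in> borel_measurable (lebesgue_on cube) \<and>
    integrable (lebesgue_on cube) (\<lambda>x. (norm (f x))\<^sup>2)}"

lift_definition l2_inner :: "'a::euclidean_space field_class \<Rightarrow> 'a field_class \<Rightarrow> real"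
  is "\<lambda>f g. set_lebesgue_integral lebesgue cube (\<lambda>x. f x \<bullet> g x)"
proof -
  fix f f' g g' :: "pt \<Rightarrow> 'a"
  assume "AE x in lebesgue. x \<in> cube \<longrightarrow> f x = f' x" "AE x in lebesgue. x \<in> cube \<longrightarrow> g x = g' x"
  then have ae: "AE x in lebesgue.
      indicat_real cube x *\<^sub>R (f x \<bullet> g x) = indicat_real cube x *\<^sub>R (f' x \<bullet> g' x)"
      (is "AE x in lebesgue. ?a x = ?b x")
    by (rule eventually_elim2) (auto simp: indicator_def)
  then have ae': "AE x in lebesgue. ?b x = ?a x"
    by (rule eventually_mono) (rule sym)
  show "set_lebesgue_integral lebesgue cube (\<lambda>x. f x \<bullet> g x) =
      set_lebesgue_integral lebesgue cube (\<lambda>x. f' x \<bullet> g' x)"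
    unfolding set_lebesgue_integral_def
  proof (cases "?a \<in> borel_measurable lebesgue")
    case True
    then have "?b \<in> borel_measurable lebesgue"
      using ae by (rule borel_measurable_AE)
    with True show "integral\<^sup>L lebesgue ?a = integral\<^sup>L lebesgue ?b"
      using ae by (rule integral_cong_AE)
  next
    case False
    then have "?b \<notin> borel_measurable lebesgue"
      using borel_measurable_AE[OF _ ae'] by (rule contrapos_nn)
    then have b: "\<not> integrable lebesgue ?b"
      by (rule contrapos_nn) (rule borel_measurable_integrable)
    from False have a: "\<not> integrable lebesgue ?a"
      by (rule contrapos_nn) (rule borel_measurable_integrable)
    show "integral\<^sup>L lebesgue ?a = integral\<^sup>L lebesgue ?b"
      by (rule trans[OF not_integrable_integral_eq[OF a] not_integrable_integral_eq[OF b, symmetric]])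
  qed
qed

lift_definition const_on :: "'a::real_vector field_class \<Rightarrow> pt set \<Rightarrow> 'a \<Rightarrow> bool"
  is "\<lambda>f T A. AE x in lebesgue. x \<in> cube \<and> x \<in> T \<longrightarrow> f x = A"
proof (rule ext, rule ext)
  fix f g :: "pt \<Rightarrow> 'a" and T :: "pt set" and A :: 'a
  assume "AE x in lebesgue. x \<in> cube \<longrightarrow> f x = g x"
  then have "AE x in lebesgue.
      (x \<in> cube \<and> x \<in> T \<longrightarrow> f x = A) \<longleftrightarrow> (x \<in> cube \<and> x \<in> T \<longrightarrow> g x = A)"
    by (rule eventually_mono) (metis (full_types))
  then show "(AE x in lebesgue. x \<in> cube \<and> x \<in> T \<longrightarrow> f x = A) \<longleftrightarrow>
      (AE x in lebesgue. x \<in> cube \<and> x \<in> T \<longrightarrow> g x = A)"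
    by (rule eventually_subst)
qed

text \<open>The constant value \<open>u|\<^sub>T\<close> on a lifted tetrahedron \<open>T\<close>.\<close>

definition val :: "pt set set \<Rightarrow> 'a::real_vector field_class \<Rightarrow> pt set \<Rightarrow> 'a"
  where "val K u T = (THE A. \<exists>k\<in>int_lattice. \<exists>T0\<in>K. T = (+) k ` T0 \<and> const_on u T0 A)"

section \<open>Smooth test fields and differential operators\<close>

definition partial :: "3 \<Rightarrow> (pt \<Rightarrow> 'a::real_normed_vector) \<Rightarrow> pt \<Rightarrow> 'a"
  where "partial i f x = frechet_derivative f (at x) (axis i 1)"

definition smooth :: "(pt \<Rightarrow> 'a::real_normed_vector) \<Rightarrow> bool"
  where "smooth f \<longleftrightarrow> (\<forall>ks. foldr partial ks f differentiable_on UNIV)"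

definition test_V :: "(pt \<Rightarrow> pt) set"
  where "test_V = {v. smooth v \<and> periodic v}"

definition test_S :: "(pt \<Rightarrow> mat3) set"
  where "test_S = {v. smooth v \<and> periodic v \<and> (\<forall>x. transpose (v x) = v x)}"

definition curl :: "(pt \<Rightarrow> pt) \<Rightarrow> pt \<Rightarrow> pt"
  where "curl v x = vector [partial 2 v x $ 3 - partial 3 v x $ 2,
    partial 3 v x $ 1 - partial 1 v x $ 3, partial 1 v x $ 2 - partial 2 v x $ 1]"

definition mcurl :: "(pt \<Rightarrow> mat3) \<Rightarrow> pt \<Rightarrow> mat3"
  where "mcurl A x = (\<chi> i. curl (\<lambda>p. A p $ i) x)"

definition inc_smooth :: "(pt \<Rightarrow> mat3) \<Rightarrow> pt \<Rightarrow> mat3"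
  where "inc_smooth v = mcurl (\<lambda>x. transpose (mcurl v x))"

text \<open>The symmetric gradient, for fields that are differentiable almost everywhere.\<close>

definition eps :: "(pt \<Rightarrow> pt) \<Rightarrow> mat3 field_class"
  where "eps u = class_of (\<lambda>x. let D = matrix (frechet_derivative u (at x))
    in (1/2) *\<^sub>R (D + transpose D))"

section \<open>Christiansen's discrete spaces\<close>

definition pw_linear :: "pt set set \<Rightarrow> (pt \<Rightarrow> 'a::real_normed_vector) set"
  where "pw_linear K = {v. periodic v \<and> continuous_on UNIV v \<and>
    (\<forall>T\<in>K. \<exists>A b. linear A \<and> (\<forall>x\<in>T. v x = A x + b))}"

definition X0 :: "pt set set \<Rightarrow> (pt \<Rightarrow> pt) set"
  where "X0 K = pw_linear K"

definition edge_moment_on :: "pt set set \<Rightarrow> mat3 field_class \<Rightarrow> edge \<Rightarrow> pt set \<Rightarrow> real"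
  where "edge_moment_on K m e T = edge_integral e (\<lambda>x. tangent e \<bullet> (val K m T *v tangent e))"

definition X1 :: "pt set set \<Rightarrow> mat3 field_class set"
  where "X1 K = {m \<in> L2_fields.
    (\<forall>T\<in>K. \<exists>A. transpose A = A \<and> const_on m T A) \<and>
    (\<forall>e\<in>edges K. \<exists>r. \<forall>T\<in>tets K. seg e face_of T \<longrightarrow> edge_moment_on K m e T = r)}"

text \<open>The single value of \<open>\<integral>\<^sub>e t\<^sub>e\<^sup>T m t\<^sub>e\<close>.\<close>

definition edge_moment :: "pt set set \<Rightarrow> mat3 field_class \<Rightarrow> edge \<Rightarrow> real"
  where "edge_moment K m e = (THE r. \<forall>T\<in>tets K. seg e face_of T \<longrightarrow> edge_moment_on K m e T = r)"

text \<open>Distributions are functionals on test fields, extended by zero to all other fields.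
  \<open>edge_delta e\<close> is \<open>t\<^sub>e t\<^sub>e\<^sup>T \<delta>\<^sub>e\<close> and \<open>pt_delta a y\<close> is \<open>a \<delta>\<^sub>y\<close>.\<close>

definition edge_delta :: "edge \<Rightarrow> (pt \<Rightarrow> mat3) \<Rightarrow> real"
  where "edge_delta e = (\<lambda>v. if v \<in> test_S
    then edge_integral e (\<lambda>x. tangent e \<bullet> (v x *v tangent e)) else 0)"

definition pt_delta :: "pt \<Rightarrow> pt \<Rightarrow> (pt \<Rightarrow> pt) \<Rightarrow> real"
  where "pt_delta a y = (\<lambda>v. if v \<in> test_V then a \<bullet> v y else 0)"

definition X2 :: "edge set \<Rightarrow> ((pt \<Rightarrow> mat3) \<Rightarrow> real) set"
  where "X2 E = {\<Sum>e\<in>E. a e *\<^sub>R edge_delta e | a. True}"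

definition X3 :: "pt set set \<Rightarrow> ((pt \<Rightarrow> pt) \<Rightarrow> real) set"
  where "X3 K = {\<Sum>y\<in>mesh_vertices K. pt_delta (a y) y | a. True}"

text \<open>The coefficients of elements of \<open>X2\<close> and \<open>X3\<close>, and the pairings with \<open>X1\<close> and \<open>X0\<close>.\<close>

definition coef2 :: "edge set \<Rightarrow> ((pt \<Rightarrow> mat3) \<Rightarrow> real) \<Rightarrow> edge \<Rightarrow> real"
  where "coef2 E w = (THE a. (\<forall>e. e \<notin> E \<longrightarrow> a e = 0) \<and> w = (\<Sum>e\<in>E. a e *\<^sub>R edge_delta e))"

definition coef3 :: "pt set set \<Rightarrow> ((pt \<Rightarrow> pt) \<Rightarrow> real) \<Rightarrow> pt \<Rightarrow> pt"
  where "coef3 K w = (THE a. (\<forall>y. y \<notin> mesh_vertices K \<longrightarrow> a y = 0) \<and>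
    w = (\<Sum>y\<in>mesh_vertices K. pt_delta (a y) y))"

definition pair2 :: "pt set set \<Rightarrow> edge set \<Rightarrow> ((pt \<Rightarrow> mat3) \<Rightarrow> real) \<Rightarrow> mat3 field_class \<Rightarrow> real"
  where "pair2 K E w m = (\<Sum>e\<in>E. coef2 E w e * edge_moment K m e)"

definition pair3 :: "pt set set \<Rightarrow> ((pt \<Rightarrow> pt) \<Rightarrow> real) \<Rightarrow> (pt \<Rightarrow> pt) \<Rightarrow> real"
  where "pair3 K w u = (\<Sum>y\<in>mesh_vertices K. coef3 K w y \<bullet> u y)"

section \<open>Operators on the distributional part\<close>

definition inc_distr :: "mat3 field_class \<Rightarrow> (pt \<Rightarrow> mat3) \<Rightarrow> real"
  where "inc_distr u = (\<lambda>v. if v \<in> test_S then l2_inner u (class_of (inc_smooth v)) else 0)"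

text \<open>\<open>m_vec e F\<close> is the unit vector tangent to \<open>F\<close>, orthogonal to \<open>e\<close> and pointing into \<open>F\<close>.
  The two conditions \<open>t \<times> m = n\<close> and \<open>t \<times> n = -m\<close> on the normal \<open>n\<close> are equivalent to
  the first of them. \<open>adj_tet K F p n\<close> is the tetrahedron containing the face \<open>F\<close> that \<open>n\<close> points
  into, for a point \<open>p\<close> of \<open>F\<close>.\<close>

definition m_vec :: "edge \<Rightarrow> pt set \<Rightarrow> pt"
  where "m_vec e F = (THE m. norm m = 1 \<and> m \<bullet> tangent e = 0 \<and>
    (\<exists>s>0. midpoint (fst e) (snd e) + s *\<^sub>R m \<in> F))"

definition n_vec :: "edge \<Rightarrow> pt set \<Rightarrow> pt"
  where "n_vec e F = cross3 (tangent e) (m_vec e F)"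

definition adj_tet :: "pt set set \<Rightarrow> pt set \<Rightarrow> pt \<Rightarrow> pt \<Rightarrow> pt set"
  where "adj_tet K F p n = (THE T. T \<in> tets K \<and> F face_of T \<and> (\<exists>q\<in>T. (q - p) \<bullet> n > 0))"

definition face_jump :: "pt set set \<Rightarrow> mat3 field_class \<Rightarrow> edge \<Rightarrow> pt set \<Rightarrow> mat3"
  where "face_jump K u e F =
    val K u (adj_tet K F (fst e) (n_vec e F)) - val K u (adj_tet K F (fst e) (- n_vec e F))"

definition jump :: "pt set set \<Rightarrow> mat3 field_class \<Rightarrow> edge \<Rightarrow> real"
  where "jump K u e = (\<Sum>F | F \<in> subsimps K 2 \<and> seg e face_of F.
    m_vec e F \<bullet> (face_jump K u e F *v n_vec e F))"

definition inc_jump :: "pt set set \<Rightarrow> edge set \<Rightarrow> mat3 field_class \<Rightarrow> (pt \<Rightarrow> mat3) \<Rightarrow> real"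
  where "inc_jump K E u = (\<Sum>e\<in>E. jump K u e *\<^sub>R edge_delta e)"

text \<open>With the orientation conventions of the jumps above (\<open>t, m, n\<close> right-handed, value on the
  side that \<open>n\<close> points into minus value on the other side), \<open>inc_distr u = - inc_jump K E u\<close>. For
  instance, if \<open>e\<close> lies on the third axis and \<open>u\<close> equals the symmetric matrix with entries
  \<open>u\<^sub>1\<^sub>2 = u\<^sub>2\<^sub>1 = 1\<close> and zero otherwise in the first quadrant of the first two coordinates, and zero
  elsewhere, then \<open>(inc u)\<^sub>3\<^sub>3 = - 2 \<partial>\<^sub>1 \<partial>\<^sub>2 u\<^sub>1\<^sub>2 = - 2 \<delta>\<^sub>e\<close>, while both faces of the quadrant
  contribute \<open>1\<close> to the jump at \<open>e\<close>.\<close>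

definition div_distr :: "edge set \<Rightarrow> ((pt \<Rightarrow> mat3) \<Rightarrow> real) \<Rightarrow> (pt \<Rightarrow> pt) \<Rightarrow> real"
  where "div_distr E w = (\<Sum>e\<in>E. coef2 E w e *\<^sub>R
    (pt_delta (tangent e) (head e) - pt_delta (tangent e) (tail e)))"

section \<open>Basis functions\<close>

definition hat :: "pt set set \<Rightarrow> pt \<Rightarrow> pt \<Rightarrow> real"
  where "hat K y = (THE f. f \<in> pw_linear K \<and> f y = 1 \<and> (\<forall>z\<in>mesh_vertices K. z \<noteq> y \<longrightarrow> f z = 0))"

definition psi :: "pt set set \<Rightarrow> edge \<Rightarrow> mat3 field_class"
  where "psi K e = (THE m. m \<in> X1 K \<and> edge_moment K m e = 1 \<and>
    (\<forall>g\<in>edges K. g \<noteq> e \<and> g \<noteq> rev_edge e \<longrightarrow> edge_moment K m g = 0))"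

section \<open>Chains and co-chains\<close>

text \<open>The coefficients of a 1-chain are indexed by all oriented edges, so that
  \<open>edge_chain (rev_edge e) = - edge_chain e\<close>. Co-chains are linear functionals on chains,
  extended by zero outside the space of chains.\<close>

definition edge_chain :: "edge \<Rightarrow> edge \<Rightarrow> real"
  where "edge_chain e = (\<lambda>g. if g = e then 1 else if g = rev_edge e then -1 else 0)"

definition chains1 :: "edge set \<Rightarrow> (edge \<Rightarrow> real) set"
  where "chains1 E = {\<Sum>e\<in>E. a e *\<^sub>R edge_chain e | a. True}"

definition cochains1 :: "edge set \<Rightarrow> ((edge \<Rightarrow> real) \<Rightarrow> real) set"
  where "cochains1 E = {\<phi>. linear_on (chains1 E) \<phi> \<and> (\<forall>c. c \<notin> chains1 E \<longrightarrow> \<phi> c = 0)}"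

definition edge_dual :: "edge set \<Rightarrow> edge \<Rightarrow> (edge \<Rightarrow> real) \<Rightarrow> real"
  where "edge_dual E e = (\<lambda>c. if c \<in> chains1 E then c e else 0)"

text \<open>\<open>vtx_chain L y\<close> is the vector-valued 0-chain \<open>L y\<close>, and \<open>vtx_dual K L y\<close> the vector-valued
  0-co-chain \<open>L y\<^sup>*\<close>, as a functional on 0-chains.\<close>

definition vtx_chain :: "pt \<Rightarrow> pt \<Rightarrow> pt \<Rightarrow> pt"
  where "vtx_chain L y = (\<lambda>z. if z = y then L else 0)"

definition chains0V :: "pt set set \<Rightarrow> (pt \<Rightarrow> pt) set"
  where "chains0V K = {\<Sum>z\<in>mesh_vertices K. vtx_chain (b z) z | b. True}"

definition vtx_dual :: "pt set set \<Rightarrow> pt \<Rightarrow> pt \<Rightarrow> (pt \<Rightarrow> pt) \<Rightarrow> real"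
  where "vtx_dual K L y = (\<lambda>b. if b \<in> chains0V K then L \<bullet> b y else 0)"

definition cochains0V :: "pt set set \<Rightarrow> ((pt \<Rightarrow> pt) \<Rightarrow> real) set"
  where "cochains0V K = {\<Sum>y\<in>mesh_vertices K. vtx_dual K (c y) y | c. True}"

section \<open>The maps from Christiansen's spaces to chains and co-chains\<close>

definition J0 :: "pt set set \<Rightarrow> (pt \<Rightarrow> pt) \<Rightarrow> (pt \<Rightarrow> pt) \<Rightarrow> real"
  where "J0 K u = (THE c. c \<in> cochains0V K \<and>
    (\<forall>y\<in>mesh_vertices K. \<forall>L. c (vtx_chain L y) = L \<bullet> u y))"

definition J1 :: "pt set set \<Rightarrow> edge set \<Rightarrow> mat3 field_class \<Rightarrow> (edge \<Rightarrow> real) \<Rightarrow> real"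
  where "J1 K E u = (THE \<phi>. \<phi> \<in> cochains1 E \<and> (\<forall>e\<in>E. \<phi> (edge_chain e) = edge_moment K u e))"

definition J2 :: "pt set set \<Rightarrow> edge set \<Rightarrow> ((pt \<Rightarrow> mat3) \<Rightarrow> real) \<Rightarrow> edge \<Rightarrow> real"
  where "J2 K E w = (THE c. c \<in> chains1 E \<and> (\<forall>e\<in>E. edge_dual E e c = pair2 K E w (psi K e)))"

definition J3 :: "pt set set \<Rightarrow> ((pt \<Rightarrow> pt) \<Rightarrow> real) \<Rightarrow> pt \<Rightarrow> pt"
  where "J3 K w = (THE b. b \<in> chains0V K \<and>
    (\<forall>y\<in>mesh_vertices K. \<forall>L. vtx_dual K L y b = pair3 K w (\<lambda>x. hat K y x *\<^sub>R L)))"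

text \<open>The unit tangent vector of an edge with end point \<open>y\<close>, oriented towards \<open>y\<close>.\<close>

definition tangent_to :: "pt \<Rightarrow> edge \<Rightarrow> pt"
  where "tangent_to y e = (if head e = y then tangent e else tangent (rev_edge e))"

end

theory Submission
  imports Defs
begin

text \<open>
  The simplices are lifted to the space, on which the integer lattice acts by translations. The
  gluing condition moves a triangle on a face of the cube to the opposite face. Applied once for
  each coordinate in which two lifted tetrahedra lie in different cubes, it shows that lifted
  tetrahedra meet in common faces (\<open>tets_face_of\<close>). Hence a triangle has exactly one tetrahedron on
  each side (\<open>two_tets\<close>), and around an edge each tetrahedron is entered through one of its two
  triangles at the edge and left through the other, so that the jumps of any function of the
  tetrahedra add up to zero (\<open>telescoping\<close>).

  The maps \<open>J\<close> are coordinate maps. A symmetric matrix is determined by its quadratic form on the six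
  edge vectors of a tetrahedron, and these six numbers can be prescribed (\<open>edge_forms_zero\<close>,
  \<open>edge_forms_exist\<close>); thus an element of \<open>X1\<close> is the same as one number for each edge of the torus
  (\<open>X1_eq_moments\<close>, \<open>X1_exists\<close>). In the same way an element of \<open>X0\<close> is the same as one vector for each
  vertex (\<open>pw_linear_eqI\<close>, \<open>pw_linear_exists\<close>). For \<open>X2\<close> and \<open>X3\<close> the point is the linear independence
  of the edge and vertex distributions. It is seen by testing with high powers of a trigonometric
  polynomial that has the value 1 at the midpoint of one edge, or at one vertex, and smaller values
  on the other edges, or at the other vertices (\<open>edge_delta_independent\<close>, \<open>pt_delta_independent\<close>).

  For \<open>m\<close> in \<open>X1\<close>, integration by parts on each tetrahedron turns the pairing of \<open>m\<close> with \<open>inc v\<close> into a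
  sum over the triangles of products of the jump \<open>J\<close> of \<open>m\<close> with averages of \<open>curl v\<close>. Since \<open>m\<close> has
  the same edge moments on both sides, the form of \<open>J\<close> on tangent vectors of the triangle vanishes
  (\<open>jump_tangent_free\<close>). By this, only the components of \<open>curl v\<close> normal to the triangle
  contribute, which Stokes' theorem converts into averages of \<open>v\<close> over the three edges
  (\<open>triangle_fluxes\<close>). Finally the triangles around one edge are collected: the parts of their
  contributions that are orthogonal to the edge depend linearly on \<open>J\<close> and telescope, and the parts
  along the edge add up to the jump of \<open>m\<close> at the edge (\<open>edge_star_sum\<close>). The result is
  \<open>inc_distr m = - inc_jump K E m\<close> (\<open>inc_distr_eq_jump\<close>), which reduces both choices of \<open>inc\<close> to the
  jumps and explains the sign \<open>\<sigma>\<close>.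

  The sequence is a complex for the following reasons. The gradient of a continuous piecewise
  linear field jumps by a matrix of rank one across a triangle, the contribution of the triangle
  to the jump of the symmetric gradient at an edge is linear in that matrix, and so these
  contributions telescope (\<open>jump_eps\<close>). Conversely the symmetric gradient of a smooth field \<open>v\<close> is
  annihilated by \<open>inc\<close>, so that the jump formula gives
  \<open>\<Sum>\<^sub>e [m]\<^sub>e t\<^sub>e \<bullet> (v(z) - v(x)) = 0\<close>, where \<open>e\<close> runs from \<open>x\<close> to \<open>z\<close>; fields with a peak at one vertex
  show that the forces \<open>[m]\<^sub>e t\<^sub>e\<close> are in equilibrium there, which is the vanishing of the divergence
  (\<open>jump_equilibrium\<close>).

  The maps \<open>r\<close> are transported along the isomorphisms \<open>J\<close>. Their formulas follow by evaluation on the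
  bases of hat functions, of the fields \<open>psi\<close> and of the edge distributions; a field \<open>psi\<close> vanishes on
  every tetrahedron without its edge, which confines its jumps to the patch of the edge
  (\<open>jump_outside_patch\<close>).
\<close>

text \<open>Translates are kept in the form \<open>(+) k ` S\<close>, to which the lemmas on translations apply.\<close>

declare image_cong_simp [cong del]

section \<open>The lifted mesh\<close>

lemma lattice_0 [simp]: "0 \<in> int_lattice"
  by (simp add: int_lattice_def)

lemma lattice_add: "k \<in> int_lattice \<Longrightarrow> l \<in> int_lattice \<Longrightarrow> k + l \<in> int_lattice"
  by (simp add: int_lattice_def)

lemma lattice_minus: "k \<in> int_lattice \<Longrightarrow> - k \<in> int_lattice"
  by (simp add: int_lattice_def)

lemma lattice_diff: "k \<in> int_lattice \<Longrightarrow> l \<in> int_lattice \<Longrightarrow> k - l \<in> int_lattice"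
  by (simp add: int_lattice_def)

lemma lattice_axis: "axis i 1 \<in> int_lattice"
  by (simp add: int_lattice_def axis_def)

lemma torus_pt_diff_lattice: "torus_pt x - x \<in> int_lattice"
  by (simp add: int_lattice_def torus_pt_def frac_def)

lemma torus_pt_eq_iff: "torus_pt x = torus_pt y \<longleftrightarrow> x - y \<in> int_lattice"
proof -
  have "frac a = frac b \<longleftrightarrow> a - b \<in> \<int>" for a b :: real
  proof
    assume "frac a = frac b"
    then have "a - b = of_int (\<lfloor>a\<rfloor> - \<lfloor>b\<rfloor>)" by (simp add: frac_def)
    then show "a - b \<in> \<int>" by (metis Ints_of_int)
  next
    assume "a - b \<in> \<int>"
    then obtain n where "a - b = of_int n" by (auto elim: Ints_cases)
    then have "a = b + of_int n" by simp
    then show "frac a = frac b" by (simp add: frac_def)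
  qed
  then show ?thesis
    by (simp add: torus_pt_def int_lattice_def vec_eq_iff)
qed

lemma torus_pt_add: "k \<in> int_lattice \<Longrightarrow> torus_pt (x + k) = torus_pt x"
  by (simp add: torus_pt_eq_iff)

lemma torus_pt_idem [simp]: "torus_pt (torus_pt x) = torus_pt x"
  by (simp add: torus_pt_eq_iff torus_pt_diff_lattice)

lemma torus_pt_in_cube: "torus_pt x \<in> cube"
  by (auto simp: torus_pt_def cube_def mem_box_cart frac_ge_0 less_imp_le[OF frac_lt_1])

lemma periodic_add: "periodic f \<Longrightarrow> k \<in> int_lattice \<Longrightarrow> f (k + x) = f x"
  unfolding periodic_def by (subst add.commute) blast

lemma periodic_torus_pt: "periodic f \<Longrightarrow> f (torus_pt x) = f x"
  using periodic_add[of f "torus_pt x - x" x] torus_pt_diff_lattice[of x] by simp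

lemma simplex_translation: "n simplex S \<Longrightarrow> n simplex ((+) k ` S)"
proof -
  assume "n simplex S"
  then obtain C where C: "\<not> affine_dependent C" "int (card C) = n + 1" "S = convex hull C"
    by (auto simp: simplex_def)
  have "\<not> affine_dependent ((+) k ` C)" using C(1) affine_dependent_translation_eq[of C k] by simp
  moreover have "card ((+) k ` C) = card C" by (intro card_image) simp
  ultimately show ?thesis unfolding simplex_def
    using C(2,3) convex_hull_translation[of k C] by metis
qed

lemma translation_translation: "(+) k ` (+) l ` S = (+) (k + l) ` (S :: 'a::ab_group_add set)"
  by (simp add: image_comp o_def add.assoc cong: image_cong_simp)

lemma translation_minus [simp]: "(+) (-k) ` (+) k ` S = (S :: 'a::ab_group_add set)"
  "(+) k ` (+) (-k) ` S = (S :: 'a::ab_group_add set)"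
  by (simp_all add: translation_translation)

lemma simplex_translation_iff: "n simplex ((+) k ` S) \<longleftrightarrow> n simplex S"
  using simplex_translation[of n S k] simplex_translation[of n "(+) k ` S" "-k"] by auto

lemma face_of_translation_left: "F face_of ((+) k ` T) \<longleftrightarrow> ((+) (-k) ` F) face_of T"
  for T :: "pt set"
  by (metis face_of_translation_eq translation_minus(1))

text \<open>Iterated translations of a point by \<open>k\<close> would leave every bounded set. This makes the lattice act
  freely on simplices.\<close>

lemma bounded_translation_eq_0:
  fixes S :: "pt set"
  assumes "bounded S" "S \<noteq> {}" "(+) k ` S = S"
  shows "k = 0"
proof (rule ccontr)
  assume "k \<noteq> 0"
  obtain x where x: "x \<in> S" using assms by blast
  have step: "x + real n *\<^sub>R k \<in> S" for n
  proof (induction n)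
    case (Suc n)
    then have "k + (x + real n *\<^sub>R k) \<in> S" using assms(3) by blast
    then show ?case by (simp add: algebra_simps)
  qed (use x in simp)
  obtain B where B: "\<And>y. y \<in> S \<Longrightarrow> norm y \<le> B" using assms(1) by (auto simp: bounded_iff)
  obtain n :: nat where n: "real n * norm k > B + norm x"
    using ex_less_of_nat_mult[of "norm k"] \<open>k \<noteq> 0\<close> by auto
  have "norm (real n *\<^sub>R k) \<le> norm (x + real n *\<^sub>R k) + norm x"
    by (metis add_diff_cancel_left' norm_triangle_ineq4)
  then show False using n B[OF step[of n]] by simp
qed

locale mesh =
  fixes K :: "pt set set"
  assumes mesh: "torus_mesh K"
begin

lemma finite_K: "finite K"
  using mesh by (simp add: torus_mesh_def triangulation_def)

lemma K_simplex: "T \<in> K \<Longrightarrow> 3 simplex T"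
  using mesh by (simp add: torus_mesh_def)

lemma Union_K: "\<Union>K = cube"
  using mesh by (simp add: torus_mesh_def)

lemma K_face: "T \<in> K \<Longrightarrow> T' \<in> K \<Longrightarrow> (T \<inter> T') face_of T"
  using mesh by (simp add: torus_mesh_def triangulation_def)

lemma glue: "2 simplex F \<Longrightarrow> F \<subseteq> {x. x $ i = 0} \<Longrightarrow>
   (\<exists>T\<in>K. F face_of T) \<longleftrightarrow> (\<exists>T\<in>K. ((+) (axis i 1) ` F) face_of T)"
  using mesh unfolding torus_mesh_def by blast

lemma K_inj: "T \<in> K \<Longrightarrow> inj_on torus_pt (vertices_of T)"
  using mesh by (simp add: torus_mesh_def)

lemma K_cube: "T \<in> K \<Longrightarrow> T \<subseteq> cube"
  using Union_K by blast

lemma tets_simplex: "T \<in> tets K \<Longrightarrow> 3 simplex T"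
  by (auto simp: tets_def K_simplex simplex_translation_iff)

lemma K_tets: "T \<in> K \<Longrightarrow> T \<in> tets K"
  unfolding tets_def using lattice_0 by force

lemma tets_translation: "T \<in> tets K \<Longrightarrow> k \<in> int_lattice \<Longrightarrow> (+) k ` T \<in> tets K"
  unfolding tets_def using lattice_add by (auto simp: translation_translation) blast

lemma simplex3_interior: "3 simplex T \<Longrightarrow> interior T \<noteq> {}" for T :: "pt set"
proof -
  assume T: "3 simplex T"
  then have "aff_dim T = int DIM(pt)" by (simp add: aff_dim_simplex)
  then have "affine hull T = UNIV" by (simp only: aff_dim_eq_full)
  then have "interior T = rel_interior T" by (simp add: rel_interior_interior)
  moreover have "T \<noteq> {}" using T by auto
  ultimately show ?thesis using rel_interior_eq_empty[OF convex_simplex[OF T]] by simp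
qed

lemma tets_interior: "T \<in> tets K \<Longrightarrow> interior T \<noteq> {}"
  using tets_simplex simplex3_interior by blast

lemma tets_convex: "T \<in> tets K \<Longrightarrow> convex T"
  using tets_simplex convex_simplex by blast

lemma tets_compact: "T \<in> tets K \<Longrightarrow> compact T"
  using tets_simplex compact_simplex by blast

text \<open>The traces of the tetrahedra on the plane \<open>x $ i = 0\<close> that are not triangles have dimension at most
  1. Extruded along the axis they become negligible sets, and finitely many of these cannot cover
  the open set of points of the cube above a piece of the plane that the triangles leave out.\<close>

lemma cube_face_covered:
  assumes p: "p \<in> cube" "p $ i = 0"
  shows "\<exists>T\<in>K. p \<in> T \<and> 2 simplex (T \<inter> {x. x $ i = 0}) \<and> (T \<inter> {x. x $ i = 0}) face_of T"
proof -
  let ?H = "{x::pt. x $ i = 0}"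
  define P where "P x = x - (x $ i) *\<^sub>R axis i 1" for x :: pt
  have P_nth: "P x $ j = (if j = i then 0 else x $ j)" for x j
    by (simp add: P_def axis_def)
  have linP: "linear P"
    unfolding P_def by (rule linearI) (auto simp: algebra_simps scaleR_add_left)
  have face: "(T \<inter> ?H) face_of T" if "T \<in> K" for T
  proof -
    have "?H = {x. axis i 1 \<bullet> x = 0}" by (simp add: inner_axis')
    moreover have "axis i 1 \<bullet> x \<ge> 0" if "x \<in> T" for x
      using K_cube[OF \<open>T \<in> K\<close>] that
      by (auto simp: inner_axis' cube_def mem_box_cart)
    ultimately show ?thesis
      using face_of_Int_supporting_hyperplane_ge[of T 0 "axis i 1"] convex_simplex[OF K_simplex[OF that]]
      by auto
  qed
  have dimH: "aff_dim ?H = 2"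
  proof -
    have "?H = {x. axis i 1 \<bullet> x = 0}" by (simp add: inner_axis')
    then show ?thesis using aff_dim_hyperplane[of "axis i (1::real) :: pt" 0] by (simp add: axis_eq_0_iff)
  qed
  have simp2: "2 simplex (T \<inter> ?H)" if TK: "T \<in> K" "aff_dim (T \<inter> ?H) \<ge> 2" for T
  proof -
    obtain C where C: "\<not> affine_dependent C" "T = convex hull C"
      using K_simplex[OF TK(1)] by (auto simp: simplex_def)
    obtain c where c: "c \<subseteq> C" "T \<inter> ?H = convex hull c"
      using face[OF TK(1)] face_of_convex_hull_affine_independent[OF C(1)] C(2) by auto
    have ind: "\<not> affine_dependent c" using c C affine_dependent_subset by blast
    have "aff_dim (T \<inter> ?H) \<le> aff_dim ?H" by (rule aff_dim_subset) simp
    then have "aff_dim (T \<inter> ?H) = 2" using dimH that(2) by linarith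
    then have "int (card c) = 3"
      using c(2) aff_dim_affine_independent[OF ind] by (simp add: aff_dim_convex_hull)
    then show ?thesis unfolding simplex_def using ind c(2) by auto
  qed
  define A where "A = {T \<in> K. aff_dim (T \<inter> ?H) \<ge> 2}"
  define L where "L = {T \<in> K. \<not> aff_dim (T \<inter> ?H) \<ge> 2}"
  have neg: "negligible (P -` (T \<inter> ?H))" if "T \<in> L" for T
  proof -
    have "aff_dim (T \<inter> ?H) \<le> 1" using that by (auto simp: L_def)
    show ?thesis
    proof (cases "T \<inter> ?H = {}")
      case False
      then obtain q where q: "q \<in> T \<inter> ?H" by blast
      let ?B = "insert (q + axis i 1) (T \<inter> ?H)"
      have sub: "P -` (T \<inter> ?H) \<subseteq> affine hull ?B"
      proof
        fix x assume "x \<in> P -` (T \<inter> ?H)"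
        then have 1: "P x \<in> affine hull ?B" by (simp add: hull_inc)
        have 2: "q \<in> affine hull ?B" "q + axis i 1 \<in> affine hull ?B" using q by (auto intro: hull_inc)
        have "P x + (x $ i) *\<^sub>R ((q + axis i 1) - q) \<in> affine hull ?B"
          by (rule mem_affine_3_minus[OF affine_affine_hull 1 2(2) 2(1)])
        then show "x \<in> affine hull ?B" by (simp add: P_def)
      qed
      have "aff_dim ?B \<le> 2"
        using \<open>aff_dim (T \<inter> ?H) \<le> 1\<close> by (simp add: aff_dim_insert)
      then obtain a b where ab: "a \<noteq> 0" "affine hull ?B \<subseteq> {x. a \<bullet> x = b}"
        using aff_lowdim_subset_hyperplane[of "affine hull ?B"] by (auto simp: aff_dim_affine_hull)
      show ?thesis
        by (rule negligible_subset[OF negligible_hyperplane[of a b]]) (use ab sub in auto)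
    qed simp
  qed
  have finA: "finite A" "finite L" using finite_K by (auto simp: A_def L_def)
  have closed: "closed (\<Union>T\<in>A. T \<inter> ?H)"
  proof (intro closed_UN finA ballI closed_Int)
    fix T assume "T \<in> A" then show "closed T" using closed_simplex[OF K_simplex] by (auto simp: A_def)
    show "closed ?H" using closed_hyperplane[of "axis i (1::real) :: pt" 0] by (simp add: inner_axis')
  qed
  have "p \<in> (\<Union>T\<in>A. T \<inter> ?H)"
  proof (rule ccontr)
    assume "p \<notin> (\<Union>T\<in>A. T \<inter> ?H)"
    then obtain e where e: "e > 0" "ball p e \<inter> (\<Union>T\<in>A. T \<inter> ?H) = {}"
    proof -
      from \<open>p \<notin> (\<Union>T\<in>A. T \<inter> ?H)\<close> have "p \<in> - (\<Union>T\<in>A. T \<inter> ?H)" by simp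
      then obtain e where "e > 0" "ball p e \<subseteq> - (\<Union>T\<in>A. T \<inter> ?H)"
        by (rule openE[OF open_Compl[OF closed]])
      then show ?thesis using that by blast
    qed
    let ?W = "box 0 1 \<inter> ball p e"
    have "p \<in> closure (box 0 (1::pt))"
    proof -
      have "box 0 (1::pt) \<noteq> {}" by (simp add: interval_ne_empty_cart)
      then show ?thesis using p by (simp add: cube_def closure_box)
    qed
    then obtain y where "y \<in> box 0 1" "dist y p < e"
      using e(1) unfolding closure_approachable by blast
    then have ne: "?W \<noteq> {}" by (auto simp: dist_commute)
    have "?W \<subseteq> (\<Union>T\<in>L. P -` (T \<inter> ?H))"
    proof
      fix x assume x: "x \<in> ?W"
      have "P x \<in> cube" using x by (auto simp: cube_def mem_box_cart P_nth intro: less_imp_le)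
      then obtain T where T: "T \<in> K" "P x \<in> T" using Union_K by blast
      have "norm (P x - p) \<le> norm (x - p)"
        using p(2) by (intro norm_le_componentwise_cart) (auto simp: P_nth)
      then have "P x \<in> ball p e" using x by (auto simp: dist_norm norm_minus_commute)
      then have "T \<notin> A" using e(2) T(2) by (auto simp: P_nth)
      then show "x \<in> (\<Union>T\<in>L. P -` (T \<inter> ?H))" using T by (auto simp: A_def L_def P_nth)
    qed
    then have "negligible ?W"
      by (rule negligible_subset[rotated]) (intro negligible_Union; use neg finA in blast)
    then show False using ne open_not_negligible[of ?W] by (auto simp: open_Int)
  qed
  then show ?thesis using simp2 face by (auto simp: A_def)
qed

text \<open>A relative interior point of the trace lies in one of the triangles that cover the face of the
  cube, and then the whole trace does. Unlike the trace itself, which may be an edge or a vertex, that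
  triangle can be moved by the gluing condition.\<close>

lemma trace_in_triangle:
  assumes T: "T \<in> K" and ne: "T \<inter> {x. x $ i = 0} \<noteq> {}"
  shows "\<exists>F. 2 simplex F \<and> F \<subseteq> {x. x $ i = 0} \<and> (\<exists>T'\<in>K. F face_of T') \<and>
    T \<inter> {x. x $ i = 0} \<subseteq> F"
proof -
  let ?H = "{x::pt. x $ i = 0}"
  have cH: "convex ?H" using convex_hyperplane[of "axis i (1::real) :: pt" 0] by (simp add: inner_axis')
  have cv: "convex (T \<inter> ?H)" using cH convex_simplex[OF K_simplex[OF T]] by (rule convex_Int[rotated])
  then obtain p where p: "p \<in> rel_interior (T \<inter> ?H)" using ne rel_interior_eq_empty by blast
  then have pT: "p \<in> T" "p $ i = 0" using rel_interior_subset by blast+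
  then obtain T' where T': "T' \<in> K" "p \<in> T'" "2 simplex (T' \<inter> ?H)" "(T' \<inter> ?H) face_of T'"
    using cube_face_covered[of p i] K_cube[OF T] by blast
  have "T \<inter> ?H \<subseteq> T \<inter> T'"
    by (rule subset_of_face_of[OF K_face[OF T T'(1)]]) (use p pT T' in auto)
  then show ?thesis using T' by (intro exI[of _ "T' \<inter> ?H"]) auto
qed

text \<open>Induction on the number of coordinates in which the shift \<open>k\<close> is not zero. Two tetrahedra of the
  cube that meet after a shift with \<open>k $ i \<noteq> 0\<close> meet on a face of the cube orthogonal to the axis \<open>i\<close>.
  There the first one may be replaced by a triangle \<open>F\<close> containing its trace, and the gluing
  condition provides a tetrahedron with the opposite copy of \<open>F\<close> as a face, whose shift relative to
  the second tetrahedron has \<open>i\<close>-th coordinate zero.\<close>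

lemma K_translated_face:
  assumes "T \<in> K" "T' \<in> K" "k \<in> int_lattice" "card {i. k $ i \<noteq> 0} = n"
  shows "(T \<inter> (+) k ` T') face_of T \<and> (T \<inter> (+) k ` T') face_of ((+) k ` T')"
  using assms
proof (induction n arbitrary: T T' k)
  case 0
  then have "k = 0" by (simp add: vec_eq_iff)
  then show ?case using K_face[of T T'] K_face[of T' T] 0 by (simp add: Int_commute)
next
  case (Suc n)
  then have "{i. k $ i \<noteq> 0} \<noteq> {}" by (metis card.empty nat.distinct(1))
  then obtain i where i: "k $ i \<noteq> 0" by blast
  \<comment> \<open>It suffices to treat negative shifts; for the others exchange the two tetrahedra.\<close>
  have neg: "(S \<inter> (+) l ` S') face_of S \<and> (S \<inter> (+) l ` S') face_of ((+) l ` S')"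
    if S: "S \<in> K" "S' \<in> K" and l: "l \<in> int_lattice" "card {i. l $ i \<noteq> 0} = Suc n" "l $ i < 0" for S S' l
  proof (cases "S \<inter> (+) l ` S' = {}")
    case True
    then show ?thesis by (metis empty_face_of)
  next
    case False
    let ?H = "{x::pt. x $ i = 0}"
    have li: "l $ i \<in> \<int>" using l(1) by (simp add: int_lattice_def)
    have bd: "0 \<le> x $ j \<and> x $ j \<le> 1" if "x \<in> S \<or> x \<in> S'" for x j
      using that K_cube[OF S(1)] K_cube[OF S(2)] by (auto simp: cube_def mem_box_cart)
    have le: "l $ i \<le> -1" using li l(3) by (auto elim!: Ints_cases)
    obtain x where x: "x \<in> S" "x - l \<in> S'" using False by fastforce
    have lm1: "l $ i = -1" using bd[of x i] bd[of "x - l" i] x le by auto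
    \<comment> \<open>A shift by one unit leaves only a common face of the two cubes.\<close>
    have inH: "S \<inter> (+) l ` S' \<subseteq> ?H"
    proof
      fix y assume "y \<in> S \<inter> (+) l ` S'"
      then obtain z where "y \<in> S" "z \<in> S'" "y = l + z" by blast
      then show "y \<in> ?H" using bd[of y i] bd[of z i] lm1 by auto
    qed
    then have "S \<inter> ?H \<noteq> {}" using False by blast
    then obtain F S1 where F: "2 simplex F" "F \<subseteq> ?H" "S1 \<in> K" "F face_of S1" "S \<inter> ?H \<subseteq> F"
      using trace_in_triangle[OF S(1)] by blast
    then obtain S2 where S2: "S2 \<in> K" "((+) (axis i 1) ` F) face_of S2" using glue[of F i] by blast
    let ?S2 = "(+) (- axis i 1) ` S2" and ?S' = "(+) l ` S'"
    have F2: "F face_of ?S2" using S2(2) by (simp add: face_of_translation_left)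
    define l' where "l' = l + axis i 1"
    have l': "l' \<in> int_lattice" using l(1) lattice_axis lattice_add by (simp add: l'_def)
    have "{j. l $ j \<noteq> 0} = insert i {j. l' $ j \<noteq> 0}"
      using l(3) lm1 by (auto simp: l'_def axis_def split: if_splits)
    moreover have "i \<notin> {j. l' $ j \<noteq> 0}" using lm1 by (simp add: l'_def)
    ultimately have "card {j. l' $ j \<noteq> 0} = n" using l(2) by simp
    from Suc.IH[OF S2(1) S(2) l' this]
    have ih: "(S2 \<inter> (+) l' ` S') face_of S2" "(S2 \<inter> (+) l' ` S') face_of ((+) l' ` S')" by auto
    have eq: "(+) (- axis i 1) ` (S2 \<inter> (+) l' ` S') = ?S2 \<inter> ?S'"
      by (simp add: image_Int translation_translation l'_def)
    have eq': "(+) (- axis i 1) ` (+) l' ` S' = ?S'"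
      by (simp add: translation_translation l'_def)
    have f1: "(?S2 \<inter> ?S') face_of ?S2" "(?S2 \<inter> ?S') face_of ?S'"
      using ih face_of_translation_eq[of "- axis i 1"] eq eq' by metis+
    \<comment> \<open>By the induction hypothesis, the translate of \<open>S2\<close>, of which \<open>F\<close> is a face, meets that of \<open>S'\<close> in a face.\<close>
    have FS: "F \<inter> ?S' = F \<inter> (?S2 \<inter> ?S')" using face_of_imp_subset[OF F2] by blast
    have f2: "(F \<inter> ?S') face_of ?S2" unfolding FS by (rule face_of_Int[OF F2 f1(1)])
    then have "(F \<inter> ?S') face_of (?S2 \<inter> ?S')"
      by (rule face_of_subset) (use face_of_imp_subset[OF F2] in auto)
    then have f3: "(F \<inter> ?S') face_of ?S'" using f1(2) face_of_trans by blast
    have f4: "(F \<inter> ?S') face_of F" by (rule face_of_subset[OF f2]) (use face_of_imp_subset[OF F2] in auto)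
    have "(S \<inter> S1) face_of S" "(S \<inter> S1) face_of S1"
      using K_face[OF S(1) F(3)] K_face[OF F(3) S(1)] by (auto simp: Int_commute)
    have A: "S \<inter> ?H = S \<inter> S1 \<inter> F" using F(2,4,5) face_of_imp_subset by blast
    have A1: "(S \<inter> ?H) face_of S1" unfolding A by (rule face_of_Int) fact+
    have A2: "(S \<inter> ?H) face_of F" by (rule face_of_subset[OF A1 F(5) face_of_imp_subset[OF F(4)]])
    have A3: "(S \<inter> ?H) face_of S"
    proof -
      have "(S \<inter> ?H) face_of (S \<inter> S1)" by (rule face_of_subset[OF A1]) (use A in auto)
      then show ?thesis using \<open>(S \<inter> S1) face_of S\<close> face_of_trans by blast
    qed
    \<comment> \<open>The intersection is cut out of \<open>F\<close> by two of its faces, one from each side.\<close>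
    have E: "S \<inter> ?S' = (S \<inter> ?H) \<inter> (F \<inter> ?S')" using inH F(5) by blast
    have "(S \<inter> ?S') face_of F" unfolding E by (rule face_of_Int[OF A2 f4])
    then have "(S \<inter> ?S') face_of (S \<inter> ?H)" "(S \<inter> ?S') face_of (F \<inter> ?S')"
      by (rule face_of_subset; use inH F(5) in blast)+
    then show ?thesis using A3 f3 face_of_trans by blast
  qed
  show ?case
  proof (cases "k $ i < 0")
    case True
    then show ?thesis using neg Suc.prems by blast
  next
    case False
    have "{i. (-k) $ i \<noteq> 0} = {i. k $ i \<noteq> 0}" by auto
    then have "(T' \<inter> (+) (-k) ` T) face_of T' \<and> (T' \<inter> (+) (-k) ` T) face_of ((+) (-k) ` T)"
      using neg[of T' T "-k"] Suc.prems False i lattice_minus by auto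
    then have "((+) k ` (T' \<inter> (+) (-k) ` T)) face_of ((+) k ` T')"
      "((+) k ` (T' \<inter> (+) (-k) ` T)) face_of ((+) k ` (+) (-k) ` T)"
      by (simp_all only: face_of_translation_eq)
    then show ?thesis by (simp add: image_Int Int_commute)
  qed
qed

lemma tets_face_of:
  assumes "T \<in> tets K" "T' \<in> tets K"
  shows "(T \<inter> T') face_of T"
proof -
  obtain k S k' S' where T: "T = (+) k ` S" "k \<in> int_lattice" "S \<in> K"
    "T' = (+) k' ` S'" "k' \<in> int_lattice" "S' \<in> K"
    using assms by (auto simp: tets_def)
  have "(S \<inter> (+) (k' - k) ` S') face_of S"
    using K_translated_face[OF T(3,6), of "k' - k"] T lattice_diff by blast
  then have "((+) k ` (S \<inter> (+) (k' - k) ` S')) face_of T" using T by simp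
  then show ?thesis using T by (simp add: image_Int translation_translation)
qed

lemma tets_cover: "\<exists>T\<in>tets K. x \<in> T"
proof -
  obtain T where "T \<in> K" "torus_pt x \<in> T" using torus_pt_in_cube Union_K by blast
  then have "x \<in> (+) (x - torus_pt x) ` T" by (auto simp: image_iff intro!: bexI[of _ "torus_pt x"])
  moreover have "(+) (x - torus_pt x) ` T \<in> tets K"
    using \<open>T \<in> K\<close> K_tets tets_translation lattice_minus[OF torus_pt_diff_lattice[of x]] by simp
  ultimately show ?thesis by blast
qed

lemma finite_lattice_bounded: "finite {k \<in> int_lattice. norm k \<le> B}"
proof -
  let ?N = "{- \<lceil>B\<rceil>..\<lceil>B\<rceil>}"
  have "{k \<in> int_lattice. norm k \<le> B} \<subseteq> (\<lambda>f. \<chi> i. of_int (f i)) ` (PiE (UNIV::3 set) (\<lambda>_. ?N))"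
  proof
    fix k assume k: "k \<in> {k \<in> int_lattice. norm k \<le> B}"
    then have "\<exists>n. k $ i = of_int n" for i by (auto simp: int_lattice_def elim: Ints_cases)
    then obtain f where f: "\<And>i. k $ i = of_int (f i)" by metis
    have "\<bar>k $ i\<bar> \<le> B" for i using component_le_norm_cart[of k i] k by simp
    then have "\<bar>of_int (f i) :: real\<bar> \<le> of_int \<lceil>B\<rceil>" for i using f by (metis le_of_int_ceiling order_trans)
    then have "f i \<in> ?N" for i by (simp add: abs_le_iff) (metis (no_types, opaque_lifting) \<open>\<And>i. \<bar>real_of_int (f i)\<bar> \<le> real_of_int \<lceil>B\<rceil>\<close> abs_le_iff minus_le_iff of_int_abs of_int_le_iff)
    then show "k \<in> (\<lambda>f. \<chi> i. of_int (f i)) ` (PiE UNIV (\<lambda>_. ?N))"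
      using f by (intro image_eqI[of _ _ f]) (auto simp: vec_eq_iff)
  qed
  then show ?thesis by (rule finite_subset) (intro finite_imageI finite_PiE; simp)
qed

lemma tets_locally_finite:
  assumes "bounded S"
  shows "finite {T \<in> tets K. T \<inter> S \<noteq> {}}"
proof -
  obtain B where B: "\<And>x. x \<in> S \<Longrightarrow> norm x \<le> B" using assms by (auto simp: bounded_iff)
  obtain C where C: "\<And>x. x \<in> cube \<Longrightarrow> norm x \<le> C"
    using bounded_cbox[of 0 "1::pt"] by (auto simp: bounded_iff cube_def)
  have "{T \<in> tets K. T \<inter> S \<noteq> {}} \<subseteq> (\<lambda>(k, T). (+) k ` T) ` ({k \<in> int_lattice. norm k \<le> B + C} \<times> K)"
  proof
    fix T assume "T \<in> {T \<in> tets K. T \<inter> S \<noteq> {}}"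
    then obtain k T0 x where T: "T = (+) k ` T0" "k \<in> int_lattice" "T0 \<in> K" "x \<in> T0" "k + x \<in> S"
      by (auto simp: tets_def)
    have "norm k \<le> norm (k + x) + norm x" by (metis add_diff_cancel_right' norm_triangle_ineq4)
    then have "norm k \<le> B + C" using B[OF T(5)] C[of x] K_cube[OF T(3)] T(4) by force
    then show "T \<in> (\<lambda>(k, T). (+) k ` T) ` ({k \<in> int_lattice. norm k \<le> B + C} \<times> K)" using T by force
  qed
  then show ?thesis by (rule finite_subset) (intro finite_imageI finite_cartesian_product finite_lattice_bounded finite_K)
qed

text \<open>Interiors of tetrahedra of \<open>K\<close> lie in the open unit cube, which is disjoint from its translates.\<close>

lemma tets_rep_unique:
  assumes "(+) k ` S = (+) l ` T" "S \<in> K" "T \<in> K" "k \<in> int_lattice" "l \<in> int_lattice"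
  shows "k = l" "S = T"
proof -
  have S: "S = (+) (l - k) ` T"
    using arg_cong[OF assms(1), of "(`) ((+) (-k))"] by (simp add: translation_translation del: image_cong_simp)
  obtain x where x: "x \<in> interior S" using tets_interior K_tets assms(2) by blast
  have int: "interior U \<subseteq> box 0 1" if "U \<in> K" for U
    using interior_mono[OF K_cube[OF that]] by (simp add: cube_def interior_cbox)
  have "x - (l - k) \<in> interior T" using x unfolding S interior_translation by auto
  then have "x - (l - k) \<in> box 0 1" "x \<in> box 0 1" using x int assms(2,3) by blast+
  moreover have "0 < y $ i \<and> y $ i < 1" if "y \<in> box 0 1" for y :: pt and i
    using that by (simp add: mem_box_cart)
  ultimately have "0 < (x - (l - k)) $ i \<and> (x - (l - k)) $ i < 1" "0 < x $ i \<and> x $ i < 1" for i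
    by blast+
  then have "0 < x $ i - (l - k) $ i" "x $ i - (l - k) $ i < 1" "0 < x $ i" "x $ i < 1" for i
    by (simp_all only: vector_minus_component)
  then have "\<bar>(l - k) $ i\<bar> < 1" for i by (smt (verit))
  moreover have "(l - k) $ i \<in> \<int>" for i using lattice_diff[OF assms(5,4)] by (simp add: int_lattice_def)
  ultimately have "(l - k) $ i = 0" for i using Ints_nonzero_abs_less1 by blast
  then show "k = l" by (simp add: vec_eq_iff)
  then show "S = T" using S by simp
qed

lemma tets_interior_disjoint:
  assumes "T \<in> tets K" "T' \<in> tets K" "T \<inter> interior T' \<noteq> {}"
  shows "T = T'"
proof -
  have "(T' \<inter> T) \<inter> interior T' \<noteq> {}" using assms(3) interior_subset[of T'] by blast
  then have "T' \<inter> T = T'"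
    using face_of_disjoint_interior[OF tets_face_of[OF assms(2,1)]] by blast
  then have 1: "T' \<subseteq> T" by blast
  then have "interior T' \<subseteq> interior T" by (rule interior_mono)
  then have "(T \<inter> T') \<inter> interior T \<noteq> {}" using assms(3) interior_subset[of T'] by blast
  then have "T \<inter> T' = T"
    using face_of_disjoint_interior[OF tets_face_of[OF assms(1,2)]] by blast
  with 1 show ?thesis by blast
qed

subsection \<open>Subsimplices\<close>

lemma subsimps_translation: "S \<in> subsimps K l \<Longrightarrow> k \<in> int_lattice \<Longrightarrow> (+) k ` S \<in> subsimps K l"
  unfolding subsimps_def using tets_translation simplex_translation face_of_translation_eq by blast

lemma subsimps_simplex: "S \<in> subsimps K l \<Longrightarrow> l simplex S"
  by (simp add: subsimps_def)

text \<open>Faces of two tetrahedra cut out faces of the common face of these tetrahedra.\<close>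

lemma face_of_tets_Int:
  assumes "S face_of T" "S' face_of T'" "T \<in> tets K" "T' \<in> tets K"
  shows "(S \<inter> S') face_of S"
proof -
  have "(T \<inter> T') face_of T" "(T \<inter> T') face_of T'"
    using tets_face_of[OF assms(3,4)] tets_face_of[OF assms(4,3)] by (auto simp: Int_commute)
  have "S \<inter> (T \<inter> T') face_of (T \<inter> T')"
    using face_of_slice[OF assms(1), of "T \<inter> T'"] face_of_imp_convex[OF \<open>(T \<inter> T') face_of T\<close>]
    by (metis inf.absorb_iff2 inf_le1 Int_assoc Int_left_absorb)
  moreover have "S' \<inter> (T \<inter> T') face_of (T \<inter> T')"
    using face_of_slice[OF assms(2), of "T \<inter> T'"] face_of_imp_convex[OF \<open>(T \<inter> T') face_of T\<close>]
    by (metis Int_assoc Int_commute Int_left_absorb)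
  ultimately have "(S \<inter> (T \<inter> T')) \<inter> (S' \<inter> (T \<inter> T')) face_of (T \<inter> T')" by (rule face_of_Int)
  moreover have "(S \<inter> (T \<inter> T')) \<inter> (S' \<inter> (T \<inter> T')) = S \<inter> S'"
    using assms(1,2) face_of_imp_subset by blast
  ultimately have "(S \<inter> S') face_of T"
    using \<open>(T \<inter> T') face_of T\<close> face_of_trans by metis
  then show ?thesis by (rule face_of_subset) (use assms(1) face_of_imp_subset in auto)
qed

lemma subsimps_Int: "S \<in> subsimps K l \<Longrightarrow> S' \<in> subsimps K m \<Longrightarrow> (S \<inter> S') face_of S"
  unfolding subsimps_def using face_of_tets_Int by blast

lemma subsimps_subset_face_of_tet:
  assumes "S \<in> subsimps K l" "T \<in> tets K" "S \<subseteq> T"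
  shows "S face_of T"
proof -
  obtain T0 where T0: "T0 \<in> tets K" "S face_of T0" using assms(1) by (auto simp: subsimps_def)
  have "S face_of (T \<inter> T0)"
    by (rule face_of_subset[OF T0(2)]) (use assms(3) face_of_imp_subset[OF T0(2)] in auto)
  then show ?thesis using tets_face_of[OF assms(2) T0(1)] face_of_trans by blast
qed

lemma subsimps_subset_face_of:
  assumes "S \<in> subsimps K l" "F \<in> subsimps K m" "S \<subseteq> F"
  shows "S face_of F"
  using subsimps_Int[OF assms(2,1)] assms(3) by (simp add: inf.absorb2)

lemma face_of_subsimps: "S face_of F \<Longrightarrow> F \<in> subsimps K m \<Longrightarrow> l simplex S \<Longrightarrow> S \<in> subsimps K l"
  unfolding subsimps_def using face_of_trans by blast

lemma finite_faces_simplex: "n simplex T \<Longrightarrow> finite {F. F face_of T}"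
  by (rule finite_polytope_faces) (rule simplex_imp_polytope)

lemma subsimps_locally_finite:
  assumes "bounded B"
  shows "finite {S \<in> subsimps K l. S \<inter> B \<noteq> {}}"
proof -
  have "{S \<in> subsimps K l. S \<inter> B \<noteq> {}} \<subseteq> (\<Union>T\<in>{T \<in> tets K. T \<inter> B \<noteq> {}}. {F. F face_of T})"
    using face_of_imp_subset by (fastforce simp: subsimps_def)
  then show ?thesis
    by (rule finite_subset) (use tets_locally_finite[OF assms] finite_faces_simplex[OF tets_simplex] in blast)
qed

end

section \<open>Tetrahedra and triangles\<close>

text \<open>A normal vector of the triangle, of length twice its area.\<close>

abbreviation nrm3 :: "pt \<Rightarrow> pt \<Rightarrow> pt \<Rightarrow> pt"
  where "nrm3 p q r \<equiv> cross3 (q - p) (r - p)"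

text \<open>Six times the signed volume of the tetrahedron with vertices \<open>a\<close>, \<open>b\<close>, \<open>c\<close>, \<open>d\<close>. Determinants of
  this kind are preferred to barycentric coordinates because identities between them are
  polynomial.\<close>

definition vol :: "pt \<Rightarrow> pt \<Rightarrow> pt \<Rightarrow> pt \<Rightarrow> real"
  where "vol a b c d = nrm3 a b c \<bullet> (d - a)"

text \<open>Cramer's rule: the coordinates of \<open>x\<close> with respect to three vectors.\<close>

lemma cramer: "(x \<bullet> cross3 v w) *\<^sub>R u + (x \<bullet> cross3 w u) *\<^sub>R v + (x \<bullet> cross3 u v) *\<^sub>R w
    = (cross3 u v \<bullet> w) *\<^sub>R x"
  by (simp add: vec_eq_iff forall_3 cross_components inner_vec_def sum_3) algebra

lemma cross_cross_left: "cross3 u (cross3 u v) = (u \<bullet> v) *\<^sub>R u - (u \<bullet> u) *\<^sub>R v"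
  by (simp add: vec_eq_iff forall_3 cross_components inner_vec_def sum_3) algebra

lemma cross_cross_right: "cross3 (cross3 u v) w = (u \<bullet> w) *\<^sub>R v - (v \<bullet> w) *\<^sub>R u"
  by (simp add: vec_eq_iff forall_3 cross_components inner_vec_def sum_3) algebra

lemma vol_perm: "vol a b d c = - vol a b c d" "vol a c b d = - vol a b c d"
  "vol b a c d = - vol a b c d"
  by (simp_all add: vol_def cross_components inner_vec_def sum_3 vec_eq_iff) algebra+

lemma vol_sum: "vol x b c d + vol a x c d + vol a b x d + vol a b c x = vol a b c d"
  by (simp add: vol_def cross_components inner_vec_def sum_3) algebra

lemma vol_combination:
  "vol x b c d *\<^sub>R a + vol a x c d *\<^sub>R b + vol a b x d *\<^sub>R c + vol a b c x *\<^sub>R d = vol a b c d *\<^sub>R x"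
  by (simp add: vol_def vec_eq_iff forall_3 cross_components inner_vec_def sum_3) algebra

lemma vol_translation [simp]: "vol (k + a) (k + b) (k + c) (k + d) = vol a b c d"
  by (simp add: vol_def)

lemma vol_nonzero_distinct:
  assumes "vol a b c d \<noteq> 0"
  shows "a \<noteq> b" "a \<noteq> c" "a \<noteq> d" "b \<noteq> c" "b \<noteq> d" "c \<noteq> d"
  using assms by (auto simp only: vol_def dot_cross_self cross_refl diff_self cross_zero_left
      cross_zero_right inner_zero_left inner_zero_right)

lemma nrm3_nonzero_distinct:
  assumes "nrm3 p q r \<noteq> 0"
  shows "p \<noteq> q" "p \<noteq> r" "q \<noteq> r"
  using assms by auto

lemma nrm3_perm: "nrm3 q r p = nrm3 p q r" "nrm3 p r q = - nrm3 p q r" "nrm3 q p r = - nrm3 p q r"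
  by (simp_all add: vec_eq_iff forall_3 cross_components algebra_simps)

lemma vol_imp_nrm3: "vol a b c d \<noteq> 0 \<Longrightarrow> nrm3 a b c \<noteq> 0"
  by (auto simp: vol_def)

lemma affine_independent_3:
  assumes "nrm3 a b c \<noteq> 0"
  shows "\<not> affine_dependent {a, b, c}"
proof
  note d = nrm3_nonzero_distinct[OF assms]
  assume "affine_dependent {a, b, c}"
  then obtain U where U: "sum U {a,b,c} = 0" "\<exists>v\<in>{a,b,c}. U v \<noteq> 0" "(\<Sum>v\<in>{a,b,c}. U v *\<^sub>R v) = 0"
    by (auto simp: affine_dependent_explicit_finite)
  have e: "U b *\<^sub>R (b - a) + U c *\<^sub>R (c - a) = 0"
  proof -
    have "U a = - U b - U c" using U(1) d by simp
    then have "U a *\<^sub>R a = - (U b *\<^sub>R a) - U c *\<^sub>R a" by (simp add: scaleR_diff_left)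
    moreover have "U b *\<^sub>R b + U c *\<^sub>R c = - (U a *\<^sub>R a)"
      using U(3) d by (simp add: eq_neg_iff_add_eq_0 add.commute)
    ultimately have "(U b *\<^sub>R b + U c *\<^sub>R c) - (U b *\<^sub>R a + U c *\<^sub>R a) = 0" by simp
    then have "(U b *\<^sub>R b - U b *\<^sub>R a) + (U c *\<^sub>R c - U c *\<^sub>R a) = 0" by (simp add: algebra_simps)
    then show ?thesis by (simp add: scaleR_diff_right)
  qed
  have "cross3 (b - a) (U b *\<^sub>R (b - a) + U c *\<^sub>R (c - a)) = U c *\<^sub>R nrm3 a b c"
    by (simp add: cross_add_right cross_mult_right)
  then have "U c = 0" using e assms by simp
  have "cross3 (U b *\<^sub>R (b - a) + U c *\<^sub>R (c - a)) (c - a) = U b *\<^sub>R nrm3 a b c"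
    by (simp add: cross_add_left cross_mult_left)
  then have "U b = 0" using e assms by simp
  then show False using U d \<open>U c = 0\<close> by auto
qed

lemma affine_independent_4:
  assumes "vol a b c d \<noteq> 0"
  shows "\<not> affine_dependent {a, b, c, d}"
proof
  note D = vol_nonzero_distinct[OF assms]
  assume "affine_dependent {a, b, c, d}"
  then obtain U where U: "sum U {a,b,c,d} = 0" "\<exists>v\<in>{a,b,c,d}. U v \<noteq> 0" "(\<Sum>v\<in>{a,b,c,d}. U v *\<^sub>R v) = 0"
    by (auto simp: affine_dependent_explicit_finite)
  have e: "U b *\<^sub>R (b - a) + U c *\<^sub>R (c - a) + U d *\<^sub>R (d - a) = 0"
  proof -
    have "U a = - U b - U c - U d" using U(1) D by simp
    then have "U a *\<^sub>R a = - (U b *\<^sub>R a) - U c *\<^sub>R a - U d *\<^sub>R a" by (simp add: scaleR_diff_left)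
    moreover have "U b *\<^sub>R b + U c *\<^sub>R c + U d *\<^sub>R d = - (U a *\<^sub>R a)"
      using U(3) D by (simp add: eq_neg_iff_add_eq_0 add_ac)
    ultimately have "(U b *\<^sub>R b + U c *\<^sub>R c + U d *\<^sub>R d) - (U b *\<^sub>R a + U c *\<^sub>R a + U d *\<^sub>R a) = 0" by simp
    then have "(U b *\<^sub>R b - U b *\<^sub>R a) + (U c *\<^sub>R c - U c *\<^sub>R a) + (U d *\<^sub>R d - U d *\<^sub>R a) = 0" by (simp add: algebra_simps)
    then show ?thesis by (simp add: scaleR_diff_right)
  qed
  have 1: "nrm3 a b c \<bullet> (U b *\<^sub>R (b - a) + U c *\<^sub>R (c - a) + U d *\<^sub>R (d - a)) = U d * vol a b c d"
    by (simp add: inner_add_right vol_def dot_cross_self)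
  have 2: "nrm3 a b d \<bullet> (U b *\<^sub>R (b - a) + U c *\<^sub>R (c - a) + U d *\<^sub>R (d - a)) = U c * vol a b d c"
    by (simp add: inner_add_right vol_def dot_cross_self)
  have 3: "nrm3 a c d \<bullet> (U b *\<^sub>R (b - a) + U c *\<^sub>R (c - a) + U d *\<^sub>R (d - a)) = U b * vol a c d b"
    by (simp add: inner_add_right vol_def dot_cross_self)
  have "vol a c d b = vol a b c d" using vol_perm(1,2) by metis
  then have "U b = 0" "U c = 0" "U d = 0" using e 1 2 3 assms vol_perm(1)[of a b c d] by auto
  then show False using U D by auto
qed

lemma nrm3_nonzero:
  assumes "\<not> affine_dependent {a, b, c}" "a \<noteq> b" "a \<noteq> c" "b \<noteq> c"
  shows "nrm3 a b c \<noteq> 0"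
proof
  assume 0: "nrm3 a b c = 0"
  define \<beta> \<gamma> where "\<beta> = (b - a) \<bullet> (c - a)" and "\<gamma> = - ((b - a) \<bullet> (b - a))"
  have e: "\<beta> *\<^sub>R (b - a) + \<gamma> *\<^sub>R (c - a) = 0"
    using cross_cross_left[of "b - a" "c - a"] 0 by (simp add: \<beta>_def \<gamma>_def)
  have g: "\<gamma> \<noteq> 0" using assms(2) by (simp add: \<gamma>_def)
  define U where "U v = (if v = a then - \<beta> - \<gamma> else if v = b then \<beta> else \<gamma>)" for v
  have "sum U {a,b,c} = 0" "U c \<noteq> 0" "(\<Sum>v\<in>{a,b,c}. U v *\<^sub>R v) = 0"
    using assms(2-4) e g by (auto simp: U_def algebra_simps scaleR_add_left scaleR_diff_left)
  then have "affine_dependent {a, b, c}"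
    unfolding affine_dependent_explicit_finite[OF finite.insertI[OF finite.insertI[OF finite.insertI[OF finite.emptyI]]]] by blast
  then show False using assms(1) by simp
qed

lemma vol_nonzero:
  assumes "\<not> affine_dependent {a, b, c, d}" "a \<noteq> b" "a \<noteq> c" "a \<noteq> d" "b \<noteq> c" "b \<noteq> d" "c \<noteq> d"
  shows "vol a b c d \<noteq> 0"
proof
  assume 0: "vol a b c d = 0"
  have "\<not> affine_dependent {a, b, c}" using assms(1) affine_dependent_subset[of "{a,b,c}" "{a,b,c,d}"] by blast
  then have N: "nrm3 a b c \<noteq> 0" using nrm3_nonzero assms by blast
  let ?x = "nrm3 a b c"
  define \<beta> \<gamma> \<delta> where "\<beta> = ?x \<bullet> cross3 (c - a) (d - a)" and "\<gamma> = ?x \<bullet> cross3 (d - a) (b - a)"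
    and "\<delta> = ?x \<bullet> ?x"
  have e: "\<beta> *\<^sub>R (b - a) + \<gamma> *\<^sub>R (c - a) + \<delta> *\<^sub>R (d - a) = 0"
    using cramer[of ?x "c - a" "d - a" "b - a"] 0 by (simp add: \<beta>_def \<gamma>_def \<delta>_def vol_def)
  have g: "\<delta> \<noteq> 0" using N by (simp add: \<delta>_def)
  define U where "U v = (if v = a then - \<beta> - \<gamma> - \<delta> else if v = b then \<beta> else if v = c then \<gamma> else \<delta>)" for v
  have "sum U {a,b,c,d} = 0" "U d \<noteq> 0" "(\<Sum>v\<in>{a,b,c,d}. U v *\<^sub>R v) = 0"
    using assms(2-) e g by (auto simp: U_def algebra_simps scaleR_add_left scaleR_diff_left)
  then have "affine_dependent {a, b, c, d}"
    unfolding affine_dependent_explicit_finite[OF finite.insertI[OF finite.insertI[OF finite.insertI[OF finite.insertI[OF finite.emptyI]]]]] by blast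
  then show False using assms(1) by simp
qed

text \<open>Barycentric coordinates are quotients of volumes.\<close>

lemma tet_memI:
  assumes "vol a b c d \<noteq> 0" "vol x b c d / vol a b c d \<ge> 0" "vol a x c d / vol a b c d \<ge> 0"
    "vol a b x d / vol a b c d \<ge> 0" "vol a b c x / vol a b c d \<ge> 0"
  shows "x \<in> convex hull {a, b, c, d}"
proof -
  note D = vol_nonzero_distinct[OF assms(1)]
  let ?v = "vol a b c d"
  define U where "U v = (if v = a then vol x b c d / ?v else if v = b then vol a x c d / ?v else
     if v = c then vol a b x d / ?v else vol a b c x / ?v)" for v
  have "(1 / ?v) *\<^sub>R (vol x b c d *\<^sub>R a + vol a x c d *\<^sub>R b + vol a b x d *\<^sub>R c + vol a b c x *\<^sub>R d) = x"
    using assms(1) by (simp add: vol_combination)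
  then have "(\<Sum>v\<in>{a,b,c,d}. U v *\<^sub>R v) = x"
    using D by (simp add: U_def scaleR_add_right add.assoc)
  moreover have "vol x b c d / ?v + vol a x c d / ?v + vol a b x d / ?v + vol a b c x / ?v = 1"
    using assms(1) vol_sum[of x b c d a] by (simp add: add_divide_distrib[symmetric])
  then have "sum U {a,b,c,d} = 1" using D by (simp add: U_def)
  moreover have "\<forall>v\<in>{a,b,c,d}. 0 \<le> U v" using assms by (auto simp: U_def)
  ultimately show ?thesis by (subst convex_hull_finite) auto
qed

lemma tet_memE:
  assumes "x \<in> convex hull {a, b, c, d}"
  obtains s t u v where "x = s *\<^sub>R a + t *\<^sub>R b + u *\<^sub>R c + v *\<^sub>R d" "0 \<le> s" "0 \<le> t" "0 \<le> u" "0 \<le> v"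
    "s + t + u + v = 1"
proof -
  let ?S = "{s *\<^sub>R a + t *\<^sub>R b + u *\<^sub>R c + v *\<^sub>R d | s t u v. 0 \<le> s \<and> 0 \<le> t \<and> 0 \<le> u \<and> 0 \<le> v \<and> s + t + u + v = 1}"
  have "convex ?S"
  proof (rule convexI)
    fix y z and p q :: real assume "y \<in> ?S" "z \<in> ?S" and pq: "0 \<le> p" "0 \<le> q" "p + q = 1"
    then obtain s t u v s' t' u' v' where
      y: "y = s *\<^sub>R a + t *\<^sub>R b + u *\<^sub>R c + v *\<^sub>R d" "0 \<le> s" "0 \<le> t" "0 \<le> u" "0 \<le> v" "s + t + u + v = 1" and
      z: "z = s' *\<^sub>R a + t' *\<^sub>R b + u' *\<^sub>R c + v' *\<^sub>R d" "0 \<le> s'" "0 \<le> t'" "0 \<le> u'" "0 \<le> v'" "s' + t' + u' + v' = 1"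
      by auto
    have "(p * s + q * s') + (p * t + q * t') + (p * u + q * u') + (p * v + q * v') = p * (s+t+u+v) + q * (s'+t'+u'+v')"
      by (simp add: algebra_simps)
    then have "(p * s + q * s') + (p * t + q * t') + (p * u + q * u') + (p * v + q * v') = 1" using y(6) z(6) pq(3) by simp
    moreover have "p *\<^sub>R y + q *\<^sub>R z = (p * s + q * s') *\<^sub>R a + (p * t + q * t') *\<^sub>R b + (p * u + q * u') *\<^sub>R c + (p * v + q * v') *\<^sub>R d"
      by (simp add: y(1) z(1) algebra_simps)
    moreover have "0 \<le> p * s + q * s'" "0 \<le> p * t + q * t'" "0 \<le> p * u + q * u'" "0 \<le> p * v + q * v'" using y z pq by auto
    ultimately show "p *\<^sub>R y + q *\<^sub>R z \<in> ?S" by blast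
  qed
  moreover have "{a,b,c,d} \<subseteq> ?S"
  proof -
    have "a = 1 *\<^sub>R a + 0 *\<^sub>R b + 0 *\<^sub>R c + 0 *\<^sub>R d" "b = 0 *\<^sub>R a + 1 *\<^sub>R b + 0 *\<^sub>R c + 0 *\<^sub>R d"
      "c = 0 *\<^sub>R a + 0 *\<^sub>R b + 1 *\<^sub>R c + 0 *\<^sub>R d" "d = 0 *\<^sub>R a + 0 *\<^sub>R b + 0 *\<^sub>R c + 1 *\<^sub>R d" by simp_all
    then show ?thesis by (fastforce simp del: scaleR_zero_left scaleR_one add_0_left add_0_right)
  qed
  ultimately have "convex hull {a,b,c,d} \<subseteq> ?S" by (simp add: hull_minimal)
  then show thesis using assms that by blast
qed

lemma tet_interiorI:
  assumes "vol a b c d \<noteq> 0" "vol x b c d / vol a b c d > 0" "vol a x c d / vol a b c d > 0"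
    "vol a b x d / vol a b c d > 0" "vol a b c x / vol a b c d > 0"
  shows "x \<in> interior (convex hull {a, b, c, d})"
proof -
  note D = vol_nonzero_distinct[OF assms(1)]
  let ?v = "vol a b c d"
  define U where "U v = (if v = a then vol x b c d / ?v else if v = b then vol a x c d / ?v else
     if v = c then vol a b x d / ?v else vol a b c x / ?v)" for v
  have "(1 / ?v) *\<^sub>R (vol x b c d *\<^sub>R a + vol a x c d *\<^sub>R b + vol a b x d *\<^sub>R c + vol a b c x *\<^sub>R d) = x"
    using assms(1) by (simp add: vol_combination)
  then have "(\<Sum>v\<in>{a,b,c,d}. U v *\<^sub>R v) = x"
    using D by (simp add: U_def scaleR_add_right add.assoc)
  moreover have "vol x b c d / ?v + vol a x c d / ?v + vol a b x d / ?v + vol a b c x / ?v = 1"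
    using assms(1) vol_sum[of x b c d a] by (simp add: add_divide_distrib[symmetric])
  then have "sum U {a,b,c,d} = 1" using D by (simp add: U_def)
  moreover have "\<forall>v\<in>{a,b,c,d}. 0 < U v" using assms by (auto simp: U_def)
  moreover have "card {a,b,c,d} = 4" using D by simp
  ultimately show ?thesis
    by (subst interior_convex_hull_explicit_minimal[OF affine_independent_4[OF assms(1)]]) auto
qed

subsection \<open>Faces of simplices\<close>

lemma convex_hull_inj_Pow:
  fixes C :: "'a::euclidean_space set"
  assumes "\<not> affine_dependent C"
  shows "inj_on (\<lambda>c. convex hull c) (Pow C)"
proof (rule inj_onI)
  fix c d assume "c \<in> Pow C" "d \<in> Pow C" "convex hull c = convex hull d"
  moreover from this have "\<not> affine_dependent c" "\<not> affine_dependent d"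
    using assms affine_dependent_subset by blast+
  ultimately show "c = d"
    using extreme_point_of_convex_hull_affine_independent[of c]
      extreme_point_of_convex_hull_affine_independent[of d] by auto
qed

lemma simplex_hullD:
  fixes C :: "'a::euclidean_space set"
  assumes "\<not> affine_dependent C" "n simplex (convex hull C)"
  shows "int (card C) = n + 1"
  using aff_dim_simplex[OF assms(2)] aff_dim_affine_independent[OF assms(1)] by (simp add: aff_dim_convex_hull)

text \<open>A face of the hull of an affinely independent set is the hull of a subset, and the dimension of a
  facet leaves out one point.\<close>

lemma sum_facets:
  fixes C :: "'a::euclidean_space set"
  assumes "\<not> affine_dependent C" "int (card C) = n + 2"
  shows "(\<Sum>F | n simplex F \<and> F face_of (convex hull C). f F) = (\<Sum>v\<in>C. f (convex hull (C - {v})))"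
proof -
  have fin: "finite C" using assms(1) aff_independent_finite by blast
  have "inj_on (\<lambda>v. convex hull (C - {v})) C"
  proof (rule inj_onI)
    fix v w assume vw: "v \<in> C" "w \<in> C" "convex hull (C - {v}) = convex hull (C - {w})"
    then have "C - {v} = C - {w}" using inj_onD[OF convex_hull_inj_Pow[OF assms(1)], of "C - {v}" "C - {w}"] by blast
    then show "v = w" using vw by blast
  qed
  moreover have "{F. n simplex F \<and> F face_of (convex hull C)} = (\<lambda>v. convex hull (C - {v})) ` C"
  proof (intro equalityI subsetI)
    fix F assume "F \<in> {F. n simplex F \<and> F face_of (convex hull C)}"
    then obtain c where c: "c \<subseteq> C" "F = convex hull c" "n simplex F"
      using face_of_convex_hull_affine_independent[OF assms(1)] by auto
    have "\<not> affine_dependent c" using c assms(1) affine_dependent_subset by blast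
    then have "int (card c) = n + 1" using simplex_hullD c by blast
    then have "card (C - c) = 1" using c(1) fin assms(2) card_Diff_subset[of c C] finite_subset[of c C]
      by simp
    then obtain v where "C - c = {v}" by (auto simp: card_1_singleton_iff)
    then have "v \<in> C" "c = C - {v}" using c(1) by auto
    then show "F \<in> (\<lambda>v. convex hull (C - {v})) ` C" using c(2) by blast
  next
    fix F assume "F \<in> (\<lambda>v. convex hull (C - {v})) ` C"
    then obtain v where v: "v \<in> C" "F = convex hull (C - {v})" by blast
    have "\<not> affine_dependent (C - {v})" using assms(1) affine_dependent_subset by blast
    moreover have "int (card (C - {v})) = n + 1" using v(1) fin assms(2) by (cases "card C") (auto simp: card_Diff_singleton)
    ultimately have "n simplex F" unfolding simplex_def v(2) by blast
    moreover have "F face_of (convex hull C)"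
      using face_of_convex_hull_affine_independent[OF assms(1)] v by blast
    ultimately show "F \<in> {F. n simplex F \<and> F face_of (convex hull C)}" by simp
  qed
  ultimately show ?thesis by (simp add: sum.reindex)
qed

lemma simplex_vertices_of:
  fixes C :: "pt set"
  assumes "\<not> affine_dependent C"
  shows "vertices_of (convex hull C) = C"
  using extreme_point_of_convex_hull_affine_independent[OF assms] by (auto simp: vertices_of_def)

lemma vertices_of_face: "F face_of T \<Longrightarrow> vertices_of F = vertices_of T \<inter> F"
  by (auto simp: vertices_of_def extreme_point_of_face)

lemma triangle_exE:
  fixes F :: "pt set"
  assumes "2 simplex F"
  obtains p q r where "nrm3 p q r \<noteq> 0" "F = convex hull {p, q, r}"
proof -
  obtain C where C: "\<not> affine_dependent C" "card C = 3" "F = convex hull C"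
    using assms by (auto simp: simplex_def)
  then obtain p q r where "C = {p, q, r}" "p \<noteq> q" "p \<noteq> r" "q \<noteq> r" by (auto simp: card_3_iff)
  then show thesis using that C nrm3_nonzero by metis
qed

lemma tet_over_triangle:
  assumes "3 simplex T" "convex hull {p, q, r} face_of T" "nrm3 p q r \<noteq> 0"
  obtains d where "T = convex hull {p, q, r, d}" "vol p q r d \<noteq> 0"
proof -
  obtain C where C: "\<not> affine_dependent C" "card C = 4" "T = convex hull C"
    using assms by (auto simp: simplex_def)
  have fin: "finite C" using C(1) aff_independent_finite by blast
  have sub: "{p, q, r} \<subseteq> C"
    using vertices_of_face[OF assms(2)] simplex_vertices_of[OF C(1)]
      simplex_vertices_of[OF affine_independent_3[OF assms(3)]] C(3) by blast
  note d = nrm3_nonzero_distinct[OF assms(3)]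
  have "card (C - {p, q, r}) = 1" using card_Diff_subset[OF _ sub] C(2) d by simp
  then obtain d where dd: "C - {p, q, r} = {d}" by (auto simp: card_1_singleton_iff)
  then have "C = {p, q, r, d}" "d \<notin> {p,q,r}" using sub by auto
  then show thesis using that[of d] C vol_nonzero[of p q r d] d by auto
qed

lemma triangle_over_segment:
  fixes F :: "pt set"
  assumes "2 simplex F" "closed_segment x z face_of F" "x \<noteq> z"
  obtains r where "F = convex hull {x, z, r}" "nrm3 x z r \<noteq> 0"
proof -
  obtain C where C: "\<not> affine_dependent C" "card C = 3" "F = convex hull C"
    using assms by (auto simp: simplex_def)
  have "{x, z} \<subseteq> C"
    using segment_face_of[OF assms(2)] C by (simp add: extreme_point_of_convex_hull_affine_independent)
  have fin: "finite C" using C(1) aff_independent_finite by blast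
  have "card (C - {x, z}) = 1" using card_Diff_subset[OF _ \<open>{x, z} \<subseteq> C\<close>] C(2) assms(3) by simp
  then obtain d where dd: "C - {x, z} = {d}" by (auto simp: card_1_singleton_iff)
  then have "C = {x, z, d}" "d \<notin> {x, z}" using \<open>{x, z} \<subseteq> C\<close> by auto
  then show thesis using that[of d] C nrm3_nonzero[of x z d] assms(3) by auto
qed

lemma tet_over_segment:
  fixes T :: "pt set"
  assumes "3 simplex T" "closed_segment x z face_of T" "x \<noteq> z"
  obtains r s where "T = convex hull {x, z, r, s}" "vol x z r s \<noteq> 0"
proof -
  obtain C where C: "\<not> affine_dependent C" "card C = 4" "T = convex hull C"
    using assms by (auto simp: simplex_def)
  have "{x, z} \<subseteq> C"
    using segment_face_of[OF assms(2)] C by (simp add: extreme_point_of_convex_hull_affine_independent)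
  have fin: "finite C" using C(1) aff_independent_finite by blast
  have "card (C - {x, z}) = 2" using card_Diff_subset[OF _ \<open>{x, z} \<subseteq> C\<close>] C(2) assms(3) by simp
  then obtain r s where dd: "C - {x, z} = {r, s}" "r \<noteq> s" by (auto simp: card_2_iff)
  then have "C = {x, z, r, s}" "r \<notin> {x, z}" "s \<notin> {x, z}" using \<open>{x, z} \<subseteq> C\<close> by auto
  then show thesis using that[of r s] C vol_nonzero[of x z r s] assms(3) dd by auto
qed

lemma tet_ex:
  fixes T :: "pt set"
  assumes "3 simplex T"
  obtains a b c d where "T = convex hull {a, b, c, d}" "vol a b c d \<noteq> 0"
proof -
  obtain C where C: "\<not> affine_dependent C" "card C = 4" "T = convex hull C"
    using assms by (auto simp: simplex_def)
  from C(2) have "card C = Suc 3" by simp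
  then obtain a C' where "C = insert a C'" "a \<notin> C'" "card C' = 3"
    unfolding card_Suc_eq by blast
  then obtain b c d where "C = {a,b,c,d}" "b \<noteq> c" "b \<noteq> d" "c \<noteq> d" "a \<notin> {b,c,d}" by (auto simp: card_3_iff)
  then show thesis using that[of a b c d] C vol_nonzero[of a b c d] by auto
qed

lemma tet_subface:
  assumes "vol a b c d \<noteq> 0" "S \<subseteq> {a, b, c, d}"
  shows "convex hull S face_of (convex hull {a, b, c, d})"
  using face_of_convex_hull_affine_independent[OF affine_independent_4[OF assms(1)]] assms(2) by blast

lemma triangle_subface:
  assumes "nrm3 p q r \<noteq> 0" "S \<subseteq> {p, q, r}"
  shows "convex hull S face_of (convex hull {p, q, r})"
  using face_of_convex_hull_affine_independent[OF affine_independent_3[OF assms(1)]] assms(2) by blast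

lemma triangle_simplex: "nrm3 p q r \<noteq> 0 \<Longrightarrow> 2 simplex (convex hull {p, q, r})"
  using affine_independent_3[where a=p and b=q and c=r] nrm3_nonzero_distinct[where p=p and q=q and r=r] unfolding simplex_def
  by (intro exI[of _ "{p,q,r}"]) simp

lemma sum_tet_facets:
  assumes "vol a b c d \<noteq> 0"
  shows "(\<Sum>F | 2 simplex F \<and> F face_of (convex hull {a, b, c, d}). f F) =
    f (convex hull {b, c, d}) + f (convex hull {a, c, d}) + f (convex hull {a, b, d}) + f (convex hull {a, b, c})"
proof -
  note D = vol_nonzero_distinct[OF assms]
  have "{a,b,c,d} - {a} = {b,c,d}" "{a,b,c,d} - {b} = {a,c,d}" "{a,b,c,d} - {c} = {a,b,d}" "{a,b,c,d} - {d} = {a,b,c}"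
    using D by auto
  then show ?thesis
    using sum_facets[OF affine_independent_4[OF assms], of 2 f] D by (simp add: add.assoc)
qed

lemma sum_triangle_facets:
  assumes "nrm3 p q r \<noteq> 0"
  shows "(\<Sum>S | 1 simplex S \<and> S face_of (convex hull {p, q, r}). f S) =
    f (closed_segment q r) + f (closed_segment r p) + f (closed_segment p q)"
proof -
  note D = nrm3_nonzero_distinct[OF assms]
  have "{p,q,r} - {p} = {q,r}" "{p,q,r} - {q} = {r,p}" "{p,q,r} - {r} = {p,q}"
    using D by auto
  then show ?thesis
    using sum_facets[OF affine_independent_3[OF assms], of 1 f] D by (simp add: add.assoc segment_convex_hull)
qed

lemma facets_through_segment:
  assumes "vol x z r s \<noteq> 0"
  shows "{F. 2 simplex F \<and> closed_segment x z face_of F \<and> F face_of (convex hull {x, z, r, s})} =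
    {convex hull {x, z, r}, convex hull {x, z, s}}" (is "?L = ?R")
    "convex hull {x, z, r} \<noteq> convex hull {x, z, s}"
proof -
  note D = vol_nonzero_distinct[OF assms]
  have v2: "vol x z s r \<noteq> 0" using assms vol_perm(1)[of x z r s] by simp
  have N: "nrm3 x z r \<noteq> 0" "nrm3 x z s \<noteq> 0"
    using assms v2 vol_imp_nrm3 by blast+
  note ind = affine_independent_4[OF assms]
  have ne: "convex hull {x, z, r} = convex hull {x, z, s} \<Longrightarrow> {x,z,r} = {x,z,s}"
    using inj_onD[OF convex_hull_inj_Pow[OF ind], of "{x,z,r}" "{x,z,s}"] by blast
  then show "convex hull {x, z, r} \<noteq> convex hull {x, z, s}" using D by auto
  show "?L = ?R"
  proof (intro equalityI subsetI)
    fix F assume F: "F \<in> ?L"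
    then obtain t where t: "F = convex hull {x, z, t}" "nrm3 x z t \<noteq> 0"
      using triangle_over_segment D by blast
    have "vertices_of F \<subseteq> {x,z,r,s}"
      using F vertices_of_face[of F "convex hull {x,z,r,s}"] simplex_vertices_of[OF ind] by auto
    then have "t \<in> {x,z,r,s}" using simplex_vertices_of[OF affine_independent_3[OF t(2)]] t(1) by auto
    then show "F \<in> ?R" using t nrm3_nonzero_distinct[OF t(2)] by auto
  next
    fix F assume "F \<in> ?R"
    then show "F \<in> ?L"
      using triangle_simplex[OF N(1)] triangle_simplex[OF N(2)]
        triangle_subface[OF N(1), of "{x,z}"] triangle_subface[OF N(2), of "{x,z}"]
        tet_subface[OF assms, of "{x,z,r}"] tet_subface[OF assms, of "{x,z,s}"]
      by (auto simp: segment_convex_hull)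
  qed
qed

subsection \<open>The tetrahedra on both sides of a triangle\<close>

lemma orthogonal_both_cross:
  assumes "n \<bullet> u = 0" "n \<bullet> v = 0"
  shows "(cross3 u v \<bullet> cross3 u v) *\<^sub>R n = (n \<bullet> cross3 u v) *\<^sub>R cross3 u v"
proof -
  have "n \<bullet> cross3 v (cross3 u v) = 0"
    using cross_cross_right[of u v v] assms
    by (simp add: cross_skew[of v "cross3 u v"] inner_diff_right)
  then show ?thesis using cramer[of n v "cross3 u v" u] assms
    by (simp add: cross_cross_right cross_skew[of "cross3 u v" u] inner_diff_right)
qed

text \<open>The centroid has barycentric coordinates \<open>1/3\<close> for the vertices of the triangle, and these stay
  positive nearby by continuity; the fourth one is positive on the side of \<open>d\<close>.\<close>

lemma centroid_push_interior:
  assumes v: "vol p q r d \<noteq> 0" and n: "n \<bullet> (q - p) = 0" "n \<bullet> (r - p) = 0" and nd: "n \<bullet> (d - p) > 0"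
  defines "m \<equiv> (1/3) *\<^sub>R (p + q + r)"
  shows "\<forall>\<^sub>F \<epsilon> in at_right 0. m + \<epsilon> *\<^sub>R n \<in> interior (convex hull {p, q, r, d})"
proof -
  let ?v = "vol p q r d" and ?x = "\<lambda>\<epsilon>. m + \<epsilon> *\<^sub>R n"
  let ?N = "nrm3 p q r"
  have pos: "vol p q r (?x \<epsilon>) / ?v > 0" if "\<epsilon> > 0" for \<epsilon>
  proof -
    have e: "(?N \<bullet> ?N) *\<^sub>R n = (n \<bullet> ?N) *\<^sub>R ?N" using orthogonal_both_cross[OF n] .
    have "vol p q r (?x \<epsilon>) = \<epsilon> * (?N \<bullet> n)"
    proof -
      have "m - p = (1/3) *\<^sub>R ((q - p) + (r - p))" by (simp add: m_def algebra_simps vec_eq_iff)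
      then have "?N \<bullet> (m - p) = 0" by (simp only: inner_scaleR_right inner_add_right dot_cross_self add_0_right mult_zero_right)
      then show ?thesis by (simp add: vol_def inner_add_right inner_diff_right)
    qed
    moreover have "(?N \<bullet> ?N) * (n \<bullet> (d - p)) = (n \<bullet> ?N) * ?v"
      using arg_cong[OF e, of "\<lambda>y. y \<bullet> (d - p)"] by (simp add: vol_def)
    moreover have "(?N \<bullet> ?N) * (n \<bullet> (d - p)) > 0" using nd vol_imp_nrm3[OF v] by simp
    ultimately show ?thesis using that v
      by (auto simp: zero_less_divide_iff zero_less_mult_iff mult_less_0_iff inner_commute)
  qed
  have c: "vol m q r d / ?v = 1/3" "vol p m r d / ?v = 1/3" "vol p q m d / ?v = 1/3"
  proof -
    have m3: "p $ i + q $ i + r $ i = 3 * m $ i" for i by (simp add: m_def)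
    have "3 * vol m q r d = ?v" "3 * vol p m r d = ?v" "3 * vol p q m d = ?v"
      using m3[of 1] m3[of 2] m3[of 3]
      by (simp_all only: vol_def cross_components inner_vec_def sum_3 vector_minus_component inner_real_def) algebra+
    then show "vol m q r d / ?v = 1/3" "vol p m r d / ?v = 1/3" "vol p q m d / ?v = 1/3"
      using v by (simp_all add: field_simps)
  qed
  have lim: "((\<lambda>\<epsilon>. ?x \<epsilon>) \<longlongrightarrow> m + 0 *\<^sub>R n) (at_right 0)" by (intro tendsto_intros)
  have "((\<lambda>\<epsilon>. vol (?x \<epsilon>) q r d / ?v) \<longlongrightarrow> vol (m + 0 *\<^sub>R n) q r d / ?v) (at_right 0)"
    "((\<lambda>\<epsilon>. vol p (?x \<epsilon>) r d / ?v) \<longlongrightarrow> vol p (m + 0 *\<^sub>R n) r d / ?v) (at_right 0)"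
    "((\<lambda>\<epsilon>. vol p q (?x \<epsilon>) d / ?v) \<longlongrightarrow> vol p q (m + 0 *\<^sub>R n) d / ?v) (at_right 0)"
    unfolding vol_def inner_vec_def sum_3 cross_components vector_minus_component
    by (intro tendsto_intros tendsto_vec_nth v[unfolded vol_def inner_vec_def sum_3 cross_components vector_minus_component])+
  then have l: "((\<lambda>\<epsilon>. vol (?x \<epsilon>) q r d / ?v) \<longlongrightarrow> 1/3) (at_right 0)"
    "((\<lambda>\<epsilon>. vol p (?x \<epsilon>) r d / ?v) \<longlongrightarrow> 1/3) (at_right 0)"
    "((\<lambda>\<epsilon>. vol p q (?x \<epsilon>) d / ?v) \<longlongrightarrow> 1/3) (at_right 0)" using c by simp_all
  have "\<forall>\<^sub>F \<epsilon> in at_right 0. vol (?x \<epsilon>) q r d / ?v > 0" "\<forall>\<^sub>F \<epsilon> in at_right 0. vol p (?x \<epsilon>) r d / ?v > 0"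
    "\<forall>\<^sub>F \<epsilon> in at_right 0. vol p q (?x \<epsilon>) d / ?v > 0"
    by (rule order_tendstoD(1)[OF l(1)] order_tendstoD(1)[OF l(2)] order_tendstoD(1)[OF l(3)], simp)+
  moreover have "\<forall>\<^sub>F \<epsilon> in at_right (0::real). \<epsilon> > 0" by (rule eventually_at_right_less)
  ultimately show ?thesis
    by eventually_elim (intro tet_interiorI[OF v] pos)
qed

context mesh
begin

text \<open>A point slightly off the centroid of \<open>F\<close> lies in some tetrahedron. By local finiteness that
  tetrahedron contains the centroid itself if the point is close enough, and then it has \<open>F\<close> as a
  face since the mesh is face-to-face.\<close>

lemma side_exists:
  assumes F: "F \<in> subsimps K 2" "F = convex hull {p, q, r}" "nrm3 p q r \<noteq> 0"
    and n: "n \<bullet> (q - p) = 0" "n \<bullet> (r - p) = 0" "n \<noteq> 0"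
  shows "\<exists>T. T \<in> tets K \<and> F face_of T \<and> (\<exists>y\<in>T. (y - p) \<bullet> n > 0)"
proof -
  obtain T0 where T0: "T0 \<in> tets K" "F face_of T0" using F(1) by (auto simp: subsimps_def)
  define m where "m = (1/3) *\<^sub>R (p + q + r)"
  note D = nrm3_nonzero_distinct[OF F(3)]
  have m: "m \<in> rel_interior F"
    unfolding F(2) rel_interior_convex_hull_explicit[OF affine_independent_3[OF F(3)]]
    using D by (auto intro!: exI[of _ "\<lambda>_. 1/3"] simp: m_def scaleR_add_right)
  let ?A = "{T \<in> tets K. T \<inter> cball m (norm n) \<noteq> {}}"
  let ?B = "{T \<in> ?A. m \<notin> T}"
  have "finite ?B" by (rule finite_subset[OF _ tets_locally_finite[of "cball m (norm n)"]]) auto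
  then have "closed (\<Union>?B)" using tets_compact compact_imp_closed by (intro closed_Union) auto
  then have "open (- \<Union>?B)" by (rule open_Compl)
  moreover have "m \<in> - \<Union>?B" by blast
  ultimately obtain e where e: "e > 0" "ball m e \<subseteq> - \<Union>?B" using openE by blast
  define \<epsilon> where "\<epsilon> = min 1 (e / (2 * norm n))"
  have eps: "0 < \<epsilon>" "\<epsilon> \<le> 1" "\<epsilon> * norm n < e"
  proof -
    show "0 < \<epsilon>" "\<epsilon> \<le> 1" using e n by (auto simp: \<epsilon>_def)
    have "\<epsilon> * norm n \<le> e / (2 * norm n) * norm n" by (rule mult_right_mono) (auto simp: \<epsilon>_def)
    also have "\<dots> < e" using e n by (simp add: field_simps)
    finally show "\<epsilon> * norm n < e" .
  qed
  let ?x = "m + \<epsilon> *\<^sub>R n"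
  obtain T where T: "T \<in> tets K" "?x \<in> T" using tets_cover by blast
  have "?x \<in> cball m (norm n)" using eps by (simp add: dist_norm mult_left_le_one_le)
  then have "T \<in> ?A" using T by blast
  moreover have "?x \<in> ball m e" using eps by (simp add: dist_norm)
  then have "T \<notin> ?B" using e(2) T(2) by blast
  ultimately have mT: "m \<in> T" by blast
  have "m \<in> T0" using m T0(2) rel_interior_subset face_of_imp_subset by blast
  then have "F \<subseteq> T0 \<inter> T"
    using subset_of_face_of[OF tets_face_of[OF T0(1) T(1)] face_of_imp_subset[OF T0(2)]] m mT by blast
  then have "F face_of T" using subsimps_subset_face_of_tet[OF F(1) T(1)] by blast
  moreover have "(?x - p) \<bullet> n > 0"
  proof -
    have "?x - p = (1/3) *\<^sub>R ((q - p) + (r - p)) + \<epsilon> *\<^sub>R n" by (simp add: m_def algebra_simps vec_eq_iff)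
    then have "n \<bullet> (?x - p) = \<epsilon> * (n \<bullet> n)"
      by (simp only: inner_add_right inner_scaleR_right n add_0_right add_0_left mult_zero_right)
    then show ?thesis using eps n by (simp add: inner_commute)
  qed
  ultimately show ?thesis using T by blast
qed

lemma tet_side:
  assumes "T = convex hull {p, q, r, d}" "n \<bullet> (q - p) = 0" "n \<bullet> (r - p) = 0"
  shows "(\<exists>y\<in>T. (y - p) \<bullet> n > 0) \<longleftrightarrow> n \<bullet> (d - p) > 0"
proof
  assume "\<exists>y\<in>T. (y - p) \<bullet> n > 0"
  then obtain y where y: "y \<in> T" "(y - p) \<bullet> n > 0" by blast
  then obtain s t u v where e: "y = s *\<^sub>R p + t *\<^sub>R q + u *\<^sub>R r + v *\<^sub>R d" "0 \<le> v" "s + t + u + v = 1"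
    using tet_memE assms(1) by metis
  have s: "s = 1 - t - u - v" using e(3) by linarith
  have "y - p = t *\<^sub>R (q - p) + u *\<^sub>R (r - p) + v *\<^sub>R (d - p)"
    unfolding e(1) s by (simp add: algebra_simps scaleR_diff_left)
  then have "n \<bullet> (y - p) = v * (n \<bullet> (d - p))" using assms by (simp add: inner_add_right)
  then show "n \<bullet> (d - p) > 0" using y(2) e(2) by (simp add: inner_commute zero_less_mult_iff)
next
  assume "n \<bullet> (d - p) > 0"
  moreover have "d \<in> T" unfolding assms(1) by (simp add: hull_inc)
  ultimately show "\<exists>y\<in>T. (y - p) \<bullet> n > 0" by (auto simp: inner_commute)
qed

text \<open>Both tetrahedra contain the points slightly off the centroid of \<open>F\<close> in their interiors.\<close>

lemma side_unique:
  assumes F: "F = convex hull {p, q, r}" "nrm3 p q r \<noteq> 0"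
    and n: "n \<bullet> (q - p) = 0" "n \<bullet> (r - p) = 0"
    and T: "T \<in> tets K" "F face_of T" "\<exists>y\<in>T. (y - p) \<bullet> n > 0"
    and T': "T' \<in> tets K" "F face_of T'" "\<exists>y\<in>T'. (y - p) \<bullet> n > 0"
  shows "T = T'"
proof -
  obtain d where d: "T = convex hull {p, q, r, d}" "vol p q r d \<noteq> 0"
    using tet_over_triangle[OF tets_simplex[OF T(1)]] T(2) F by metis
  obtain d' where d': "T' = convex hull {p, q, r, d'}" "vol p q r d' \<noteq> 0"
    using tet_over_triangle[OF tets_simplex[OF T'(1)]] T'(2) F by metis
  let ?m = "(1/3) *\<^sub>R (p + q + r)"
  have "\<forall>\<^sub>F \<epsilon> in at_right 0. ?m + \<epsilon> *\<^sub>R n \<in> interior T"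
    unfolding d(1) using tet_side[OF d(1) n] T(3) d n by (intro centroid_push_interior) auto
  moreover have "\<forall>\<^sub>F \<epsilon> in at_right 0. ?m + \<epsilon> *\<^sub>R n \<in> interior T'"
    unfolding d'(1) using tet_side[OF d'(1) n] T'(3) d' n by (intro centroid_push_interior) auto
  ultimately have "\<forall>\<^sub>F \<epsilon> in at_right 0. ?m + \<epsilon> *\<^sub>R n \<in> interior T \<inter> interior T'"
    by eventually_elim blast
  then have "\<exists>\<epsilon>. ?m + \<epsilon> *\<^sub>R n \<in> interior T \<inter> interior T'"
    using eventually_happens trivial_limit_at_right_real by blast
  then show ?thesis using tets_interior_disjoint[OF T(1) T'(1)] interior_subset by blast
qed

lemma adj_tet_props:
  assumes F: "F \<in> subsimps K 2" "F = convex hull {p, q, r}" "nrm3 p q r \<noteq> 0"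
    and n: "n \<bullet> (q - p) = 0" "n \<bullet> (r - p) = 0" "n \<noteq> 0"
  shows "adj_tet K F p n \<in> tets K" "F face_of adj_tet K F p n"
    "\<exists>y\<in>adj_tet K F p n. (y - p) \<bullet> n > 0"
    "\<And>T. T \<in> tets K \<Longrightarrow> F face_of T \<Longrightarrow> (\<exists>y\<in>T. (y - p) \<bullet> n > 0) \<Longrightarrow> T = adj_tet K F p n"
proof -
  have ex1: "\<exists>!T. T \<in> tets K \<and> F face_of T \<and> (\<exists>y\<in>T. (y - p) \<bullet> n > 0)"
    using side_exists[OF F n] side_unique[OF F(2,3) n(1,2)] by blast
  note th = theI'[OF ex1, folded adj_tet_def]
  show "adj_tet K F p n \<in> tets K" "F face_of adj_tet K F p n" "\<exists>y\<in>adj_tet K F p n. (y - p) \<bullet> n > 0"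
    using th by auto
  show "\<And>T. T \<in> tets K \<Longrightarrow> F face_of T \<Longrightarrow> (\<exists>y\<in>T. (y - p) \<bullet> n > 0) \<Longrightarrow> T = adj_tet K F p n"
    using ex1 th by blast
qed

lemma side_nonzero:
  assumes "vol p q r d \<noteq> 0" "n \<bullet> (q - p) = 0" "n \<bullet> (r - p) = 0" "n \<noteq> 0"
  shows "n \<bullet> (d - p) \<noteq> 0"
proof
  assume 0: "n \<bullet> (d - p) = 0"
  let ?N = "nrm3 p q r"
  have e: "(?N \<bullet> ?N) *\<^sub>R n = (n \<bullet> ?N) *\<^sub>R ?N" using orthogonal_both_cross[OF assms(2,3)] .
  have "(?N \<bullet> ?N) * (n \<bullet> (d - p)) = (n \<bullet> ?N) * vol p q r d"
    using arg_cong[OF e, of "\<lambda>y. y \<bullet> (d - p)"] by (simp only: vol_def inner_scaleR_left)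
  then have "n \<bullet> ?N = 0" using 0 assms(1) by simp
  then show False using e assms(4) vol_imp_nrm3[OF assms(1)] by simp
qed

lemma two_tets:
  assumes F: "F \<in> subsimps K 2" "F = convex hull {p, q, r}" "nrm3 p q r \<noteq> 0"
    and n: "n \<bullet> (q - p) = 0" "n \<bullet> (r - p) = 0" "n \<noteq> 0"
  shows "{T \<in> tets K. F face_of T} = {adj_tet K F p n, adj_tet K F p (-n)}"
    "adj_tet K F p n \<noteq> adj_tet K F p (-n)"
    "\<not> (\<exists>y\<in>adj_tet K F p (-n). (y - p) \<bullet> n > 0)"
proof -
  have n': "(-n) \<bullet> (q - p) = 0" "(-n) \<bullet> (r - p) = 0" "-n \<noteq> 0" using n by simp_all
  note P = adj_tet_props[OF F n] and M = adj_tet_props[OF F n']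
  have ex: "\<exists>d. T = convex hull {p, q, r, d} \<and> vol p q r d \<noteq> 0" if "T \<in> tets K" "F face_of T" for T
    using tet_over_triangle[OF tets_simplex[OF that(1)]] that(2) F(2,3) by metis
  show 1: "\<not> (\<exists>y\<in>adj_tet K F p (-n). (y - p) \<bullet> n > 0)"
  proof -
    obtain d where d: "adj_tet K F p (-n) = convex hull {p, q, r, d}" using ex[OF M(1,2)] by blast
    show ?thesis using M(3) tet_side[OF d n(1,2)] tet_side[OF d n'(1,2)] by auto
  qed
  then show "adj_tet K F p n \<noteq> adj_tet K F p (-n)" using P(3) by metis
  show "{T \<in> tets K. F face_of T} = {adj_tet K F p n, adj_tet K F p (-n)}"
  proof (intro equalityI subsetI)
    fix T assume "T \<in> {T \<in> tets K. F face_of T}"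
    then have T: "T \<in> tets K" "F face_of T" by auto
    obtain d where d: "T = convex hull {p, q, r, d}" "vol p q r d \<noteq> 0" using ex[OF T] by blast
    have "n \<bullet> (d - p) > 0 \<or> (-n) \<bullet> (d - p) > 0" using side_nonzero[OF d(2) n] by auto
    then show "T \<in> {adj_tet K F p n, adj_tet K F p (-n)}"
      using P(4)[OF T] M(4)[OF T] tet_side[OF d(1) n(1,2)] tet_side[OF d(1) n'(1,2)] by blast
  qed (use P(1,2) M(1,2) in auto)
qed

end

subsection \<open>The frame of an edge in a triangle\<close>

text \<open>The vector pointing into the triangle is obtained by the Gram-Schmidt process from \<open>z - x\<close> and
  \<open>r - x\<close>.\<close>

lemma edge_frame:
  assumes N: "nrm3 x z r \<noteq> 0" and F: "F = convex hull {x, z, r}"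
  shows "n_vec (x, z) F = sgn (nrm3 x z r)" "m_vec (x, z) F = cross3 (sgn (nrm3 x z r)) (tangent (x, z))"
proof -
  note D = nrm3_nonzero_distinct[OF N]
  define u w t where "u = z - x" and "w = r - x" and "t = sgn u"
  have tan: "tangent (x, z) = t" by (simp add: tangent_def t_def u_def)
  have N': "nrm3 x z r = cross3 u w" by (simp add: u_def w_def)
  have u0: "norm u > 0" using D by (simp add: u_def)
  have tt: "t \<bullet> t = 1" "norm t = 1" using u0 by (simp_all add: t_def norm_sgn dot_square_norm)
  have ut: "u = norm u *\<^sub>R t" using u0 by (simp add: t_def sgn_div_norm)
  define M where "M = w - (w \<bullet> t) *\<^sub>R t"
  have Mt: "M \<bullet> t = 0" by (simp add: M_def inner_diff_left tt)
  have crM: "norm u *\<^sub>R cross3 t M = cross3 u w"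
    by (subst ut) (simp add: M_def Cross3.right_diff_distrib cross_mult_right cross_mult_left)
  then have M0: "M \<noteq> 0" using N N' by auto
  define m where "m = sgn M"
  have m: "norm m = 1" "m \<bullet> t = 0" using M0 Mt by (simp_all add: m_def norm_sgn sgn_div_norm)
  have crm: "cross3 t m = (1 / norm M / norm u) *\<^sub>R cross3 u w"
    unfolding crM[symmetric] using u0 by (simp add: m_def sgn_div_norm cross_mult_right divide_inverse)
  have "(norm (cross3 t m))\<^sup>2 = 1" using norm_cross_dot[of t m] m tt by (simp add: inner_commute)
  then have n1: "norm (cross3 t m) = 1" by (smt (verit) norm_ge_zero power2_eq_1_iff)
  have "cross3 t m = sgn (cross3 t m)" by (simp add: sgn_div_norm n1)
  also have "\<dots> = sgn (cross3 u w)" unfolding crm using u0 M0 by (simp add: sgn_scaleR)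
  finally have n: "cross3 t m = sgn (nrm3 x z r)" by (simp add: N')
  have "cross3 (sgn (nrm3 x z r)) t = m"
    unfolding n[symmetric] using m tt by (simp add: cross_cross_right)
  moreover have "m_vec (x, z) F = m"
    unfolding m_vec_def tan fst_conv snd_conv
  proof (rule the_equality)
    have "\<exists>s>0. midpoint x z + s *\<^sub>R m \<in> F"
    proof -
      define c where "c = (w \<bullet> t) / norm u"
      \<comment> \<open>So small that the barycentric coordinates at \<open>x\<close> and \<open>z\<close>, both \<open>1/2\<close> at the midpoint, remain non-negative.\<close>
      define s where "s = 1 / (2 * (1 + \<bar>c\<bar>))"
      have s: "s > 0" "s * (1 + \<bar>c\<bar>) = 1/2" by (auto simp: s_def field_simps add_nonneg_eq_0_iff)
      have Mc: "M = w - c *\<^sub>R u" unfolding M_def c_def using u0 by (subst (2) ut) simp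
      have "s * c \<le> s * (1 + \<bar>c\<bar>)" "s * (1 - c) \<le> s * (1 + \<bar>c\<bar>)"
        using s(1) by (intro mult_left_mono; linarith)+
      then have b: "s * c \<le> 1/2" "s - s * c \<le> 1/2" using s(2) by (simp_all add: algebra_simps)
      have "midpoint x z + s *\<^sub>R M = (1/2 - s + s * c) *\<^sub>R x + (1/2 - s * c) *\<^sub>R z + s *\<^sub>R r"
        by (simp add: Mc u_def w_def midpoint_def vec_eq_iff algebra_simps)
      moreover have "\<dots> \<in> F" unfolding F convex_hull_3 using b s
        by (intro CollectI exI conjI refl) auto
      moreover have "(s * norm M) *\<^sub>R m = s *\<^sub>R M" using M0 by (simp add: m_def sgn_div_norm)
      ultimately have "midpoint x z + (s * norm M) *\<^sub>R m \<in> F" by simp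
      then show ?thesis using s M0 by (intro exI[of _ "s * norm M"]) simp
    qed
    then show "norm m = 1 \<and> m \<bullet> t = 0 \<and> (\<exists>s>0. midpoint x z + s *\<^sub>R m \<in> F)" using m by simp
  next
    fix m' assume m': "norm m' = 1 \<and> m' \<bullet> t = 0 \<and> (\<exists>s>0. midpoint x z + s *\<^sub>R m' \<in> F)"
    then obtain s where s: "s > 0" "midpoint x z + s *\<^sub>R m' \<in> F" by blast
    then obtain \<alpha> \<beta> \<gamma> where c: "midpoint x z + s *\<^sub>R m' = \<alpha> *\<^sub>R x + \<beta> *\<^sub>R z + \<gamma> *\<^sub>R r"
      "0 \<le> \<gamma>" "\<alpha> + \<beta> + \<gamma> = 1" unfolding F convex_hull_3 by auto
    have \<alpha>: "\<alpha> = 1 - \<beta> - \<gamma>" using c(3) by linarith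
    have sm: "s *\<^sub>R m' = (\<beta> - 1/2) *\<^sub>R u + \<gamma> *\<^sub>R w"
    proof -
      have "s *\<^sub>R m' = \<alpha> *\<^sub>R x + \<beta> *\<^sub>R z + \<gamma> *\<^sub>R r - midpoint x z" using c(1) by (simp add: algebra_simps)
      then show ?thesis unfolding \<alpha> by (simp add: u_def w_def midpoint_def vec_eq_iff algebra_simps)
    qed
    have "(s *\<^sub>R m') \<bullet> t = 0" using m' by simp
    then have "(\<beta> - 1/2) * norm u + \<gamma> * (w \<bullet> t) = 0"
      unfolding sm by (subst (asm) ut) (simp add: inner_add_left tt)
    then have "(\<beta> - 1/2) * norm u = - (\<gamma> * (w \<bullet> t))" by linarith
    then have "s *\<^sub>R m' = \<gamma> *\<^sub>R M"
      unfolding sm by (subst ut) (simp add: M_def scaleR_diff_right)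
    then have "(1 / s) *\<^sub>R (s *\<^sub>R m') = (1 / s) *\<^sub>R (\<gamma> *\<^sub>R M)" by simp
    then have sM: "m' = (\<gamma> / s) *\<^sub>R M" using s(1) by simp
    then have "\<gamma> \<noteq> 0" using m' by auto
    then have "\<gamma> / s > 0" using c(2) s(1) by simp
    have "m' = sgn m'" using m' by (simp add: sgn_div_norm)
    also have "\<dots> = m" unfolding sM m_def sgn_scaleR sgn_pos[OF \<open>\<gamma> / s > 0\<close>] by simp
    finally show "m' = m" .
  qed
  ultimately show "m_vec (x, z) F = cross3 (sgn (nrm3 x z r)) (tangent (x, z))" by (simp add: tan)
  show "n_vec (x, z) F = sgn (nrm3 x z r)" using \<open>m_vec (x, z) F = m\<close> n by (simp add: n_vec_def tan)
qed

context mesh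
begin

abbreviation tri_star :: "pt set \<Rightarrow> pt set set"
  where "tri_star S \<equiv> {F. F \<in> subsimps K 2 \<and> S face_of F}"

lemma finite_tri_star: "S \<noteq> {} \<Longrightarrow> bounded S \<Longrightarrow> finite (tri_star S)"
  by (rule finite_subset[OF _ subsimps_locally_finite[of S 2]]) (auto dest: face_of_imp_subset)

lemma finite_tet_star: "S \<noteq> {} \<Longrightarrow> bounded S \<Longrightarrow> finite {T \<in> tets K. S face_of T}"
  by (rule finite_subset[OF _ tets_locally_finite[of S]]) (auto dest: face_of_imp_subset)

lemma tri_star_frame:
  assumes "x \<noteq> z" "F \<in> tri_star (closed_segment x z)"
  obtains r where "F = convex hull {x, z, r}" "nrm3 x z r \<noteq> 0" "n_vec (x, z) F = sgn (nrm3 x z r)"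
    "m_vec (x, z) F = cross3 (n_vec (x, z) F) (tangent (x, z))"
    "n_vec (x, z) F \<bullet> (z - x) = 0" "n_vec (x, z) F \<bullet> (r - x) = 0" "n_vec (x, z) F \<noteq> 0" "norm (n_vec (x, z) F) = 1"
proof -
  obtain r where r: "F = convex hull {x, z, r}" "nrm3 x z r \<noteq> 0"
    using triangle_over_segment[OF subsimps_simplex _ assms(1)] assms(2) by blast
  show thesis
    by (rule that[OF r])
      (use edge_frame[OF r(2,1)] r in \<open>simp_all add: sgn_div_norm dot_cross_self inner_commute\<close>)
qed

text \<open>Around an edge, every tetrahedron lies on the positive side of one of its two triangles through
  the edge and on the negative side of the other one.\<close>

lemma telescoping:
  fixes G :: "pt set \<Rightarrow> 'a::real_vector"
  assumes "x \<noteq> z"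
  shows "(\<Sum>F\<in>tri_star (closed_segment x z).
    G (adj_tet K F x (n_vec (x, z) F)) - G (adj_tet K F x (- n_vec (x, z) F))) = 0"
proof -
  let ?S = "closed_segment x z" and ?n = "n_vec (x, z)"
  let ?T = "{T \<in> tets K. ?S face_of T}"
  \<comment> \<open>The sign with which a tetrahedron occurs at a triangle.\<close>
  define sg :: "pt set \<Rightarrow> pt set \<Rightarrow> real" where "sg T F = (if \<exists>y\<in>T. (y - x) \<bullet> ?n F > 0 then 1 else -1)" for T F
  have S: "?S \<noteq> {}" "bounded ?S" by (auto intro: compact_imp_bounded)
  have A: "G (adj_tet K F x (?n F)) - G (adj_tet K F x (- ?n F)) =
     (\<Sum>T\<in>{T \<in> ?T. F face_of T}. sg T F *\<^sub>R G T)" if F: "F \<in> tri_star ?S" for F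
  proof -
    obtain r where r: "F = convex hull {x, z, r}" "nrm3 x z r \<noteq> 0"
      and n: "?n F \<bullet> (z - x) = 0" "?n F \<bullet> (r - x) = 0" "?n F \<noteq> 0"
      by (rule tri_star_frame[OF assms F])
    have F2: "F \<in> subsimps K 2" using F by simp
    have "{T \<in> ?T. F face_of T} = {T \<in> tets K. F face_of T}"
      using F face_of_trans by blast
    also have "\<dots> = {adj_tet K F x (?n F), adj_tet K F x (- ?n F)}" by (rule two_tets(1)[OF F2 r n])
    finally show ?thesis
      using two_tets(2,3)[OF F2 r n] adj_tet_props(3)[OF F2 r n] by (simp add: sg_def)
  qed
  have B: "(\<Sum>F\<in>{F \<in> tri_star ?S. F face_of T}. sg T F *\<^sub>R G T) = 0" if T: "T \<in> ?T" for T
  proof -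
    have T': "T \<in> tets K" "?S face_of T" using T by auto
    obtain r s where rs: "T = convex hull {x, z, r, s}" "vol x z r s \<noteq> 0"
      using tet_over_segment[OF tets_simplex[OF T'(1)] T'(2) assms] by blast
    let ?F1 = "convex hull {x, z, r}" and ?F2 = "convex hull {x, z, s}"
    have v2: "vol x z s r \<noteq> 0" using rs vol_perm(1)[of x z r s] by simp
    have e: "{F \<in> tri_star ?S. F face_of T} = {?F1, ?F2}"
      unfolding facets_through_segment(1)[OF rs(2), symmetric] rs(1)[symmetric]
      using T'(1) by (auto simp: subsimps_def)
    note N1 = vol_imp_nrm3[OF rs(2)] and N2 = vol_imp_nrm3[OF v2]
    have T2: "T = convex hull {x, z, s, r}" using rs(1) by (simp add: insert_commute)
    have o: "sgn (nrm3 p q r) \<bullet> (q - p) = 0" "sgn (nrm3 p q r) \<bullet> (r - p) = 0" for p q r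
      by (simp_all add: sgn_div_norm dot_cross_self)
    have s1: "sg T ?F1 = (if vol x z r s > 0 then 1 else -1)"
      unfolding sg_def edge_frame(1)[OF N1 refl] tet_side[OF rs(1) o]
      using N1 by (simp add: sgn_div_norm vol_def zero_less_mult_iff)
    have s2: "sg T ?F2 = (if vol x z s r > 0 then 1 else -1)"
      unfolding sg_def edge_frame(1)[OF N2 refl] tet_side[OF T2 o]
      using N2 by (simp add: sgn_div_norm vol_def zero_less_mult_iff)
    have "sg T ?F1 + sg T ?F2 = 0" using s1 s2 rs(2) vol_perm(1)[of x z r s] by auto
    then show ?thesis unfolding e using facets_through_segment(2)[OF rs(2)]
      by (simp add: scaleR_add_left[symmetric])
  qed
  have "(\<Sum>F\<in>tri_star ?S. G (adj_tet K F x (?n F)) - G (adj_tet K F x (- ?n F))) =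
      (\<Sum>F\<in>tri_star ?S. \<Sum>T\<in>{T \<in> ?T. F face_of T}. sg T F *\<^sub>R G T)"
    by (rule sum.cong[OF refl A])
  also have "\<dots> = (\<Sum>T\<in>?T. \<Sum>F\<in>{F \<in> tri_star ?S. F face_of T}. sg T F *\<^sub>R G T)"
    by (rule sum.swap_restrict[OF finite_tri_star[OF S] finite_tet_star[OF S]])
  also have "\<dots> = 0" by (rule sum.neutral) (use B in blast)
  finally show ?thesis .
qed

end

section \<open>Integrals over tetrahedra, triangles and segments\<close>

definition seg_avg :: "pt \<Rightarrow> pt \<Rightarrow> (pt \<Rightarrow> 'a::euclidean_space) \<Rightarrow> 'a"
  where "seg_avg p q f = integral {0..1} (\<lambda>s. f (p + s *\<^sub>R (q - p)))"

definition std2 :: "(real \<times> real) set"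
  where "std2 = {(y, z). 0 \<le> y \<and> 0 \<le> z \<and> y + z \<le> 1}"

definition std3 :: "(real \<times> real \<times> real) set"
  where "std3 = {(x, y, z). 0 \<le> x \<and> 0 \<le> y \<and> 0 \<le> z \<and> x + y + z \<le> 1}"

text \<open>Half of the mean value over the triangle: its product with \<open>nrm3 p q r\<close> is the integral of the
  field times the unit normal. The parametrisation is not symmetric in the three vertices; the
  symmetry is \<open>tri_avg_perm\<close>.\<close>

definition tri_avg :: "pt \<Rightarrow> pt \<Rightarrow> pt \<Rightarrow> (pt \<Rightarrow> 'a::euclidean_space) \<Rightarrow> 'a"
  where "tri_avg p q r f = (\<integral>w. indicator std2 w *\<^sub>R
    f (p + fst w *\<^sub>R (q - p) + snd w *\<^sub>R (r - p)) \<partial>lborel)"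

lemma compact_std2: "compact std2"
proof (rule compact_eq_bounded_closed[THEN iffD2], rule conjI)
  have "std2 \<subseteq> cbox (0, 0) (1, 1)" by (auto simp: std2_def)
  then show "bounded std2" using bounded_cbox bounded_subset by blast
  have "std2 = {w. 0 \<le> fst w} \<inter> {w. 0 \<le> snd w} \<inter> {w. fst w + snd w \<le> 1}" by (auto simp: std2_def)
  moreover have "closed \<dots>" by (intro closed_Int closed_Collect_le continuous_intros)
  ultimately show "closed std2" by simp
qed

lemma compact_std3: "compact std3"
proof (rule compact_eq_bounded_closed[THEN iffD2], rule conjI)
  have "std3 \<subseteq> cbox (0, 0, 0) (1, 1, 1)" by (auto simp: std3_def)
  then show "bounded std3" using bounded_cbox bounded_subset by blast
  have "std3 = {w. 0 \<le> fst w} \<inter> {w. 0 \<le> fst (snd w)} \<inter> {w. 0 \<le> snd (snd w)} \<inter>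
    {w. fst w + fst (snd w) + snd (snd w) \<le> 1}" by (auto simp: std3_def)
  moreover have "closed \<dots>" by (intro closed_Int closed_Collect_le continuous_intros)
  ultimately show "closed std3" by simp
qed

lemma tri_avg_integrable:
  fixes f :: "pt \<Rightarrow> 'a::euclidean_space"
  assumes "continuous_on UNIV f"
  shows "integrable lborel (\<lambda>w. indicator std2 w *\<^sub>R f (p + fst w *\<^sub>R u + snd w *\<^sub>R v))"
  by (intro borel_integrable_compact compact_std2 continuous_on_compose2[OF assms] continuous_intros) auto

lemma lborel_integral_seg_avg:
  fixes f :: "pt \<Rightarrow> 'a::euclidean_space"
  assumes "continuous_on UNIV f"
  shows "(\<integral>s. indicator {0..1} s *\<^sub>R f (p + s *\<^sub>R (q - p)) \<partial>lborel) = seg_avg p q f"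
proof -
  have "set_integrable lborel {0..1} (\<lambda>s. f (p + s *\<^sub>R (q - p)))"
    by (intro borel_integrable_atLeastAtMost' continuous_on_compose2[OF assms] continuous_intros) auto
  from set_borel_integral_eq_integral(2)[OF this] show ?thesis
    by (simp add: seg_avg_def set_lebesgue_integral_def)
qed

lemma tri_avg_iterated:
  fixes f :: "pt \<Rightarrow> 'a::euclidean_space"
  assumes "continuous_on UNIV f"
  shows "tri_avg p q r f = (\<integral>z. indicator {0..1} z *\<^sub>R (\<integral>y. indicator {0..1-z} y *\<^sub>R
    f (p + y *\<^sub>R (q - p) + z *\<^sub>R (r - p)) \<partial>lborel) \<partial>lborel)"
proof -
  let ?g = "\<lambda>y z. indicator std2 (y, z) *\<^sub>R f (p + y *\<^sub>R (q - p) + z *\<^sub>R (r - p))"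
  have "integrable (lborel \<Otimes>\<^sub>M lborel) (case_prod ?g)"
    using tri_avg_integrable[OF assms, of p "q - p" "r - p"]
    by (simp add: lborel_prod case_prod_beta')
  then have "(\<integral>z. (\<integral>y. ?g y z \<partial>lborel) \<partial>lborel) = integral\<^sup>L (lborel \<Otimes>\<^sub>M lborel) (case_prod ?g)"
    by (rule lborel_pair.integral_snd)
  also have "\<dots> = tri_avg p q r f"
    by (simp add: tri_avg_def lborel_prod case_prod_beta')
  also have "(\<lambda>z. (\<integral>y. ?g y z \<partial>lborel)) = (\<lambda>z. indicator {0..1} z *\<^sub>R (\<integral>y. indicator {0..1-z} y *\<^sub>R
    f (p + y *\<^sub>R (q - p) + z *\<^sub>R (r - p)) \<partial>lborel))"
  proof
    fix z :: real
    show "(\<integral>y. ?g y z \<partial>lborel) = indicator {0..1} z *\<^sub>R (\<integral>y. indicator {0..1-z} y *\<^sub>R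
      f (p + y *\<^sub>R (q - p) + z *\<^sub>R (r - p)) \<partial>lborel)"
    proof (cases "z \<in> {0..1}")
      case True
      then have "(\<integral>y. ?g y z \<partial>lborel) = (\<integral>y. indicator {0..1-z} y *\<^sub>R f (p + y *\<^sub>R (q - p) + z *\<^sub>R (r - p)) \<partial>lborel)"
        by (intro Bochner_Integration.integral_cong refl) (auto simp: std2_def indicator_def)
      then show ?thesis using True by simp
    next
      case False
      then have "(\<lambda>y. ?g y z) = (\<lambda>y. 0)" by (auto simp: std2_def indicator_def fun_eq_iff)
      then have "(\<integral>y. ?g y z \<partial>lborel) = 0" by (simp only: Bochner_Integration.integral_zero)
      then show ?thesis using False by simp
    qed
  qed
  finally show ?thesis ..
qed

lemma tri_avg_swap:
  fixes f :: "pt \<Rightarrow> 'a::euclidean_space"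
  assumes "continuous_on UNIV f"
  shows "tri_avg p r q f = tri_avg p q r f"
proof -
  let ?g = "\<lambda>w. indicator std2 w *\<^sub>R f (p + fst w *\<^sub>R (q - p) + snd w *\<^sub>R (r - p))"
  have "?g \<in> borel_measurable (lborel \<Otimes>\<^sub>M lborel)"
    using borel_measurable_integrable[OF tri_avg_integrable[OF assms, of p "q - p" "r - p"]]
    by (simp add: lborel_prod)
  from lborel_pair.integral_product_swap[OF this]
  have "(\<integral>(x, y). ?g (y, x) \<partial>lborel) = integral\<^sup>L lborel ?g" by (simp add: lborel_prod)
  moreover have "(\<lambda>(x, y). ?g (y, x)) = (\<lambda>w. indicator std2 w *\<^sub>R f (p + fst w *\<^sub>R (r - p) + snd w *\<^sub>R (q - p)))"
    by (auto simp: fun_eq_iff std2_def indicator_def add_ac)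
  ultimately show ?thesis by (simp add: tri_avg_def)
qed

text \<open>In the iterated integral the inner variable \<open>y\<close> is replaced by \<open>1 - z - y\<close>, which exchanges \<open>p\<close>
  and \<open>q\<close>.\<close>

lemma tri_avg_swap12:
  fixes f :: "pt \<Rightarrow> 'a::euclidean_space"
  assumes "continuous_on UNIV f"
  shows "tri_avg q p r f = tri_avg p q r f"
proof -
  have "(\<integral>y. indicator {0..1-z} y *\<^sub>R f (q + y *\<^sub>R (p - q) + z *\<^sub>R (r - q)) \<partial>lborel) =
    (\<integral>y. indicator {0..1-z} y *\<^sub>R f (p + y *\<^sub>R (q - p) + z *\<^sub>R (r - p)) \<partial>lborel)" for z :: real
  proof -
    have e: "q + (1 - z + - 1 * y) *\<^sub>R (p - q) + z *\<^sub>R (r - q) = p + y *\<^sub>R (q - p) + z *\<^sub>R (r - p)" for y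
      by (simp add: algebra_simps vec_eq_iff)
    have "(\<integral>y. indicator {0..1-z} y *\<^sub>R f (q + y *\<^sub>R (p - q) + z *\<^sub>R (r - q)) \<partial>lborel) =
      (\<integral>y. indicator {0..1-z} (1 - z + -1 * y) *\<^sub>R f (q + (1 - z + -1 * y) *\<^sub>R (p - q) + z *\<^sub>R (r - q)) \<partial>lborel)"
      by (subst lborel_integral_real_affine[of "-1" _ "1 - z"]) simp_all
    also have "\<dots> = (\<integral>y. indicator {0..1-z} y *\<^sub>R f (p + y *\<^sub>R (q - p) + z *\<^sub>R (r - p)) \<partial>lborel)"
      unfolding e by (intro Bochner_Integration.integral_cong refl) (auto simp: indicator_def)
    finally show ?thesis .
  qed
  then show ?thesis by (simp add: tri_avg_iterated[OF assms])
qed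

lemma tri_avg_perm:
  fixes f :: "pt \<Rightarrow> 'a::euclidean_space"
  assumes "continuous_on UNIV f"
  shows "tri_avg p r q f = tri_avg p q r f" "tri_avg q p r f = tri_avg p q r f"
    "tri_avg q r p f = tri_avg p q r f" "tri_avg r p q f = tri_avg p q r f" "tri_avg r q p f = tri_avg p q r f"
  using tri_avg_swap[OF assms] tri_avg_swap12[OF assms] by metis+

lemma seg_avg_swap:
  fixes f :: "pt \<Rightarrow> 'a::euclidean_space"
  assumes "continuous_on UNIV f"
  shows "seg_avg q p f = seg_avg p q f"
proof -
  have e: "q + (1 + - 1 * s) *\<^sub>R (p - q) = p + s *\<^sub>R (q - p)" for s
    by (simp add: algebra_simps vec_eq_iff)
  have "(\<integral>s. indicator {0..1} s *\<^sub>R f (q + s *\<^sub>R (p - q)) \<partial>lborel) =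
      (\<integral>s. indicator {0..1} (1 + -1 * s) *\<^sub>R f (q + (1 + -1 * s) *\<^sub>R (p - q)) \<partial>lborel)"
    by (subst lborel_integral_real_affine[of "-1" _ 1]) simp_all
  also have "\<dots> = (\<integral>s. indicator {0..1} s *\<^sub>R f (p + s *\<^sub>R (q - p)) \<partial>lborel)"
    unfolding e by (intro Bochner_Integration.integral_cong refl) (auto simp: indicator_def)
  finally show ?thesis by (simp add: lborel_integral_seg_avg[OF assms])
qed

text \<open>The fundamental theorem of calculus on the lines parallel to one edge, which end on the two other
  edges.\<close>

lemma tri_avg_derivative:
  fixes f g :: "pt \<Rightarrow> 'a::euclidean_space"
  assumes d: "\<And>x s. ((\<lambda>s. f (x + s *\<^sub>R (q - p))) has_vector_derivative g (x + s *\<^sub>R (q - p))) (at s)"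
    and f: "continuous_on UNIV f" and g: "continuous_on UNIV g"
  shows "tri_avg p q r g = seg_avg q r f - seg_avg p r f"
proof -
  let ?F = "\<lambda>z. f (q + z *\<^sub>R (r - q)) - f (p + z *\<^sub>R (r - p))"
  have inner: "(\<integral>y. indicator {0..1-z} y *\<^sub>R g (p + y *\<^sub>R (q - p) + z *\<^sub>R (r - p)) \<partial>lborel) = ?F z"
    if z: "z \<in> {0..1}" for z
  proof -
    let ?x = "p + z *\<^sub>R (r - p)"
    have "(\<integral>y. indicator {0..1-z} y *\<^sub>R g (?x + y *\<^sub>R (q - p)) \<partial>lborel) =
      f (?x + (1 - z) *\<^sub>R (q - p)) - f (?x + 0 *\<^sub>R (q - p))"
      by (rule integral_FTC_Icc)
        (use z in \<open>auto intro!: has_vector_derivative_at_within[OF d] continuous_on_compose2[OF g] continuous_intros\<close>)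
    moreover have "?x + (1 - z) *\<^sub>R (q - p) = q + z *\<^sub>R (r - q)"
      by (simp add: algebra_simps vec_eq_iff)
    moreover have "?x + y *\<^sub>R (q - p) = p + y *\<^sub>R (q - p) + z *\<^sub>R (r - p)" for y by simp
    ultimately show ?thesis by simp
  qed
  have int: "integrable lborel (\<lambda>z. indicator {0..1} z *\<^sub>R f (a + z *\<^sub>R (b - a)))" for a b
    by (intro borel_integrable_compact continuous_on_compose2[OF f] continuous_intros) auto
  have "tri_avg p q r g = (\<integral>z. indicator {0..1} z *\<^sub>R ?F z \<partial>lborel)"
    unfolding tri_avg_iterated[OF g]
  proof (intro Bochner_Integration.integral_cong refl)
    fix z :: real
    show "indicator {0..1} z *\<^sub>R (\<integral>y. indicator {0..1-z} y *\<^sub>R g (p + y *\<^sub>R (q - p) + z *\<^sub>R (r - p)) \<partial>lborel) =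
      indicator {0..1} z *\<^sub>R ?F z"
      by (cases "z \<in> {0..1}") (simp_all add: inner del: atLeastAtMost_iff)
  qed
  also have "\<dots> = seg_avg q r f - seg_avg p r f"
    by (simp only: scaleR_diff_right[of "indicator _ _"] Bochner_Integration.integral_diff[OF int int] lborel_integral_seg_avg[OF f])
  finally show ?thesis .
qed

lemma seg_avg_derivative:
  fixes f g :: "pt \<Rightarrow> 'a::euclidean_space"
  assumes d: "\<And>x s. ((\<lambda>s. f (x + s *\<^sub>R (q - p))) has_vector_derivative g (x + s *\<^sub>R (q - p))) (at s)"
  shows "seg_avg p q g = f q - f p"
proof -
  have "((\<lambda>s. g (p + s *\<^sub>R (q - p))) has_integral f (p + 1 *\<^sub>R (q - p)) - f (p + 0 *\<^sub>R (q - p))) {0..1}"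
    by (rule fundamental_theorem_of_calculus) (auto intro!: has_vector_derivative_at_within d)
  then show ?thesis unfolding seg_avg_def by (simp add: integral_unique)
qed

text \<open>The fundamental theorem of calculus on the lines parallel to the edge from \<open>a\<close> to \<open>b\<close>, which end
  on the faces opposite to \<open>a\<close> and \<open>b\<close>.\<close>

lemma std3_derivative:
  fixes f g :: "pt \<Rightarrow> 'a::euclidean_space"
  assumes d: "\<And>x s. ((\<lambda>s. f (x + s *\<^sub>R (b - a))) has_vector_derivative g (x + s *\<^sub>R (b - a))) (at s)"
    and f: "continuous_on UNIV f" and g: "continuous_on UNIV g"
  shows "(\<integral>w. indicator std3 w *\<^sub>R g (a + fst w *\<^sub>R (b - a) + fst (snd w) *\<^sub>R (c - a) + snd (snd w) *\<^sub>R (d - a)) \<partial>lborel)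
    = tri_avg b c d f - tri_avg a c d f"
proof -
  let ?G = "\<lambda>x v. indicator std3 (x, v) *\<^sub>R g (a + x *\<^sub>R (b - a) + fst v *\<^sub>R (c - a) + snd v *\<^sub>R (d - a))"
  let ?L = "\<lambda>v. f (b + fst v *\<^sub>R (c - b) + snd v *\<^sub>R (d - b)) - f (a + fst v *\<^sub>R (c - a) + snd v *\<^sub>R (d - a))"
  have inner: "(\<integral>x. ?G x v \<partial>lborel) = indicator std2 v *\<^sub>R ?L v" for v
  proof (cases "v \<in> std2")
    case True
    obtain y z where v: "v = (y, z)" by force
    then have yz: "0 \<le> y" "0 \<le> z" "y + z \<le> 1" using True by (auto simp: std2_def)
    let ?x = "a + y *\<^sub>R (c - a) + z *\<^sub>R (d - a)"
    have "(\<integral>x. ?G x v \<partial>lborel) = (\<integral>x. indicator {0..1-y-z} x *\<^sub>R g (?x + x *\<^sub>R (b - a)) \<partial>lborel)"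
      using yz by (intro Bochner_Integration.integral_cong refl) (auto simp: v std3_def indicator_def add_ac)
    also have "\<dots> = f (?x + (1 - y - z) *\<^sub>R (b - a)) - f (?x + 0 *\<^sub>R (b - a))"
      by (rule integral_FTC_Icc)
        (use yz in \<open>auto intro!: has_vector_derivative_at_within[OF d] continuous_on_compose2[OF g] continuous_intros\<close>)
    also have "?x + (1 - y - z) *\<^sub>R (b - a) = b + y *\<^sub>R (c - b) + z *\<^sub>R (d - b)"
      by (simp add: algebra_simps vec_eq_iff)
    finally show ?thesis using True by (simp add: v)
  next
    case False
    then have "(\<lambda>x. ?G x v) = (\<lambda>x. 0)" by (auto simp: std2_def std3_def indicator_def fun_eq_iff)
    then have "(\<integral>x. ?G x v \<partial>lborel) = 0" by (simp only: Bochner_Integration.integral_zero)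
    then show ?thesis using False by simp
  qed
  have "integrable lborel (\<lambda>w. indicator std3 w *\<^sub>R g (a + fst w *\<^sub>R (b - a) + fst (snd w) *\<^sub>R (c - a) + snd (snd w) *\<^sub>R (d - a)))"
    by (intro borel_integrable_compact compact_std3 continuous_on_compose2[OF g] continuous_intros) auto
  then have int: "integrable (lborel \<Otimes>\<^sub>M lborel) (case_prod ?G)"
    by (simp add: lborel_prod case_prod_beta')
  have "(\<integral>w. indicator std3 w *\<^sub>R g (a + fst w *\<^sub>R (b - a) + fst (snd w) *\<^sub>R (c - a) + snd (snd w) *\<^sub>R (d - a)) \<partial>lborel)
     = integral\<^sup>L (lborel \<Otimes>\<^sub>M lborel) (case_prod ?G)"
    by (simp add: lborel_prod case_prod_beta')
  also have "\<dots> = (\<integral>v. (\<integral>x. ?G x v \<partial>lborel) \<partial>lborel)"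
    by (rule lborel_pair.integral_snd[OF int, symmetric])
  also have "\<dots> = (\<integral>v. indicator std2 v *\<^sub>R ?L v \<partial>lborel)" unfolding inner ..
  also have "\<dots> = tri_avg b c d f - tri_avg a c d f"
    by (simp only: scaleR_diff_right[of "indicator _ _"] tri_avg_def
        Bochner_Integration.integral_diff[OF tri_avg_integrable[OF f] tri_avg_integrable[OF f]])
  finally show ?thesis .
qed

subsection \<open>Parametrisation of a tetrahedron\<close>

definition vec3 :: "real \<times> real \<times> real \<Rightarrow> pt"
  where "vec3 w = vector [fst w, fst (snd w), snd (snd w)]"

lemma vec3_nth [simp]: "vec3 w $ 1 = fst w" "vec3 w $ 2 = fst (snd w)" "vec3 w $ 3 = snd (snd w)"
  by (simp_all add: vec3_def)

lemma continuous_vec3: "continuous_on UNIV vec3"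
proof -
  have "linear vec3" by (rule linearI) (simp_all add: vec_eq_iff forall_3)
  then show ?thesis by (simp add: linear_continuous_on linear_linear)
qed

lemma prod_Basis_pt: "(\<Prod>b\<in>(Basis :: pt set). h b) = h (axis 1 1) * h (axis 2 1) * h (axis 3 1)"
proof -
  have B: "(Basis :: pt set) = (\<lambda>i::3. axis i (1::real)) ` UNIV"
    unfolding Basis_vec_def by auto
  have I: "inj (\<lambda>i::3. axis i (1::real) :: pt)"
  proof (rule injI)
    fix i j :: 3 assume "(axis i 1 :: pt) = axis j 1"
    then have "(axis i 1 :: pt) $ i = axis j 1 $ i" by simp
    then show "i = j" unfolding axis_def by (simp split: if_splits)
  qed
  have "(\<Prod>b\<in>(Basis :: pt set). h b) = (\<Prod>i\<in>UNIV. h (axis i 1))"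
    unfolding B prod.reindex[OF I] o_def ..
  also have "\<dots> = h (axis 1 1) * h (axis 2 1) * h (axis 3 1)"
    unfolding UNIV_3 by (simp add: mult.assoc)
  finally show ?thesis .
qed

lemma emeasure_lborel_Times:
  fixes A :: "'a::euclidean_space set" and B :: "'b::euclidean_space set"
  assumes "A \<in> sets borel" "B \<in> sets borel"
  shows "emeasure lborel (A \<times> B) = emeasure lborel A * emeasure lborel B"
  using assms by (subst lborel_prod[symmetric]) (simp add: lborel.emeasure_pair_measure_Times)

lemma distr_vec3: "distr lborel borel vec3 = lborel"
proof (rule lborel_eqI[symmetric])
  have m [measurable]: "vec3 \<in> borel \<rightarrow>\<^sub>M borel"
    using borel_measurable_continuous_onI[OF continuous_vec3] .
  fix l u :: pt assume le: "\<And>b. b \<in> Basis \<Longrightarrow> l \<bullet> b \<le> u \<bullet> b"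
  have le': "l $ i \<le> u $ i" for i
    using le[of "axis i 1"] axis_in_Basis_iff[of i "1::real"] by (simp add: inner_axis)
  have "vec3 -` box l u = box (l $ 1) (u $ 1) \<times> (box (l $ 2) (u $ 2) \<times> box (l $ 3) (u $ 3))"
    by (auto simp: mem_box_cart forall_3)
  then have "emeasure (distr lborel borel vec3) (box l u) =
      emeasure lborel (box (l $ 1) (u $ 1) \<times> (box (l $ 2) (u $ 2) \<times> box (l $ 3) (u $ 3)))"
    by (simp add: emeasure_distr)
  also have "\<dots> = emeasure lborel (box (l $ 1) (u $ 1)) * (emeasure lborel (box (l $ 2) (u $ 2)) * emeasure lborel (box (l $ 3) (u $ 3)))"
    by (subst emeasure_lborel_Times, simp, intro borel_open open_Times open_box,
        subst emeasure_lborel_Times) simp_all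
  also have "\<dots> = ennreal ((u $ 1 - l $ 1) * ((u $ 2 - l $ 2) * (u $ 3 - l $ 3)))"
    using le' by (simp add: ennreal_mult)
  also have "\<dots> = (\<Prod>b\<in>Basis. (u - l) \<bullet> b)"
    by (simp add: prod_Basis_pt inner_axis mult.assoc)
  finally show "emeasure (distr lborel borel vec3) (box l u) = (\<Prod>b\<in>Basis. (u - l) \<bullet> b)" .
qed simp

lemma tet_param:
  assumes v: "vol a b c d \<noteq> 0"
  shows "convex hull {a, b, c, d} =
    (\<lambda>w. a + fst w *\<^sub>R (b - a) + fst (snd w) *\<^sub>R (c - a) + snd (snd w) *\<^sub>R (d - a)) ` std3"
proof (intro equalityI subsetI)
  fix x assume "x \<in> convex hull {a, b, c, d}"
  then obtain s t u v where x: "x = s *\<^sub>R a + t *\<^sub>R b + u *\<^sub>R c + v *\<^sub>R d" "0 \<le> s" "0 \<le> t" "0 \<le> u" "0 \<le> v"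
    "s + t + u + v = 1" using tet_memE by blast
  then have s: "s = 1 - t - u - v" by linarith
  have "x = a + t *\<^sub>R (b - a) + u *\<^sub>R (c - a) + v *\<^sub>R (d - a)"
    unfolding x(1) s by (simp add: algebra_simps vec_eq_iff)
  then show "x \<in> (\<lambda>w. a + fst w *\<^sub>R (b - a) + fst (snd w) *\<^sub>R (c - a) + snd (snd w) *\<^sub>R (d - a)) ` std3"
    using x(2-) s by (intro image_eqI[of _ _ "(t, u, v)"]) (auto simp: std3_def)
next
  fix x assume "x \<in> (\<lambda>w. a + fst w *\<^sub>R (b - a) + fst (snd w) *\<^sub>R (c - a) + snd (snd w) *\<^sub>R (d - a)) ` std3"
  then obtain t u w where x: "x = a + t *\<^sub>R (b - a) + u *\<^sub>R (c - a) + w *\<^sub>R (d - a)"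
    "0 \<le> t" "0 \<le> u" "0 \<le> w" "t + u + w \<le> 1" by (auto simp: std3_def)
  have xa: "x - a = t *\<^sub>R (b - a) + u *\<^sub>R (c - a) + w *\<^sub>R (d - a)" by (simp add: x(1))
  have y: "vol a y c d = nrm3 a c d \<bullet> (y - a)" "vol a b y d = - (nrm3 a b d \<bullet> (y - a))"
    "vol a b c y = nrm3 a b c \<bullet> (y - a)" for y
    using vol_perm(2)[of a y c d] vol_perm(1)[of a c y d] vol_perm(1)[of a b y d] by (simp_all add: vol_def)
  have "vol a x c d = t * vol a b c d" "vol a b x d = u * vol a b c d" "vol a b c x = w * vol a b c d"
    unfolding y(1)[of x] y(2)[of x] y(3)[of x] xa
    using y(1)[of b] y(2)[of c] y(3)[of d]
    by (simp_all only: inner_add_right inner_scaleR_right dot_cross_self)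
      (simp_all add: mult_minus_right[symmetric] del: mult_minus_right)
  moreover from this have "vol x b c d = (1 - t - u - w) * vol a b c d"
    using vol_sum[of x b c d a] by (simp add: algebra_simps)
  ultimately show "x \<in> convex hull {a, b, c, d}" using x(2-) v by (intro tet_memI) auto
qed

lemma integral_tet:
  fixes f :: "pt \<Rightarrow> pt"
  assumes f: "continuous_on UNIV f" and v: "vol a b c d \<noteq> 0"
  shows "integral (convex hull {a, b, c, d}) f = \<bar>vol a b c d\<bar> *\<^sub>R
    (\<integral>w. indicator std3 w *\<^sub>R f (a + fst w *\<^sub>R (b - a) + fst (snd w) *\<^sub>R (c - a) + snd (snd w) *\<^sub>R (d - a)) \<partial>lborel)"
proof -
  let ?T = "convex hull {a, b, c, d}"
  define L where "L x = x $ 1 *\<^sub>R (b - a) + x $ 2 *\<^sub>R (c - a) + x $ 3 *\<^sub>R (d - a)" for x :: pt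
  have linL: "linear L" unfolding L_def by (rule linearI) (simp_all add: algebra_simps)
  have contL: "continuous_on A L" for A by (simp add: linL linear_continuous_on linear_linear)
  have T: "?T = (\<lambda>x. a + L x) ` vec3 ` std3"
    unfolding tet_param[OF v] by (simp add: image_comp o_def L_def add.assoc)
  have cS: "compact (vec3 ` std3)"
    by (rule compact_continuous_image[OF continuous_on_subset[OF continuous_vec3] compact_std3]) simp
  have cLS: "compact (L ` vec3 ` std3)" by (rule compact_continuous_image[OF contL cS])
  have cT: "compact ?T" by (rule finite_imp_compact_convex_hull) simp
  have lin: "integral A g = (\<integral>x. indicator A x *\<^sub>R g x \<partial>lborel)" if "compact A" "continuous_on A g"
    for A and g :: "pt \<Rightarrow> pt"
  proof -
    have "set_integrable lborel A g" unfolding set_integrable_def by (rule borel_integrable_compact[OF that])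
    from set_borel_integral_eq_integral(2)[OF this] show ?thesis by (simp add: set_lebesgue_integral_def)
  qed
  have meas: "(\<lambda>x. indicator A x *\<^sub>R g x) \<in> borel_measurable borel" if "compact A" "continuous_on A g"
    for A and g :: "pt \<Rightarrow> pt"
    using borel_measurable_integrable[OF borel_integrable_compact[OF that]] by simp
  have fs: "continuous_on A f" for A using f continuous_on_subset by blast
  have fa: "continuous_on A (\<lambda>x. f (a + x))" for A
    by (intro continuous_on_compose2[OF f] continuous_intros) auto
  have faL: "continuous_on A (\<lambda>x. f (a + L x))" for A
    by (intro continuous_on_compose2[OF f] continuous_intros contL) auto
  have "integral ?T f = (\<integral>x. indicator ?T x *\<^sub>R f x \<partial>distr lborel borel ((+) a))"
    by (simp add: lin[OF cT fs] lborel_distr_plus)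
  also have "\<dots> = (\<integral>x. indicator ?T (a + x) *\<^sub>R f (a + x) \<partial>lborel)"
    by (rule integral_distr) (use meas[OF cT fs] in simp_all)
  also have "(\<lambda>x. indicator ?T (a + x) *\<^sub>R f (a + x)) = (\<lambda>x. indicator (L ` vec3 ` std3) x *\<^sub>R f (a + x))"
    unfolding T by (auto simp: indicator_def fun_eq_iff)
  also have "(\<integral>x. indicator (L ` vec3 ` std3) x *\<^sub>R f (a + x) \<partial>lborel) = integral (L ` vec3 ` std3) (\<lambda>x. f (a + x))"
    by (rule lin[OF cLS fa, symmetric])
  also have "\<dots> = \<bar>det (matrix L)\<bar> *\<^sub>R integral (vec3 ` std3) ((\<lambda>x. f (a + x)) \<circ> L)"
  proof (rule integral_change_of_variables_linear[OF linL], rule disjI2)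
    have "integrable lborel (\<lambda>x. indicator (vec3 ` std3) x *\<^sub>R ((\<lambda>x. f (a + x)) \<circ> L) x)"
      unfolding o_def by (rule borel_integrable_compact[OF cS faL])
    then show "((\<lambda>x. f (a + x)) \<circ> L) absolutely_integrable_on (vec3 ` std3)"
      unfolding set_integrable_def using integrable_completion borel_measurable_integrable by blast
  qed
  also have "integral (vec3 ` std3) ((\<lambda>x. f (a + x)) \<circ> L) =
    (\<integral>x. indicator (vec3 ` std3) x *\<^sub>R f (a + L x) \<partial>distr lborel borel vec3)"
    unfolding o_def by (simp add: lin[OF cS faL] distr_vec3)
  also have "\<dots> = (\<integral>w. indicator (vec3 ` std3) (vec3 w) *\<^sub>R f (a + L (vec3 w)) \<partial>lborel)"
    by (rule integral_distr) (use meas[OF cS faL] borel_measurable_continuous_onI[OF continuous_vec3] in simp_all)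
  also have "(\<lambda>w. indicator (vec3 ` std3) (vec3 w) *\<^sub>R f (a + L (vec3 w))) =
    (\<lambda>w. indicator std3 w *\<^sub>R f (a + fst w *\<^sub>R (b - a) + fst (snd w) *\<^sub>R (c - a) + snd (snd w) *\<^sub>R (d - a)))"
  proof -
    have "inj vec3" by (rule injI) (metis prod.collapse vec3_nth)
    then have "indicator (vec3 ` std3) (vec3 w) = (indicator std3 w :: real)" for w
      by (auto simp: indicator_def inj_image_mem_iff)
    then show ?thesis by (simp add: L_def add.assoc fun_eq_iff)
  qed
  also have "det (matrix L) = vol a b c d"
    by (simp add: det_3 matrix_def L_def axis_def vol_def cross_components inner_vec_def sum_3) algebra
  finally show ?thesis .
qed

subsection \<open>The divergence theorem on a tetrahedron and Stokes' theorem on a triangle\<close>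

definition C1_field :: "(pt \<Rightarrow> 'a::euclidean_space) \<Rightarrow> bool"
  where "C1_field f \<longleftrightarrow> (\<forall>x. f differentiable (at x)) \<and> (\<forall>i. continuous_on UNIV (partial i f))"

lemma C1_continuous: "C1_field f \<Longrightarrow> continuous_on UNIV f"
  by (simp add: C1_field_def continuous_on_eq_continuous_within differentiable_imp_continuous_within)

lemma C1_partial_continuous: "C1_field f \<Longrightarrow> continuous_on UNIV (partial i f)"
  by (simp add: C1_field_def)

lemma frechet_partial:
  assumes "f differentiable (at x)"
  shows "frechet_derivative f (at x) w = (\<Sum>i\<in>UNIV. w $ i *\<^sub>R partial i f x)"
proof -
  have lin: "linear (frechet_derivative f (at x))" using assms by (rule linear_frechet_derivative)
  have "w = (\<Sum>i\<in>UNIV. w $ i *\<^sub>R axis i 1)" by (simp add: vec_eq_iff axis_def if_distrib cong: if_cong)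
  then have "frechet_derivative f (at x) w = frechet_derivative f (at x) (\<Sum>i\<in>UNIV. w $ i *\<^sub>R axis i 1)" by simp
  also have "\<dots> = (\<Sum>i\<in>UNIV. w $ i *\<^sub>R partial i f x)"
    by (simp only: linear_sum[OF lin] linear_scale[OF lin] partial_def)
  finally show ?thesis .
qed

lemma C1_directional:
  assumes "C1_field f"
  shows "((\<lambda>s. f (x + s *\<^sub>R w)) has_vector_derivative (\<Sum>i\<in>UNIV. w $ i *\<^sub>R partial i f (x + s *\<^sub>R w))) (at s)"
proof -
  have d: "f differentiable (at (x + s *\<^sub>R w))" using assms by (simp add: C1_field_def)
  have "(f has_derivative frechet_derivative f (at (x + s *\<^sub>R w))) (at (x + s *\<^sub>R w))"
    using d by (simp add: frechet_derivative_works)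
  moreover have "((\<lambda>s. x + s *\<^sub>R w) has_vector_derivative w) (at s)"
    by (auto intro!: derivative_eq_intros simp: has_vector_derivative_def)
  ultimately have "(f \<circ> (\<lambda>s. x + s *\<^sub>R w) has_vector_derivative frechet_derivative f (at (x + s *\<^sub>R w)) w) (at s)"
    by (intro vector_derivative_diff_chain_within) (auto intro: has_derivative_at_withinI)
  then show ?thesis by (simp add: o_def frechet_partial[OF d])
qed

abbreviation dirderiv :: "pt \<Rightarrow> (pt \<Rightarrow> 'a::real_normed_vector) \<Rightarrow> pt \<Rightarrow> 'a"
  where "dirderiv w f \<equiv> \<lambda>x. \<Sum>i\<in>UNIV. w $ i *\<^sub>R partial i f x"

lemma C1_dirderiv_continuous: "C1_field f \<Longrightarrow> continuous_on UNIV (dirderiv w f)"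
  by (intro continuous_intros C1_partial_continuous)

lemma tet_dirderiv:
  fixes f :: "pt \<Rightarrow> pt"
  assumes "C1_field f" "vol a b c d \<noteq> 0"
  shows "integral (convex hull {a, b, c, d}) (dirderiv (b - a) f) =
    \<bar>vol a b c d\<bar> *\<^sub>R (tri_avg b c d f - tri_avg a c d f)"
  unfolding integral_tet[OF C1_dirderiv_continuous[OF assms(1)] assms(2)]
    std3_derivative[OF C1_directional[OF assms(1)] C1_continuous[OF assms(1)] C1_dirderiv_continuous[OF assms(1)]] ..

lemma integrable_tet:
  fixes f :: "pt \<Rightarrow> 'a::euclidean_space"
  assumes "continuous_on UNIV f" "compact T"
  shows "f integrable_on T" "f absolutely_integrable_on T"
proof -
  have "integrable lborel (\<lambda>x. indicator T x *\<^sub>R f x)"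
    using assms continuous_on_subset by (intro borel_integrable_compact) auto
  then show "f absolutely_integrable_on T"
    unfolding set_integrable_def using integrable_completion borel_measurable_integrable by blast
  then show "f integrable_on T" by (rule set_lebesgue_integral_eq_integral(1))
qed

text \<open>Every coordinate direction is a combination of the three edge directions at \<open>a\<close>, by Cramer's rule,
  and along these the fundamental theorem of calculus applies. The coefficients combine to
  normal vectors of the faces, as in the divergence theorem.\<close>

lemma tet_partial:
  fixes f :: "pt \<Rightarrow> pt"
  assumes f: "C1_field f" and v: "vol a b c d \<noteq> 0"
  shows "integral (convex hull {a, b, c, d}) (partial i f) = sgn (vol a b c d) *\<^sub>R
    (nrm3 b c d $ i *\<^sub>R tri_avg b c d f - nrm3 a c d $ i *\<^sub>R tri_avg a c d f
     + nrm3 a b d $ i *\<^sub>R tri_avg a b d f - nrm3 a b c $ i *\<^sub>R tri_avg a b c f)"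
proof -
  let ?v = "vol a b c d" and ?T = "convex hull {a, b, c, d}"
  let ?I = "\<lambda>w. integral ?T (dirderiv w f)"
  let ?e = "axis i (1::real) :: pt"
  have fc: "continuous_on UNIV f" using f by (rule C1_continuous)
  have cT: "compact ?T" by (rule finite_imp_compact_convex_hull) simp
  have v2: "vol a c b d \<noteq> 0" "\<bar>vol a c b d\<bar> = \<bar>?v\<bar>" using v vol_perm(2)[of a b c d] by auto
  have v3: "vol a d b c = ?v" using vol_perm(1)[of a d b c] vol_perm(2)[of a d c b] vol_perm(1)[of a b c d]
      vol_perm(2)[of a b d c] vol_perm(1) vol_perm(2) by (metis minus_minus)
  have Ib: "?I (b - a) = \<bar>?v\<bar> *\<^sub>R (tri_avg b c d f - tri_avg a c d f)" by (rule tet_dirderiv[OF f v])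
  have "?T = convex hull {a, c, b, d}" "?T = convex hull {a, d, b, c}" by (simp_all add: insert_commute)
  then have Ic: "?I (c - a) = \<bar>?v\<bar> *\<^sub>R (tri_avg b c d f - tri_avg a b d f)"
    and Id: "?I (d - a) = \<bar>?v\<bar> *\<^sub>R (tri_avg b c d f - tri_avg a b c f)"
    using tet_dirderiv[OF f v2(1)] tet_dirderiv[OF f, of a d b c] v v2(2) v3
      tri_avg_perm[OF fc, of b c d] by simp_all
  have e: "?v *\<^sub>R ?e = nrm3 a c d $ i *\<^sub>R (b - a) - nrm3 a b d $ i *\<^sub>R (c - a) + nrm3 a b c $ i *\<^sub>R (d - a)"
    using cramer[of ?e "c - a" "d - a" "b - a"] cross_skew[of "d - a" "b - a"]
    by (simp add: inner_axis' vol_def)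
  have lin: "dirderiv (p *\<^sub>R u + q *\<^sub>R w) f x = p *\<^sub>R dirderiv u f x + q *\<^sub>R dirderiv w f x" for p q u w x
    by (simp add: scaleR_add_left scaleR_sum_right sum.distrib)
  have "?v *\<^sub>R partial i f x = nrm3 a c d $ i *\<^sub>R dirderiv (b - a) f x - nrm3 a b d $ i *\<^sub>R dirderiv (c - a) f x
    + nrm3 a b c $ i *\<^sub>R dirderiv (d - a) f x" for x
  proof -
    have "?v *\<^sub>R partial i f x = dirderiv (?v *\<^sub>R ?e) f x"
      by (simp add: axis_def if_distrib[of "\<lambda>t. t *\<^sub>R _"] if_distrib[of "\<lambda>t. _ * t"] cong: if_cong)
    also have "?v *\<^sub>R ?e = nrm3 a c d $ i *\<^sub>R (b - a) + 1 *\<^sub>R ((- nrm3 a b d $ i) *\<^sub>R (c - a) + nrm3 a b c $ i *\<^sub>R (d - a))"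
      using e by simp
    finally show ?thesis unfolding lin by simp
  qed
  moreover have gen: "integral ?T (\<lambda>x. p *\<^sub>R g1 x - q *\<^sub>R g2 x + r *\<^sub>R g3 x) =
      p *\<^sub>R integral ?T g1 - q *\<^sub>R integral ?T g2 + r *\<^sub>R integral ?T g3"
    if "g1 integrable_on ?T" "g2 integrable_on ?T" "g3 integrable_on ?T" for p q r and g1 g2 g3 :: "pt \<Rightarrow> pt"
    using that by (simp add: integral_add integral_diff integrable_cmul integrable_add integrable_diff integral_cmul)
  ultimately have "integral ?T (\<lambda>x. ?v *\<^sub>R partial i f x) = integral ?T (\<lambda>x. nrm3 a c d $ i *\<^sub>R dirderiv (b - a) f x -
      nrm3 a b d $ i *\<^sub>R dirderiv (c - a) f x + nrm3 a b c $ i *\<^sub>R dirderiv (d - a) f x)" by simp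
  also have "\<dots> = nrm3 a c d $ i *\<^sub>R ?I (b - a) - nrm3 a b d $ i *\<^sub>R ?I (c - a) + nrm3 a b c $ i *\<^sub>R ?I (d - a)"
    by (rule gen) (rule integrable_tet(1)[OF C1_dirderiv_continuous[OF f] cT])+
  finally have main: "?v *\<^sub>R integral ?T (partial i f) = nrm3 a c d $ i *\<^sub>R ?I (b - a) - nrm3 a b d $ i *\<^sub>R ?I (c - a) + nrm3 a b c $ i *\<^sub>R ?I (d - a)"
    by (simp add: integral_cmul)
  have N: "nrm3 b c d $ i = nrm3 a c d $ i - nrm3 a b d $ i + nrm3 a b c $ i"
    using exhaust_3[of i] by (auto simp: cross_components algebra_simps)
  have "?v *\<^sub>R integral ?T (partial i f) = \<bar>?v\<bar> *\<^sub>R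
    (nrm3 b c d $ i *\<^sub>R tri_avg b c d f - nrm3 a c d $ i *\<^sub>R tri_avg a c d f
     + nrm3 a b d $ i *\<^sub>R tri_avg a b d f - nrm3 a b c $ i *\<^sub>R tri_avg a b c f)"
    unfolding main Ib Ic Id N by (simp add: vec_eq_iff algebra_simps)
  then have "(1 / ?v) *\<^sub>R (?v *\<^sub>R integral ?T (partial i f)) = (1 / ?v) *\<^sub>R (\<bar>?v\<bar> *\<^sub>R
    (nrm3 b c d $ i *\<^sub>R tri_avg b c d f - nrm3 a c d $ i *\<^sub>R tri_avg a c d f
     + nrm3 a b d $ i *\<^sub>R tri_avg a b d f - nrm3 a b c $ i *\<^sub>R tri_avg a b c f))" by simp
  moreover have "1 / ?v * \<bar>?v\<bar> = sgn ?v" using v by (auto simp: sgn_if)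
  ultimately show ?thesis using v by (simp only: scaleR_scaleR) simp
qed

lemma curl_components: "curl f x $ 1 = partial 2 f x $ 3 - partial 3 f x $ 2"
  "curl f x $ 2 = partial 3 f x $ 1 - partial 1 f x $ 3"
  "curl f x $ 3 = partial 1 f x $ 2 - partial 2 f x $ 1"
  by (simp_all add: curl_def)

lemma C1_curl_continuous: "C1_field f \<Longrightarrow> continuous_on UNIV (curl f)"
proof -
  assume f: "C1_field f"
  have "continuous_on UNIV (\<lambda>x. \<chi> i. curl f x $ i)"
  proof (rule continuous_on_vec_lambda)
    fix i :: 3
    show "continuous_on UNIV (\<lambda>x. curl f x $ i)"
      using exhaust_3[of i]
      by (elim disjE; simp only: curl_components; intro continuous_intros C1_partial_continuous[OF f])
  qed
  then show ?thesis by simp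
qed

lemma tet_curl:
  fixes f :: "pt \<Rightarrow> pt"
  assumes f: "C1_field f" and v: "vol a b c d \<noteq> 0"
  shows "integral (convex hull {a, b, c, d}) (curl f) = sgn (vol a b c d) *\<^sub>R
    (cross3 (nrm3 b c d) (tri_avg b c d f) - cross3 (nrm3 a c d) (tri_avg a c d f)
     + cross3 (nrm3 a b d) (tri_avg a b d f) - cross3 (nrm3 a b c) (tri_avg a b c f))"
proof -
  let ?T = "convex hull {a, b, c, d}"
  have cT: "compact ?T" by (rule finite_imp_compact_convex_hull) simp
  have int: "integral ?T (\<lambda>x. partial i f x $ j - partial k f x $ l) =
     integral ?T (partial i f) $ j - integral ?T (partial k f) $ l" for i j k l
  proof -
    have I: "partial i f integrable_on ?T" for i
      by (rule integrable_tet(1)[OF C1_partial_continuous[OF f] cT])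
    have "(\<lambda>x. partial i f x $ j) integrable_on ?T" for i j
      by (rule integrable_tet(1)[OF _ cT]) (intro continuous_intros C1_partial_continuous[OF f])
    then show ?thesis by (simp add: integral_diff integral_component_eq_cart[OF I])
  qed
  have c: "integral ?T (curl f) $ k = integral ?T (\<lambda>x. curl f x $ k)" for k
    by (rule integral_component_eq_cart[OF integrable_tet(1)[OF C1_curl_continuous[OF f] cT], symmetric])
  show ?thesis
    by (simp add: vec_eq_iff forall_3 c curl_components int tet_partial[OF f v])
      (simp add: cross_components algebra_simps)
qed

lemma tri_avg_bounded_linear:
  fixes f :: "pt \<Rightarrow> 'a::euclidean_space" and h :: "'a \<Rightarrow> 'b::euclidean_space"
  assumes "continuous_on UNIV f" "bounded_linear h"
  shows "tri_avg p q r (\<lambda>x. h (f x)) = h (tri_avg p q r f)"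
proof -
  interpret bounded_linear h by fact
  show ?thesis
    unfolding tri_avg_def using integral_bounded_linear[OF assms(2) tri_avg_integrable[OF assms(1), of p "q - p" "r - p"]]
    by (simp add: scale)
qed

lemma seg_avg_bounded_linear:
  fixes f :: "pt \<Rightarrow> 'a::euclidean_space" and h :: "'a \<Rightarrow> 'b::euclidean_space"
  assumes "continuous_on UNIV f" "bounded_linear h"
  shows "seg_avg p q (\<lambda>x. h (f x)) = h (seg_avg p q f)"
proof -
  have "(\<lambda>s. f (p + s *\<^sub>R (q - p))) integrable_on {0..1}"
    by (intro integrable_continuous_interval continuous_on_compose2[OF assms(1)] continuous_intros) auto
  from integral_linear[OF this assms(2)] show ?thesis by (simp add: seg_avg_def o_def)
qed

lemma tri_avg_diff:
  fixes f g :: "pt \<Rightarrow> 'a::euclidean_space"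
  assumes "continuous_on UNIV f" "continuous_on UNIV g"
  shows "tri_avg p q r (\<lambda>x. f x - g x) = tri_avg p q r f - tri_avg p q r g"
  unfolding tri_avg_def
  by (simp only: scaleR_diff_right[of "indicator _ _"]
      Bochner_Integration.integral_diff[OF tri_avg_integrable[OF assms(1)] tri_avg_integrable[OF assms(2)]])

text \<open>The normal component of the curl consists of derivatives along two edges of the triangle, and
  these are integrated by \<open>tri_avg_derivative\<close>.\<close>

lemma triangle_stokes:
  fixes f :: "pt \<Rightarrow> pt"
  assumes f: "C1_field f"
  shows "nrm3 p q r \<bullet> tri_avg p q r (curl f) =
    seg_avg q r f \<bullet> (r - q) + seg_avg r p f \<bullet> (p - r) + seg_avg p q f \<bullet> (q - p)"
proof -
  note fc = C1_continuous[OF f] and dc = C1_dirderiv_continuous[OF f] and dd = C1_directional[OF f]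
  have e: "nrm3 p q r \<bullet> curl f x = dirderiv (q - p) f x \<bullet> (r - p) - dirderiv (r - p) f x \<bullet> (q - p)" for x
    by (simp add: inner_vec_def sum_3 cross_components curl_components algebra_simps)
  have "nrm3 p q r \<bullet> tri_avg p q r (curl f) = tri_avg p q r (\<lambda>x. nrm3 p q r \<bullet> curl f x)"
    by (rule tri_avg_bounded_linear[OF C1_curl_continuous[OF f] bounded_linear_inner_right, symmetric])
  also have "\<dots> = tri_avg p q r (\<lambda>x. dirderiv (q - p) f x \<bullet> (r - p)) - tri_avg p q r (\<lambda>x. dirderiv (r - p) f x \<bullet> (q - p))"
    unfolding e by (intro tri_avg_diff continuous_on_inner dc continuous_on_const)
  also have "\<dots> = tri_avg p q r (dirderiv (q - p) f) \<bullet> (r - p) - tri_avg p q r (dirderiv (r - p) f) \<bullet> (q - p)"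
    by (simp only: tri_avg_bounded_linear[OF dc bounded_linear_inner_left])
  also have "tri_avg p q r (dirderiv (q - p) f) = seg_avg q r f - seg_avg p r f"
    by (rule tri_avg_derivative[OF dd fc dc])
  also have "tri_avg p q r (dirderiv (r - p) f) = seg_avg q r f - seg_avg p q f"
    using tri_avg_derivative[OF dd fc dc, of p r q] seg_avg_swap[OF fc, of q r] tri_avg_swap[OF dc, of p q r "r - p"] by simp
  also have "seg_avg p r f = seg_avg r p f" by (rule seg_avg_swap[OF fc])
  finally show ?thesis by (simp add: inner_diff_left inner_diff_right algebra_simps)
qed

section \<open>Piecewise constant fields\<close>

lemma class_of_ex: "\<exists>f. m = class_of f"
  by transfer (auto intro: exI)

lemma class_of_eq_iff: "class_of f = class_of g \<longleftrightarrow> (AE x in lebesgue. x \<in> cube \<longrightarrow> f x = g x)"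
  by transfer simp

lemma const_on_class_of: "const_on (class_of f) T A \<longleftrightarrow> (AE x in lebesgue. x \<in> cube \<and> x \<in> T \<longrightarrow> f x = A)"
  by transfer simp

lemma class_of_add: "class_of f + class_of g = class_of (\<lambda>x. f x + g x)"
  by transfer simp

lemma class_of_scaleR: "c *\<^sub>R class_of f = class_of (\<lambda>x. c *\<^sub>R f x)"
  by transfer simp

text \<open>The edge moment times the length of the edge. Unlike the moment it is polynomial in the end
  points.\<close>

definition edge_form :: "mat3 \<Rightarrow> pt \<Rightarrow> pt \<Rightarrow> real"
  where "edge_form A x z = (z - x) \<bullet> (A *v (z - x))"

lemma edge_form_swap: "edge_form A z x = edge_form A x z"
  by (simp add: edge_form_def matrix_vector_mult_diff_distrib inner_diff_left inner_diff_right)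

lemma edge_form_translation [simp]: "edge_form A (k + x) (k + z) = edge_form A x z"
  by (simp add: edge_form_def)

lemma edge_form_add: "edge_form (A + B) x z = edge_form A x z + edge_form B x z"
  by (simp add: edge_form_def matrix_vector_mult_add_rdistrib inner_add_right)

lemma edge_form_scaleR: "edge_form (c *\<^sub>R A) x z = c * edge_form A x z"
  by (simp add: edge_form_def scaleR_matrix_vector_assoc[symmetric])

text \<open>The values of an element of \<open>X1\<close> on the lifted tetrahedra: \<open>X1\<close> is described by these families
  (\<open>X1_props\<close>, \<open>regge_step_field\<close>), so that its classes modulo null sets need not be handled
  further.\<close>

definition regge :: "pt set set \<Rightarrow> (pt set \<Rightarrow> mat3) set"
  where "regge K = {U. (\<forall>T\<in>tets K. transpose (U T) = U T) \<and>
    (\<forall>T\<in>tets K. \<forall>k\<in>int_lattice. U ((+) k ` T) = U T) \<and>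
    (\<forall>T\<in>tets K. \<forall>T'\<in>tets K. \<forall>x z. x \<noteq> z \<and> closed_segment x z face_of T \<and> closed_segment x z face_of T' \<longrightarrow>
       edge_form (U T) x z = edge_form (U T') x z)}"

definition step_field :: "pt set set \<Rightarrow> (pt set \<Rightarrow> 'a::real_vector) \<Rightarrow> 'a field_class"
  where "step_field K U = class_of (\<lambda>x. \<Sum>T\<in>K. indicat_real (interior T) x *\<^sub>R U T)"

lemma step_field_add: "step_field K U + step_field K W = step_field K (\<lambda>T. U T + W T)"
  by (simp add: step_field_def class_of_add scaleR_add_right sum.distrib)

lemma step_field_scaleR: "c *\<^sub>R step_field K U = step_field K (\<lambda>T. c *\<^sub>R U T)"
  by (simp add: step_field_def class_of_scaleR scaleR_sum_right mult.commute)

lemma transpose_add: "transpose (A + B) = transpose A + transpose (B :: mat3)"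
  by (simp add: transpose_def vec_eq_iff)

lemma transpose_scaleR: "transpose (c *\<^sub>R A) = c *\<^sub>R transpose (A :: mat3)"
  by (simp add: transpose_def vec_eq_iff)

context mesh
begin

lemma negligible_frontier_K: "T \<in> K \<Longrightarrow> negligible (frontier T)"
  using negligible_convex_frontier convex_simplex K_simplex by blast

lemma K_not_negligible: "T \<in> K \<Longrightarrow> \<not> negligible T"
  using tets_interior[OF K_tets] open_not_negligible[of "interior T"] negligible_subset interior_subset
  by blast

text \<open>Two values would be attained almost everywhere on a set of positive measure.\<close>

lemma const_on_unique:
  assumes T: "T \<in> K" and A: "const_on m T A" "const_on m T B"
  shows "A = B"
proof (rule ccontr)
  assume ne: "A \<noteq> B"
  obtain f where f: "m = class_of f" using class_of_ex by blast
  have "AE x in lebesgue. x \<notin> T"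
    using A unfolding f const_on_class_of
  proof eventually_elim
    case (elim x)
    then show ?case using ne K_cube[OF T] by blast
  qed
  moreover have "T \<in> sets lebesgue"
    using compact_simplex[OF K_simplex[OF T]] lmeasurable_compact fmeasurableD by blast
  ultimately have "T \<in> null_sets lebesgue" by (simp add: AE_iff_null_sets)
  then show False using K_not_negligible[OF T] negligible_iff_null_sets by blast
qed

lemma val_translation:
  assumes "T \<in> K" "k \<in> int_lattice" "const_on m T A"
  shows "val K m ((+) k ` T) = A"
  unfolding val_def
proof (rule the_equality)
  show "\<exists>l\<in>int_lattice. \<exists>S\<in>K. (+) k ` T = (+) l ` S \<and> const_on m S A" using assms by blast
next
  fix B assume "\<exists>l\<in>int_lattice. \<exists>S\<in>K. (+) k ` T = (+) l ` S \<and> const_on m S B"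
  then obtain l S where S: "l \<in> int_lattice" "S \<in> K" "(+) k ` T = (+) l ` S" "const_on m S B" by blast
  then have "S = T" using tets_rep_unique(2)[OF S(3) assms(1) S(2) assms(2) S(1)] by simp
  then show "B = A" using const_on_unique assms S by blast
qed

lemma val_eq: "T \<in> K \<Longrightarrow> const_on m T A \<Longrightarrow> val K m T = A"
  using val_translation[of T 0 m A] by simp

lemma tets_cases:
  assumes "T \<in> tets K"
  obtains k S where "k \<in> int_lattice" "S \<in> K" "T = (+) k ` S"
  using assms by (auto simp: tets_def)

lemma const_on_step_field:
  assumes T: "T \<in> K"
  shows "const_on (step_field K U) T (U T)"
proof -
  have "AE x in lebesgue. x \<notin> frontier T"
    using negligible_frontier_K[OF T] by (simp add: AE_not_in negligible_iff_null_sets)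
  then show ?thesis unfolding step_field_def const_on_class_of
  proof eventually_elim
    case (elim x)
    show ?case
    proof
      assume x: "x \<in> cube \<and> x \<in> T"
      then have xi: "x \<in> interior T" using elim by (simp add: frontier_def closure_subset[THEN subsetD])
      have "(\<Sum>S\<in>K. indicat_real (interior S) x *\<^sub>R U S) = (\<Sum>S\<in>K. if S = T then U T else 0)"
      proof (rule sum.cong[OF refl])
        fix S assume S: "S \<in> K"
        show "indicat_real (interior S) x *\<^sub>R U S = (if S = T then U T else 0)"
          using xi x tets_interior_disjoint[OF K_tets[OF T] K_tets[OF S]] by (auto simp: indicator_def)
      qed
      then show "(\<Sum>S\<in>K. indicat_real (interior S) x *\<^sub>R U S) = U T" using T finite_K by simp
    qed
  qed
qed

lemma val_step_field:
  assumes "T \<in> tets K" "\<And>T k. T \<in> tets K \<Longrightarrow> k \<in> int_lattice \<Longrightarrow> U ((+) k ` T) = U T"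
  shows "val K (step_field K U) T = U T"
  using assms(1)
proof (rule tets_cases)
  fix k S assume "k \<in> int_lattice" "S \<in> K" "T = (+) k ` S"
  then show ?thesis using val_translation[OF _ _ const_on_step_field] assms(2) K_tets by metis
qed

lemma step_field_L2: "step_field K U \<in> L2_fields" for U :: "pt set \<Rightarrow> 'a::euclidean_space"
proof -
  let ?f = "\<lambda>x. \<Sum>T\<in>K. indicat_real (interior T) x *\<^sub>R U T"
  have m1: "?f \<in> borel_measurable lborel" by measurable
  then have m: "?f \<in> borel_measurable (lebesgue_on cube)"
    by (intro measurable_restrict_space1 measurable_completion) 
  define B where "B = (\<Sum>T\<in>K. norm (U T))"
  have b: "norm (?f x) \<le> B" for x
    unfolding B_def by (rule sum_norm_le) (simp add: indicator_def)
  have "finite_measure (lebesgue_on cube)"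
    by (rule finite_measure_lebesgue_on) (simp add: cube_def)
  then have "integrable (lebesgue_on cube) (\<lambda>x. (norm (?f x))\<^sup>2)"
    by (rule finite_measure.integrable_const_bound[where B = "B\<^sup>2"])
      (use b m in \<open>auto intro!: power_mono borel_measurable_power borel_measurable_norm\<close>)
  then show ?thesis unfolding L2_fields_def step_field_def using m by blast
qed

lemma field_eqI:
  assumes "\<And>T. T \<in> K \<Longrightarrow> const_on m T (A T)" "\<And>T. T \<in> K \<Longrightarrow> const_on m' T (A T)"
  shows "m = m'"
proof -
  obtain f f' where f: "m = class_of f" "m' = class_of f'" using class_of_ex by metis
  have "AE x in lebesgue. \<forall>T\<in>K. x \<in> cube \<and> x \<in> T \<longrightarrow> f x = f' x"
  proof (rule eventually_ball_finite[OF finite_K], rule ballI)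
    fix T assume T: "T \<in> K"
    show "AE x in lebesgue. x \<in> cube \<and> x \<in> T \<longrightarrow> f x = f' x"
      using assms(1)[OF T] assms(2)[OF T] unfolding f const_on_class_of by eventually_elim auto
  qed
  then show ?thesis unfolding f class_of_eq_iff
  proof eventually_elim
    case (elim x)
    then show ?case using Union_K by blast
  qed
qed

lemma edge_face_tet: "closed_segment x z \<in> subsimps K 1 \<Longrightarrow> \<exists>T\<in>tets K. closed_segment x z face_of T"
  by (auto simp: subsimps_def)

lemma edge_moment_on_val:
  "edge_moment_on K m (x, z) T = edge_form (val K m T) x z / norm (z - x)"
proof (cases "z = x")
  case False
  have "edge_moment_on K m (x, z) T = norm (z - x) * (sgn (z - x) \<bullet> (val K m T *v sgn (z - x)))"
    by (simp add: edge_moment_on_def edge_integral_def tangent_def)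
  also have "\<dots> = edge_form (val K m T) x z / norm (z - x)"
  proof -
    define w where "w = z - x"
    have "norm w \<noteq> 0" using False by (simp add: w_def)
    then show ?thesis unfolding edge_form_def w_def[symmetric]
      by (simp add: sgn_div_norm matrix_vector_mult_scaleR field_simps)
  qed
  finally show ?thesis .
qed (simp add: edge_moment_on_def edge_integral_def edge_form_def)

lemma edges_iff: "(x, z) \<in> edges K \<longleftrightarrow> x \<noteq> z \<and> closed_segment x z \<in> subsimps K 1 \<and> torus_pt x = x"
  by (simp add: edges_def)

lemma segment_translation: "(+) k ` closed_segment x z = closed_segment (k + x) (k + z)"
  by (simp add: closed_segment_translation)

lemma edge_shift:
  assumes "x \<noteq> z" "closed_segment x z \<in> subsimps K 1"
  shows "(torus_pt x, torus_pt x + (z - x)) \<in> edges K"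
proof -
  have "closed_segment (torus_pt x) (torus_pt x + (z - x)) = (+) (torus_pt x - x) ` closed_segment x z"
    unfolding segment_translation by (simp add: algebra_simps)
  then show ?thesis using assms subsimps_translation[OF assms(2) torus_pt_diff_lattice[of x]]
    by (simp add: edges_iff)
qed

lemma reggeI:
  assumes "\<And>T. T \<in> tets K \<Longrightarrow> transpose (U T) = U T"
    "\<And>T k. T \<in> tets K \<Longrightarrow> k \<in> int_lattice \<Longrightarrow> U ((+) k ` T) = U T"
    "\<And>T T' x z. T \<in> tets K \<Longrightarrow> T' \<in> tets K \<Longrightarrow> x \<noteq> z \<Longrightarrow> closed_segment x z face_of T \<Longrightarrow>
      closed_segment x z face_of T' \<Longrightarrow> edge_form (U T) x z = edge_form (U T') x z"
  shows "U \<in> regge K"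
  using assms unfolding regge_def by blast

lemma reggeD:
  assumes "U \<in> regge K" "T \<in> tets K"
  shows "transpose (U T) = U T" "k \<in> int_lattice \<Longrightarrow> U ((+) k ` T) = U T"
    "T' \<in> tets K \<Longrightarrow> x \<noteq> z \<Longrightarrow> closed_segment x z face_of T \<Longrightarrow>
      closed_segment x z face_of T' \<Longrightarrow> edge_form (U T) x z = edge_form (U T') x z"
  using assms unfolding regge_def by blast+

lemma X1_props:
  assumes m: "m \<in> X1 K"
  shows "T \<in> K \<Longrightarrow> const_on m T (val K m T)"
    and "val K m \<in> regge K"
proof -
  have c: "transpose (val K m T) = val K m T \<and> const_on m T (val K m T)" if "T \<in> K" for T
    using m that val_eq unfolding X1_def by force
  then show "T \<in> K \<Longrightarrow> const_on m T (val K m T)" by blast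
  have tr: "val K m ((+) k ` T) = val K m T" if T: "T \<in> tets K" and k: "k \<in> int_lattice" for k T
    using T
  proof (rule tets_cases)
    fix l S assume S: "l \<in> int_lattice" "S \<in> K" "T = (+) l ` S"
    have "(+) k ` T = (+) (k + l) ` S" unfolding S(3) by (simp add: translation_translation)
    then show ?thesis using val_translation[OF S(2) lattice_add[OF k S(1)]] val_translation[OF S(2,1)] c[OF S(2)] S(3)
      by metis
  qed
  have sym: "transpose (val K m T) = val K m T" if T: "T \<in> tets K" for T
    using T by (rule tets_cases) (metis tr K_tets c)
  have "edge_form (val K m T) x z = edge_form (val K m T') x z"
    if T: "T \<in> tets K" "T' \<in> tets K" and xz: "x \<noteq> z" "closed_segment x z face_of T" "closed_segment x z face_of T'" for T T' x z
  proof -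
    let ?k = "torus_pt x - x"
    let ?e = "(torus_pt x, torus_pt x + (z - x))"
    have k: "?k \<in> int_lattice" by (rule torus_pt_diff_lattice)
    have "closed_segment x z \<in> subsimps K 1"
      using xz T one_simplex_segment by (auto simp: subsimps_def)
    then have e: "?e \<in> edges K" using edge_shift xz(1) by blast
    have s: "seg ?e = (+) ?k ` closed_segment x z" unfolding segment_translation by (simp add: seg_def algebra_simps)
    have f: "seg ?e face_of ((+) ?k ` T)" "seg ?e face_of ((+) ?k ` T')" unfolding s using xz by simp_all
    have t: "(+) ?k ` T \<in> tets K" "(+) ?k ` T' \<in> tets K" using tets_translation T k by blast+
    obtain r where "\<forall>T\<in>tets K. seg ?e face_of T \<longrightarrow> edge_moment_on K m ?e T = r"
      using m e unfolding X1_def by blast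
    then have "edge_moment_on K m ?e ((+) ?k ` T) = edge_moment_on K m ?e ((+) ?k ` T')"
      using f t by metis
    then have "edge_form (val K m T) (torus_pt x) (torus_pt x + (z - x)) =
        edge_form (val K m T') (torus_pt x) (torus_pt x + (z - x))"
      using xz(1) tr T k by (simp add: edge_moment_on_val)
    then show ?thesis by (simp add: edge_form_def)
  qed
  then show "val K m \<in> regge K" by (intro reggeI sym tr)
qed

lemma regge_step_field:
  assumes U: "U \<in> regge K"
  shows "step_field K U \<in> X1 K" "\<And>T. T \<in> tets K \<Longrightarrow> val K (step_field K U) T = U T"
proof -
  show v: "val K (step_field K U) T = U T" if "T \<in> tets K" for T
    by (rule val_step_field[OF that reggeD(2)[OF U]])
  have "\<exists>r. \<forall>T\<in>tets K. seg e face_of T \<longrightarrow> edge_moment_on K (step_field K U) e T = r" if e: "e \<in> edges K" for e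
  proof -
    obtain x z where xz: "e = (x, z)" by force
    then have "x \<noteq> z" "closed_segment x z \<in> subsimps K 1" using e by (simp_all add: edges_iff)
    then obtain T where T: "T \<in> tets K" "closed_segment x z face_of T" using edge_face_tet by blast
    have "edge_moment_on K (step_field K U) e T' = edge_form (U T) x z / norm (z - x)"
      if T': "T' \<in> tets K" "seg e face_of T'" for T'
    proof -
      have "edge_form (U T) x z = edge_form (U T') x z"
        using reggeD(3)[OF U T(1) T'(1) \<open>x \<noteq> z\<close> T(2)] T'(2) by (simp add: xz seg_def)
      then show ?thesis using v T' by (simp add: xz edge_moment_on_val)
    qed
    then show ?thesis by blast
  qed
  moreover have "\<exists>A. transpose A = A \<and> const_on (step_field K U) T A" if "T \<in> K" for T
    using const_on_step_field[OF that] reggeD(1)[OF U K_tets[OF that]] by blast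
  ultimately show "step_field K U \<in> X1 K" using step_field_L2 by (auto simp: X1_def)
qed

lemma X1_step_field: "m \<in> X1 K \<Longrightarrow> m = step_field K (val K m)"
  by (rule field_eqI[OF X1_props(1) const_on_step_field])

lemma regge_add:
  assumes "U \<in> regge K" "W \<in> regge K"
  shows "(\<lambda>T. U T + W T) \<in> regge K"
proof (rule reggeI, goal_cases)
  case (3 T T' x z)
  then show ?case using reggeD(3)[OF assms(1) 3] reggeD(3)[OF assms(2) 3] by (simp add: edge_form_add)
qed (use reggeD(1,2)[OF assms(1)] reggeD(1,2)[OF assms(2)] in \<open>simp_all add: transpose_add\<close>)

lemma regge_scaleR:
  assumes "U \<in> regge K"
  shows "(\<lambda>T. c *\<^sub>R U T) \<in> regge K"
proof (rule reggeI, goal_cases)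
  case (3 T T' x z)
  then show ?case using reggeD(3)[OF assms(1) 3] by (simp add: edge_form_scaleR)
qed (use reggeD(1,2)[OF assms(1)] in \<open>simp_all add: transpose_scaleR\<close>)

lemma X1_add:
  assumes "m \<in> X1 K" "m' \<in> X1 K"
  shows "m + m' \<in> X1 K" "\<And>T. T \<in> tets K \<Longrightarrow> val K (m + m') T = val K m T + val K m' T"
proof -
  have "m + m' = step_field K (\<lambda>T. val K m T + val K m' T)"
    unfolding step_field_add[symmetric]
    by (rule arg_cong2[where f = "(+)", OF X1_step_field[OF assms(1)] X1_step_field[OF assms(2)]])
  then show "m + m' \<in> X1 K" "\<And>T. T \<in> tets K \<Longrightarrow> val K (m + m') T = val K m T + val K m' T"
    using regge_step_field[OF regge_add[OF X1_props(2)[OF assms(1)] X1_props(2)[OF assms(2)]]] by simp_all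
qed

lemma X1_scaleR:
  assumes "m \<in> X1 K"
  shows "c *\<^sub>R m \<in> X1 K" "\<And>T. T \<in> tets K \<Longrightarrow> val K (c *\<^sub>R m) T = c *\<^sub>R val K m T"
proof -
  have "c *\<^sub>R m = step_field K (\<lambda>T. c *\<^sub>R val K m T)"
    unfolding step_field_scaleR[symmetric] by (rule arg_cong[OF X1_step_field[OF assms(1)]])
  then show "c *\<^sub>R m \<in> X1 K" "\<And>T. T \<in> tets K \<Longrightarrow> val K (c *\<^sub>R m) T = c *\<^sub>R val K m T"
    using regge_step_field[OF regge_scaleR[OF X1_props(2)[OF assms]]] by simp_all
qed

lemma subspace_X1: "subspace (X1 K)"
proof -
  have "(\<lambda>T. 0) \<in> regge K" by (simp add: regge_def edge_form_def transpose_def vec_eq_iff)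
  moreover have "step_field K (\<lambda>T. 0 :: mat3) = 0"
    using step_field_scaleR[of 0 K "\<lambda>T. 0"] by simp
  ultimately have "0 \<in> X1 K" using regge_step_field(1) by metis
  then show ?thesis unfolding subspace_def using X1_add(1) X1_scaleR(1) by blast
qed

lemma edge_moment_eq:
  assumes m: "m \<in> X1 K" and e: "(x, z) \<in> edges K" and T: "T \<in> tets K" "closed_segment x z face_of T"
  shows "edge_moment K m (x, z) = edge_form (val K m T) x z / norm (z - x)"
proof -
  obtain r where r: "\<forall>T\<in>tets K. seg (x, z) face_of T \<longrightarrow> edge_moment_on K m (x, z) T = r"
    using m e unfolding X1_def by blast
  have s: "seg (x, z) = closed_segment x z" by (simp add: seg_def)
  have "edge_moment K m (x, z) = r"
    unfolding edge_moment_def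
  proof (rule the_equality)
    fix r' assume "\<forall>T\<in>tets K. seg (x, z) face_of T \<longrightarrow> edge_moment_on K m (x, z) T = r'"
    then show "r' = r" using r T s by metis
  qed (rule r)
  then show ?thesis using r T s edge_moment_on_val by metis
qed

lemma X1_eqI:
  assumes "m \<in> X1 K" "m' \<in> X1 K" "\<And>T. T \<in> K \<Longrightarrow> val K m T = val K m' T"
  shows "m = m'"
  using field_eqI[OF X1_props(1)[OF assms(1)]] X1_props(1)[OF assms(2)] assms(3) by metis

end

subsection \<open>Symmetric matrices and the six edges of a tetrahedron\<close>

lemma sym_bilinear: "transpose A = A \<Longrightarrow> x \<bullet> (A *v y) = y \<bullet> (A *v x)" for A :: mat3
  by (metis dot_lmul_matrix inner_commute vector_transpose_matrix)

text \<open>Polarisation gives the bilinear form on all pairs of edge vectors at the vertex \<open>a\<close>, which are a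
  basis.\<close>

lemma edge_forms_zero:
  fixes A :: mat3
  assumes v: "vol a b c d \<noteq> 0" and sym: "transpose A = A"
    and z: "edge_form A a b = 0" "edge_form A a c = 0" "edge_form A a d = 0"
      "edge_form A b c = 0" "edge_form A b d = 0" "edge_form A c d = 0"
  shows "A = 0"
proof -
  have pol: "(p - a) \<bullet> (A *v (q - a)) = 0" if "edge_form A a p = 0" "edge_form A a q = 0" "edge_form A p q = 0" for p q
  proof -
    have e: "q - p = (q - a) - (p - a)" by simp
    have "edge_form A p q = (q - a) \<bullet> (A *v (q - a)) - (q - a) \<bullet> (A *v (p - a)) - (p - a) \<bullet> (A *v (q - a)) + (p - a) \<bullet> (A *v (p - a))"
      unfolding edge_form_def e by (simp only: matrix_vector_mult_diff_distrib inner_diff_left inner_diff_right)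
    then show ?thesis using that sym_bilinear[OF sym, of "q - a" "p - a"] by (simp add: edge_form_def)
  qed
  have basis: "x = 0" if "(b - a) \<bullet> x = 0" "(c - a) \<bullet> x = 0" "(d - a) \<bullet> x = 0" for x
  proof -
    have "vol a b c d * (x \<bullet> x) = (vol a b c d *\<^sub>R x) \<bullet> x" by simp
    also have "\<dots> = 0" unfolding vol_def cramer[symmetric, where x = x]
      using that by (simp add: inner_add_left)
    finally show ?thesis using v by simp
  qed
  have zero: "A *v (q - a) = 0" if q: "q \<in> {b, c, d}" for q
    using q pol z edge_form_swap[of A] by (intro basis) (auto simp: edge_form_def)
  have "A *v x = 0" for x
  proof -
    have "vol a b c d *\<^sub>R (A *v x) = A *v (vol a b c d *\<^sub>R x)" by (simp add: matrix_vector_mult_scaleR)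
    also have "\<dots> = 0" unfolding vol_def cramer[symmetric, where x = x]
      using zero by (simp add: matrix_vector_right_distrib matrix_vector_mult_scaleR)
    finally show ?thesis using v by simp
  qed
  then show ?thesis by (simp add: matrix_eq)
qed

definition outer :: "pt \<Rightarrow> pt \<Rightarrow> mat3"
  where "outer u v = (\<chi> i j. u $ i * v $ j)"

lemma outer_mult: "outer u v *v x = (v \<bullet> x) *\<^sub>R u"
  by (simp add: outer_def matrix_vector_mult_def inner_vec_def vec_eq_iff sum_distrib_left mult_ac)

lemma transpose_outer: "transpose (outer u v) = outer v u"
  by (simp add: outer_def transpose_def vec_eq_iff mult.commute)

lemma dual_basis:
  assumes v: "vol a b c d \<noteq> 0"
  obtains gb gc gd where "gb \<bullet> (b - a) = 1" "gb \<bullet> (c - a) = 0" "gb \<bullet> (d - a) = 0"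
    "gc \<bullet> (b - a) = 0" "gc \<bullet> (c - a) = 1" "gc \<bullet> (d - a) = 0"
    "gd \<bullet> (b - a) = 0" "gd \<bullet> (c - a) = 0" "gd \<bullet> (d - a) = 1"
proof -
  let ?v = "vol a b c d"
  have "cross3 (c - a) (d - a) \<bullet> (b - a) = ?v" "cross3 (d - a) (b - a) \<bullet> (c - a) = ?v" "cross3 (b - a) (c - a) \<bullet> (d - a) = ?v"
    by (simp_all add: vol_def cross_components inner_vec_def sum_3 algebra_simps)
  then show thesis
    by (intro that[of "(1 / ?v) *\<^sub>R cross3 (c - a) (d - a)" "(1 / ?v) *\<^sub>R cross3 (d - a) (b - a)" "(1 / ?v) *\<^sub>R cross3 (b - a) (c - a)"])
      (use v in \<open>simp_all only: inner_scaleR_left dot_cross_self, simp_all\<close>)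
qed

text \<open>The matrix is a combination of products of vectors of the basis dual to the edge vectors at \<open>a\<close>;
  the coefficients \<open>\<beta>\<close> of the mixed products are forced by polarisation.\<close>

lemma edge_forms_exist:
  fixes M :: "pt \<Rightarrow> pt \<Rightarrow> real"
  assumes v: "vol a b c d \<noteq> 0"
  shows "\<exists>A. transpose A = A \<and> edge_form A a b = M a b \<and> edge_form A a c = M a c \<and> edge_form A a d = M a d \<and>
    edge_form A b c = M b c \<and> edge_form A b d = M b d \<and> edge_form A c d = M c d"
proof -
  obtain gb gc gd where g: "gb \<bullet> (b - a) = 1" "gb \<bullet> (c - a) = 0" "gb \<bullet> (d - a) = 0"
    "gc \<bullet> (b - a) = 0" "gc \<bullet> (c - a) = 1" "gc \<bullet> (d - a) = 0"
    "gd \<bullet> (b - a) = 0" "gd \<bullet> (c - a) = 0" "gd \<bullet> (d - a) = 1" by (rule dual_basis[OF v])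
  define \<beta> where "\<beta> p q = (M a p + M a q - M p q) / 2" for p q
  define A where "A = M a b *\<^sub>R outer gb gb + M a c *\<^sub>R outer gc gc + M a d *\<^sub>R outer gd gd +
    \<beta> b c *\<^sub>R (outer gb gc + outer gc gb) + \<beta> b d *\<^sub>R (outer gb gd + outer gd gb) + \<beta> c d *\<^sub>R (outer gc gd + outer gd gc)"
  have form: "x \<bullet> (A *v x) = M a b * (gb \<bullet> x)\<^sup>2 + M a c * (gc \<bullet> x)\<^sup>2 + M a d * (gd \<bullet> x)\<^sup>2 +
    2 * \<beta> b c * (gb \<bullet> x) * (gc \<bullet> x) + 2 * \<beta> b d * (gb \<bullet> x) * (gd \<bullet> x) + 2 * \<beta> c d * (gc \<bullet> x) * (gd \<bullet> x)" for x
    by (simp add: A_def matrix_vector_mult_add_rdistrib scaleR_matrix_vector_assoc[symmetric] outer_mult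
        inner_add_right inner_commute[of x] power2_eq_square algebra_simps)
  have d: "c - b = (c - a) - (b - a)" "d - b = (d - a) - (b - a)" "d - c = (d - a) - (c - a)" by simp_all
  have "transpose A = A"
    by (simp add: A_def transpose_add transpose_scaleR transpose_outer add_ac)
  moreover have "edge_form A a b = M a b" "edge_form A a c = M a c" "edge_form A a d = M a d"
    unfolding edge_form_def form by (simp_all only: g) simp_all
  moreover have "edge_form A b c = M b c" "edge_form A b d = M b d" "edge_form A c d = M c d"
    unfolding edge_form_def form d inner_diff_right[of _ "_ - a" "_ - a"] g
    by (simp_all add: \<beta>_def field_simps)
  ultimately show ?thesis by blast
qed

subsection \<open>Edges of the torus\<close>

text \<open>The element of the oriented set \<open>E\<close> that represents an arbitrary lifted segment.\<close>

definition edge_rep :: "edge set \<Rightarrow> pt \<Rightarrow> pt \<Rightarrow> edge"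
  where "edge_rep E x z = (let e = (torus_pt x, torus_pt x + (z - x)) in if e \<in> E then e else rev_edge e)"

context mesh
begin

lemma rev_edge_edges:
  assumes "e \<in> edges K"
  shows "rev_edge e \<in> edges K"
proof -
  obtain x z where e: "e = (x, z)" by force
  then have "z \<noteq> x" "closed_segment z x \<in> subsimps K 1"
    using assms by (auto simp: edges_iff closed_segment_commute)
  then show ?thesis using edge_shift e by (simp add: rev_edge_def)
qed

lemma rev_edge_rev_edge:
  assumes "e \<in> edges K"
  shows "rev_edge (rev_edge e) = e"
proof -
  obtain x z where e: "e = (x, z)" by force
  have "torus_pt x = x" using assms by (simp add: e edges_iff)
  moreover have "torus_pt (torus_pt z + (x - z)) = torus_pt x"
    using torus_pt_add[OF torus_pt_diff_lattice[of z], of x] by (simp add: algebra_simps)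
  ultimately show ?thesis by (simp add: e rev_edge_def)
qed

lemma segment_ends_distinct:
  assumes "T \<in> tets K" "closed_segment x z face_of T" "x \<noteq> z"
  shows "torus_pt x \<noteq> torus_pt z"
  using assms(1)
proof (rule tets_cases)
  fix k S assume S: "k \<in> int_lattice" "S \<in> K" "T = (+) k ` S"
  have "closed_segment (x - k) (z - k) face_of S"
    using assms(2) unfolding S(3) face_of_translation_left segment_translation by simp
  then have "x - k \<in> vertices_of S" "z - k \<in> vertices_of S"
    using segment_face_of by (auto simp: vertices_of_def)
  then have "torus_pt (x - k) \<noteq> torus_pt (z - k)" using K_inj[OF S(2)] assms(3) by (auto dest: inj_onD)
  then show ?thesis using torus_pt_add[OF lattice_minus[OF S(1)]] by simp
qed

lemma head_neq_tail:
  assumes "e \<in> edges K"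
  shows "head e \<noteq> tail e"
proof -
  obtain x z where e: "e = (x, z)" by force
  then have xz: "x \<noteq> z" "closed_segment x z \<in> subsimps K 1" "torus_pt x = x" using assms by (auto simp: edges_iff)
  then show ?thesis using edge_face_tet[OF xz(2)] segment_ends_distinct e by (auto simp: head_def tail_def)
qed

lemma edge_moment_rev:
  assumes m: "m \<in> X1 K" and e: "e \<in> edges K"
  shows "edge_moment K m (rev_edge e) = edge_moment K m e"
proof -
  obtain x z where xz: "e = (x, z)" by force
  then have "closed_segment x z \<in> subsimps K 1" using e by (simp add: edges_iff)
  then obtain T where T: "T \<in> tets K" "closed_segment x z face_of T" using edge_face_tet by blast
  let ?k = "torus_pt z - z"
  have k: "?k \<in> int_lattice" by (rule torus_pt_diff_lattice)
  have "closed_segment (torus_pt z) (torus_pt z + (x - z)) = (+) ?k ` closed_segment x z"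
    unfolding segment_translation by (simp add: algebra_simps closed_segment_commute)
  then have "closed_segment (torus_pt z) (torus_pt z + (x - z)) face_of ((+) ?k ` T)" using T by simp
  moreover have "(torus_pt z, torus_pt z + (x - z)) \<in> edges K"
    using rev_edge_edges[OF e] by (simp add: xz rev_edge_def)
  ultimately have "edge_moment K m (torus_pt z, torus_pt z + (x - z)) = edge_form (val K m ((+) ?k ` T)) (torus_pt z) (torus_pt z + (x - z)) / norm (x - z)"
    using edge_moment_eq[OF m _ tets_translation[OF T(1) k]] by simp
  also have "val K m ((+) ?k ` T) = val K m T" by (rule reggeD(2)[OF X1_props(2)[OF m] T(1) k])
  also have "edge_form (val K m T) (torus_pt z) (torus_pt z + (x - z)) = edge_form (val K m T) x z"
    using edge_form_swap[of "val K m T" x z] by (simp add: edge_form_def)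
  also have "\<dots> / norm (x - z) = edge_moment K m e"
    using edge_moment_eq[OF m _ T] e by (simp add: xz norm_minus_commute)
  finally show ?thesis by (simp add: xz rev_edge_def)
qed

text \<open>The initial points lie in the unit cube, which by local finiteness meets finitely many segments of
  the mesh, and every segment has two orientations.\<close>

lemma finite_edges: "finite (edges K)"
proof -
  let ?S = "{S \<in> subsimps K 1. S \<inter> cube \<noteq> {}}"
  have "finite ?S" by (rule subsimps_locally_finite) (simp add: cube_def)
  moreover have "finite ((vertices_of S) \<times> (vertices_of S))" if "S \<in> ?S" for S
  proof -
    have "1 simplex S" using that subsimps_simplex by blast
    then obtain C where "\<not> affine_dependent C" "S = convex hull C" by (auto simp: simplex_def)
    then show ?thesis using simplex_vertices_of aff_independent_finite by auto
  qed
  ultimately have "finite (\<Union>S\<in>?S. vertices_of S \<times> vertices_of S)" by blast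
  moreover have "edges K \<subseteq> (\<Union>S\<in>?S. vertices_of S \<times> vertices_of S)"
  proof
    fix e assume e: "e \<in> edges K"
    obtain x z where xz: "e = (x, z)" by force
    then have E: "x \<noteq> z" "closed_segment x z \<in> subsimps K 1" "torus_pt x = x" using e by (auto simp: edges_iff)
    have "x \<in> cube" using torus_pt_in_cube[of x] E by simp
    then have "closed_segment x z \<in> ?S" using E by auto
    moreover have "x \<in> vertices_of (closed_segment x z)" "z \<in> vertices_of (closed_segment x z)"
      by (auto simp: vertices_of_def extreme_point_of_segment)
    ultimately show "e \<in> (\<Union>S\<in>?S. vertices_of S \<times> vertices_of S)" using xz by blast
  qed
  ultimately show ?thesis by (rule finite_subset[rotated])
qed

end

locale oriented_mesh = mesh +
  fixes E :: "edge set"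
  assumes orient: "orientation K E"
begin

lemma E_edges: "e \<in> E \<Longrightarrow> e \<in> edges K"
  using orient by (auto simp: orientation_def)

lemma finite_E: "finite E"
  using finite_edges E_edges by (meson finite_subset subsetI)

lemma E_rev_iff: "e \<in> edges K \<Longrightarrow> rev_edge e \<in> E \<longleftrightarrow> e \<notin> E"
  using orient by (auto simp: orientation_def)

lemma edge_rep_in_E: "x \<noteq> z \<Longrightarrow> closed_segment x z \<in> subsimps K 1 \<Longrightarrow> edge_rep E x z \<in> E"
  using edge_shift[of x z] E_rev_iff by (simp add: edge_rep_def Let_def)

lemma edge_rep_swap:
  assumes "x \<noteq> z" "closed_segment x z \<in> subsimps K 1"
  shows "edge_rep E z x = edge_rep E x z"
proof -
  let ?e = "(torus_pt x, torus_pt x + (z - x))"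
  have e: "?e \<in> edges K" using edge_shift assms by blast
  have "torus_pt (torus_pt x + (z - x)) = torus_pt z"
    using torus_pt_add[OF torus_pt_diff_lattice[of x], of z] by (simp add: algebra_simps)
  then have "(torus_pt z, torus_pt z + (x - z)) = rev_edge ?e" by (simp add: rev_edge_def)
  then show ?thesis using E_rev_iff[OF e] rev_edge_rev_edge[OF e] by (simp add: edge_rep_def Let_def)
qed

lemma edge_rep_translation:
  assumes "k \<in> int_lattice"
  shows "edge_rep E (k + x) (k + z) = edge_rep E x z"
  using torus_pt_add[OF assms, of x] by (simp add: edge_rep_def Let_def add.commute)

lemma edge_rep_self: "(x, z) \<in> E \<Longrightarrow> edge_rep E x z = (x, z)"
  using E_edges[of "(x, z)"] by (simp add: edge_rep_def edges_iff)

lemma face_segment_subsimp: "T \<in> tets K \<Longrightarrow> x \<noteq> z \<Longrightarrow> closed_segment x z face_of T \<Longrightarrow> closed_segment x z \<in> subsimps K 1"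
  using one_simplex_segment by (auto simp: subsimps_def)

lemma edge_form_moment:
  assumes m: "m \<in> X1 K" and T: "T \<in> tets K" and xz: "x \<noteq> z" "closed_segment x z face_of T"
  shows "edge_form (val K m T) x z = norm (z - x) * edge_moment K m (edge_rep E x z)"
proof -
  let ?e = "(torus_pt x, torus_pt x + (z - x))" and ?k = "torus_pt x - x"
  have k: "?k \<in> int_lattice" by (rule torus_pt_diff_lattice)
  have e: "?e \<in> edges K" using edge_shift face_segment_subsimp T xz by blast
  have "closed_segment (torus_pt x) (torus_pt x + (z - x)) = (+) ?k ` closed_segment x z"
    unfolding segment_translation by (simp add: algebra_simps)
  then have "closed_segment (torus_pt x) (torus_pt x + (z - x)) face_of ((+) ?k ` T)" using xz by simp
  from edge_moment_eq[OF m e tets_translation[OF T k] this]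
  have "edge_moment K m ?e = edge_form (val K m T) (torus_pt x) (torus_pt x + (z - x)) / norm (z - x)"
    using reggeD(2)[OF X1_props(2)[OF m] T k] by simp
  then have "norm (z - x) * edge_moment K m ?e = edge_form (val K m T) x z"
    using xz(1) by (simp add: edge_form_def)
  then show ?thesis using edge_moment_rev[OF m e] by (simp add: edge_rep_def Let_def)
qed

lemma tet_edges_faces:
  assumes v: "vol a b c d \<noteq> 0" and pq: "p \<in> {a,b,c,d}" "q \<in> {a,b,c,d}"
  shows "closed_segment p q face_of (convex hull {a,b,c,d})"
  using tet_subface[OF v, of "{p, q}"] pq by (simp add: segment_convex_hull)

lemma tet_matrix_eqI:
  assumes T: "3 simplex T" and sym: "transpose A = A" "transpose B = B"
    and eq: "\<And>x z. x \<noteq> z \<Longrightarrow> closed_segment x z face_of T \<Longrightarrow> edge_form A x z = edge_form B x z"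
  shows "A = B"
proof -
  obtain a b c d where t: "T = convex hull {a,b,c,d}" "vol a b c d \<noteq> 0" using tet_ex[OF T] by blast
  note D = vol_nonzero_distinct[OF t(2)]
  have d: "edge_form (A - B) x z = edge_form A x z - edge_form B x z" for x z
    by (simp add: edge_form_def matrix_vector_mult_diff_rdistrib inner_diff_right)
  have z: "edge_form (A - B) p q = 0" if "p \<in> {a,b,c,d}" "q \<in> {a,b,c,d}" "p \<noteq> q" for p q
    using eq[OF that(3)] tet_edges_faces[OF t(2) that(1,2)] t(1) d by simp
  have "A - B = 0"
    by (rule edge_forms_zero[OF t(2)]) (use z D sym in \<open>auto simp: transpose_def vec_eq_iff\<close>)
  then show ?thesis by simp
qed

lemma X1_eq_moments:
  assumes m: "m \<in> X1 K" "m' \<in> X1 K" and eq: "\<And>e. e \<in> E \<Longrightarrow> edge_moment K m e = edge_moment K m' e"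
  shows "m = m'"
proof (rule X1_eqI[OF m])
  fix T assume "T \<in> K"
  then have T: "T \<in> tets K" by (rule K_tets)
  show "val K m T = val K m' T"
  proof (rule tet_matrix_eqI[OF tets_simplex[OF T]])
    show "transpose (val K m T) = val K m T" "transpose (val K m' T) = val K m' T"
      using reggeD(1)[OF X1_props(2)] m T by blast+
    fix x z :: pt assume xz: "x \<noteq> z" "closed_segment x z face_of T"
    have "edge_rep E x z \<in> E" using edge_rep_in_E face_segment_subsimp T xz by blast
    then show "edge_form (val K m T) x z = edge_form (val K m' T) x z"
      using edge_form_moment[OF m(1) T xz] edge_form_moment[OF m(2) T xz] eq by simp
  qed
qed

text \<open>On each lifted tetrahedron the moments of its edges are prescribed through their representatives in
  \<open>E\<close>. The resulting matrices are invariant under the lattice, since a matrix is determined by its edge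
  forms.\<close>

lemma X1_exists:
  fixes a :: "edge \<Rightarrow> real"
  shows "\<exists>m\<in>X1 K. \<forall>e\<in>E. edge_moment K m e = a e"
proof -
  define M where "M x z = norm (z - x) * a (edge_rep E x z)" for x z
  let ?P = "\<lambda>T A. transpose A = A \<and> (\<forall>x z. x \<noteq> z \<and> closed_segment x z face_of T \<longrightarrow> edge_form A x z = M x z)"
  define U where "U T = (SOME A. ?P T A)" for T
  have ex: "\<exists>A. ?P T A" if T: "T \<in> tets K" for T
  proof -
    obtain p q r s where t: "T = convex hull {p,q,r,s}" "vol p q r s \<noteq> 0" using tet_ex[OF tets_simplex[OF T]] by blast
    obtain A where A: "transpose A = A" "edge_form A p q = M p q" "edge_form A p r = M p r" "edge_form A p s = M p s"
      "edge_form A q r = M q r" "edge_form A q s = M q s" "edge_form A r s = M r s"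
      using edge_forms_exist[OF t(2), of M] by blast
    have "edge_form A x z = M x z" if xz: "x \<noteq> z" "closed_segment x z face_of T" for x z
    proof -
      have "x \<in> {p,q,r,s}" "z \<in> {p,q,r,s}"
        using segment_face_of[OF xz(2)] simplex_vertices_of[OF affine_independent_4[OF t(2)]] t(1)
        by (auto simp: vertices_of_def)
      moreover have "M z x = M x z"
        using edge_rep_swap[OF xz(1) face_segment_subsimp[OF T xz]] by (simp add: M_def norm_minus_commute)
      ultimately show ?thesis using A edge_form_swap[of A] xz(1) by auto
    qed
    then show ?thesis using A(1) by blast
  qed
  have U: "?P T (U T)" if "T \<in> tets K" for T
    unfolding U_def by (rule someI_ex[OF ex[OF that]])
  have "U \<in> regge K"
  proof (rule reggeI)
    fix T assume T: "T \<in> tets K"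
    show "transpose (U T) = U T" using U[OF T] by blast
    fix k assume k: "k \<in> int_lattice"
    show "U ((+) k ` T) = U T"
    proof (rule tet_matrix_eqI[OF tets_simplex[OF T]])
      show "transpose (U ((+) k ` T)) = U ((+) k ` T)" "transpose (U T) = U T"
        using U[OF T] U[OF tets_translation[OF T k]] by blast+
      fix x z :: pt assume xz: "x \<noteq> z" "closed_segment x z face_of T"
      then have "closed_segment (k + x) (k + z) face_of ((+) k ` T)"
        by (simp add: segment_translation[symmetric])
      then have "edge_form (U ((+) k ` T)) (k + x) (k + z) = M (k + x) (k + z)"
        using conjunct2[OF U[OF tets_translation[OF T k]], rule_format, of "k + x" "k + z"] xz(1)
        by (simp only: add_left_cancel simp_thms not_False_eq_True)
      also have "\<dots> = M x z" by (simp add: M_def edge_rep_translation[OF k])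
      also have "\<dots> = edge_form (U T) x z" using U[OF T] xz by simp
      finally show "edge_form (U ((+) k ` T)) x z = edge_form (U T) x z" by simp
    qed
  next
    fix T T' :: "pt set" and x z :: pt
    assume "T \<in> tets K" "T' \<in> tets K" "x \<noteq> z" "closed_segment x z face_of T" "closed_segment x z face_of T'"
    then show "edge_form (U T) x z = edge_form (U T') x z" using U by metis
  qed
  note st = regge_step_field[OF this]
  have "edge_moment K (step_field K U) e = a e" if e: "e \<in> E" for e
  proof -
    obtain x z where xz: "e = (x, z)" by force
    have ed: "(x, z) \<in> edges K" using E_edges e xz by blast
    then have E: "x \<noteq> z" "closed_segment x z \<in> subsimps K 1" by (auto simp: edges_iff)
    obtain T where T: "T \<in> tets K" "closed_segment x z face_of T" using edge_face_tet[OF E(2)] by blast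
    have "edge_form (U T) x z = norm (z - x) * a e"
      using U[OF T(1)] T(2) E(1) edge_rep_self e xz by (simp add: M_def)
    then show ?thesis using edge_moment_eq[OF st(1) ed T] st(2)[OF T(1)] E(1) xz by simp
  qed
  then show ?thesis using st(1) by blast
qed

lemma psi_props:
  assumes e: "e \<in> E"
  shows "psi K e \<in> X1 K" "\<And>g. g \<in> E \<Longrightarrow> edge_moment K (psi K e) g = (if g = e then 1 else 0)"
proof -
  let ?P = "\<lambda>m. m \<in> X1 K \<and> edge_moment K m e = 1 \<and>
    (\<forall>g\<in>edges K. g \<noteq> e \<and> g \<noteq> rev_edge e \<longrightarrow> edge_moment K m g = 0)"
  obtain m where m: "m \<in> X1 K" "\<forall>g\<in>E. edge_moment K m g = (if g = e then 1 else 0)"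
    using X1_exists[of "\<lambda>g. if g = e then 1 else 0"] by blast
  have nre: "rev_edge e \<notin> E" using E_rev_iff[OF E_edges[OF e]] e by blast
  have "?P m"
  proof (intro conjI ballI impI)
    fix g assume g: "g \<in> edges K" "g \<noteq> e \<and> g \<noteq> rev_edge e"
    show "edge_moment K m g = 0"
    proof (cases "g \<in> E")
      case False
      then have "rev_edge g \<in> E" using E_rev_iff g by blast
      moreover have "rev_edge g \<noteq> e" using g rev_edge_rev_edge by metis
      ultimately show ?thesis using m edge_moment_rev[OF m(1) g(1)] by auto
    qed (use m g in auto)
  qed (use m e in auto)
  moreover have "m' = m" if P: "?P m'" for m'
  proof (rule X1_eq_moments)
    fix g assume g: "g \<in> E"
    then have "g \<in> edges K" "g \<noteq> rev_edge e" using nre E_edges by blast+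
    then show "edge_moment K m' g = edge_moment K m g" using P m g by (cases "g = e") simp_all
  qed (use P m in auto)
  ultimately have "psi K e = m" unfolding psi_def by (rule the_equality)
  then show "psi K e \<in> X1 K" "\<And>g. g \<in> E \<Longrightarrow> edge_moment K (psi K e) g = (if g = e then 1 else 0)"
    using m by auto
qed

end

section \<open>The incompatibility of a piecewise constant field\<close>

subsection \<open>Continuously differentiable fields\<close>

lemma partial_bounded_linear:
  fixes f :: "pt \<Rightarrow> 'a::euclidean_space" and h :: "'a \<Rightarrow> 'b::euclidean_space"
  assumes "f differentiable (at x)" "bounded_linear h"
  shows "(\<lambda>x. h (f x)) differentiable (at x)" "partial i (\<lambda>x. h (f x)) x = h (partial i f x)"
proof -
  have "(f has_derivative frechet_derivative f (at x)) (at x)" using assms(1) by (simp add: frechet_derivative_works)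
  then have d: "((\<lambda>x. h (f x)) has_derivative (\<lambda>w. h (frechet_derivative f (at x) w))) (at x)"
    by (rule bounded_linear.has_derivative[OF assms(2)])
  then show "(\<lambda>x. h (f x)) differentiable (at x)" by (auto simp: differentiable_def)
  show "partial i (\<lambda>x. h (f x)) x = h (partial i f x)"
    using frechet_derivative_at[OF d, symmetric] by (simp add: partial_def)
qed

lemma C1_bounded_linear:
  fixes f :: "pt \<Rightarrow> 'a::euclidean_space" and h :: "'a \<Rightarrow> 'b::euclidean_space"
  assumes f: "C1_field f" and h: "bounded_linear h"
  shows "C1_field (\<lambda>x. h (f x))" "partial i (\<lambda>x. h (f x)) = (\<lambda>x. h (partial i f x))"
proof -
  have d: "f differentiable (at x)" for x using f by (simp add: C1_field_def)
  have p: "partial i (\<lambda>x. h (f x)) = (\<lambda>x. h (partial i f x))" for i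
    using partial_bounded_linear(2)[OF d h] by blast
  then show "partial i (\<lambda>x. h (f x)) = (\<lambda>x. h (partial i f x))" .
  show "C1_field (\<lambda>x. h (f x))" unfolding C1_field_def p
    using partial_bounded_linear(1)[OF d h] C1_partial_continuous[OF f]
    by (auto intro!: bounded_linear.continuous_on[OF h])
qed

lemma partial_diff:
  assumes "f differentiable (at x)" "g differentiable (at x)"
  shows "partial i (\<lambda>x. f x - g x) x = partial i f x - partial i g x"
proof -
  have "((\<lambda>x. f x - g x) has_derivative (\<lambda>w. frechet_derivative f (at x) w - frechet_derivative g (at x) w)) (at x)"
    using assms by (intro has_derivative_diff) (simp_all add: frechet_derivative_works)
  from frechet_derivative_at[OF this, symmetric] show ?thesis by (simp add: partial_def)
qed

lemma C1_diff:
  fixes f g :: "pt \<Rightarrow> 'a::euclidean_space"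
  assumes f: "C1_field f" and g: "C1_field g"
  shows "C1_field (\<lambda>x. f x - g x)"
proof -
  have d: "f differentiable (at x)" "g differentiable (at x)" for x using f g by (simp_all add: C1_field_def)
  have "partial i (\<lambda>x. f x - g x) = (\<lambda>x. partial i f x - partial i g x)" for i
    using partial_diff[OF d] by blast
  then show ?thesis unfolding C1_field_def
    using d C1_partial_continuous[OF f] C1_partial_continuous[OF g]
    by (auto intro!: continuous_intros differentiable_diff)
qed

lemma C1_vec:
  fixes f :: "pt \<Rightarrow> pt"
  assumes f: "\<And>j. C1_field (\<lambda>x. f x $ j)"
  shows "C1_field f"
proof -
  have d: "(\<lambda>x. f x $ j) differentiable (at x)" for j x using f by (simp add: C1_field_def)
  have D: "(f has_derivative (\<lambda>w. \<chi> j. frechet_derivative (\<lambda>x. f x $ j) (at x) w)) (at x)" for x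
  proof -
    have "((\<lambda>x. f x $ j) has_derivative frechet_derivative (\<lambda>x. f x $ j) (at x)) (at x)" for j
      using d by (simp add: frechet_derivative_works)
    then have "((\<lambda>y. \<Sum>j\<in>UNIV. f y $ j *\<^sub>R axis j 1 :: pt) has_derivative
      (\<lambda>w. \<Sum>j\<in>UNIV. frechet_derivative (\<lambda>x. f x $ j) (at x) w *\<^sub>R axis j 1)) (at x)"
      by (intro has_derivative_sum has_derivative_scaleR_left)
    moreover have e: "(\<Sum>j\<in>UNIV. h j *\<^sub>R axis j 1 :: pt) = (\<chi> j. h j)" for h
      by (simp add: vec_eq_iff axis_def if_distrib cong: if_cong)
    ultimately show ?thesis by (simp add: e)
  qed
  have p: "partial i f x = (\<chi> j. partial i (\<lambda>x. f x $ j) x)" for i x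
    using frechet_derivative_at[OF D[of x], symmetric] by (simp add: partial_def)
  have "continuous_on UNIV (\<lambda>x. \<chi> j. partial i (\<lambda>x. f x $ j) x)" for i
    by (intro continuous_on_vec_lambda C1_partial_continuous f)
  then have "continuous_on UNIV (partial i f)" for i using p by presburger
  then show ?thesis unfolding C1_field_def using D by (auto simp: differentiable_def)
qed

lemma smooth_differentiable: "smooth f \<Longrightarrow> f differentiable (at x)"
  unfolding smooth_def differentiable_on_def by (metis UNIV_I foldr.simps(1) id_apply)

lemma smooth_partial: "smooth f \<Longrightarrow> smooth (partial i f)"
  unfolding smooth_def
proof
  fix ks assume "\<forall>ks. foldr partial ks f differentiable_on UNIV"
  then have "foldr partial (ks @ [i]) f differentiable_on UNIV" by blast
  then show "foldr partial ks (partial i f) differentiable_on UNIV" by simp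
qed

lemma smooth_continuous: "smooth f \<Longrightarrow> continuous_on UNIV f"
  using smooth_differentiable differentiable_imp_continuous_within
  by (metis continuous_on_eq_continuous_within)

lemma smooth_C1:
  fixes f :: "pt \<Rightarrow> 'a::euclidean_space"
  shows "smooth f \<Longrightarrow> C1_field f"
  unfolding C1_field_def using smooth_differentiable smooth_continuous[OF smooth_partial] by blast

lemma bounded_linear_nth2: "bounded_linear (\<lambda>A :: mat3. A $ i $ j)"
  by (rule bounded_linear_compose[OF bounded_linear_vec_nth bounded_linear_vec_nth])

lemma mcurl_row: "mcurl A x $ i = curl (\<lambda>p. A p $ i) x"
  by (simp add: mcurl_def)

lemma smooth_row_C1: "smooth v \<Longrightarrow> C1_field (\<lambda>p. (v p :: mat3) $ j)"
  by (rule C1_bounded_linear(1)[OF smooth_C1 bounded_linear_vec_nth])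

lemma curl_row_smooth:
  assumes v: "smooth (v :: pt \<Rightarrow> mat3)"
  shows "C1_field (\<lambda>p. curl (\<lambda>q. v q $ j) p)"
proof (rule C1_vec)
  fix k :: 3
  have p: "partial i (\<lambda>q. v q $ j) = (\<lambda>q. partial i v q $ j)" for i
    by (rule C1_bounded_linear(2)[OF smooth_C1[OF v] bounded_linear_vec_nth])
  have c: "C1_field (\<lambda>q. partial i v q $ j $ l)" for i l
    by (rule C1_bounded_linear(1)[OF smooth_C1[OF smooth_partial[OF v]] bounded_linear_nth2])
  show "C1_field (\<lambda>x. curl (\<lambda>q. v q $ j) x $ k)"
    using exhaust_3[of k] by (elim disjE; simp only: curl_components p; intro C1_diff c)
qed

lemma transpose_mcurl_row_C1:
  assumes v: "smooth (v :: pt \<Rightarrow> mat3)"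
  shows "C1_field (\<lambda>p. transpose (mcurl v p) $ i)"
proof (rule C1_vec)
  fix j :: 3
  have "C1_field (\<lambda>p. curl (\<lambda>q. v q $ j) p $ i)"
    by (rule C1_bounded_linear(1)[OF curl_row_smooth[OF v] bounded_linear_vec_nth])
  then show "C1_field (\<lambda>p. transpose (mcurl v p) $ i $ j)"
    by (simp add: transpose_def mcurl_row)
qed

lemma partial_periodic:
  assumes p: "periodic f"
  shows "periodic (partial i f)"
  unfolding periodic_def partial_def
proof (intro ballI allI)
  have shift: "(f has_derivative D) (at x)" if k: "k \<in> int_lattice" and "(f has_derivative D) (at (x + k))" for k x D
  proof -
    have "((\<lambda>y. y + k) has_derivative (\<lambda>w. w)) (at x)" by (auto intro!: derivative_eq_intros)
    from diff_chain_at[OF this that(2)] have "((\<lambda>y. f (y + k)) has_derivative D) (at x)" by (simp add: o_def)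
    then show ?thesis using p k by (simp add: periodic_def)
  qed
  fix k x assume k: "k \<in> int_lattice"
  have "(f has_derivative D) (at (x + k)) \<longleftrightarrow> (f has_derivative D) (at x)" for D
    using shift[OF k, of D x] shift[OF lattice_minus[OF k], of D "x + k"] by auto
  then show "frechet_derivative f (at (x + k)) (axis i 1) = frechet_derivative f (at x) (axis i 1)"
    unfolding frechet_derivative_def by simp
qed

lemma curl_periodic:
  assumes "periodic f"
  shows "periodic (curl f)"
  using partial_periodic[OF assms] unfolding periodic_def curl_def by simp

subsection \<open>Fluxes through the faces of a tetrahedron\<close>

text \<open>The integral of a field times the outer normal (as a cross product) over the face opposite to \<open>d\<close>.
  The sign of the volume makes the normal point away from \<open>d\<close>.\<close>

definition oriented_flux :: "pt \<Rightarrow> pt \<Rightarrow> pt \<Rightarrow> pt \<Rightarrow> (pt \<Rightarrow> pt) \<Rightarrow> pt"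
  where "oriented_flux p q r d f = - (sgn (vol p q r d) *\<^sub>R cross3 (nrm3 p q r) (tri_avg p q r f))"

text \<open>The flux as a function of sets. The choice is independent of the enumeration of the vertices
  (\<open>face_flux_eq\<close>).\<close>

definition face_flux :: "pt set \<Rightarrow> pt set \<Rightarrow> (pt \<Rightarrow> pt) \<Rightarrow> pt"
  where "face_flux T F f = (SOME y. \<exists>p q r d. F = convex hull {p, q, r} \<and> T = convex hull {p, q, r, d} \<and>
    vol p q r d \<noteq> 0 \<and> y = oriented_flux p q r d f)"

lemma oriented_flux_swap:
  assumes "continuous_on UNIV f"
  shows "oriented_flux q p r d f = oriented_flux p q r d f" "oriented_flux p r q d f = oriented_flux p q r d f"
  using vol_perm(3)[of p q r d] vol_perm(2)[of p q r d] nrm3_perm(2,3) [where p=p and q=q and r=r]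
    tri_avg_perm(1,2)[OF assms, of p q r]
  by (simp_all add: oriented_flux_def cross_minus_left sgn_minus)

lemma face_flux_eq:
  assumes f: "continuous_on UNIV f" and v: "vol p q r d \<noteq> 0"
  shows "face_flux (convex hull {p, q, r, d}) (convex hull {p, q, r}) f = oriented_flux p q r d f"
  unfolding face_flux_def
proof (rule some_equality)
  show "\<exists>p' q' r' d'. convex hull {p, q, r} = convex hull {p', q', r'} \<and> convex hull {p, q, r, d} = convex hull {p', q', r', d'} \<and>
    vol p' q' r' d' \<noteq> 0 \<and> oriented_flux p q r d f = oriented_flux p' q' r' d' f" using v by blast
next
  fix y assume "\<exists>p' q' r' d'. convex hull {p, q, r} = convex hull {p', q', r'} \<and> convex hull {p, q, r, d} = convex hull {p', q', r', d'} \<and>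
    vol p' q' r' d' \<noteq> 0 \<and> y = oriented_flux p' q' r' d' f"
  then obtain p' q' r' d' where e: "convex hull {p, q, r} = convex hull {p', q', r'}"
    "convex hull {p, q, r, d} = convex hull {p', q', r', d'}" "vol p' q' r' d' \<noteq> 0" "y = oriented_flux p' q' r' d' f" by blast
  have 3: "{p, q, r} = {p', q', r'}"
    using arg_cong[OF e(1), of vertices_of]
    by (simp only: simplex_vertices_of[OF affine_independent_3[OF vol_imp_nrm3[OF v]]]
      simplex_vertices_of[OF affine_independent_3[OF vol_imp_nrm3[OF e(3)]]])
  have 4: "{p, q, r, d} = {p', q', r', d'}"
    using arg_cong[OF e(2), of vertices_of]
    by (simp only: simplex_vertices_of[OF affine_independent_4[OF v]]
      simplex_vertices_of[OF affine_independent_4[OF e(3)]])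
  note D = vol_nonzero_distinct[OF v] and D' = vol_nonzero_distinct[OF e(3)]
  have "{p, q, r, d} - {p, q, r} = {d}" using D by auto
  moreover have "{p', q', r', d'} - {p', q', r'} = {d'}" using D' by auto
  ultimately have d: "d' = d" using 3 4 by simp
  have f1: "oriented_flux p r q d f = oriented_flux p q r d f" by (rule oriented_flux_swap(2)[OF f])
  have f2: "oriented_flux q p r d f = oriented_flux p q r d f" by (rule oriented_flux_swap(1)[OF f])
  have f3: "oriented_flux q r p d f = oriented_flux p q r d f" by (rule trans[OF oriented_flux_swap(2)[OF f] f2])
  have f4: "oriented_flux r p q d f = oriented_flux p q r d f" by (rule trans[OF oriented_flux_swap(1)[OF f] f1])
  have f5: "oriented_flux r q p d f = oriented_flux p q r d f" by (rule trans[OF oriented_flux_swap(2)[OF f] f4])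
  have "(p' = p \<and> q' = q \<and> r' = r) \<or> (p' = p \<and> q' = r \<and> r' = q) \<or> (p' = q \<and> q' = p \<and> r' = r) \<or>
    (p' = q \<and> q' = r \<and> r' = p) \<or> (p' = r \<and> q' = p \<and> r' = q) \<or> (p' = r \<and> q' = q \<and> r' = p)"
  proof -
    have "p' \<in> {p, q, r}" "q' \<in> {p, q, r}" "r' \<in> {p, q, r}" using 3 by blast+
    then show ?thesis using D'(1,2,4) by (simp only: insert_iff empty_iff) metis
  qed
  then show "y = oriented_flux p q r d f"
    unfolding e(4) d using f1 f2 f3 f4 f5 by (elim disjE conjE) (simp_all only:)
qed

lemma integral_curl_fluxes:
  assumes f: "C1_field f" and T: "3 simplex T"
  shows "integral T (curl f) = (\<Sum>F | 2 simplex F \<and> F face_of T. face_flux T F f)"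
proof -
  obtain a b c d where t: "T = convex hull {a,b,c,d}" "vol a b c d \<noteq> 0" using tet_ex[OF T] by blast
  have fc: "continuous_on UNIV f" using f by (rule C1_continuous)
  have v: "vol a b d c = - vol a b c d" "vol a c d b = vol a b c d" "vol b c d a = - vol a b c d"
    using vol_perm by (metis, metis minus_minus, metis minus_minus)
  have "face_flux T (convex hull {b,c,d}) f = oriented_flux b c d a f"
    "face_flux T (convex hull {a,c,d}) f = oriented_flux a c d b f"
    "face_flux T (convex hull {a,b,d}) f = oriented_flux a b d c f"
    "face_flux T (convex hull {a,b,c}) f = oriented_flux a b c d f"
    using face_flux_eq[OF fc, of b c d a] face_flux_eq[OF fc, of a c d b] face_flux_eq[OF fc, of a b d c]
      face_flux_eq[OF fc, of a b c d] t v by (simp_all add: insert_commute)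
  note fl = this[unfolded t(1)]
  show ?thesis
    unfolding t(1) tet_curl[OF f t(2)] sum_tet_facets[OF t(2)] fl oriented_flux_def v
    by (simp add: sgn_minus scaleR_add_right scaleR_diff_right)
qed

lemma tri_avg_translation:
  assumes "periodic f" "k \<in> int_lattice"
  shows "tri_avg (k + p) (k + q) (k + r) f = tri_avg p q r f"
  unfolding tri_avg_def using periodic_add[OF assms] by (simp add: add.assoc)

lemma seg_avg_translation:
  assumes "periodic f" "k \<in> int_lattice"
  shows "seg_avg (k + p) (k + q) f = seg_avg p q f"
  unfolding seg_avg_def using periodic_add[OF assms] by (simp add: add.assoc)

lemma hull_translation: "(+) k ` (convex hull {a, b, c}) = convex hull {k + a, k + b, k + c}"
  "(+) k ` (convex hull {a, b, c, d}) = convex hull {k + a, k + b, k + c, k + d}" for a :: pt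
  using convex_hull_translation[of k "{a, b, c}"] convex_hull_translation[of k "{a, b, c, d}"] by simp_all

lemma face_flux_translation:
  assumes f: "continuous_on UNIV f" "periodic f" and k: "k \<in> int_lattice"
    and T: "3 simplex T" "F face_of T" "2 simplex F"
  shows "face_flux ((+) k ` T) ((+) k ` F) f = face_flux T F f"
proof -
  obtain p q r where F: "nrm3 p q r \<noteq> 0" "F = convex hull {p, q, r}" using triangle_exE[OF T(3)] by blast
  then obtain d where d: "T = convex hull {p, q, r, d}" "vol p q r d \<noteq> 0"
    using tet_over_triangle[OF T(1)] T(2) by blast
  have "vol (k + p) (k + q) (k + r) (k + d) \<noteq> 0" using d by simp
  from face_flux_eq[OF f(1) this] face_flux_eq[OF f(1) d(2)] show ?thesis
    unfolding F d hull_translation by (simp add: oriented_flux_def tri_avg_translation[OF f(2) k])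
qed

subsection \<open>Sums over orbits of the lattice\<close>

text \<open>A set of representatives of the orbits of the lattice in \<open>X\<close>, the action being free on \<open>A\<close>.\<close>

definition transversal :: "pt set set \<Rightarrow> pt set set \<Rightarrow> bool"
  where "transversal A X \<longleftrightarrow> finite A \<and> A \<subseteq> X \<and> (\<forall>P\<in>X. \<exists>k\<in>int_lattice. (+) k ` P \<in> A) \<and>
    (\<forall>P\<in>A. \<forall>k\<in>int_lattice. (+) k ` P \<in> A \<longrightarrow> k = 0)"

text \<open>Both sides are sums over the orbits of related pairs \<open>(P, Q)\<close>: every orbit has exactly one member
  with \<open>P\<close> in \<open>A\<close> and exactly one member with \<open>Q\<close> in \<open>B\<close>. It replaces interchanging sums over the
  tetrahedra, triangles and edges of the torus.\<close>

lemma orbit_sum: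
  fixes h :: "pt set \<Rightarrow> pt set \<Rightarrow> 'a::comm_monoid_add"
  assumes A: "transversal A X" and B: "transversal B Y"
    and R: "\<And>P Q. R P Q \<Longrightarrow> P \<in> X \<and> Q \<in> Y"
    and Rk: "\<And>P Q k. R P Q \<Longrightarrow> k \<in> int_lattice \<Longrightarrow> R ((+) k ` P) ((+) k ` Q)"
    and fin: "\<And>P. P \<in> X \<Longrightarrow> finite {Q. R P Q}" "\<And>Q. Q \<in> Y \<Longrightarrow> finite {P. R P Q}"
    and h: "\<And>P Q k. R P Q \<Longrightarrow> k \<in> int_lattice \<Longrightarrow> h ((+) k ` P) ((+) k ` Q) = h P Q"
  shows "(\<Sum>P\<in>A. \<Sum>Q | R P Q. h P Q) = (\<Sum>Q\<in>B. \<Sum>P | R P Q. h P Q)"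
proof -
  \<comment> \<open>The shift that moves a simplex to the representative of its orbit.\<close>
  define s where "s C P = (SOME k. k \<in> int_lattice \<and> (+) k ` P \<in> C)" for C P
  have sA: "s A P \<in> int_lattice" "(+) (s A P) ` P \<in> A" if "P \<in> X" for P
    using someI_ex[of "\<lambda>k. k \<in> int_lattice \<and> (+) k ` P \<in> A"] A that
    unfolding transversal_def s_def by blast+
  have sB: "s B P \<in> int_lattice" "(+) (s B P) ` P \<in> B" if "P \<in> Y" for P
    using someI_ex[of "\<lambda>k. k \<in> int_lattice \<and> (+) k ` P \<in> B"] B that
    unfolding transversal_def s_def by blast+
  let ?i = "\<lambda>(P, Q). ((+) (s A P) ` P, (+) (s A P) ` Q)"
  let ?j = "\<lambda>(P, Q). ((+) (s B Q) ` P, (+) (s B Q) ` Q)"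
  have AX: "P \<in> X" if "P \<in> A" for P using A that by (auto simp: transversal_def)
  have BY: "P \<in> Y" if "P \<in> B" for P using B that by (auto simp: transversal_def)
  have A0: "k = 0" if "P \<in> A" "k \<in> int_lattice" "(+) k ` P \<in> A" for P k
    using A that by (auto simp: transversal_def)
  have B0: "k = 0" if "P \<in> B" "k \<in> int_lattice" "(+) k ` P \<in> B" for P k
    using B that by (auto simp: transversal_def)
  have id0: "(+) 0 ` P = P" for P :: "pt set" by simp
  have inv1: "s A ((+) (s B Q) ` P) + s B Q = 0" if PQ: "P \<in> A" "R P Q" for P Q
  proof -
    have r: "R ((+) (s B Q) ` P) ((+) (s B Q) ` Q)" using Rk[OF PQ(2)] sB R[OF PQ(2)] by blast
    then have x: "(+) (s B Q) ` P \<in> X" using R by blast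
    show ?thesis
      using A0[OF PQ(1), of "s A ((+) (s B Q) ` P) + s B Q"] sA[OF x] sB(1)[of Q] R[OF PQ(2)]
      by (simp add: lattice_add translation_translation)
  qed
  have inv2: "s B ((+) (s A P) ` Q) + s A P = 0" if PQ: "Q \<in> B" "R P Q" for P Q
  proof -
    have r: "R ((+) (s A P) ` P) ((+) (s A P) ` Q)" using Rk[OF PQ(2)] sA R[OF PQ(2)] by blast
    then have x: "(+) (s A P) ` Q \<in> Y" using R by blast
    show ?thesis
      using B0[OF PQ(1), of "s B ((+) (s A P) ` Q) + s A P"] sB[OF x] sA(1)[of P] R[OF PQ(2)]
      by (simp add: lattice_add translation_translation)
  qed
  have "(\<Sum>P\<in>A. \<Sum>Q | R P Q. h P Q) = (\<Sum>(P, Q)\<in>Sigma A (\<lambda>P. {Q. R P Q}). h P Q)"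
    using A fin(1) AX by (intro sum.Sigma) (auto simp: transversal_def)
  also have "\<dots> = (\<Sum>(P, Q)\<in>{(P, Q). R P Q \<and> Q \<in> B}. h P Q)"
  proof (rule sum.reindex_bij_witness[where i = ?i and j = ?j], goal_cases)
    case (1 a)
    then obtain P Q where a: "a = (P, Q)" "P \<in> A" "R P Q" by auto
    show ?case using inv1[OF a(2,3)] by (simp add: a(1) translation_translation)
  next
    case (2 a)
    then obtain P Q where a: "a = (P, Q)" "P \<in> A" "R P Q" by auto
    then show ?case using sB[of Q] R Rk by auto
  next
    case (3 a)
    then obtain P Q where a: "a = (P, Q)" "Q \<in> B" "R P Q" by auto
    show ?case using inv2[OF a(2,3)] by (simp add: a(1) translation_translation)
  next
    case (4 a)
    then obtain P Q where a: "a = (P, Q)" "Q \<in> B" "R P Q" by auto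
    then show ?case using sA[of P] R Rk by auto
  next
    case (5 a)
    then obtain P Q where a: "a = (P, Q)" "P \<in> A" "R P Q" by auto
    then show ?case using h[OF a(3), of "s B Q"] sB(1)[of Q] R by auto
  qed
  also have "\<dots> = (\<Sum>(Q, P)\<in>Sigma B (\<lambda>Q. {P. R P Q}). h P Q)"
    by (rule sum.reindex_bij_witness[where i = "\<lambda>(P, Q). (Q, P)" and j = "\<lambda>(P, Q). (Q, P)"]) auto
  also have "\<dots> = (\<Sum>Q\<in>B. \<Sum>P | R P Q. h P Q)"
    using B fin(2) BY by (intro sum.Sigma[symmetric]) (auto simp: transversal_def)
  finally show ?thesis .
qed

context oriented_mesh
begin

lemma transversal_K: "transversal K (tets K)"
  unfolding transversal_def
proof (intro conjI ballI impI)
  fix P assume "P \<in> tets K"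
  then obtain k S where kS: "k \<in> int_lattice" "S \<in> K" "P = (+) k ` S" by (rule tets_cases)
  then have "(+) (-k) ` P \<in> K" by (simp add: translation_translation)
  then show "\<exists>k\<in>int_lattice. (+) k ` P \<in> K" using lattice_minus kS(1) by blast
next
  fix P k assume "P \<in> K" "k \<in> int_lattice" "(+) k ` P \<in> K"
  then show "k = 0" using tets_rep_unique(1)[of k P 0 "(+) k ` P"] by simp
qed (use finite_K K_tets in auto)

lemma subsimps_bounded_nonempty: "S \<in> subsimps K l \<Longrightarrow> l \<ge> 0 \<Longrightarrow> bounded S \<and> S \<noteq> {}"
proof -
  assume "S \<in> subsimps K l" "l \<ge> 0"
  then have s: "l simplex S" by (rule_tac subsimps_simplex)
  then show "bounded S \<and> S \<noteq> {}"
    using compact_imp_bounded[OF compact_simplex[OF s]] \<open>l \<ge> 0\<close> by auto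
qed

lemma transversal_exists: "l \<ge> 0 \<Longrightarrow> \<exists>B. transversal B (subsimps K l)"
proof -
  assume l: "l \<ge> 0"
  \<comment> \<open>The representative depends on the orbit only (\<open>r2\<close>), hence is fixed by \<open>r\<close> (\<open>fixr\<close>).\<close>
  define r where "r F = (SOME G. \<exists>k\<in>int_lattice. G = (+) k ` F)" for F :: "pt set"
  have r1: "\<exists>k\<in>int_lattice. r F = (+) k ` F" for F
    unfolding r_def by (rule someI_ex) (use lattice_0 in blast)
  have orb: "{G. \<exists>k\<in>int_lattice. G = (+) k ` (+) l ` F} = {G. \<exists>k\<in>int_lattice. G = (+) k ` F}"
    if "l \<in> int_lattice" for F :: "pt set" and l
  proof (intro equalityI subsetI; clarsimp simp: translation_translation)
    fix k assume "k \<in> int_lattice"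
    then show "\<exists>m\<in>int_lattice. (+) (k + l) ` F = (+) m ` F" using lattice_add that by blast
  next
    fix k assume "k \<in> int_lattice"
    then show "\<exists>m\<in>int_lattice. (+) k ` F = (+) (m + l) ` F"
      using lattice_diff that by (intro bexI[of _ "k - l"]) auto
  qed
  have r2: "r ((+) l ` F) = r F" if "l \<in> int_lattice" for l F
    using arg_cong[OF orb[OF that, of F], of "\<lambda>S. SOME G. G \<in> S"] by (simp add: r_def)
  define B where "B = r ` subsimps K l"
  have sub: "B \<subseteq> subsimps K l"
  proof
    fix G assume "G \<in> B"
    then obtain F where "F \<in> subsimps K l" "G = r F" by (auto simp: B_def)
    then show "G \<in> subsimps K l" using r1[of F] subsimps_translation by auto
  qed
  have fixr: "r G = G" if "G \<in> B" for G
  proof -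
    obtain F where "G = r F" using \<open>G \<in> B\<close> by (auto simp: B_def)
    then show ?thesis using r1[of F] r2 by auto
  qed
  have "B \<subseteq> r ` (\<Union>T\<in>K. {F. F face_of T})"
  proof
    fix G assume "G \<in> B"
    then obtain F where F: "F \<in> subsimps K l" "G = r F" by (auto simp: B_def)
    then obtain T where T: "T \<in> tets K" "F face_of T" by (auto simp: subsimps_def)
    obtain k S where kS: "k \<in> int_lattice" "S \<in> K" "T = (+) k ` S" using T(1) by (rule tets_cases)
    have "(+) (-k) ` F face_of S" using T(2) unfolding kS(3) face_of_translation_left .
    moreover have "G = r ((+) (-k) ` F)" using r2[OF lattice_minus[OF kS(1)]] F(2) by simp
    ultimately show "G \<in> r ` (\<Union>T\<in>K. {F. F face_of T})" using kS(2) by blast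
  qed
  moreover have "finite (r ` (\<Union>T\<in>K. {F. F face_of T}))"
    using finite_K finite_faces_simplex[OF K_simplex] by blast
  ultimately have "finite B" by (rule finite_subset)
  moreover have "\<exists>k\<in>int_lattice. (+) k ` F \<in> B" if "F \<in> subsimps K l" for F
    using r1[of F] that unfolding B_def by (metis imageI)
  moreover have "k = 0" if "F \<in> B" "k \<in> int_lattice" "(+) k ` F \<in> B" for F k
  proof -
    have "(+) k ` F = F" using fixr[OF that(1)] fixr[OF that(3)] r2[OF that(2), of F] by simp
    moreover have "F \<in> subsimps K l" using sub that(1) by blast
    ultimately show ?thesis using bounded_translation_eq_0 subsimps_bounded_nonempty[OF _ l] by blast
  qed
  ultimately have "transversal B (subsimps K l)" unfolding transversal_def using sub by blast
  then show ?thesis by blast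
qed

lemma edge_rep_seg: "\<exists>k\<in>int_lattice. seg (edge_rep E x z) = (+) k ` closed_segment x z"
proof (cases "(torus_pt x, torus_pt x + (z - x)) \<in> E")
  case True
  then show ?thesis
    by (intro bexI[OF _ torus_pt_diff_lattice[of x]])
      (unfold segment_translation, simp add: edge_rep_def Let_def seg_def algebra_simps)
next
  case False
  let ?y = "torus_pt x + (z - x)"
  have y: "torus_pt ?y = torus_pt z"
    using torus_pt_add[OF torus_pt_diff_lattice[of x], of z] by (simp add: algebra_simps)
  have "seg (edge_rep E x z) = closed_segment (torus_pt z) (torus_pt z + (x - z))"
    using False y by (simp add: edge_rep_def Let_def rev_edge_def seg_def)
  also have "\<dots> = (+) (torus_pt z - z) ` closed_segment x z"
    unfolding segment_translation by (simp add: algebra_simps closed_segment_commute)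
  finally show ?thesis using torus_pt_diff_lattice[of z] by blast
qed

lemma E_subsimp: "e \<in> E \<Longrightarrow> fst e \<noteq> snd e \<and> seg e \<in> subsimps K 1"
  using E_edges[of e] by (cases e) (simp add: edges_iff seg_def)

lemma edge_rep_seg_eq:
  assumes "closed_segment x z = closed_segment x' z'" "x \<noteq> z" "closed_segment x z \<in> subsimps K 1"
  shows "edge_rep E x z = edge_rep E x' z'"
proof -
  have "{x, z} = {x', z'}" using assms(1) by (rule closed_segment_eq[THEN iffD1])
  then have "x' = x \<and> z' = z \<or> x' = z \<and> z' = x" by (auto simp: doubleton_eq_iff)
  then show ?thesis using edge_rep_swap[OF assms(2,3)] by auto
qed

lemma seg_translate_eq:
  assumes "e \<in> E" "g \<in> E" "seg g = (+) k ` seg e" "k \<in> int_lattice"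
  shows "g = e" "k = 0"
proof -
  obtain x z x' z' where e: "e = (x, z)" "g = (x', z')" by force
  have "closed_segment x' z' = closed_segment (k + x) (k + z)"
    using assms(3) by (simp add: e seg_def segment_translation)
  then have "edge_rep E x' z' = edge_rep E (k + x) (k + z)"
    using E_subsimp[OF assms(2)] by (intro edge_rep_seg_eq) (auto simp: e seg_def)
  then show "g = e" using edge_rep_translation[OF assms(4)] edge_rep_self assms(1,2) e by metis
  then have "(+) k ` seg e = seg e" using assms(3) by simp
  then show "k = 0" using bounded_translation_eq_0[of "seg e" k] subsimps_bounded_nonempty[of "seg e" 1] E_subsimp[OF assms(1)] by auto
qed

lemma inj_on_seg: "inj_on seg E"
proof (rule inj_onI)
  fix e g assume "e \<in> E" "g \<in> E" "seg e = seg g"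
  then show "e = g" using seg_translate_eq(1)[of g e 0] by simp
qed

lemma subsimps_1_segment:
  assumes "S \<in> subsimps K 1"
  obtains x z where "S = closed_segment x z" "x \<noteq> z"
proof -
  obtain C where C: "card C = 2" "S = convex hull C"
    using subsimps_simplex[OF assms] by (auto simp: simplex_def)
  then obtain x z where "C = {x, z}" "x \<noteq> z" by (auto simp: card_2_iff)
  then show thesis using that C(2) by (simp add: segment_convex_hull)
qed

lemma transversal_E: "transversal (seg ` E) (subsimps K 1)"
  unfolding transversal_def
proof (intro conjI ballI impI)
  fix P assume P: "P \<in> subsimps K 1"
  obtain x z where xz: "P = closed_segment x z" "x \<noteq> z" using subsimps_1_segment[OF P] .
  then have "edge_rep E x z \<in> E" using edge_rep_in_E P by blast
  then show "\<exists>k\<in>int_lattice. (+) k ` P \<in> seg ` E" using edge_rep_seg[of x z] xz by auto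
next
  fix P k assume "P \<in> seg ` E" "k \<in> int_lattice" "(+) k ` P \<in> seg ` E"
  then show "k = 0" using seg_translate_eq(2) by (metis imageE)
qed (use finite_E E_subsimp in auto)

end

section \<open>The jump formula for the incompatibility\<close>

subsection \<open>Jumps with vanishing tangential part\<close>

text \<open>For independent \<open>u\<close> and \<open>v\<close> with normal vector \<open>n\<close> these are the matrices \<open>n a\<^sup>T + a n\<^sup>T\<close>.\<close>

definition tangent_free :: "mat3 \<Rightarrow> pt \<Rightarrow> pt \<Rightarrow> bool"
  where "tangent_free J u v \<longleftrightarrow> transpose J = J \<and> u \<bullet> (J *v u) = 0 \<and> u \<bullet> (J *v v) = 0 \<and> v \<bullet> (J *v v) = 0"

lemma tangent_free_mult:
  assumes J: "tangent_free J u v"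
  shows "(cross3 u v \<bullet> cross3 u v) *\<^sub>R (J *v u) = ((J *v u) \<bullet> cross3 u v) *\<^sub>R cross3 u v"
    "(cross3 u v \<bullet> cross3 u v) *\<^sub>R (J *v v) = ((J *v v) \<bullet> cross3 u v) *\<^sub>R cross3 u v"
  using J sym_bilinear[of J u v] unfolding tangent_free_def
  by (intro orthogonal_both_cross; simp add: inner_commute)+

text \<open>On the plane \<open>J\<close> takes values along \<open>N\<close>, which the cross product with \<open>N\<close> annihilates, so only the
  normal part of \<open>x\<close> counts.\<close>

lemma tangent_free_cross:
  assumes J: "tangent_free J u v"
  defines "N \<equiv> cross3 u v"
  shows "(N \<bullet> N) *\<^sub>R cross3 (J *v x) N = (x \<bullet> N) *\<^sub>R cross3 (J *v N) N"
proof (cases "N = 0")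
  case False
  have z: "cross3 (J *v u) N = 0" "cross3 (J *v v) N = 0"
  proof -
    have "(N \<bullet> N) *\<^sub>R cross3 (J *v u) N = cross3 ((N \<bullet> N) *\<^sub>R (J *v u)) N" by (simp add: cross_mult_left)
    also have "\<dots> = 0" unfolding N_def tangent_free_mult(1)[OF J] by (simp add: cross_mult_left)
    finally show "cross3 (J *v u) N = 0" using False by simp
    have "(N \<bullet> N) *\<^sub>R cross3 (J *v v) N = cross3 ((N \<bullet> N) *\<^sub>R (J *v v)) N" by (simp add: cross_mult_left)
    also have "\<dots> = 0" unfolding N_def tangent_free_mult(2)[OF J] by (simp add: cross_mult_left)
    finally show "cross3 (J *v v) N = 0" using False by simp
  qed
  have "(N \<bullet> N) *\<^sub>R cross3 (J *v x) N = cross3 (J *v ((N \<bullet> N) *\<^sub>R x)) N"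
    by (simp add: matrix_vector_mult_scaleR cross_mult_left)
  also have "(N \<bullet> N) *\<^sub>R x = (x \<bullet> cross3 v N) *\<^sub>R u + (x \<bullet> cross3 N u) *\<^sub>R v + (x \<bullet> N) *\<^sub>R N"
    using cramer[of x v N u] by (simp add: N_def)
  also have "cross3 (J *v \<dots>) N = (x \<bullet> N) *\<^sub>R cross3 (J *v N) N"
    using z by (simp add: matrix_vector_right_distrib matrix_vector_mult_scaleR cross_add_left cross_mult_left)
  finally show ?thesis .
qed simp

text \<open>The rows of \<open>J\<close> are its values on the coordinate vectors, whose cross products with \<open>N\<close> are by
  \<open>tangent_free_cross\<close> multiples of one vector with factors \<open>N $ i\<close>. Summation of these factors against
  \<open>b\<close> leaves the normal components \<open>N \<bullet> C j\<close>, which Stokes' theorem can integrate.\<close>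

lemma tangent_free_flux:
  fixes C :: "3 \<Rightarrow> pt" and b :: "3 \<Rightarrow> pt"
  assumes J: "tangent_free J u v" and b: "\<And>i j. b i $ j = C j $ i" and N: "N = cross3 u v"
  shows "(N \<bullet> N) * (\<Sum>i\<in>UNIV. J $ i \<bullet> cross3 N (b i)) = (\<Sum>j\<in>UNIV. cross3 (J *v N) N $ j * (N \<bullet> C j))"
proof -
  have row: "J *v axis i 1 = J $ i" for i
  proof -
    have "(J *v axis i 1) $ j = J $ i $ j" for j
    proof -
      have "(J *v axis i 1) $ j = J $ j $ i"
        by (simp add: matrix_vector_mult_def axis_def if_distrib cong: if_cong)
      also have "\<dots> = transpose J $ i $ j" by (simp add: transpose_def)
      finally show ?thesis using J by (simp add: tangent_free_def)
    qed
    then show ?thesis by (simp add: vec_eq_iff)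
  qed
  have "(N \<bullet> N) * (J $ i \<bullet> cross3 N (b i)) = N $ i * (cross3 (J *v N) N \<bullet> b i)" for i
  proof -
    have "J $ i \<bullet> cross3 N (b i) = cross3 (J $ i) N \<bullet> b i"
      by (simp add: cross_components inner_vec_def sum_3 algebra_simps)
    then have "(N \<bullet> N) * (J $ i \<bullet> cross3 N (b i)) = ((N \<bullet> N) *\<^sub>R cross3 (J *v axis i 1) N) \<bullet> b i" by (simp add: row)
    also have "\<dots> = N $ i * (cross3 (J *v N) N \<bullet> b i)"
      using tangent_free_cross[OF J, of "axis i 1"] by (simp add: N[symmetric] inner_axis')
    finally show ?thesis .
  qed
  then have "(N \<bullet> N) * (\<Sum>i\<in>UNIV. J $ i \<bullet> cross3 N (b i)) = (\<Sum>i\<in>UNIV. N $ i * (cross3 (J *v N) N \<bullet> b i))"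
    by (simp add: sum_distrib_left)
  also have "\<dots> = (\<Sum>j\<in>UNIV. cross3 (J *v N) N $ j * (N \<bullet> C j))"
    by (simp add: inner_vec_def sum_3 b algebra_simps)
  finally show ?thesis .
qed

lemma tangent_freeI:
  assumes "transpose J = J" "edge_form J p q = 0" "edge_form J p r = 0" "edge_form J q r = 0"
  shows "tangent_free J (q - p) (r - p)"
proof -
  have e: "r - q = (r - p) - (q - p)" by simp
  have "edge_form J q r = (r - p) \<bullet> (J *v (r - p)) - (r - p) \<bullet> (J *v (q - p)) - (q - p) \<bullet> (J *v (r - p)) + (q - p) \<bullet> (J *v (q - p))"
    unfolding edge_form_def e by (simp only: matrix_vector_mult_diff_distrib inner_diff_left inner_diff_right)
  then show ?thesis using assms sym_bilinear[OF assms(1), of "r - p" "q - p"]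
    by (simp add: tangent_free_def edge_form_def)
qed

subsection \<open>Testing a piecewise constant field with a smooth incompatibility\<close>

lemma l2_inner_class_of:
  "l2_inner (class_of f) (class_of g) = set_lebesgue_integral lebesgue cube (\<lambda>x. f x \<bullet> g x)"
  by transfer simp

abbreviation curl_row :: "(pt \<Rightarrow> mat3) \<Rightarrow> 3 \<Rightarrow> pt \<Rightarrow> pt"
  where "curl_row v i \<equiv> \<lambda>p. transpose (mcurl v p) $ i"

lemma inc_smooth_row: "inc_smooth v x $ i = curl (curl_row v i) x"
  by (simp add: inc_smooth_def mcurl_row)

lemma inc_smooth_continuous:
  assumes "smooth v"
  shows "continuous_on UNIV (inc_smooth v)"
proof -
  have "continuous_on UNIV (\<lambda>x. \<chi> i. inc_smooth v x $ i)"
    unfolding inc_smooth_row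
    by (intro continuous_on_vec_lambda C1_curl_continuous transpose_mcurl_row_C1 assms)
  then show ?thesis by simp
qed

context mesh
begin

lemma l2_inner_step_field:
  fixes w :: "pt \<Rightarrow> 'a::euclidean_space"
  assumes w: "continuous_on UNIV w"
  shows "l2_inner (step_field K U) (class_of w) = (\<Sum>T\<in>K. integral T (\<lambda>x. U T \<bullet> w x))"
proof -
  let ?g = "\<lambda>T x. indicat_real (interior T) x *\<^sub>R (U T \<bullet> w x)"
  have c: "continuous_on UNIV (\<lambda>x. U T \<bullet> w x)" for T by (intro continuous_intros w)
  have si: "set_integrable lebesgue (interior T) (\<lambda>x. U T \<bullet> w x)" if T: "T \<in> K" for T
    by (rule set_integrable_subset[OF integrable_tet(2)[OF c compact_simplex[OF K_simplex[OF T]]]])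
      (auto simp: interior_subset)
  have "l2_inner (step_field K U) (class_of w) = (\<integral>x. (\<Sum>T\<in>K. ?g T x) \<partial>lebesgue)"
    unfolding step_field_def l2_inner_class_of set_lebesgue_integral_def
  proof (intro Bochner_Integration.integral_cong refl)
    fix x :: pt
    have "indicat_real cube x * (indicat_real (interior T) x * y) = indicat_real (interior T) x * y" if "T \<in> K" for T y
      using K_cube[OF that] interior_subset[of T] by (auto simp: indicator_def)
    then show "indicat_real cube x *\<^sub>R ((\<Sum>T\<in>K. indicat_real (interior T) x *\<^sub>R U T) \<bullet> w x) = (\<Sum>T\<in>K. ?g T x)"
      unfolding inner_sum_left real_scaleR_def inner_scaleR_left sum_distrib_left by (intro sum.cong refl)
  qed
  also have "\<dots> = (\<Sum>T\<in>K. \<integral>x. ?g T x \<partial>lebesgue)"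
    by (rule Bochner_Integration.integral_sum) (use si in \<open>simp add: set_integrable_def\<close>)
  also have "\<dots> = (\<Sum>T\<in>K. integral T (\<lambda>x. U T \<bullet> w x))"
  proof (rule sum.cong[OF refl])
    fix T assume T: "T \<in> K"
    have "(\<integral>x. ?g T x \<partial>lebesgue) = integral (interior T) (\<lambda>x. U T \<bullet> w x)"
      using set_lebesgue_integral_eq_integral(2)[OF si[OF T]] by (simp add: set_lebesgue_integral_def)
    also have "\<dots> = integral T (\<lambda>x. U T \<bullet> w x)"
    proof (rule integral_spike_set)
      have "{x \<in> T - interior T. U T \<bullet> w x \<noteq> 0} \<subseteq> frontier T"
        using closure_subset by (auto simp: frontier_def)
      then show "negligible {x \<in> T - interior T. U T \<bullet> w x \<noteq> 0}"
        using negligible_frontier_K[OF T] negligible_subset by blast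
      have "{x \<in> interior T - T. U T \<bullet> w x \<noteq> 0} = {}" using interior_subset by blast
      then show "negligible {x \<in> interior T - T. U T \<bullet> w x \<noteq> 0}" by (simp only: negligible_empty)
    qed
    finally show "(\<integral>x. ?g T x \<partial>lebesgue) = integral T (\<lambda>x. U T \<bullet> w x)" .
  qed
  finally show ?thesis .
qed

lemma l2_inner_fluxes:
  assumes m: "m \<in> X1 K" and v: "smooth v"
  shows "l2_inner m (class_of (inc_smooth v)) =
    (\<Sum>T\<in>K. \<Sum>F | T \<in> tets K \<and> 2 simplex F \<and> F face_of T. \<Sum>i\<in>UNIV. val K m T $ i \<bullet> face_flux T F (curl_row v i))"
proof -
  have "integral T (\<lambda>x. A \<bullet> inc_smooth v x) = (\<Sum>F | T \<in> tets K \<and> 2 simplex F \<and> F face_of T. \<Sum>i\<in>UNIV. A $ i \<bullet> face_flux T F (curl_row v i))"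
    if T: "T \<in> K" for T A
  proof -
    have C: "C1_field (curl_row v i)" for i by (rule transpose_mcurl_row_C1[OF v])
    have i: "curl (curl_row v i) integrable_on T" for i
      by (rule integrable_tet(1)[OF C1_curl_continuous[OF C] compact_simplex[OF K_simplex[OF T]]])
    have il: "(\<lambda>x. A $ i \<bullet> curl (curl_row v i) x) integrable_on T"
      "integral T (\<lambda>x. A $ i \<bullet> curl (curl_row v i) x) = A $ i \<bullet> integral T (curl (curl_row v i))" for i
      using integrable_linear[OF i bounded_linear_inner_right[of "A $ i"]]
        integral_linear[OF i bounded_linear_inner_right[of "A $ i"]] by (simp_all add: o_def)
    have "integral T (\<lambda>x. A \<bullet> inc_smooth v x) = integral T (\<lambda>x. \<Sum>i\<in>UNIV. A $ i \<bullet> curl (curl_row v i) x)"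
      by (simp add: inner_vec_def[of A] inc_smooth_row)
    also have "\<dots> = (\<Sum>i\<in>UNIV. A $ i \<bullet> integral T (curl (curl_row v i)))"
      by (simp add: integral_sum il)
    also have "\<dots> = (\<Sum>i\<in>UNIV. \<Sum>F | 2 simplex F \<and> F face_of T. A $ i \<bullet> face_flux T F (curl_row v i))"
      by (simp add: integral_curl_fluxes[OF C K_simplex[OF T]] inner_sum_right)
    also have "\<dots> = (\<Sum>F | 2 simplex F \<and> F face_of T. \<Sum>i\<in>UNIV. A $ i \<bullet> face_flux T F (curl_row v i))"
      by (rule sum.swap)
    finally show ?thesis using K_tets[OF T] by simp
  qed
  then show ?thesis
    using arg_cong[OF X1_step_field[OF m], of "\<lambda>u. l2_inner u (class_of (inc_smooth v))"]
    by (simp add: l2_inner_step_field[OF inc_smooth_continuous[OF v]])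
qed

subsection \<open>The contribution of one triangle\<close>

lemma adj_tet_base:
  assumes "(p' - p) \<bullet> n = 0"
  shows "adj_tet K F p' n = adj_tet K F p n"
proof -
  have "(q - p') \<bullet> n = (q - p) \<bullet> n" for q
    using assms by (simp add: inner_diff_left)
  then show ?thesis by (simp add: adj_tet_def)
qed

text \<open>The forms on the three edges of the triangle agree on both sides, and polarisation does the rest.\<close>

lemma jump_tangent_free:
  assumes m: "m \<in> X1 K" and N: "nrm3 p q r \<noteq> 0"
    and T: "T \<in> tets K" "convex hull {p, q, r} face_of T" "T' \<in> tets K" "convex hull {p, q, r} face_of T'"
  shows "tangent_free (val K m T - val K m T') (q - p) (r - p)"
proof -
  note D = nrm3_nonzero_distinct[OF N]
  have e: "edge_form (val K m T) x z = edge_form (val K m T') x z"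
    if xz: "x \<in> {p, q, r}" "z \<in> {p, q, r}" "x \<noteq> z" for x z
  proof -
    have "closed_segment x z face_of (convex hull {p, q, r})"
      unfolding segment_convex_hull by (rule triangle_subface[OF N]) (use xz in auto)
    then have "closed_segment x z face_of T" "closed_segment x z face_of T'" using T face_of_trans by blast+
    then show ?thesis using reggeD(3)[OF X1_props(2)[OF m] T(1) T(3) xz(3)] by blast
  qed
  have d: "edge_form (A - B) x z = edge_form A x z - edge_form B x z" for A B x z
    by (simp add: edge_form_def matrix_vector_mult_diff_rdistrib inner_diff_right)
  have "transpose (A - B) = transpose A - transpose B" for A B :: mat3 by (simp add: transpose_def vec_eq_iff)
  then have "transpose (val K m T - val K m T') = val K m T - val K m T'"
    using reggeD(1)[OF X1_props(2)[OF m]] T by simp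
  then show ?thesis by (rule tangent_freeI) (use e D d in auto)
qed

text \<open>The contribution of one edge of a triangle after the application of Stokes' theorem.\<close>

definition edge_term :: "mat3 field_class \<Rightarrow> (pt \<Rightarrow> mat3) \<Rightarrow> pt \<Rightarrow> pt \<Rightarrow> pt set \<Rightarrow> real"
  where "edge_term m v x z F = cross3 (face_jump K m (x, z) F *v n_vec (x, z) F) (n_vec (x, z) F) \<bullet>
    (seg_avg x z v *v (z - x))"

lemma sgn_orth: "sgn (nrm3 p q r) \<bullet> (q - p) = 0" "sgn (nrm3 p q r) \<bullet> (r - p) = 0"
  by (simp_all add: sgn_div_norm dot_cross_self)

text \<open>The outer normals of the two tetrahedra are opposite, so the jump of the values appears. It pairs
  with the averages of \<open>(curl v)\<^sup>T\<close>, of which only the normal components of the curls of the rows of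
  \<open>v\<close> survive, and these are circulations around the triangle.\<close>

lemma triangle_fluxes:
  assumes m: "m \<in> X1 K" and v: "smooth v" and F: "F \<in> subsimps K 2" "F = convex hull {p, q, r}" and N: "nrm3 p q r \<noteq> 0"
  shows "(\<Sum>T | T \<in> tets K \<and> 2 simplex F \<and> F face_of T. \<Sum>i\<in>UNIV. val K m T $ i \<bullet> face_flux T F (curl_row v i)) =
    - (edge_term m v q r F + edge_term m v r p F + edge_term m v p q F)"
proof -
  define N n where "N = nrm3 p q r" and "n = sgn N"
  have N0: "N \<noteq> 0" using N by (simp add: N_def)
  have n: "n \<bullet> (q - p) = 0" "n \<bullet> (r - p) = 0" "n \<noteq> 0"
    using sgn_orth[where p=p and q=q and r=r] N0 by (simp_all add: n_def N_def sgn_zero_iff)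
  have n': "-n \<bullet> (q - p) = 0" "-n \<bullet> (r - p) = 0" "-n \<noteq> 0" using n by simp_all
  define Tp Tm where "Tp = adj_tet K F p n" and "Tm = adj_tet K F p (-n)"
  note P = adj_tet_props[OF F N n, folded Tp_def] and M = adj_tet_props[OF F N n', folded Tm_def]
  define J where "J = val K m Tp - val K m Tm"
  have tf: "tangent_free J (q - p) (r - p)"
    unfolding J_def by (rule jump_tangent_free[OF m N]) (use P(1,2) M(1,2) F(2) in auto)
  have C: "C1_field (curl_row v i)" for i by (rule transpose_mcurl_row_C1[OF v])
  define b where "b i = tri_avg p q r (curl_row v i)" for i
  have fl: "face_flux T F (curl_row v i) = - sgn (n \<bullet> (d - p)) *\<^sub>R cross3 N (b i)"
    if d: "T = convex hull {p, q, r, d}" "vol p q r d \<noteq> 0" for T d i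
  proof -
    have "sgn (vol p q r d) = sgn (n \<bullet> (d - p))"
    proof -
      have "n \<bullet> (d - p) = inverse (norm N) * vol p q r d" by (simp add: vol_def n_def N_def sgn_div_norm)
      moreover have "sgn (inverse (norm N)) = 1" using N0 by (intro sgn_pos) simp
      ultimately show ?thesis by (simp only: sgn_mult mult_1)
    qed
    then show ?thesis
      using face_flux_eq[OF C1_continuous[OF C] d(2)] by (simp add: d(1) F(2) oriented_flux_def N_def b_def)
  qed
  have flp: "face_flux Tp F (curl_row v i) = - cross3 N (b i)" for i
  proof -
    obtain d where d: "Tp = convex hull {p, q, r, d}" "vol p q r d \<noteq> 0"
      using tet_over_triangle[OF tets_simplex[OF P(1)] _ N] P(2) F(2) by blast
    show ?thesis using fl[OF d] tet_side[OF d(1) n(1,2)] P(3) by simp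
  qed
  have flm: "face_flux Tm F (curl_row v i) = cross3 N (b i)" for i
  proof -
    obtain d where d: "Tm = convex hull {p, q, r, d}" "vol p q r d \<noteq> 0"
      using tet_over_triangle[OF tets_simplex[OF M(1)] _ N] M(2) F(2) by blast
    show ?thesis using fl[OF d] tet_side[OF d(1) n'(1,2)] M(3) by simp
  qed
  have "{T. T \<in> tets K \<and> 2 simplex F \<and> F face_of T} = {T \<in> tets K. F face_of T}"
    using subsimps_simplex[OF F(1)] by blast
  also have "\<dots> = {Tp, Tm}" unfolding Tp_def Tm_def by (rule two_tets(1)[OF F N n])
  finally have "(\<Sum>T | T \<in> tets K \<and> 2 simplex F \<and> F face_of T. \<Sum>i\<in>UNIV. val K m T $ i \<bullet> face_flux T F (curl_row v i)) =
     (\<Sum>i\<in>UNIV. val K m Tp $ i \<bullet> (- cross3 N (b i))) + (\<Sum>i\<in>UNIV. val K m Tm $ i \<bullet> cross3 N (b i))"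
    using two_tets(2)[OF F N n] by (simp add: flp flm Tp_def[symmetric] Tm_def[symmetric])
  also have "\<dots> = - (\<Sum>i\<in>UNIV. J $ i \<bullet> cross3 N (b i))"
    by (simp add: J_def inner_diff_left sum_subtractf sum_negf)
  finally have S: "(\<Sum>T | T \<in> tets K \<and> 2 simplex F \<and> F face_of T. \<Sum>i\<in>UNIV. val K m T $ i \<bullet> face_flux T F (curl_row v i)) =
     - (\<Sum>i\<in>UNIV. J $ i \<bullet> cross3 N (b i))" .
  define c where "c j = tri_avg p q r (curl (\<lambda>y. v y $ j))" for j
  have bc: "b i $ j = c j $ i" for i j
  proof -
    have "b i $ j = tri_avg p q r (\<lambda>y. transpose (mcurl v y) $ i $ j)"
      unfolding b_def by (rule tri_avg_bounded_linear[OF C1_continuous[OF C] bounded_linear_vec_nth, symmetric])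
    also have "\<dots> = tri_avg p q r (\<lambda>y. curl (\<lambda>y. v y $ j) y $ i)" by (simp add: transpose_def mcurl_row)
    also have "\<dots> = c j $ i"
      unfolding c_def by (rule tri_avg_bounded_linear[OF C1_curl_continuous[OF smooth_row_C1[OF v]] bounded_linear_vec_nth])
    finally show ?thesis .
  qed
  let ?W = "cross3 (J *v n) n"
  have JN: "cross3 (J *v N) N = (N \<bullet> N) *\<^sub>R ?W"
  proof -
    have "N = norm N *\<^sub>R n" using N0 by (simp add: n_def sgn_div_norm)
    then have "cross3 (J *v N) N = cross3 (J *v (norm N *\<^sub>R n)) (norm N *\<^sub>R n)" by metis
    then show ?thesis by (simp add: matrix_vector_mult_scaleR cross_mult_left cross_mult_right dot_square_norm power2_eq_square)
  qed
  have sv: "seg_avg x z (\<lambda>y. v y $ j) \<bullet> w = (seg_avg x z v *v w) $ j" for x z j w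
    by (simp add: seg_avg_bounded_linear[OF smooth_continuous[OF v] bounded_linear_vec_nth] matrix_vector_mul_component)
  have "(N \<bullet> N) * (\<Sum>i\<in>UNIV. J $ i \<bullet> cross3 N (b i)) = (\<Sum>j\<in>UNIV. cross3 (J *v N) N $ j * (N \<bullet> c j))"
    by (rule tangent_free_flux[OF tf bc N_def])
  also have "\<dots> = (N \<bullet> N) * (\<Sum>j\<in>UNIV. ?W $ j * (N \<bullet> c j))" unfolding JN by (simp add: sum_distrib_left mult.assoc)
  finally have "(\<Sum>i\<in>UNIV. J $ i \<bullet> cross3 N (b i)) = (\<Sum>j\<in>UNIV. ?W $ j * (N \<bullet> c j))" using N0 by simp
  also have "\<dots> = (\<Sum>j\<in>UNIV. ?W $ j * ((seg_avg q r v *v (r - q)) $ j + (seg_avg r p v *v (p - r)) $ j + (seg_avg p q v *v (q - p)) $ j))"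
    unfolding c_def N_def triangle_stokes[OF smooth_row_C1[OF v]] sv ..
  also have "\<dots> = ?W \<bullet> (seg_avg q r v *v (r - q)) + ?W \<bullet> (seg_avg r p v *v (p - r)) + ?W \<bullet> (seg_avg p q v *v (q - p))"
    by (simp only: inner_vec_def inner_real_def sum.distrib distrib_left)
  also have "\<dots> = edge_term m v q r F + edge_term m v r p F + edge_term m v p q F"
  proof -
    have F2: "F = convex hull {q, r, p}" and F3: "F = convex hull {r, p, q}" using F(2) by (simp_all add: insert_commute)
    have Nq: "nrm3 q r p = N" and Nr: "nrm3 r p q = N"
      using nrm3_perm(1) by (metis N_def)+
    have nv: "n_vec (p, q) F = n" "n_vec (q, r) F = n" "n_vec (r, p) F = n"
      using edge_frame(1)[OF N F(2)] edge_frame(1)[OF _ F2] edge_frame(1)[OF _ F3] N0 Nq Nr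
      by (simp_all add: n_def N_def)
    have bq: "(q - p) \<bullet> n = 0" "(q - p) \<bullet> -n = 0" "(r - p) \<bullet> n = 0" "(r - p) \<bullet> -n = 0"
      using n by (simp_all add: inner_commute)
    have "face_jump K m (p, q) F = J" "face_jump K m (q, r) F = J" "face_jump K m (r, p) F = J"
      unfolding face_jump_def nv fst_conv adj_tet_base[OF bq(1)] adj_tet_base[OF bq(2)]
        adj_tet_base[OF bq(3)] adj_tet_base[OF bq(4)] J_def Tp_def Tm_def by (rule refl)+
    then show ?thesis by (simp only: edge_term_def nv)
  qed
  finally show ?thesis using S by simp
qed

text \<open>Reversing the edge reverses the normal and hence also the sign of the jump.\<close>

lemma edge_term_swap:
  assumes v: "continuous_on UNIV v" and xz: "x \<noteq> z" and F: "F \<in> tri_star (closed_segment x z)"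
  shows "edge_term m v z x F = edge_term m v x z F"
proof -
  obtain r where r: "F = convex hull {x, z, r}" "nrm3 x z r \<noteq> 0" "n_vec (x, z) F = sgn (nrm3 x z r)"
    and n: "n_vec (x, z) F \<bullet> (z - x) = 0"
    by (rule tri_star_frame[OF xz F])
  have F2: "F = convex hull {z, x, r}" using r(1) by (simp add: insert_commute)
  have N2: "nrm3 z x r = - nrm3 x z r" by (rule nrm3_perm(3))
  then have "n_vec (z, x) F = sgn (- nrm3 x z r)" using edge_frame(1)[OF _ F2] r(2) by simp
  then have n2: "n_vec (z, x) F = - n_vec (x, z) F" using r(3) by (simp add: sgn_minus)
  have b: "(z - x) \<bullet> n_vec (x, z) F = 0" "(z - x) \<bullet> - n_vec (x, z) F = 0" using n by (simp_all add: inner_commute)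
  have "face_jump K m (z, x) F = - face_jump K m (x, z) F"
    unfolding face_jump_def n2 fst_conv minus_minus adj_tet_base[OF b(1)] adj_tet_base[OF b(2)] by simp
  moreover have "(- A) *v y = - (A *v y)" for A :: mat3 and y
    by (simp add: matrix_vector_mult_def vec_eq_iff sum_negf)
  moreover have "A *v (- y) = - (A *v y)" for A :: mat3 and y
    by (simp add: matrix_vector_mult_def vec_eq_iff sum_negf)
  moreover have "x - z = - (z - x)" by simp
  ultimately show ?thesis
    unfolding edge_term_def n2 seg_avg_swap[OF v, of z x] by (simp only:) simp
qed

lemma edge_term_translation:
  assumes m: "m \<in> X1 K" and v: "periodic v" and xz: "x \<noteq> z" and F: "F \<in> tri_star (closed_segment x z)" and k: "k \<in> int_lattice"
  shows "edge_term m v (k + x) (k + z) ((+) k ` F) = edge_term m v x z F"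
proof -
  obtain r where r: "F = convex hull {x, z, r}" "nrm3 x z r \<noteq> 0" "n_vec (x, z) F = sgn (nrm3 x z r)"
    and n: "n_vec (x, z) F \<bullet> (z - x) = 0" "n_vec (x, z) F \<bullet> (r - x) = 0" "n_vec (x, z) F \<noteq> 0"
    by (rule tri_star_frame[OF xz F])
  have F2: "F \<in> subsimps K 2" using F by simp
  have kF: "(+) k ` F = convex hull {k + x, k + z, k + r}" unfolding r(1) hull_translation ..
  have kN: "nrm3 (k + x) (k + z) (k + r) = nrm3 x z r" by simp
  have nv: "n_vec (k + x, k + z) ((+) k ` F) = n_vec (x, z) F"
    using edge_frame(1)[OF _ kF] r(2,3) by simp
  have adj: "adj_tet K ((+) k ` F) (k + x) h = (+) k ` adj_tet K F x h"
    if h: "h \<bullet> (z - x) = 0" "h \<bullet> (r - x) = 0" "h \<noteq> 0" for h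
  proof -
    note P = adj_tet_props[OF F2 r(1,2) h]
    have h': "h \<bullet> ((k + z) - (k + x)) = 0" "h \<bullet> ((k + r) - (k + x)) = 0" using h by simp_all
    have N': "nrm3 (k + x) (k + z) (k + r) \<noteq> 0" using r(2) by simp
    have "(+) k ` adj_tet K F x h = adj_tet K ((+) k ` F) (k + x) h"
    proof (rule adj_tet_props(4)[OF subsimps_translation[OF F2 k] kF N' h' h(3)])
      show "(+) k ` adj_tet K F x h \<in> tets K" using tets_translation[OF P(1) k] .
      show "((+) k ` F) face_of ((+) k ` adj_tet K F x h)" using P(2) by simp
      show "\<exists>y\<in>(+) k ` adj_tet K F x h. (y - (k + x)) \<bullet> h > 0" using P(3) by auto
    qed
    then show ?thesis ..
  qed
  have n': "- n_vec (x, z) F \<bullet> (z - x) = 0" "- n_vec (x, z) F \<bullet> (r - x) = 0" "- n_vec (x, z) F \<noteq> 0" using n by simp_all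
  have "face_jump K m (k + x, k + z) ((+) k ` F) = face_jump K m (x, z) F"
    unfolding face_jump_def nv fst_conv adj[OF n] adj[OF n']
    using reggeD(2)[OF X1_props(2)[OF m] _ k] adj_tet_props(1)[OF F2 r(1,2) n] adj_tet_props(1)[OF F2 r(1,2) n']
    by simp
  then show ?thesis by (simp add: edge_term_def nv seg_avg_translation[OF v k])
qed

text \<open>With \<open>t\<close> the tangent and \<open>n\<close> the normal of a triangle, \<open>J t\<close> is a multiple of \<open>n\<close>; this allows to
  write \<open>(J n) \<times> n\<close> as its component along \<open>t\<close>, which is the summand of the jump, minus \<open>(J t) \<times> t\<close>,
  which is linear in \<open>J\<close> and telescopes.\<close>

lemma edge_star_sum:
  assumes m: "m \<in> X1 K" and v: "continuous_on UNIV v" and xz: "x \<noteq> z"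
  shows "(\<Sum>F\<in>tri_star (closed_segment x z). edge_term m v x z F) =
    jump K m (x, z) * edge_integral (x, z) (\<lambda>p. tangent (x, z) \<bullet> (v p *v tangent (x, z)))"
proof -
  let ?S = "tri_star (closed_segment x z)"
  define t where "t = tangent (x, z)"
  let ?n = "n_vec (x, z)" and ?J = "face_jump K m (x, z)"
  have u: "z - x = norm (z - x) *\<^sub>R t" using xz by (simp add: t_def tangent_def sgn_div_norm)
  have tt: "t \<bullet> t = 1" using xz by (simp add: t_def tangent_def dot_square_norm norm_sgn)
  have A: "cross3 (?J F *v ?n F) (?n F) = (m_vec (x, z) F \<bullet> (?J F *v ?n F)) *\<^sub>R t - cross3 (?J F *v t) t" if F: "F \<in> ?S" for F
  proof -
    obtain r where r: "F = convex hull {x, z, r}" "nrm3 x z r \<noteq> 0" "?n F = sgn (nrm3 x z r)"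
      "m_vec (x, z) F = cross3 (?n F) (tangent (x, z))"
      and n: "?n F \<bullet> (z - x) = 0" "?n F \<bullet> (r - x) = 0" "?n F \<noteq> 0" and n1: "norm (?n F) = 1"
      by (rule tri_star_frame[OF xz F])
    have F2: "F \<in> subsimps K 2" using F by simp
    have n': "- ?n F \<bullet> (z - x) = 0" "- ?n F \<bullet> (r - x) = 0" "- ?n F \<noteq> 0" using n by simp_all
    note P = adj_tet_props[OF F2 r(1,2) n] and M = adj_tet_props[OF F2 r(1,2) n']
    have tf: "tangent_free (?J F) (z - x) (r - x)"
      unfolding face_jump_def fst_conv
      by (rule jump_tangent_free[OF m r(2)]) (use P(1,2) M(1,2) r(1) in auto)
    let ?N = "nrm3 x z r"
    have NN: "?N = norm ?N *\<^sub>R ?n F" using r(2,3) by (simp add: sgn_div_norm)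
    have nn: "?n F \<bullet> ?n F = 1" using n1 by (simp add: dot_square_norm)
    have e: "?J F *v (z - x) = ((?J F *v (z - x)) \<bullet> ?n F) *\<^sub>R ?n F"
    proof -
      have "(?N \<bullet> ?N) *\<^sub>R (?J F *v (z - x)) = ((?J F *v (z - x)) \<bullet> ?N) *\<^sub>R ?N" by (rule tangent_free_mult(1)[OF tf])
      also have "\<dots> = ((?J F *v (z - x)) \<bullet> (norm ?N *\<^sub>R ?n F)) *\<^sub>R (norm ?N *\<^sub>R ?n F)" using NN by metis
      also have "\<dots> = (?N \<bullet> ?N) *\<^sub>R (((?J F *v (z - x)) \<bullet> ?n F) *\<^sub>R ?n F)"
        by (simp add: dot_square_norm power2_eq_square mult_ac)
      finally show ?thesis by (rule scaleR_left_imp_eq[rotated]) (use r(2) in simp)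
    qed
    have tz: "t = (1 / norm (z - x)) *\<^sub>R (z - x)"
      by (simp add: t_def tangent_def sgn_div_norm inverse_eq_divide)
    have Jt: "?J F *v t = (t \<bullet> (?J F *v ?n F)) *\<^sub>R ?n F"
    proof -
      have "?J F *v t = ((?J F *v t) \<bullet> ?n F) *\<^sub>R ?n F"
        unfolding tz matrix_vector_mult_scaleR by (subst e) simp
      also have "(?J F *v t) \<bullet> ?n F = t \<bullet> (?J F *v ?n F)"
        using sym_bilinear[of "?J F" "?n F" t] tf by (simp add: tangent_free_def inner_commute)
      finally show ?thesis .
    qed
    have tn: "t \<bullet> ?n F = 0" unfolding tz using n(1) by (simp only: inner_scaleR_left inner_commute[of "z - x"] mult_zero_right)
    have mv: "m_vec (x, z) F = cross3 (?n F) t" using r(4) by (simp add: t_def)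
    have dec: "cross3 y (?n F) = (cross3 (?n F) t \<bullet> y) *\<^sub>R t - (t \<bullet> y) *\<^sub>R cross3 (?n F) t" for y
    proof -
      have nt: "?n F = cross3 t (cross3 (?n F) t)"
        using cross_cross_left[of t "?n F"] tt tn cross_skew[of "?n F" t] by simp
      have "cross3 y (?n F) = - cross3 (cross3 t (cross3 (?n F) t)) y" using nt cross_skew[of y "?n F"] by metis
      then show ?thesis unfolding cross_cross_right by simp
    qed
    show ?thesis unfolding mv Jt by (subst dec) (simp add: cross_mult_left)
  qed
  have "(\<Sum>F\<in>?S. cross3 (?J F *v t) t) = cross3 ((\<Sum>F\<in>?S. ?J F) *v t) t"
  proof -
    have "linear (\<lambda>A :: mat3. cross3 (A *v t) t)"
      by (rule linearI) (simp_all add: matrix_vector_mult_add_rdistrib cross_add_left scaleR_matrix_vector_assoc[symmetric] cross_mult_left)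
    then show ?thesis by (rule linear_sum[symmetric])
  qed
  also have "(\<Sum>F\<in>?S. ?J F) = 0"
    unfolding face_jump_def fst_conv by (rule telescoping[OF xz])
  finally have z: "(\<Sum>F\<in>?S. cross3 (?J F *v t) t) = 0" by simp
  have "(\<Sum>F\<in>?S. cross3 (?J F *v ?n F) (?n F)) = (\<Sum>F\<in>?S. (m_vec (x, z) F \<bullet> (?J F *v ?n F)) *\<^sub>R t - cross3 (?J F *v t) t)"
    by (rule sum.cong[OF refl A])
  also have "\<dots> = jump K m (x, z) *\<^sub>R t"
    unfolding sum_subtractf z by (simp add: jump_def scaleR_sum_left seg_def)
  finally have W: "(\<Sum>F\<in>?S. cross3 (?J F *v ?n F) (?n F)) = jump K m (x, z) *\<^sub>R t" .
  have bl: "bounded_linear (\<lambda>A :: mat3. t \<bullet> (A *v t))"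
    by (rule linear_linear[THEN iffD2], rule linearI)
      (simp_all add: matrix_vector_mult_add_rdistrib inner_add_right scaleR_matrix_vector_assoc[symmetric])
  have "edge_integral (x, z) (\<lambda>p. t \<bullet> (v p *v t)) = norm (z - x) * seg_avg x z (\<lambda>p. t \<bullet> (v p *v t))"
    by (simp add: edge_integral_def seg_avg_def)
  also have "\<dots> = norm (z - x) * (t \<bullet> (seg_avg x z v *v t))"
    by (simp only: seg_avg_bounded_linear[OF v bl])
  also have "\<dots> = t \<bullet> (seg_avg x z v *v (z - x))"
    by (subst (2) u) (simp add: matrix_vector_mult_scaleR)
  finally show ?thesis
    unfolding edge_term_def inner_sum_left[symmetric] W by (simp add: t_def)
qed

end

context oriented_mesh
begin

text \<open>\<open>edge_term\<close> as a function of sets, to which \<open>orbit_sum\<close> applies. The choice is independent of the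
  orientation by \<open>edge_term_swap\<close>.\<close>

definition segment_term :: "mat3 field_class \<Rightarrow> (pt \<Rightarrow> mat3) \<Rightarrow> pt set \<Rightarrow> pt set \<Rightarrow> real"
  where "segment_term m v S F = (SOME y. \<exists>x z. x \<noteq> z \<and> S = closed_segment x z \<and> y = edge_term m v x z F)"

lemma segment_term_eq:
  assumes v: "continuous_on UNIV v" and xz: "x \<noteq> z" and F: "F \<in> tri_star (closed_segment x z)"
  shows "segment_term m v (closed_segment x z) F = edge_term m v x z F"
  unfolding segment_term_def
proof (rule some_equality)
  fix y assume "\<exists>x' z'. x' \<noteq> z' \<and> closed_segment x z = closed_segment x' z' \<and> y = edge_term m v x' z' F"
  then obtain x' z' where e: "closed_segment x z = closed_segment x' z'" "y = edge_term m v x' z' F" by blast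
  have "{x, z} = {x', z'}" using e(1) by (rule closed_segment_eq[THEN iffD1])
  then have "x' = x \<and> z' = z \<or> x' = z \<and> z' = x" by (auto simp: doubleton_eq_iff)
  then show "y = edge_term m v x z F" using e(2) edge_term_swap[OF v xz F] by auto
qed (use xz in blast)

text \<open>The sum over tetrahedra and their faces is rearranged first by triangles and then by edges.\<close>

lemma inc_distr_eq_jump:
  assumes m: "m \<in> X1 K"
  shows "inc_distr m = - inc_jump K E m"
proof
  fix v
  have ij: "(- inc_jump K E m) v = - (\<Sum>e\<in>E. jump K m e * edge_delta e v)"
  proof -
    have "(\<Sum>e\<in>A. jump K m e *\<^sub>R edge_delta e) v = (\<Sum>e\<in>A. jump K m e * edge_delta e v)" if "finite A" for A
      using that by (induction A rule: finite_induct) (simp_all add: scaleR_fun_def)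
    then show ?thesis by (simp add: inc_jump_def finite_E fun_Compl_def)
  qed
  show "inc_distr m v = (- inc_jump K E m) v"
  proof (cases "v \<in> test_S")
    case False
    then show ?thesis unfolding ij by (simp add: inc_distr_def edge_delta_def)
  next
    case True
    then have v: "smooth v" "periodic v" by (simp_all add: test_S_def)
    note vc = smooth_continuous[OF v(1)]
    obtain FF where FF: "transversal FF (subsimps K 2)" using transversal_exists[of 2] by auto
    let ?\<Phi> = "\<lambda>T F. \<Sum>i\<in>UNIV. val K m T $ i \<bullet> face_flux T F (curl_row v i)"
    have C: "C1_field (curl_row v i)" for i by (rule transpose_mcurl_row_C1[OF v(1)])
    have per: "periodic (curl_row v i)" for i
    proof -
      have "periodic (\<lambda>p. v p $ j)" for j using v(2) by (simp add: periodic_def)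
      then have "periodic (curl (\<lambda>p. v p $ j))" for j by (rule curl_periodic)
      then show ?thesis unfolding periodic_def by (simp add: transpose_def mcurl_row vec_eq_iff)
    qed
    have "l2_inner m (class_of (inc_smooth v)) = (\<Sum>T\<in>K. \<Sum>F | T \<in> tets K \<and> 2 simplex F \<and> F face_of T. ?\<Phi> T F)"
      by (rule l2_inner_fluxes[OF m v(1)])
    also have "\<dots> = (\<Sum>F\<in>FF. \<Sum>T | T \<in> tets K \<and> 2 simplex F \<and> F face_of T. ?\<Phi> T F)"
    proof (rule orbit_sum[OF transversal_K FF], goal_cases)
      case (1 T F) then show ?case by (auto simp: subsimps_def)
    next
      case (2 T F k) then show ?case by (simp add: tets_translation simplex_translation)
    next
      case (3 T) then show ?case using finite_faces_simplex[OF tets_simplex] by (rule_tac finite_subset[of _ "{F. F face_of T}"]) auto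
    next
      case (4 F)
      have b: "bounded F" "F \<noteq> {}" using subsimps_bounded_nonempty[OF 4] by auto
      show ?case by (rule finite_subset[OF _ finite_tet_star[OF b(2,1)]]) auto
    next
      case (5 T F k)
      then have "face_flux ((+) k ` T) ((+) k ` F) (curl_row v i) = face_flux T F (curl_row v i)" for i
        by (intro face_flux_translation C1_continuous[OF C] per) (auto simp: tets_simplex)
      then show ?case using reggeD(2)[OF X1_props(2)[OF m], of T k] 5 by simp
    qed
    also have "\<dots> = (\<Sum>F\<in>FF. - (\<Sum>S | F \<in> subsimps K 2 \<and> 1 simplex S \<and> S face_of F. segment_term m v S F))"
    proof (rule sum.cong[OF refl])
      fix F assume "F \<in> FF"
      then have F: "F \<in> subsimps K 2" using FF by (auto simp: transversal_def)
      obtain p q r where r: "nrm3 p q r \<noteq> 0" "F = convex hull {p, q, r}"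
        using triangle_exE[OF subsimps_simplex[OF F]] by blast
      note D = nrm3_nonzero_distinct[OF r(1)]
      have "segment_term m v (closed_segment x z) F = edge_term m v x z F" if "x \<in> {p,q,r}" "z \<in> {p,q,r}" "x \<noteq> z" for x z
      proof (rule segment_term_eq[OF vc that(3)])
        show "F \<in> tri_star (closed_segment x z)"
          using F triangle_subface[OF r(1), of "{x, z}"] that r(2) by (simp add: segment_convex_hull)
      qed
      then have "(\<Sum>S | 1 simplex S \<and> S face_of F. segment_term m v S F) =
        edge_term m v q r F + edge_term m v r p F + edge_term m v p q F"
        using sum_triangle_facets[OF r(1), of "\<lambda>S. segment_term m v S F"] r(2) D by simp
      then show "(\<Sum>T | T \<in> tets K \<and> 2 simplex F \<and> F face_of T. ?\<Phi> T F) =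
         - (\<Sum>S | F \<in> subsimps K 2 \<and> 1 simplex S \<and> S face_of F. segment_term m v S F)"
        using triangle_fluxes[OF m v(1) F r(2,1)] F by simp
    qed
    also have "\<dots> = - (\<Sum>F\<in>FF. \<Sum>S | F \<in> subsimps K 2 \<and> 1 simplex S \<and> S face_of F. segment_term m v S F)"
      by (simp add: sum_negf)
    also have "(\<Sum>F\<in>FF. \<Sum>S | F \<in> subsimps K 2 \<and> 1 simplex S \<and> S face_of F. segment_term m v S F) =
      (\<Sum>S\<in>seg ` E. \<Sum>F | F \<in> subsimps K 2 \<and> 1 simplex S \<and> S face_of F. segment_term m v S F)"
    proof (rule orbit_sum[OF FF transversal_E], goal_cases)
      case (1 F S) then show ?case using face_of_subsimps by blast
    next
      case (2 F S k) then show ?case by (simp add: subsimps_translation simplex_translation)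
    next
      case (3 F) then show ?case using finite_faces_simplex[OF subsimps_simplex] by (rule_tac finite_subset[of _ "{S. S face_of F}"]) auto
    next
      case (4 S)
      have b: "bounded S" "S \<noteq> {}" using subsimps_bounded_nonempty[OF 4] by auto
      show ?case by (rule finite_subset[OF _ finite_tri_star[OF b(2,1)]]) auto
    next
      case (5 F S k)
      then have "S \<in> subsimps K 1" using face_of_subsimps by blast
      then obtain x z where xz: "S = closed_segment x z" "x \<noteq> z" by (rule subsimps_1_segment)
      have F: "F \<in> tri_star (closed_segment x z)" using 5 xz by simp
      have kF: "(+) k ` F \<in> tri_star (closed_segment (k + x) (k + z))"
        using F subsimps_translation[OF _ 5(2)] by (simp add: segment_translation[symmetric])
      have "segment_term m v ((+) k ` S) ((+) k ` F) = edge_term m v (k + x) (k + z) ((+) k ` F)"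
        unfolding xz(1) segment_translation by (rule segment_term_eq[OF vc _ kF]) (use xz in simp)
      also have "\<dots> = segment_term m v S F"
        using edge_term_translation[OF m v(2) xz(2) F 5(2)] segment_term_eq[OF vc xz(2) F] xz(1) by simp
      finally show ?case .
    qed
    also have "\<dots> = (\<Sum>e\<in>E. \<Sum>F | F \<in> subsimps K 2 \<and> 1 simplex (seg e) \<and> seg e face_of F. segment_term m v (seg e) F)"
      by (simp add: sum.reindex[OF inj_on_seg])
    also have "\<dots> = (\<Sum>e\<in>E. jump K m e * edge_delta e v)"
    proof (rule sum.cong[OF refl])
      fix e assume e: "e \<in> E"
      obtain x z where xz: "e = (x, z)" by force
      then have E: "x \<noteq> z" "closed_segment x z \<in> subsimps K 1" using E_subsimp[OF e] by (auto simp: seg_def)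
      have "(\<Sum>F | F \<in> subsimps K 2 \<and> 1 simplex (seg e) \<and> seg e face_of F. segment_term m v (seg e) F) =
        (\<Sum>F\<in>tri_star (closed_segment x z). segment_term m v (closed_segment x z) F)"
        using subsimps_simplex[OF E(2)] by (simp add: xz seg_def)
      also have "\<dots> = (\<Sum>F\<in>tri_star (closed_segment x z). edge_term m v x z F)"
        by (rule sum.cong[OF refl segment_term_eq[OF vc E(1)]])
      finally show "(\<Sum>F | F \<in> subsimps K 2 \<and> 1 simplex (seg e) \<and> seg e face_of F. segment_term m v (seg e) F) =
        jump K m e * edge_delta e v"
        using edge_star_sum[OF m vc E(1)] True by (simp add: xz edge_delta_def)
    qed
    finally show ?thesis using True unfolding ij by (simp add: inc_distr_def)
  qed
qed

end

section \<open>Piecewise linear fields\<close>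

lemma affine_map_exists:
  fixes G :: "pt \<Rightarrow> 'a::real_normed_vector"
  assumes T: "3 simplex T"
  shows "\<exists>A b. linear A \<and> (\<forall>v\<in>vertices_of T. A v + b = G v)"
proof -
  obtain a b c d where t: "T = convex hull {a, b, c, d}" "vol a b c d \<noteq> 0" using tet_ex[OF T] by blast
  obtain gb gc gd where g: "gb \<bullet> (b - a) = 1" "gb \<bullet> (c - a) = 0" "gb \<bullet> (d - a) = 0"
    "gc \<bullet> (b - a) = 0" "gc \<bullet> (c - a) = 1" "gc \<bullet> (d - a) = 0"
    "gd \<bullet> (b - a) = 0" "gd \<bullet> (c - a) = 0" "gd \<bullet> (d - a) = 1" by (rule dual_basis[OF t(2)])
  define A where "A x = (gb \<bullet> x) *\<^sub>R (G b - G a) + (gc \<bullet> x) *\<^sub>R (G c - G a) + (gd \<bullet> x) *\<^sub>R (G d - G a)" for x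
  have lin: "linear A" unfolding A_def
    by (rule linearI) (simp_all add: inner_add_right scaleR_add_left scaleR_add_right)
  have diff: "A b - A a = G b - G a" "A c - A a = G c - G a" "A d - A a = G d - G a"
    unfolding linear_diff[OF lin, symmetric] by (simp_all only: A_def g) simp_all
  have V: "vertices_of T = {a, b, c, d}" using simplex_vertices_of[OF affine_independent_4[OF t(2)]] t(1) by simp
  have "A v + (G a - A a) = G v" if "v \<in> vertices_of T" for v
    using that diff unfolding V by (auto simp: algebra_simps)
  then show ?thesis using lin by blast
qed

lemma affine_maps_agree:
  assumes "linear A" "linear B" "\<And>v. v \<in> C \<Longrightarrow> A v + a = B v + b" "x \<in> convex hull C"
  shows "A x + a = B x + b"
proof -
  have "convex {x. A x + a = B x + b}"
  proof (rule convexI)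
    fix x y and u v :: real
    assume "x \<in> {x. A x + a = B x + b}" "y \<in> {x. A x + a = B x + b}" "0 \<le> u" "0 \<le> v" and uv: "u + v = 1"
    then have xy: "A x = B x + b - a" "A y = B y + b - a" by (simp_all add: eq_diff_eq)
    have "A (u *\<^sub>R x + v *\<^sub>R y) = B (u *\<^sub>R x + v *\<^sub>R y) + (u + v) *\<^sub>R (b - a)"
      by (simp add: linear_add[OF assms(1)] linear_add[OF assms(2)] linear_scale[OF assms(1)]
          linear_scale[OF assms(2)] xy algebra_simps)
    then show "u *\<^sub>R x + v *\<^sub>R y \<in> {x. A x + a = B x + b}" using uv by simp
  qed
  then have "convex hull C \<subseteq> {x. A x + a = B x + b}" using assms(3) by (intro hull_minimal) auto
  then show ?thesis using assms(4) by blast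
qed

lemma simplex_hull_vertices:
  fixes S :: "pt set"
  assumes "n simplex S"
  shows "S = convex hull (vertices_of S)"
proof -
  obtain C where "\<not> affine_dependent C" "S = convex hull C" using assms by (auto simp: simplex_def)
  then show ?thesis using simplex_vertices_of by simp
qed

lemma pw_linear_add: "u \<in> pw_linear K \<Longrightarrow> w \<in> pw_linear K \<Longrightarrow> u + w \<in> pw_linear K"
proof -
  assume u: "u \<in> pw_linear K" and w: "w \<in> pw_linear K"
  have "\<exists>A b. linear A \<and> (\<forall>x\<in>T. (u + w) x = A x + b)" if T: "T \<in> K" for T
  proof -
    obtain A a B b where A: "linear A" "\<forall>x\<in>T. u x = A x + a" "linear B" "\<forall>x\<in>T. w x = B x + b"
      using u w T unfolding pw_linear_def by blast
    then have "linear (\<lambda>x. A x + B x)" "\<forall>x\<in>T. (u + w) x = (A x + B x) + (a + b)"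
      by (auto intro: linear_compose_add)
    then show ?thesis by blast
  qed
  moreover have "continuous_on UNIV (u + w)"
    using u w unfolding pw_linear_def plus_fun_def by (auto intro: continuous_on_add)
  ultimately show ?thesis using u w by (auto simp: pw_linear_def periodic_def)
qed

lemma pw_linear_scaleR: "u \<in> pw_linear K \<Longrightarrow> c *\<^sub>R u \<in> pw_linear K"
proof -
  assume u: "u \<in> pw_linear K"
  have "\<exists>A b. linear A \<and> (\<forall>x\<in>T. (c *\<^sub>R u) x = A x + b)" if T: "T \<in> K" for T
  proof -
    obtain A a where A: "linear A" "\<forall>x\<in>T. u x = A x + a" using u T unfolding pw_linear_def by blast
    then have "linear (\<lambda>x. c *\<^sub>R A x)" "\<forall>x\<in>T. (c *\<^sub>R u) x = c *\<^sub>R A x + c *\<^sub>R a"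
      by (auto intro: linear_compose_scale_right simp: scaleR_fun_def scaleR_add_right)
    then show ?thesis by blast
  qed
  moreover have "continuous_on UNIV (c *\<^sub>R u)"
    using u unfolding pw_linear_def scaleR_fun_def by (auto intro: continuous_on_scaleR continuous_on_const)
  ultimately show ?thesis using u by (auto simp: pw_linear_def periodic_def scaleR_fun_def)
qed

definition tet_grad :: "(pt \<Rightarrow> pt) \<Rightarrow> pt set \<Rightarrow> mat3"
  where "tet_grad u T = (THE D. \<exists>b. \<forall>x\<in>T. u x = D *v x + b)"

definition sym_part :: "mat3 \<Rightarrow> mat3"
  where "sym_part D = (1/2) *\<^sub>R (D + transpose D)"

lemma edge_form_sym_part: "edge_form (sym_part D) x z = (z - x) \<bullet> (D *v (z - x))"
proof -
  have "w \<bullet> (transpose D *v w) = w \<bullet> (D *v w)" for w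
    by (metis dot_lmul_matrix inner_commute vector_transpose_matrix transpose_transpose)
  then show ?thesis
    by (simp add: edge_form_def sym_part_def scaleR_matrix_vector_assoc[symmetric] matrix_vector_mult_add_rdistrib inner_add_right)
qed

text \<open>For the gradient of a field this is minus the curl.\<close>

definition axial :: "mat3 \<Rightarrow> pt"
  where "axial D = vector [D $ 2 $ 3 - D $ 3 $ 2, D $ 3 $ 1 - D $ 1 $ 3, D $ 1 $ 2 - D $ 2 $ 1]"

lemma axial_outer: "axial (outer a n) = cross3 a n"
  by (simp add: axial_def outer_def vec_eq_iff forall_3 cross_components)

context mesh
begin

lemma subspace_pw_linear: "subspace (pw_linear K)"
proof -
  have "(0 :: pt \<Rightarrow> 'a) \<in> pw_linear K"
  proof -
    have "linear (\<lambda>x :: pt. 0 :: 'a)" by (rule linearI) simp_all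
    then have "\<exists>A b. linear A \<and> (\<forall>x\<in>T. (0 :: pt \<Rightarrow> 'a) x = A x + b)" for T
      by (intro exI[of _ "\<lambda>x. 0"] exI[of _ 0] conjI) simp_all
    moreover have "continuous_on UNIV (0 :: pt \<Rightarrow> 'a)" unfolding zero_fun_def by (rule continuous_on_const)
    ultimately show ?thesis by (simp add: pw_linear_def periodic_def)
  qed
  then show ?thesis by (simp add: subspace_def pw_linear_add pw_linear_scaleR)
qed

lemma pw_linear_periodic: "u \<in> pw_linear K \<Longrightarrow> periodic u"
  by (simp add: pw_linear_def)

lemma pw_linear_tets:
  assumes u: "u \<in> pw_linear K" and T: "T \<in> tets K"
  shows "\<exists>A b. linear A \<and> (\<forall>x\<in>T. u x = A x + b)"
  using T
proof (rule tets_cases)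
  fix k S assume S: "k \<in> int_lattice" "S \<in> K" "T = (+) k ` S"
  then obtain A b where A: "linear A" "\<forall>x\<in>S. u x = A x + b" using u unfolding pw_linear_def by blast
  have "u (k + x) = A (k + x) + (b - A k)" if "x \<in> S" for x
    using A that periodic_add[OF pw_linear_periodic[OF u] S(1)] by (simp add: linear_add)
  then show ?thesis unfolding S(3) using A(1) by blast
qed

lemma tet_vertex_torus:
  assumes T: "T \<in> tets K" and v: "v \<in> vertices_of T"
  shows "torus_pt v \<in> mesh_vertices K" "{v} \<in> subsimps K 0"
proof -
  have "{v} face_of T" using v by (simp add: vertices_of_def face_of_singleton)
  then show 0: "{v} \<in> subsimps K 0" using T by (auto simp: subsimps_def)
  have "(+) (torus_pt v - v) ` {v} \<in> subsimps K 0" by (rule subsimps_translation[OF 0 torus_pt_diff_lattice])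
  then show "torus_pt v \<in> mesh_vertices K" by (simp add: mesh_vertices_def)
qed

lemma finite_mesh_vertices: "finite (mesh_vertices K)"
proof -
  have "finite {S \<in> subsimps K 0. S \<inter> cube \<noteq> {}}" by (rule subsimps_locally_finite) (simp add: cube_def)
  moreover have "(\<lambda>y. {y}) ` mesh_vertices K \<subseteq> {S \<in> subsimps K 0. S \<inter> cube \<noteq> {}}"
  proof
    fix S assume "S \<in> (\<lambda>y. {y}) ` mesh_vertices K"
    then obtain y where y: "S = {y}" "{y} \<in> subsimps K 0" "torus_pt y = y" by (auto simp: mesh_vertices_def)
    then show "S \<in> {S \<in> subsimps K 0. S \<inter> cube \<noteq> {}}" using torus_pt_in_cube[of y] by simp
  qed
  ultimately have "finite ((\<lambda>y. {y}) ` mesh_vertices K)" by (rule finite_subset[rotated])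
  then show ?thesis by (rule finite_imageD) (simp add: inj_on_def)
qed

lemma mesh_vertex_tet:
  assumes "y \<in> mesh_vertices K"
  obtains T where "T \<in> tets K" "y \<in> vertices_of T" "torus_pt y = y"
  using assms that unfolding mesh_vertices_def subsimps_def by (auto simp: face_of_singleton vertices_of_def)

lemma pw_linear_eqI:
  assumes u: "u \<in> pw_linear K" "w \<in> pw_linear K" and eq: "\<And>y. y \<in> mesh_vertices K \<Longrightarrow> u y = w y"
  shows "u = w"
proof
  fix x
  obtain T where T: "T \<in> tets K" "x \<in> T" using tets_cover by blast
  obtain A a where A: "linear A" "\<forall>x\<in>T. u x = A x + a" using pw_linear_tets[OF u(1) T(1)] by blast
  obtain B b where B: "linear B" "\<forall>x\<in>T. w x = B x + b" using pw_linear_tets[OF u(2) T(1)] by blast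
  have V: "T = convex hull (vertices_of T)" using simplex_hull_vertices[OF tets_simplex[OF T(1)]] .
  have "A v + a = B v + b" if v: "v \<in> vertices_of T" for v
  proof -
    have "v \<in> T" using v V hull_inc by metis
    moreover have "u v = w v"
      using eq[OF tet_vertex_torus(1)[OF T(1) v]] periodic_torus_pt[OF pw_linear_periodic[OF u(1)]]
        periodic_torus_pt[OF pw_linear_periodic[OF u(2)]] by simp
    ultimately show ?thesis using A B by simp
  qed
  then have "A x + a = B x + b" using affine_maps_agree[OF A(1) B(1), of "vertices_of T"] T(2) V by blast
  then show "u x = w x" using A B T(2) by simp
qed

text \<open>Vertex values on the torus are interpolated by affine maps on the lifted tetrahedra. They match
  on common faces because these are spanned by common vertices.\<close>

lemma pw_linear_exists:
  fixes g :: "pt \<Rightarrow> 'a::real_normed_vector"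
  shows "\<exists>u\<in>pw_linear K. \<forall>y\<in>mesh_vertices K. u y = g y"
proof -
  define L where "L T = (SOME (A, b). linear A \<and> (\<forall>v\<in>vertices_of T. A v + b = g (torus_pt v)))" for T
  define ap :: "(pt \<Rightarrow> 'a) \<times> 'a \<Rightarrow> pt \<Rightarrow> 'a" where "ap h x = fst h x + snd h" for h x
  have L: "linear (fst (L T)) \<and> (\<forall>v\<in>vertices_of T. ap (L T) v = g (torus_pt v))" if T: "T \<in> tets K" for T
  proof -
    have "\<exists>h. (case h of (A, b) \<Rightarrow> linear A \<and> (\<forall>v\<in>vertices_of T. A v + b = g (torus_pt v)))"
      using affine_map_exists[OF tets_simplex[OF T], of "\<lambda>v. g (torus_pt v)"] by auto
    from someI_ex[OF this] show ?thesis unfolding L_def[symmetric] ap_def by (simp add: case_prod_beta)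
  qed
  define u where "u x = ap (L (SOME T. T \<in> tets K \<and> x \<in> T)) x" for x
  have agree: "ap (L T) x = ap (L T') x" if T: "T \<in> tets K" "T' \<in> tets K" "x \<in> T" "x \<in> T'" for T T' x
  proof -
    let ?S = "T \<inter> T'"
    have f: "?S face_of T" "?S face_of T'"
      using tets_face_of[OF T(1,2)] tets_face_of[OF T(2,1)] by (simp_all add: Int_commute)
    obtain C where C: "\<not> affine_dependent C" "T = convex hull C"
      using tets_simplex[OF T(1)] by (auto simp: simplex_def)
    obtain c where c: "c \<subseteq> C" "?S = convex hull c"
      using face_of_convex_hull_affine_independent[OF C(1)] f(1) C(2) by auto
    have "\<not> affine_dependent c" using C(1) c(1) affine_dependent_subset by blast
    then have "vertices_of ?S = c" using simplex_vertices_of c(2) by simp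
    then have "c \<subseteq> vertices_of T" "c \<subseteq> vertices_of T'" using vertices_of_face f by blast+
    then have "ap (L T) v = ap (L T') v" if "v \<in> c" for v using L[OF T(1)] L[OF T(2)] that by (metis subsetD)
    then show ?thesis unfolding ap_def
      using affine_maps_agree[of "fst (L T)" "fst (L T')" c] L[OF T(1)] L[OF T(2)] T(3,4) c(2) by (metis IntI)
  qed
  have u: "u x = ap (L T) x" if T: "T \<in> tets K" "x \<in> T" for T x
  proof -
    have "\<exists>T. T \<in> tets K \<and> x \<in> T" using T by blast
    from someI_ex[OF this] show ?thesis unfolding u_def using agree T by blast
  qed
  have per: "periodic u"
    unfolding periodic_def
  proof (intro ballI allI)
    fix k x assume k: "k \<in> int_lattice"
    obtain T where T: "T \<in> tets K" "x \<in> T" using tets_cover by blast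
    let ?T = "(+) k ` T"
    have T': "?T \<in> tets K" "x + k \<in> ?T" using tets_translation[OF T(1) k] T(2) by (auto simp: add.commute)
    define B where "B = fst (L ?T)"
    have B: "linear B" using L[OF T'(1)] by (simp add: B_def)
    have "ap (L T) v = B v + (B k + snd (L ?T))" if v: "v \<in> vertices_of T" for v
    proof -
      have "k + v \<in> vertices_of ?T"
        using v face_of_translation_eq[of k "{v}" T] by (simp add: vertices_of_def face_of_singleton[symmetric])
      then have "ap (L ?T) (k + v) = g (torus_pt (k + v))" using L[OF T'(1)] by blast
      also have "torus_pt (k + v) = torus_pt v" using torus_pt_add[OF k, of v] by (simp add: add.commute)
      also have "g (torus_pt v) = ap (L T) v" using L[OF T(1)] v by simp
      finally have e: "ap (L ?T) (k + v) = ap (L T) v" .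
      show ?thesis unfolding e[symmetric] unfolding ap_def B_def[symmetric] linear_add[OF B]
        by (simp only: add.assoc add.left_commute)
    qed
    then have vx: "fst (L T) v + snd (L T) = B v + (B k + snd (L ?T))" if "v \<in> vertices_of T" for v
      using that by (simp add: ap_def)
    have xin: "x \<in> convex hull (vertices_of T)"
      using T(2) simplex_hull_vertices[OF tets_simplex[OF T(1)]] by blast
    have "ap (L T) x = B x + (B k + snd (L ?T))"
      unfolding ap_def by (rule affine_maps_agree[OF conjunct1[OF L[OF T(1)]] B vx xin])
    also have "\<dots> = ap (L ?T) (x + k)" by (simp add: ap_def B_def[symmetric] linear_add[OF B] add_ac)
    finally show "u (x + k) = u x" using u[OF T] u[OF T'] by simp
  qed
  have cT: "continuous_on T u" if T: "T \<in> tets K" for T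
  proof -
    have "continuous_on T (ap (L T))" unfolding ap_def
      using L[OF T] by (intro continuous_intros) (simp add: linear_continuous_on linear_conv_bounded_linear)
    then show ?thesis using u[OF T] by (simp cong: continuous_on_cong)
  qed
  have "isCont u x" for x
  proof -
    let ?A = "{T \<in> tets K. T \<inter> cball x 1 \<noteq> {}}"
    have "finite ?A" by (rule tets_locally_finite) simp
    then have "continuous_on (\<Union>T\<in>?A. T) u"
      using cT tets_compact compact_imp_closed by (intro continuous_on_closed_Union) auto
    moreover have "ball x 1 \<subseteq> (\<Union>T\<in>?A. T)"
    proof
      fix y assume "y \<in> ball x 1"
      moreover obtain T where "T \<in> tets K" "y \<in> T" using tets_cover by blast
      ultimately show "y \<in> (\<Union>T\<in>?A. T)" by force
    qed
    ultimately have "continuous_on (ball x 1) u" using continuous_on_subset by blast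
    then show ?thesis by (simp add: continuous_on_eq_continuous_at)
  qed
  then have "continuous_on UNIV u" by (simp add: continuous_on_eq_continuous_at)
  moreover have "\<exists>A b. linear A \<and> (\<forall>x\<in>T. u x = A x + b)" if T: "T \<in> K" for T
    using L[OF K_tets[OF T]] u[OF K_tets[OF T]] unfolding ap_def by blast
  ultimately have "u \<in> pw_linear K" using per by (simp add: pw_linear_def)
  moreover have "u y = g y" if y: "y \<in> mesh_vertices K" for y
  proof -
    obtain T where T: "T \<in> tets K" "y \<in> vertices_of T" "torus_pt y = y" by (rule mesh_vertex_tet[OF y])
    have "y \<in> T" using T(2) by (simp add: vertices_of_def extreme_point_of_def)
    then show ?thesis using u[OF T(1)] L[OF T(1)] T(2,3) by simp
  qed
  ultimately show ?thesis by blast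
qed

lemma hat_props:
  assumes y: "y \<in> mesh_vertices K"
  shows "hat K y \<in> pw_linear K" "\<And>z. z \<in> mesh_vertices K \<Longrightarrow> hat K y z = (if z = y then 1 else 0)"
proof -
  let ?P = "\<lambda>f. f \<in> pw_linear K \<and> f y = 1 \<and> (\<forall>z\<in>mesh_vertices K. z \<noteq> y \<longrightarrow> f z = (0::real))"
  obtain f where f: "f \<in> pw_linear K" "\<forall>z\<in>mesh_vertices K. f z = (if z = y then 1 else 0 :: real)"
    using pw_linear_exists[of "\<lambda>z. if z = y then 1 else 0"] by blast
  then have P: "?P f" using y by simp
  have "h = f" if "?P h" for h
    by (rule pw_linear_eqI) (use that f in auto)
  then have "hat K y = f" unfolding hat_def using P by (intro the_equality) blast+
  then show "hat K y \<in> pw_linear K" "\<And>z. z \<in> mesh_vertices K \<Longrightarrow> hat K y z = (if z = y then 1 else 0)"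
    using f by auto
qed

subsection \<open>The symmetric gradient\<close>

lemma matrix_eq_on_tet:
  assumes T: "3 simplex T" and D: "\<forall>x\<in>T. (D :: mat3) *v x + b = D' *v x + b'"
  shows "D = D'"
proof -
  obtain p q r s where t: "T = convex hull {p, q, r, s}" "vol p q r s \<noteq> 0" using tet_ex[OF T] by blast
  have e: "D *v x + b = D' *v x + b'" if "x \<in> {p, q, r, s}" for x using D that t(1) hull_inc by metis
  have d: "(D - D') *v (x - p) = 0" if "x \<in> {p, q, r, s}" for x
  proof -
    have "(D - D') *v (x - p) = (D *v x + b - (D' *v x + b')) - (D *v p + b - (D' *v p + b'))"
      by (simp add: matrix_vector_mult_diff_rdistrib matrix_vector_mult_diff_distrib)
    then show ?thesis using e[OF that] e[of p] by simp
  qed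
  have "(D - D') *v x = 0" for x
  proof -
    have "vol p q r s *\<^sub>R ((D - D') *v x) = (D - D') *v (vol p q r s *\<^sub>R x)" by (simp add: matrix_vector_mult_scaleR)
    also have "\<dots> = 0" unfolding vol_def cramer[symmetric, where x = x]
      using d by (simp add: matrix_vector_right_distrib matrix_vector_mult_scaleR)
    finally show ?thesis using t(2) by simp
  qed
  then show ?thesis by (simp add: matrix_eq matrix_vector_mult_diff_rdistrib)
qed

lemma tet_grad_eq:
  assumes T: "T \<in> tets K" and D: "\<forall>x\<in>T. u x = D *v x + b"
  shows "tet_grad u T = D"
  unfolding tet_grad_def
proof (rule the_equality)
  fix D' assume "\<exists>b'. \<forall>x\<in>T. u x = D' *v x + b'"
  then obtain b' where "\<forall>x\<in>T. u x = D' *v x + b'" by blast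
  then show "D' = D" using D by (intro matrix_eq_on_tet[OF tets_simplex[OF T], of D' b' D b]) simp
qed (use D in blast)

lemma tet_grad:
  assumes u: "u \<in> X0 K" and T: "T \<in> tets K"
  shows "\<exists>b. \<forall>x\<in>T. u x = tet_grad u T *v x + b"
proof -
  obtain A b where A: "linear A" "\<forall>x\<in>T. u x = A x + b" using pw_linear_tets u T unfolding X0_def by blast
  then have D: "\<forall>x\<in>T. u x = matrix A *v x + b" by (simp add: matrix_works linear_matrix_vector_mul_eq)
  then show ?thesis unfolding tet_grad_eq[OF T D] by blast
qed

lemma tet_grad_diff:
  assumes u: "u \<in> X0 K" and T: "T \<in> tets K" "x \<in> T" "z \<in> T"
  shows "tet_grad u T *v (z - x) = u z - u x"
  using tet_grad[OF u T(1)] T(2,3) by (auto simp: matrix_vector_mult_diff_distrib)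

lemma tet_grad_translation:
  assumes u: "u \<in> X0 K" and T: "T \<in> tets K" and k: "k \<in> int_lattice"
  shows "tet_grad u ((+) k ` T) = tet_grad u T"
proof -
  obtain b where b: "\<forall>x\<in>T. u x = tet_grad u T *v x + b" using tet_grad[OF u T] by blast
  have per: "periodic u" using u pw_linear_periodic by (simp add: X0_def)
  have "\<forall>x\<in>(+) k ` T. u x = tet_grad u T *v x + (b - tet_grad u T *v k)"
    using b periodic_add[OF per k] by (auto simp: matrix_vector_right_distrib)
  then show ?thesis by (rule tet_grad_eq[OF tets_translation[OF T k]])
qed

text \<open>The form of the gradient on an edge vector is determined by the values of the field at the end
  points, which makes it single-valued.\<close>

lemma sym_part_regge:
  assumes u: "u \<in> X0 K"
  shows "(\<lambda>T. sym_part (tet_grad u T)) \<in> regge K"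
proof (rule reggeI, goal_cases)
  case (1 T) show ?case by (simp add: sym_part_def transpose_def vec_eq_iff)
next
  case (2 T k) then show ?case by (simp add: tet_grad_translation[OF u])
next
  case (3 T T' x z)
  have "x \<in> T" "z \<in> T" "x \<in> T'" "z \<in> T'" using 3 face_of_imp_subset by fastforce+
  then show ?case using 3 by (simp add: edge_form_sym_part tet_grad_diff[OF u])
qed

lemma eps_step_field:
  assumes u: "u \<in> X0 K"
  shows "eps u = step_field K (\<lambda>T. sym_part (tet_grad u T))"
proof (rule field_eqI)
  fix T assume T: "T \<in> K"
  have "AE x in lebesgue. x \<notin> frontier T"
    using negligible_frontier_K[OF T] by (simp add: AE_not_in negligible_iff_null_sets)
  then show "const_on (eps u) T (sym_part (tet_grad u T))"
    unfolding eps_def const_on_class_of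
  proof eventually_elim
    case (elim x)
    show ?case
    proof
      assume "x \<in> cube \<and> x \<in> T"
      then have x: "x \<in> interior T" using elim by (simp add: frontier_def closure_subset[THEN subsetD])
      obtain b where b: "\<forall>x\<in>T. u x = tet_grad u T *v x + b" using tet_grad[OF u K_tets[OF T]] by blast
      have "((\<lambda>x. tet_grad u T *v x + b) has_derivative (\<lambda>w. tet_grad u T *v w)) (at x)"
        by (auto intro!: derivative_eq_intros bounded_linear_imp_has_derivative simp: matrix_vector_mul_bounded_linear)
      then have "(u has_derivative (\<lambda>w. tet_grad u T *v w)) (at x)"
        by (rule has_derivative_transform_within_open[OF _ open_interior x]) (use b interior_subset[of T] in force)
      then have "frechet_derivative u (at x) = (\<lambda>w. tet_grad u T *v w)" by (rule frechet_derivative_at[symmetric])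
      then show "(let D = matrix (frechet_derivative u (at x)) in (1/2) *\<^sub>R (D + transpose D)) = sym_part (tet_grad u T)"
        by (simp add: sym_part_def Let_def)
    qed
  qed
next
  fix T assume T: "T \<in> K"
  show "const_on (step_field K (\<lambda>T. sym_part (tet_grad u T))) T (sym_part (tet_grad u T))"
    by (rule const_on_step_field[OF T])
qed

lemma eps_X1:
  assumes u: "u \<in> X0 K"
  shows "eps u \<in> X1 K" "\<And>T. T \<in> tets K \<Longrightarrow> val K (eps u) T = sym_part (tet_grad u T)"
  unfolding eps_step_field[OF u] using regge_step_field[OF sym_part_regge[OF u]] by auto

lemma linear_on_eps: "linear_on (X0 K) eps"
  unfolding linear_on_def
proof (intro conjI ballI allI)
  fix u w assume u: "u \<in> X0 K" and w: "w \<in> X0 K"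
  have uw: "u + w \<in> X0 K" using pw_linear_add u w by (simp add: X0_def)
  have g: "tet_grad (u + w) T = tet_grad u T + tet_grad w T" if T: "T \<in> tets K" for T
  proof -
    obtain a b where "\<forall>x\<in>T. u x = tet_grad u T *v x + a" "\<forall>x\<in>T. w x = tet_grad w T *v x + b"
      using tet_grad[OF u T] tet_grad[OF w T] by blast
    then have "\<forall>x\<in>T. (u + w) x = (tet_grad u T + tet_grad w T) *v x + (a + b)"
      by (simp add: matrix_vector_mult_add_rdistrib)
    then show ?thesis by (rule tet_grad_eq[OF T])
  qed
  show "eps (u + w) = eps u + eps w"
  proof (rule X1_eqI[OF eps_X1(1)[OF uw] X1_add(1)[OF eps_X1(1)[OF u] eps_X1(1)[OF w]]])
    fix T assume "T \<in> K"
    then have T: "T \<in> tets K" by (rule K_tets)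
    show "val K (eps (u + w)) T = val K (eps u + eps w) T"
      using eps_X1(2)[OF uw T] X1_add(2)[OF eps_X1(1)[OF u] eps_X1(1)[OF w] T] eps_X1(2)[OF u T] eps_X1(2)[OF w T] g[OF T]
      by (simp add: sym_part_def transpose_add scaleR_add_right)
  qed
next
  fix c u assume u: "u \<in> X0 K"
  have cu: "c *\<^sub>R u \<in> X0 K" using pw_linear_scaleR u by (simp add: X0_def)
  have g: "tet_grad (c *\<^sub>R u) T = c *\<^sub>R tet_grad u T" if T: "T \<in> tets K" for T
  proof -
    obtain a where "\<forall>x\<in>T. u x = tet_grad u T *v x + a" using tet_grad[OF u T] by blast
    then have "\<forall>x\<in>T. (c *\<^sub>R u) x = (c *\<^sub>R tet_grad u T) *v x + c *\<^sub>R a"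
      by (simp add: scaleR_fun_def scaleR_add_right scaleR_matrix_vector_assoc)
    then show ?thesis by (rule tet_grad_eq[OF T])
  qed
  show "eps (c *\<^sub>R u) = c *\<^sub>R eps u"
  proof (rule X1_eqI[OF eps_X1(1)[OF cu] X1_scaleR(1)[OF eps_X1(1)[OF u]]])
    fix T assume "T \<in> K"
    then have T: "T \<in> tets K" by (rule K_tets)
    show "val K (eps (c *\<^sub>R u)) T = val K (c *\<^sub>R eps u) T"
      using eps_X1(2)[OF cu T] X1_scaleR(2)[OF eps_X1(1)[OF u] T] eps_X1(2)[OF u T] g[OF T]
      by (simp add: sym_part_def transpose_scaleR scaleR_add_right)
  qed
qed

lemma edge_moment_eps:
  assumes u: "u \<in> X0 K" and e: "e \<in> edges K"
  shows "edge_moment K (eps u) e = tangent e \<bullet> (u (head e) - u (tail e))"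
proof -
  obtain x z where xz: "e = (x, z)" by force
  have E: "x \<noteq> z" "closed_segment x z \<in> subsimps K 1" using e by (auto simp: xz edges_iff)
  obtain T where T: "T \<in> tets K" "closed_segment x z face_of T" using edge_face_tet[OF E(2)] by blast
  have xT: "x \<in> T" "z \<in> T" using face_of_imp_subset[OF T(2)] by auto
  have per: "periodic u" using u pw_linear_periodic by (simp add: X0_def)
  have "edge_moment K (eps u) e = (z - x) \<bullet> (u z - u x) / norm (z - x)"
    using edge_moment_eq[OF eps_X1(1)[OF u] _ T] e eps_X1(2)[OF u T(1)] tet_grad_diff[OF u T(1) xT]
    by (simp add: xz edge_form_sym_part)
  also have "\<dots> = tangent e \<bullet> (u (head e) - u (tail e))"
    by (simp add: xz tangent_def head_def tail_def periodic_torus_pt[OF per] sgn_div_norm divide_inverse)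
  finally show ?thesis .
qed

text \<open>The jump of the gradient vanishes on tangent vectors of the triangle by continuity, hence equals
  \<open>a n\<^sup>T\<close>. With \<open>m = n \<times> t\<close> the summand \<open>m \<bullet> sym(a n\<^sup>T) n\<close> is half of \<open>t \<bullet> (a \<times> n)\<close>, and \<open>a \<times> n\<close> is a linear
  function of the matrix \<open>a n\<^sup>T\<close>; so the summands telescope.\<close>

lemma jump_eps:
  assumes u: "u \<in> X0 K" and xz: "x \<noteq> z"
  shows "jump K (eps u) (x, z) = 0"
proof -
  let ?S = "tri_star (closed_segment x z)" and ?n = "n_vec (x, z)"
  define t where "t = tangent (x, z)"
  let ?D = "\<lambda>F. tet_grad u (adj_tet K F x (?n F)) - tet_grad u (adj_tet K F x (- ?n F))"
  have A: "m_vec (x, z) F \<bullet> (face_jump K (eps u) (x, z) F *v ?n F) = (1/2) * (t \<bullet> axial (?D F))" if F: "F \<in> ?S" for F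
  proof -
    obtain r where r: "F = convex hull {x, z, r}" "nrm3 x z r \<noteq> 0" "?n F = sgn (nrm3 x z r)"
      "m_vec (x, z) F = cross3 (?n F) (tangent (x, z))"
      and n: "?n F \<bullet> (z - x) = 0" "?n F \<bullet> (r - x) = 0" "?n F \<noteq> 0" and n1: "norm (?n F) = 1"
      by (rule tri_star_frame[OF xz F])
    have F2: "F \<in> subsimps K 2" using F by simp
    have n': "- ?n F \<bullet> (z - x) = 0" "- ?n F \<bullet> (r - x) = 0" "- ?n F \<noteq> 0" using n by simp_all
    note P = adj_tet_props[OF F2 r(1,2) n] and M = adj_tet_props[OF F2 r(1,2) n']
    let ?N = "nrm3 x z r"
    have V: "x \<in> F" "z \<in> F" "r \<in> F" unfolding r(1) by (auto intro: hull_inc)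
    have D0: "?D F *v (y - x) = 0" if "y \<in> F" for y
    proof -
      have "x \<in> adj_tet K F x (?n F)" "y \<in> adj_tet K F x (?n F)" "x \<in> adj_tet K F x (- ?n F)" "y \<in> adj_tet K F x (- ?n F)"
        using that V(1) face_of_imp_subset[OF P(2)] face_of_imp_subset[OF M(2)] by blast+
      then show ?thesis
        by (simp add: matrix_vector_mult_diff_rdistrib tet_grad_diff[OF u P(1)] tet_grad_diff[OF u M(1)])
    qed
    have nn: "?n F \<bullet> ?n F = 1" using n1 by (simp add: dot_square_norm)
    have NN: "?N = norm ?N *\<^sub>R ?n F" using r(2,3) by (simp add: sgn_div_norm)
    define a where "a = ?D F *v ?n F"
    have Dy: "?D F *v y = (?n F \<bullet> y) *\<^sub>R a" for y
    proof -
      have "(?N \<bullet> ?N) *\<^sub>R (?D F *v y) = ?D F *v ((?N \<bullet> ?N) *\<^sub>R y)" by (simp add: matrix_vector_mult_scaleR)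
      also have "(?N \<bullet> ?N) *\<^sub>R y = (y \<bullet> cross3 (r - x) ?N) *\<^sub>R (z - x) + (y \<bullet> cross3 ?N (z - x)) *\<^sub>R (r - x) + (y \<bullet> ?N) *\<^sub>R ?N"
        using cramer[of y "r - x" ?N "z - x"] by simp
      also have "?D F *v \<dots> = (y \<bullet> ?N) *\<^sub>R (?D F *v ?N)"
        using D0[OF V(2)] D0[OF V(3)] by (simp only: matrix_vector_right_distrib matrix_vector_mult_scaleR) simp
      also have "\<dots> = (y \<bullet> (norm ?N *\<^sub>R ?n F)) *\<^sub>R (?D F *v (norm ?N *\<^sub>R ?n F))" using NN by metis
      also have "\<dots> = (?N \<bullet> ?N) *\<^sub>R ((?n F \<bullet> y) *\<^sub>R a)"
        by (simp add: a_def matrix_vector_mult_scaleR dot_square_norm power2_eq_square inner_commute mult_ac)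
      finally show ?thesis by (rule scaleR_left_imp_eq[rotated]) (use r(2) in simp)
    qed
    then have Do: "?D F = outer a (?n F)" by (simp add: matrix_eq outer_mult)
    have mv: "m_vec (x, z) F = cross3 (?n F) t" using r(4) by (simp add: t_def)
    have jf: "face_jump K (eps u) (x, z) F = sym_part (?D F)"
      unfolding face_jump_def fst_conv eps_X1(2)[OF u P(1)] eps_X1(2)[OF u M(1)]
      by (simp add: sym_part_def transpose_def vec_eq_iff field_simps)
    have "sym_part (outer a (?n F)) *v ?n F = (1/2) *\<^sub>R (a + (a \<bullet> ?n F) *\<^sub>R ?n F)"
      unfolding sym_part_def transpose_outer scaleR_matrix_vector_assoc[symmetric] matrix_vector_mult_add_rdistrib outer_mult nn
      by simp
    then have "m_vec (x, z) F \<bullet> (face_jump K (eps u) (x, z) F *v ?n F) = (1/2) * (cross3 (?n F) t \<bullet> a)"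
      unfolding jf Do mv by (simp add: inner_add_right dot_cross_self)
    also have "cross3 (?n F) t \<bullet> a = t \<bullet> cross3 a (?n F)"
      by (simp add: cross_components inner_vec_def sum_3 algebra_simps)
    finally show ?thesis unfolding Do axial_outer .
  qed
  have "jump K (eps u) (x, z) = (\<Sum>F\<in>?S. (1/2) * (t \<bullet> axial (?D F)))"
    unfolding jump_def seg_def fst_conv snd_conv by (rule sum.cong[OF refl A])
  also have "\<dots> = (1/2) * (t \<bullet> axial (\<Sum>F\<in>?S. ?D F))"
  proof -
    have "linear (\<lambda>D. (1/2) * (t \<bullet> axial D))"
      by (rule linearI) (simp_all add: axial_def inner_vec_def sum_3 algebra_simps)
    then show ?thesis by (rule linear_sum[symmetric])
  qed
  also have "(\<Sum>F\<in>?S. ?D F) = 0" by (rule telescoping[OF xz])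
  also have "axial 0 = 0" by (simp add: axial_def vec_eq_iff forall_3)
  finally show ?thesis by simp
qed

end

section \<open>Trigonometric test fields\<close>

text \<open>An algebra of periodic functions that is closed under partial derivatives. The phase shift makes it
  contain the cosines.\<close>

inductive trig :: "(pt \<Rightarrow> real) \<Rightarrow> bool" where
  trig_const: "trig (\<lambda>x. c)"
| trig_sin: "trig (\<lambda>x. sin (2 * pi * x $ i + c))"
| trig_add: "trig f \<Longrightarrow> trig g \<Longrightarrow> trig (\<lambda>x. f x + g x)"
| trig_mult: "trig f \<Longrightarrow> trig g \<Longrightarrow> trig (\<lambda>x. f x * g x)"

lemma partial_has_derivative: "(f has_derivative D) (at x) \<Longrightarrow> partial i f x = D (axis i 1)"
  unfolding partial_def using frechet_derivative_at[of f D x] by simp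

lemma partial_const: "partial i (\<lambda>x. c) = (\<lambda>x. 0)"
  by (rule ext) (rule partial_has_derivative[OF has_derivative_const])

lemma partial_add:
  assumes "f differentiable (at x)" "g differentiable (at x)"
  shows "partial i (\<lambda>x. f x + g x) x = partial i f x + partial i g x"
  unfolding partial_def[of i f] partial_def[of i g]
  by (rule partial_has_derivative) (use assms in \<open>auto intro!: has_derivative_add simp: frechet_derivative_works\<close>)

lemma partial_mult:
  fixes f g :: "pt \<Rightarrow> real"
  assumes "f differentiable (at x)" "g differentiable (at x)"
  shows "partial i (\<lambda>x. f x * g x) x = f x * partial i g x + partial i f x * g x"
  unfolding partial_def[of i f] partial_def[of i g]
  by (rule partial_has_derivative) (use assms in \<open>auto intro!: has_derivative_mult simp: frechet_derivative_works\<close>)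

lemma sin_coordinate_derivative:
  "((\<lambda>x :: pt. sin (2 * pi * x $ i + c)) has_derivative (\<lambda>w. 2 * pi * w $ i * cos (2 * pi * x $ i + c))) (at x)"
  by (auto intro!: derivative_eq_intros bounded_linear_imp_has_derivative bounded_linear_vec_nth simp: mult_ac)

lemma trig_differentiable: "trig f \<Longrightarrow> f differentiable (at x)"
proof (induction rule: trig.induct)
  case (trig_sin i c)
  then show ?case using sin_coordinate_derivative by (auto simp: differentiable_def)
qed (auto intro: differentiable_add differentiable_mult)

lemma partial_sin_coordinate:
  "partial j (\<lambda>x. sin (2 * pi * x $ i + c)) = (\<lambda>x. (if i = j then 2 * pi else 0) * sin (2 * pi * x $ i + (c + pi / 2)))"
proof
  fix x :: pt
  have "sin (2 * pi * x $ i + (c + pi / 2)) = cos (2 * pi * x $ i + c)"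
    using sin_add[of "2 * pi * x $ i + c" "pi / 2"] by (simp add: add.assoc)
  then show "partial j (\<lambda>x. sin (2 * pi * x $ i + c)) x = (if i = j then 2 * pi else 0) * sin (2 * pi * x $ i + (c + pi / 2))"
    using partial_has_derivative[OF sin_coordinate_derivative[of i c x], of j] by (simp add: axis_def)
qed

lemma partial_add_trig: "trig f \<Longrightarrow> trig g \<Longrightarrow> partial i (\<lambda>x. f x + g x) = (\<lambda>x. partial i f x + partial i g x)"
  using partial_add[OF trig_differentiable trig_differentiable] by blast

lemma partial_mult_trig: "trig f \<Longrightarrow> trig g \<Longrightarrow> partial i (\<lambda>x. f x * g x) = (\<lambda>x. f x * partial i g x + partial i f x * g x)"
  using partial_mult[OF trig_differentiable trig_differentiable] by blast

lemma trig_partial: "trig f \<Longrightarrow> trig (partial i f)"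
proof (induction rule: trig.induct)
  case (trig_const c) then show ?case by (simp add: partial_const trig.trig_const)
next
  case (trig_sin k c) then show ?case unfolding partial_sin_coordinate by (intro trig.intros)
next
  case (trig_add f g) then show ?case by (simp add: partial_add_trig trig.trig_add)
next
  case (trig_mult f g) then show ?case by (simp add: partial_mult_trig trig.trig_add trig.trig_mult)
qed

lemma trig_partial_commute: "trig f \<Longrightarrow> partial i (partial j f) = partial j (partial i f)"
proof (induction rule: trig.induct)
  case (trig_const c) then show ?case by (simp add: partial_const)
next
  case (trig_sin k c)
  have "partial a (partial b (\<lambda>x. sin (2 * pi * x $ k + c))) = (\<lambda>x. ((if k = a then 2 * pi else 0) * (if k = b then 2 * pi else 0)) * sin (2 * pi * x $ k + (c + pi / 2 + pi / 2)))" for a b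
    unfolding partial_sin_coordinate[of b] by (subst partial_mult_trig[OF trig.trig_const trig.trig_sin])
      (simp add: partial_const partial_sin_coordinate fun_eq_iff)
  then show ?case by simp
next
  case (trig_add f g)
  then show ?case by (simp add: partial_add_trig trig_partial)
next
  case (trig_mult f g)
  have "partial a (partial b (\<lambda>x. f x * g x)) = (\<lambda>x. f x * partial a (partial b g) x + partial a f x * partial b g x
    + (partial b f x * partial a g x + partial a (partial b f) x * g x))" for a b
    using trig_mult by (simp add: partial_mult_trig partial_add_trig trig_partial trig.intros)
  then show ?case using trig_mult by (simp add: fun_eq_iff)
qed

lemma trig_periodic: "trig f \<Longrightarrow> periodic f"
proof (induction rule: trig.induct)
  case (trig_sin i c)
  show ?case unfolding periodic_def
  proof (intro ballI allI)
    fix k x :: pt assume "k \<in> int_lattice"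
    then obtain n :: int where n: "k $ i = of_int n" unfolding int_lattice_def by (auto elim: Ints_cases)
    have "2 * pi * (x + k) $ i + c = (2 * pi * x $ i + c) + of_int n * (2 * pi)" by (simp add: n algebra_simps)
    also have "sin \<dots> = sin (2 * pi * x $ i + c)"
    proof -
      have "sin (of_int n * (2 * pi)) = 0" "cos (of_int n * (2 * pi)) = 1"
        using sin_int_2pin[of n] cos_int_2pin[of n] by (simp_all add: mult_ac)
      then show ?thesis by (simp only: sin_add[of _ "of_int n * (2 * pi)"] mult_1_right mult_zero_right add_0_right)
    qed
    finally show "sin (2 * pi * (x + k) $ i + c) = sin (2 * pi * x $ i + c)" .
  qed
qed (auto simp: periodic_def)

lemma trig_continuous: "trig f \<Longrightarrow> continuous_on A f"
  using trig_differentiable differentiable_imp_continuous_within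
  by (metis continuous_at_imp_continuous_on)

lemma trig_C1: "trig f \<Longrightarrow> C1_field f"
  by (simp add: C1_field_def trig_differentiable trig_continuous trig_partial)

lemma trig_power: "trig f \<Longrightarrow> trig (\<lambda>x. f x ^ n)"
  by (induction n) (auto intro: trig.intros)

text \<open>Vector- and matrix-valued trigonometric polynomials; they supply all test fields.\<close>

inductive tfield :: "(pt \<Rightarrow> 'a::euclidean_space) \<Rightarrow> bool" where
  tfield_base: "trig f \<Longrightarrow> tfield (\<lambda>x. f x *\<^sub>R L)"
| tfield_add: "tfield f \<Longrightarrow> tfield g \<Longrightarrow> tfield (\<lambda>x. f x + g x)"

lemma tfield_differentiable: "tfield f \<Longrightarrow> f differentiable (at x)"
proof (induction rule: tfield.induct)
  case (tfield_base f L)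
  then show ?case by (intro partial_bounded_linear(1)[OF trig_differentiable bounded_linear_scaleR_left])
qed (auto intro: differentiable_add)

lemma partial_trig_scaleR: "trig f \<Longrightarrow> partial i (\<lambda>x. f x *\<^sub>R (L :: 'a::euclidean_space)) = (\<lambda>x. partial i f x *\<^sub>R L)"
  using partial_bounded_linear(2)[OF trig_differentiable bounded_linear_scaleR_left] by blast

lemma partial_add_tfield: "tfield f \<Longrightarrow> tfield g \<Longrightarrow> partial i (\<lambda>x. f x + g x) = (\<lambda>x. partial i f x + partial i g x)"
  using partial_add[OF tfield_differentiable tfield_differentiable] by blast

lemma tfield_partial: "tfield f \<Longrightarrow> tfield (partial i f)"
proof (induction rule: tfield.induct)
  case (tfield_base f L) then show ?case by (simp add: partial_trig_scaleR trig_partial tfield.tfield_base)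
next
  case (tfield_add f g) then show ?case by (simp add: partial_add_tfield tfield.tfield_add)
qed

lemma tfield_smooth:
  assumes "tfield f"
  shows "smooth f"
proof -
  have "tfield (foldr partial ks f)" for ks
    by (induction ks) (use assms in \<open>auto intro: tfield_partial\<close>)
  then show ?thesis unfolding smooth_def differentiable_on_def
    using tfield_differentiable differentiable_at_withinI by blast
qed

lemma tfield_periodic: "tfield f \<Longrightarrow> periodic f"
proof (induction rule: tfield.induct)
  case (tfield_base f L) then show ?case using trig_periodic[of f] by (simp add: periodic_def)
qed (simp add: periodic_def)

subsection \<open>Peaks\<close>

text \<open>The factors equal \<open>cos\<^sup>2(\<pi> (x\<^sub>i - p\<^sub>i))\<close>. The function takes values in the unit interval and is 1 exactly on the
  lattice translates of \<open>p\<close>, so its powers concentrate there.\<close>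

definition peak :: "pt \<Rightarrow> pt \<Rightarrow> real"
  where "peak p x = (\<Prod>i\<in>UNIV. 1/2 + 1/2 * sin (2 * pi * x $ i + (pi / 2 - 2 * pi * p $ i)))"

lemma trig_peak: "trig (peak p)"
proof -
  have "trig (\<lambda>x. (1/2 + 1/2 * sin (2 * pi * x $ 1 + (pi / 2 - 2 * pi * p $ 1))) *
    (1/2 + 1/2 * sin (2 * pi * x $ 2 + (pi / 2 - 2 * pi * p $ 2))) * (1/2 + 1/2 * sin (2 * pi * x $ 3 + (pi / 2 - 2 * pi * p $ 3))))"
    by (intro trig.intros)
  moreover have "peak p = (\<lambda>x. (1/2 + 1/2 * sin (2 * pi * x $ 1 + (pi / 2 - 2 * pi * p $ 1))) *
    (1/2 + 1/2 * sin (2 * pi * x $ 2 + (pi / 2 - 2 * pi * p $ 2))) * (1/2 + 1/2 * sin (2 * pi * x $ 3 + (pi / 2 - 2 * pi * p $ 3))))"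
    unfolding peak_def UNIV_3 by (simp add: fun_eq_iff mult.assoc)
  ultimately show ?thesis by simp
qed

lemma half_sin_bounds: "0 \<le> 1/2 + 1/2 * sin y" "1/2 + 1/2 * sin y \<le> 1" for y :: real
proof -
  have "-1 \<le> sin y" "sin y \<le> 1" by simp_all
  then show "0 \<le> 1/2 + 1/2 * sin y" "1/2 + 1/2 * sin y \<le> 1" by linarith+
qed

lemma peak_bounds: "0 \<le> peak p x" "peak p x \<le> 1"
  unfolding peak_def by (intro prod_nonneg prod_le_1 ballI conjI half_sin_bounds)+

lemma peak_eq_1_iff: "peak p x = 1 \<longleftrightarrow> x - p \<in> int_lattice"
proof -
  let ?h = "\<lambda>i. 1/2 + 1/2 * sin (2 * pi * x $ i + (pi / 2 - 2 * pi * p $ i))"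
  have h: "?h i = 1 \<longleftrightarrow> (x - p) $ i \<in> \<int>" for i
  proof -
    have "sin (2 * pi * x $ i + (pi / 2 - 2 * pi * p $ i)) = cos (2 * pi * (x $ i - p $ i))"
      by (subst sin_cos_eq) (simp add: algebra_simps cos_diff)
    then have "?h i = 1 \<longleftrightarrow> cos (2 * pi * (x $ i - p $ i)) = 1"
      by (simp only:) linarith
    also have "\<dots> \<longleftrightarrow> (\<exists>n::int. 2 * pi * (x $ i - p $ i) = of_int n * 2 * pi)" by (simp only: cos_one_2pi_int)
    also have "\<dots> \<longleftrightarrow> (\<exists>n::int. x $ i - p $ i = of_int n)"
    proof -
      have "real_of_int n * 2 * pi = 2 * pi * of_int n" for n by simp
      then show ?thesis by (simp only: mult_cancel_left) simp
    qed
    also have "\<dots> \<longleftrightarrow> (x - p) $ i \<in> \<int>" by (auto elim: Ints_cases)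
    finally show ?thesis .
  qed
  have "peak p x = 1 \<longleftrightarrow> (\<forall>i. ?h i = 1)"
  proof
    assume 1: "peak p x = 1"
    show "\<forall>i. ?h i = 1"
    proof
      fix i
      have "peak p x = ?h i * (\<Prod>j\<in>UNIV - {i}. ?h j)" unfolding peak_def by (subst prod.remove[of _ i]) simp_all
      also have "\<dots> \<le> ?h i * 1"
        by (intro mult_left_mono prod_le_1 half_sin_bounds conjI)
      finally have "1 \<le> ?h i" by (simp only: 1 mult_1_right)
      then show "?h i = 1" by (rule order_antisym[OF half_sin_bounds(2)])
    qed
  qed (simp add: peak_def)
  then show ?thesis using h by (simp add: int_lattice_def)
qed

lemma peak_power_limit:
  "(\<lambda>n. peak p x ^ n) \<longlonglongrightarrow> (if x - p \<in> int_lattice then 1 else 0)"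
proof (cases "x - p \<in> int_lattice")
  case True
  then show ?thesis using peak_eq_1_iff[of p x] by simp
next
  case False
  then have "peak p x < 1" using peak_eq_1_iff[of p x] peak_bounds(2)[of p x] by linarith
  then show ?thesis using False peak_bounds(1)[of p x] by (simp add: LIMSEQ_realpow_zero)
qed

lemma peak_test_S: "(\<lambda>x. peak p x ^ n *\<^sub>R outer t t) \<in> test_S"
proof -
  have "tfield (\<lambda>x. peak p x ^ n *\<^sub>R outer t t)" by (intro tfield_base trig_power trig_peak)
  then show ?thesis
    by (simp add: test_S_def tfield_smooth tfield_periodic transpose_scaleR transpose_outer)
qed

lemma peak_test_V: "(\<lambda>x. peak p x ^ n *\<^sub>R L) \<in> test_V"
proof -
  have "tfield (\<lambda>x. peak p x ^ n *\<^sub>R L)" by (intro tfield_base trig_power trig_peak)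
  then show ?thesis by (simp add: test_V_def tfield_smooth tfield_periodic)
qed

subsection \<open>Linear independence of the edge and vertex distributions\<close>

lemma sum_fun_apply: "(\<Sum>a\<in>A. f a) x = (\<Sum>a\<in>A. f a x)" for f :: "'a \<Rightarrow> 'b \<Rightarrow> 'c::real_vector"
  by (induction A rule: infinite_finite_induct) auto

lemma edge_integral_seg_avg: "edge_integral e f = norm (snd e - fst e) * seg_avg (fst e) (snd e) f"
  by (simp add: edge_integral_def seg_avg_def)

lemma seg_avg_le:
  assumes "continuous_on UNIV f" "\<And>x. x \<in> closed_segment p q \<Longrightarrow> f x \<le> (M::real)"
  shows "seg_avg p q f \<le> M"
proof -
  have "(\<lambda>s. f (p + s *\<^sub>R (q - p))) integrable_on {0..1}"
    by (intro integrable_continuous_interval continuous_on_compose2[OF assms(1)] continuous_intros) auto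
  moreover have "p + s *\<^sub>R (q - p) \<in> closed_segment p q" if "s \<in> {0..1}" for s
    using that by (auto simp: in_segment algebra_simps intro!: exI[of _ s])
  ultimately have "integral {0..1} (\<lambda>s. f (p + s *\<^sub>R (q - p))) \<le> integral {0..1} (\<lambda>s::real. M)"
    by (intro integral_le) (auto intro: assms(2))
  then show ?thesis by (simp add: seg_avg_def)
qed

lemma seg_avg_nonneg:
  assumes "continuous_on UNIV f" "\<And>x. 0 \<le> (f x :: real)"
  shows "0 \<le> seg_avg p q f"
proof -
  have "(\<lambda>s. f (p + s *\<^sub>R (q - p))) integrable_on {0..1}"
    by (intro integrable_continuous_interval continuous_on_compose2[OF assms(1)] continuous_intros) auto
  then show ?thesis unfolding seg_avg_def by (rule integral_nonneg) (simp add: assms(2))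
qed

text \<open>The integrand exceeds \<open>\<rho> ^ n\<close> on a neighbourhood of the midpoint whose length does not depend on
  \<open>n\<close>.\<close>

lemma seg_avg_power_lower:
  assumes f: "continuous_on UNIV f" "\<And>x. 0 \<le> (f x :: real)" and r: "0 \<le> \<rho>" "\<rho> < f (midpoint p q)"
  shows "\<exists>\<delta>>0. \<forall>n. \<delta> * \<rho> ^ n \<le> seg_avg p q (\<lambda>x. f x ^ n)"
proof -
  let ?g = "\<lambda>s. f (p + s *\<^sub>R (q - p))"
  have cg: "continuous_on A ?g" for A by (intro continuous_on_compose2[OF f(1)] continuous_intros) auto
  have "p + (1/2) *\<^sub>R (q - p) = midpoint p q" by (simp add: midpoint_def vec_eq_iff algebra_simps)
  then have "?g (1/2) > \<rho>" using r by simp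
  moreover have "isCont ?g (1/2)" using cg[of UNIV] by (simp add: continuous_on_eq_continuous_at)
  ultimately have "\<forall>\<^sub>F s in at (1/2). ?g s > \<rho>" by (intro order_tendstoD(1)) (auto simp: isCont_def)
  then obtain d where d: "d > 0" "\<And>s. s \<noteq> 1/2 \<Longrightarrow> dist s (1/2) < d \<Longrightarrow> ?g s > \<rho>"
    unfolding eventually_at by auto
  then have d': "?g s > \<rho>" if "dist s (1/2) < d" for s 
  proof (cases "s = 1/2")
    case True
    show ?thesis unfolding True by (rule \<open>?g (1/2) > \<rho>\<close>)
  next
    case False
    then show ?thesis using d(2) that by blast
  qed
  define \<delta> where "\<delta> = min (1/2) (d / 2)"
  have \<delta>: "0 < \<delta>" "\<delta> \<le> 1/2" "\<delta> < d" using d(1) by (auto simp: \<delta>_def)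
  have "2 * \<delta> * \<rho> ^ n \<le> seg_avg p q (\<lambda>x. f x ^ n)" for n
  proof -
    have int: "(\<lambda>s. ?g s ^ n) integrable_on {a..b}" for a b
      by (intro integrable_continuous_interval continuous_on_power cg)
    have "2 * \<delta> * \<rho> ^ n = integral {1/2 - \<delta>..1/2 + \<delta>} (\<lambda>s. \<rho> ^ n)" using \<delta> by simp
    also have "\<dots> \<le> integral {1/2 - \<delta>..1/2 + \<delta>} (\<lambda>s. ?g s ^ n)"
    proof (intro integral_le int)
      fix s assume "s \<in> {1/2 - \<delta>..1/2 + \<delta>}"
      then have "dist s (1/2) < d" using \<delta> by (auto simp: dist_real_def abs_less_iff)
      then show "\<rho> ^ n \<le> ?g s ^ n" using d'[of s] r(1) by (intro power_mono) auto
    qed (rule integrable_const_ivl)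
    also have "\<dots> \<le> integral {0..1} (\<lambda>s. ?g s ^ n)"
      using \<delta> f(2) by (intro integral_subset_le int) auto
    finally show ?thesis by (simp add: seg_avg_def)
  qed
  then show ?thesis using \<delta>(1) by (intro exI[of _ "2 * \<delta>"]) auto
qed

context oriented_mesh
begin

lemma midpoint_rel_interior: "x \<noteq> z \<Longrightarrow> midpoint x z \<in> rel_interior (closed_segment x z)" for x :: pt
proof -
  assume "x \<noteq> z"
  then have "rel_interior (closed_segment x z) = open_segment x z" by (simp add: rel_interior_closed_segment)
  then show ?thesis using \<open>x \<noteq> z\<close> by simp
qed

text \<open>The midpoint is a relative interior point of the edge, so that the edge is contained in every
  subsimplex of the mesh through that point.\<close>

lemma midpoint_in_other_edge:
  assumes e: "e \<in> E" "g \<in> E" and k: "k \<in> int_lattice" and x: "k + midpoint (fst e) (snd e) \<in> seg g"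
  shows "g = e"
proof -
  obtain p q where pq: "e = (p, q)" by force
  have pqd: "p \<noteq> q" "closed_segment p q \<in> subsimps K 1" using E_subsimp[OF e(1)] by (auto simp: pq seg_def)
  have S: "(+) k ` seg e = closed_segment (k + p) (k + q)" unfolding segment_translation[symmetric] by (simp add: pq seg_def)
  have s1: "(+) k ` seg e \<in> subsimps K 1" using subsimps_translation[OF pqd(2) k] by (simp add: pq seg_def)
  have s2: "seg g \<in> subsimps K 1" using E_subsimp[OF e(2)] by blast
  have "midpoint (k + p) (k + q) = k + midpoint p q" by (simp add: midpoint_def vec_eq_iff algebra_simps)
  then have m: "k + midpoint p q \<in> rel_interior ((+) k ` seg e)"
    using midpoint_rel_interior[of "k + p" "k + q"] pqd(1) S by simp
  then have "((+) k ` seg e \<inter> seg g) \<inter> rel_interior ((+) k ` seg e) \<noteq> {}"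
    using x pq rel_interior_subset by auto
  then have "(+) k ` seg e \<subseteq> seg g"
    using subset_of_face_of[OF subsimps_Int[OF s1 s2]] by blast
  then have f: "((+) k ` seg e) face_of seg g" by (rule subsimps_subset_face_of[OF s1 s2])
  have "(+) k ` seg e = seg g"
  proof (rule ccontr)
    assume "(+) k ` seg e \<noteq> seg g"
    then have "aff_dim ((+) k ` seg e) < aff_dim (seg g)"
      using face_of_aff_dim_lt[OF _ f] convex_simplex[OF subsimps_simplex[OF s2]] by blast
    then show False using aff_dim_simplex[OF subsimps_simplex[OF s1]] aff_dim_simplex[OF subsimps_simplex[OF s2]] by simp
  qed
  then show ?thesis using seg_translate_eq(1)[OF e _ k] by simp
qed

lemma edge_delta_peak:
  "edge_delta e (\<lambda>x. peak p x ^ n *\<^sub>R outer t t) =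
    norm (snd e - fst e) * (tangent e \<bullet> t)\<^sup>2 * seg_avg (fst e) (snd e) (\<lambda>x. peak p x ^ n)"
proof -
  have "tangent e \<bullet> ((peak p x ^ n *\<^sub>R outer t t) *v tangent e) = (tangent e \<bullet> t)\<^sup>2 * peak p x ^ n" for x
    by (simp add: scaleR_matrix_vector_assoc[symmetric] outer_mult inner_commute power2_eq_square)
  then have "edge_delta e (\<lambda>x. peak p x ^ n *\<^sub>R outer t t) =
    norm (snd e - fst e) * seg_avg (fst e) (snd e) (\<lambda>x. (tangent e \<bullet> t)\<^sup>2 * peak p x ^ n)"
    by (simp add: edge_delta_def peak_test_S edge_integral_seg_avg)
  also have "seg_avg (fst e) (snd e) (\<lambda>x. (tangent e \<bullet> t)\<^sup>2 * peak p x ^ n) = (tangent e \<bullet> t)\<^sup>2 * seg_avg (fst e) (snd e) (\<lambda>x. peak p x ^ n)"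
    by (rule seg_avg_bounded_linear[OF trig_continuous[OF trig_power[OF trig_peak]] bounded_linear_mult_right])
  finally show ?thesis by simp
qed

text \<open>The test field has a peak at the midpoint of the edge \<open>e\<close>. For its \<open>n\<close>-th power the other edges
  contribute at most a constant times \<open>M ^ n\<close> with \<open>M < 1\<close>, by compactness, whereas \<open>e\<close> contributes at
  least a constant times \<open>\<rho> ^ n\<close> for a number \<open>\<rho> > M\<close>.\<close>

lemma edge_delta_independent:
  assumes z: "(\<Sum>e\<in>E. a e *\<^sub>R edge_delta e) = 0" and e: "e \<in> E"
  shows "a e = 0"
proof (rule ccontr)
  assume ne: "a e \<noteq> 0"
  define p where "p = midpoint (fst e) (snd e)"
  define t where "t = tangent e"
  let ?f = "peak p"
  have fc: "continuous_on A ?f" for A by (rule trig_continuous[OF trig_peak])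
  have fnc: "continuous_on A (\<lambda>x. ?f x ^ n)" for A n by (rule trig_continuous[OF trig_power[OF trig_peak]])
  let ?S = "\<Union>g\<in>E - {e}. seg g"
  have cS: "compact ?S" using finite_E by (intro compact_UN) (auto simp: seg_def)
  have lt: "?f x < 1" if x: "x \<in> ?S" for x
  proof (rule ccontr)
    assume "\<not> ?f x < 1"
    then have "x - p \<in> int_lattice" using peak_bounds(2)[of p x] peak_eq_1_iff[of p x] by simp
    moreover obtain g where "g \<in> E - {e}" "x \<in> seg g" using x by blast
    ultimately show False using midpoint_in_other_edge[OF e, of g "x - p"] by (simp add: p_def)
  qed
  obtain M where M: "0 \<le> M" "M < 1" "\<And>x. x \<in> ?S \<Longrightarrow> ?f x \<le> M"
  proof (cases "?S = {}")
    case True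
    then show ?thesis using that[of 0] by auto
  next
    case False
    obtain x where "x \<in> ?S" "\<forall>y\<in>?S. ?f y \<le> ?f x"
      using continuous_attains_sup[OF cS False fc] by blast
    then show ?thesis using that[of "?f x"] lt peak_bounds(1) by blast
  qed
  define \<rho> where "\<rho> = (1 + M) / 2"
  have \<rho>: "0 < \<rho>" "M < \<rho>" "\<rho> < 1" using M by (auto simp: \<rho>_def)
  have "?f (midpoint (fst e) (snd e)) = 1" using peak_eq_1_iff[of p p] by (simp add: p_def)
  then obtain \<delta> where \<delta>: "\<delta> > 0" "\<And>n. \<delta> * \<rho> ^ n \<le> seg_avg (fst e) (snd e) (\<lambda>x. ?f x ^ n)"
    using seg_avg_power_lower[OF fc peak_bounds(1), of \<rho> "fst e" "snd e"] \<rho> by auto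
  define c where "c g = a g * (norm (snd g - fst g) * (tangent g \<bullet> t)\<^sup>2)" for g
  let ?I = "\<lambda>g n. seg_avg (fst g) (snd g) (\<lambda>x. ?f x ^ n)"
  have ce: "c e \<noteq> 0"
  proof -
    have "fst e \<noteq> snd e" using E_subsimp[OF e] by blast
    moreover from this have "t \<bullet> t = 1" by (simp add: t_def tangent_def dot_square_norm norm_sgn)
    ultimately show ?thesis using ne by (simp add: c_def t_def)
  qed
  have bound: "\<bar>c e\<bar> * \<delta> \<le> (\<Sum>g\<in>E - {e}. \<bar>c g\<bar>) * (M / \<rho>) ^ n" for n
  proof -
    have "0 = (\<Sum>g\<in>E. a g *\<^sub>R edge_delta g) (\<lambda>x. ?f x ^ n *\<^sub>R outer t t)" by (simp add: z)
    also have "\<dots> = (\<Sum>g\<in>E. c g * ?I g n)"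
      by (simp add: sum_fun_apply scaleR_fun_def edge_delta_peak c_def mult.assoc)
    also have "\<dots> = c e * ?I e n + (\<Sum>g\<in>E - {e}. c g * ?I g n)" using e finite_E by (simp add: sum.remove)
    finally have "c e * ?I e n = - (\<Sum>g\<in>E - {e}. c g * ?I g n)" by linarith
    moreover have "0 \<le> ?I e n" by (rule seg_avg_nonneg[OF fnc]) (simp add: peak_bounds(1))
    then have "\<bar>c e\<bar> * ?I e n = \<bar>c e * ?I e n\<bar>" by (simp add: abs_mult)
    ultimately have "\<bar>c e\<bar> * ?I e n = \<bar>\<Sum>g\<in>E - {e}. c g * ?I g n\<bar>" by (simp only: abs_minus_cancel)
    also have "\<dots> \<le> (\<Sum>g\<in>E - {e}. \<bar>c g\<bar> * M ^ n)"
    proof (rule order_trans[OF sum_abs], rule sum_mono)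
      fix g assume g: "g \<in> E - {e}"
      have "?I g n \<le> M ^ n"
        using g M(3) by (intro seg_avg_le fnc power_mono peak_bounds(1)) (auto simp: seg_def)
      moreover have "0 \<le> ?I g n" by (rule seg_avg_nonneg[OF fnc]) (simp add: peak_bounds(1))
      ultimately show "\<bar>c g * ?I g n\<bar> \<le> \<bar>c g\<bar> * M ^ n" by (simp add: abs_mult mult_left_mono)
    qed
    also have "\<dots> = (\<Sum>g\<in>E - {e}. \<bar>c g\<bar>) * M ^ n" by (simp add: sum_distrib_right)
    finally have "\<bar>c e\<bar> * ?I e n \<le> (\<Sum>g\<in>E - {e}. \<bar>c g\<bar>) * M ^ n" .
    moreover have "\<bar>c e\<bar> * (\<delta> * \<rho> ^ n) \<le> \<bar>c e\<bar> * ?I e n" by (intro mult_left_mono \<delta>) simp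
    ultimately have "\<bar>c e\<bar> * \<delta> * \<rho> ^ n \<le> (\<Sum>g\<in>E - {e}. \<bar>c g\<bar>) * M ^ n" by (simp add: mult.assoc)
    then show ?thesis using \<rho>(1) by (simp add: power_divide field_simps)
  qed
  have "(\<lambda>n. (\<Sum>g\<in>E - {e}. \<bar>c g\<bar>) * (M / \<rho>) ^ n) \<longlonglongrightarrow> (\<Sum>g\<in>E - {e}. \<bar>c g\<bar>) * 0"
    using M(1) \<rho> by (intro tendsto_mult tendsto_const LIMSEQ_realpow_zero) auto
  then have "\<bar>c e\<bar> * \<delta> \<le> (\<Sum>g\<in>E - {e}. \<bar>c g\<bar>) * 0"
    by (rule LIMSEQ_le_const) (use bound in blast)
  then show False using ce \<delta>(1) by (simp add: mult_le_0_iff)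
qed

lemma mesh_vertices_lattice: "y \<in> mesh_vertices K \<Longrightarrow> z \<in> mesh_vertices K \<Longrightarrow> z - y \<in> int_lattice \<longleftrightarrow> z = y"
  using torus_pt_eq_iff[of z y] by (auto simp: mesh_vertices_def)

lemma peak_vertex_limit:
  assumes "y \<in> mesh_vertices K" "z \<in> mesh_vertices K"
  shows "(\<lambda>n. peak y z ^ n) \<longlonglongrightarrow> (if z = y then 1 else 0)"
  using peak_power_limit[of y z] mesh_vertices_lattice[OF assms] by simp

lemma pt_delta_independent:
  assumes z: "(\<Sum>y\<in>mesh_vertices K. pt_delta (a y) y) = 0" and y: "y \<in> mesh_vertices K"
  shows "a y = 0"
proof -
  let ?L = "a y"
  have "(\<Sum>z\<in>mesh_vertices K. a z \<bullet> ?L * peak y z ^ n) = 0" for n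
  proof -
    have "0 = (\<Sum>y\<in>mesh_vertices K. pt_delta (a y) y) (\<lambda>x. peak y x ^ n *\<^sub>R ?L)" by (simp add: z)
    also have "\<dots> = (\<Sum>z\<in>mesh_vertices K. a z \<bullet> ?L * peak y z ^ n)"
      by (simp add: sum_fun_apply pt_delta_def peak_test_V mult.commute)
    finally show ?thesis by simp
  qed
  moreover have "(\<lambda>n. \<Sum>z\<in>mesh_vertices K. a z \<bullet> ?L * peak y z ^ n) \<longlonglongrightarrow> (\<Sum>z\<in>mesh_vertices K. a z \<bullet> ?L * (if z = y then 1 else 0))"
    by (intro tendsto_sum tendsto_mult tendsto_const peak_vertex_limit y)
  ultimately have "(\<Sum>z\<in>mesh_vertices K. a z \<bullet> ?L * (if z = y then 1 else 0)) = 0"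
    by (simp add: LIMSEQ_const_iff)
  then show ?thesis using y finite_mesh_vertices by (simp add: if_distrib cong: if_cong)
qed

end

subsection \<open>Symmetric gradients of trigonometric fields are compatible\<close>

text \<open>The symmetric gradient of the vector field \<open>g L\<close>.\<close>

definition trig_strain :: "pt \<Rightarrow> (pt \<Rightarrow> real) \<Rightarrow> pt \<Rightarrow> mat3"
  where "trig_strain L g x = (\<Sum>j\<in>UNIV. partial j g x *\<^sub>R sym_part (outer L (axis j 1)))"

lemma outer_component: "outer u v $ i $ j = u $ i * v $ j"
  by (simp add: outer_def)

lemma transpose_component: "transpose A $ i $ j = A $ j $ i" for A :: mat3
  by (simp add: transpose_def)

lemma tfield_trig_strain: "trig g \<Longrightarrow> tfield (trig_strain L g)"
proof -
  assume g: "trig g"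
  have "tfield (\<lambda>x. partial 1 g x *\<^sub>R sym_part (outer L (axis 1 1)) + partial 2 g x *\<^sub>R sym_part (outer L (axis 2 1)) +
    partial 3 g x *\<^sub>R sym_part (outer L (axis 3 1)))"
    by (intro tfield_add tfield_base trig_partial g)
  then show ?thesis by (simp add: trig_strain_def[abs_def] sum_3)
qed

lemma trig_strain_entry:
  "trig_strain L g x $ n $ l = 1/2 * (L $ n * partial l g x + L $ l * partial n g x)"
proof -
  have "trig_strain L g x $ n $ l = (\<Sum>j\<in>UNIV. partial j g x * (1/2 * (L $ n * axis j 1 $ l + axis j 1 $ n * L $ l)))"
    by (simp add: trig_strain_def sym_part_def outer_component transpose_component mult.commute)
  also have "\<dots> = 1/2 * (L $ n * partial l g x + L $ l * partial n g x)"
    using exhaust_3[of n] exhaust_3[of l] by (auto simp: sum_3 axis_def algebra_simps)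
  finally show ?thesis .
qed

lemma trig_strain_test: "trig g \<Longrightarrow> trig_strain L g \<in> test_S"
  using tfield_trig_strain[of g L]
  by (simp add: test_S_def tfield_smooth tfield_periodic vec_eq_iff transpose_component trig_strain_entry algebra_simps)

lemma partial_entry:
  assumes "tfield v"
  shows "partial k (\<lambda>p. (v p :: mat3) $ n) x $ l = partial k (\<lambda>p. v p $ n $ l) x"
proof -
  have d: "v differentiable (at x)" for x by (rule tfield_differentiable[OF assms])
  show ?thesis
    using partial_bounded_linear(2)[OF d bounded_linear_vec_nth[of n]] partial_bounded_linear(2)[OF d bounded_linear_nth2[of n l]]
    by simp
qed

lemma partial_scale_trig: "trig f \<Longrightarrow> partial i (\<lambda>x. c * f x) = (\<lambda>x. c * partial i f x)"
  using partial_mult_trig[OF trig_const, of f i c] by (simp add: partial_const)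

lemma curl_trig_strain:
  assumes g: "trig g"
  shows "curl (\<lambda>q. trig_strain L g q $ n) x =
    (1/2) *\<^sub>R cross3 (\<chi> a. partial a (partial n g) x) L"
proof -
  have "partial k (\<lambda>p. trig_strain L g p $ n $ l) x = 1/2 * (L $ n * partial k (partial l g) x + L $ l * partial k (partial n g) x)" for k l
  proof -
    have "partial k (\<lambda>p. trig_strain L g p $ n $ l) = partial k (\<lambda>p. (1/2 * L $ n) * partial l g p + (1/2 * L $ l) * partial n g p)"
      by (simp add: trig_strain_entry algebra_simps)
    also have "\<dots> = (\<lambda>p. (1/2 * L $ n) * partial k (partial l g) p + (1/2 * L $ l) * partial k (partial n g) p)"
      using g by (simp only: partial_add_trig trig_mult trig_const trig_partial partial_scale_trig)
    finally show ?thesis by (simp add: algebra_simps)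
  qed
  then show ?thesis
    using trig_partial_commute[OF g]
    by (simp add: vec_eq_iff forall_3 curl_components partial_entry[OF tfield_trig_strain[OF g]] cross_components algebra_simps)
qed

text \<open>The rows of the transposed curl of the strain are gradients, so their curls vanish.\<close>

lemma inc_trig_strain:
  assumes g: "trig g"
  shows "inc_smooth (trig_strain L g) x = 0"
proof -
  let ?v = "trig_strain L g"
  have sm: "smooth ?v" by (rule tfield_smooth[OF tfield_trig_strain[OF g]])
  have row: "curl_row ?v i p $ n = 1/2 * cross3 (\<chi> a. partial a (partial n g) p) L $ i" for i p n
    by (simp add: transpose_component mcurl_row curl_trig_strain[OF g])
  have H: "trig (partial a (partial b g))" for a b using g by (intro trig_partial)
  have sym: "partial k (partial a (partial n g)) = partial n (partial a (partial k g))" for k a n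
    using trig_partial_commute[OF g] trig_partial_commute[OF trig_partial[OF g]] by metis
  have pd: "partial k (curl_row ?v i) x $ n = 1/2 * cross3 (\<chi> a. partial k (partial a (partial n g)) x) L $ i" for k i n
  proof -
    have "partial k (curl_row ?v i) x $ n = partial k (\<lambda>p. curl_row ?v i p $ n) x"
      using C1_bounded_linear(2)[OF transpose_mcurl_row_C1[OF sm] bounded_linear_vec_nth, of k i n] by simp
    also have "\<dots> = partial k (\<lambda>p. 1/2 * cross3 (\<chi> a. partial a (partial n g) p) L $ i) x" by (simp add: row)
    also have "\<dots> = 1/2 * cross3 (\<chi> a. partial k (partial a (partial n g)) x) L $ i"
    proof -
      have two: "partial k (\<lambda>p. 1/2 * (partial a (partial n g) p * c - d * partial b (partial n g) p)) x =
        1/2 * (partial k (partial a (partial n g)) x * c - d * partial k (partial b (partial n g)) x)" for a b c d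
      proof -
        have "partial k (\<lambda>p. 1/2 * (partial a (partial n g) p * c - d * partial b (partial n g) p)) =
          partial k (\<lambda>p. (1/2 * c) * partial a (partial n g) p + (- 1/2 * d) * partial b (partial n g) p)"
          by (simp add: algebra_simps)
        also have "\<dots> = (\<lambda>p. (1/2 * c) * partial k (partial a (partial n g)) p + (- 1/2 * d) * partial k (partial b (partial n g)) p)"
          by (simp only: partial_add_trig trig_mult trig_const H partial_scale_trig)
        finally show ?thesis by (simp add: algebra_simps)
      qed
      show ?thesis using exhaust_3[of i] two by (auto simp: cross_components)
    qed
    finally show ?thesis .
  qed
  have "curl (curl_row ?v i) x = 0" for i
    using sym by (simp add: vec_eq_iff forall_3 curl_components pd)
  then show ?thesis by (simp add: vec_eq_iff[of "inc_smooth ?v x"] inc_smooth_row)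
qed

text \<open>The form of the strain on the tangent is the derivative of \<open>(t \<bullet> L) g\<close> along the edge.\<close>

lemma edge_delta_trig_strain:
  assumes g: "trig g" and e: "fst e \<noteq> snd e"
  shows "edge_delta e (trig_strain L g) = (tangent e \<bullet> L) * (g (head e) - g (tail e))"
proof -
  let ?t = "tangent e" and ?x = "fst e" and ?z = "snd e"
  have u: "?z - ?x = norm (?z - ?x) *\<^sub>R ?t" using e by (simp add: tangent_def sgn_div_norm)
  have q: "?t \<bullet> (sym_part (outer L (axis j 1)) *v ?t) = (?t \<bullet> L) * ?t $ j" for j
    using edge_form_sym_part[of "outer L (axis j 1)" 0 ?t]
    by (simp add: edge_form_def outer_mult inner_axis' mult.commute)
  have "?t \<bullet> (trig_strain L g p *v ?t) = (?t \<bullet> L) * dirderiv ?t g p" for p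
  proof -
    have lin: "linear (\<lambda>A :: mat3. ?t \<bullet> (A *v ?t))"
      by (rule linearI) (simp_all add: matrix_vector_mult_add_rdistrib inner_add_right scaleR_matrix_vector_assoc[symmetric])
    have "?t \<bullet> (trig_strain L g p *v ?t) = (\<Sum>j\<in>UNIV. partial j g p * (?t \<bullet> (sym_part (outer L (axis j 1)) *v ?t)))"
      unfolding trig_strain_def by (simp only: linear_sum[OF lin] linear_scale[OF lin] real_scaleR_def)
    then show ?thesis by (simp add: q sum_distrib_left mult_ac)
  qed
  then have "edge_delta e (trig_strain L g) = norm (?z - ?x) * seg_avg ?x ?z (\<lambda>p. (?t \<bullet> L) * dirderiv ?t g p)"
    by (simp add: edge_delta_def trig_strain_test[OF g] edge_integral_seg_avg)
  also have "\<dots> = (?t \<bullet> L) * seg_avg ?x ?z (\<lambda>p. norm (?z - ?x) * dirderiv ?t g p)"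
    using seg_avg_bounded_linear[OF C1_dirderiv_continuous[OF trig_C1[OF g]] bounded_linear_mult_right, of ?x ?z "?t \<bullet> L" ?t]
      seg_avg_bounded_linear[OF C1_dirderiv_continuous[OF trig_C1[OF g]] bounded_linear_mult_right, of ?x ?z "norm (?z - ?x)" ?t]
    by (simp add: mult.left_commute)
  also have "(\<lambda>p. norm (?z - ?x) * dirderiv ?t g p) = dirderiv (?z - ?x) g"
    by (subst (2) u) (simp add: sum_distrib_left mult.assoc)
  also have "seg_avg ?x ?z (dirderiv (?z - ?x) g) = g ?z - g ?x"
    by (rule seg_avg_derivative[OF C1_directional[OF trig_C1[OF g]]])
  finally show ?thesis using periodic_torus_pt[OF trig_periodic[OF g]] by (simp add: head_def tail_def)
qed

context oriented_mesh
begin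

lemma head_tail_vertices:
  assumes "e \<in> edges K"
  shows "head e \<in> mesh_vertices K" "tail e \<in> mesh_vertices K"
proof -
  obtain x z where e: "e = (x, z)" by force
  have E: "x \<noteq> z" "closed_segment x z \<in> subsimps K 1" "torus_pt x = x" using assms by (auto simp: e edges_iff)
  obtain T where T: "T \<in> tets K" "closed_segment x z face_of T" using edge_face_tet[OF E(2)] by blast
  have "x \<in> vertices_of T" "z \<in> vertices_of T" using segment_face_of[OF T(2)] by (auto simp: vertices_of_def)
  then have "torus_pt x \<in> mesh_vertices K" "torus_pt z \<in> mesh_vertices K" using tet_vertex_torus(1)[OF T(1)] by blast+
  then show "head e \<in> mesh_vertices K" "tail e \<in> mesh_vertices K" using E(3) by (simp_all add: e head_def tail_def)
qed

text \<open>The incompatibility of \<open>m\<close> vanishes on the strain of \<open>g L\<close>. Its edge integrals are differences of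
  vertex values of \<open>g\<close>, and for \<open>g\<close> the powers of a peak at \<open>y\<close> these tend to the incidence numbers of
  \<open>y\<close>.\<close>

lemma jump_equilibrium:
  assumes m: "m \<in> X1 K" and y: "y \<in> mesh_vertices K"
  shows "(\<Sum>e\<in>E. jump K m e *\<^sub>R ((if head e = y then tangent e else 0) - (if tail e = y then tangent e else 0))) = 0"
proof -
  let ?b = "\<lambda>e. (if head e = y then 1 else 0) - (if tail e = y then 1 else (0::real))"
  have z: "(\<Sum>e\<in>E. jump K m e * (tangent e \<bullet> L) * ?b e) = 0" for L
  proof -
    have "(\<Sum>e\<in>E. jump K m e * (tangent e \<bullet> L) * (peak y (head e) ^ n - peak y (tail e) ^ n)) = 0" for n
    proof -
      let ?g = "\<lambda>x. peak y x ^ n"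
      have g: "trig ?g" by (rule trig_power[OF trig_peak])
      have t: "trig_strain L ?g \<in> test_S" by (rule trig_strain_test[OF g])
      have "class_of (inc_smooth (trig_strain L ?g)) = class_of (\<lambda>x. 0)"
        by (simp add: inc_trig_strain[OF g] class_of_eq_iff)
      then have "inc_distr m (trig_strain L ?g) = l2_inner m (class_of (\<lambda>x. 0))" using t by (simp add: inc_distr_def)
      also have "\<dots> = 0"
      proof -
        obtain f where "m = class_of f" using class_of_ex by blast
        then show ?thesis by (simp add: l2_inner_class_of set_lebesgue_integral_def)
      qed
      finally have "inc_jump K E m (trig_strain L ?g) = 0"
        using fun_cong[OF inc_distr_eq_jump[OF m], of "trig_strain L ?g"] by simp
      then have "(\<Sum>e\<in>E. jump K m e * edge_delta e (trig_strain L ?g)) = 0"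
        by (simp add: inc_jump_def sum_fun_apply scaleR_fun_def)
      moreover have "edge_delta e (trig_strain L ?g) = (tangent e \<bullet> L) * (peak y (head e) ^ n - peak y (tail e) ^ n)" if "e \<in> E" for e
        using edge_delta_trig_strain[OF g] E_subsimp[OF that] by blast
      ultimately show ?thesis by (simp add: mult.assoc)
    qed
    moreover have "(\<lambda>n. \<Sum>e\<in>E. jump K m e * (tangent e \<bullet> L) * (peak y (head e) ^ n - peak y (tail e) ^ n))
       \<longlonglongrightarrow> (\<Sum>e\<in>E. jump K m e * (tangent e \<bullet> L) * ?b e)"
      using head_tail_vertices E_edges
      by (intro tendsto_sum tendsto_mult tendsto_diff tendsto_const peak_vertex_limit y) auto
    ultimately show ?thesis by (simp add: LIMSEQ_const_iff)
  qed
  let ?w = "\<Sum>e\<in>E. jump K m e *\<^sub>R ((if head e = y then tangent e else 0) - (if tail e = y then tangent e else 0))"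
  have "(if head e = y then tangent e else 0) - (if tail e = y then tangent e else 0) = ?b e *\<^sub>R tangent e" for e
    by simp
  then have "?w \<bullet> L = (\<Sum>e\<in>E. jump K m e * (tangent e \<bullet> L) * ?b e)" for L
    by (simp only: inner_sum_left inner_scaleR_left) (simp only: mult_ac)
  then have "?w \<bullet> ?w = 0" using z by simp
  then show ?thesis by simp
qed

end

section \<open>The coordinate maps\<close>

lemma linear_onD:
  assumes "linear_on V f" "x \<in> V"
  shows "y \<in> V \<Longrightarrow> f (x + y) = f x + f y" "f (c *\<^sub>R x) = c *\<^sub>R f x"
  using assms by (auto simp: linear_on_def)

lemma linear_on_0:
  assumes "linear_on V f" "subspace V"
  shows "f 0 = 0"
  using linear_onD(2)[OF assms(1) subspace_0[OF assms(2)], of 0] by simp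

lemma linear_on_sum:
  assumes f: "linear_on V f" and V: "subspace V" and x: "\<And>i. i \<in> I \<Longrightarrow> x i \<in> V"
  shows "f (\<Sum>i\<in>I. a i *\<^sub>R x i) = (\<Sum>i\<in>I. a i *\<^sub>R f (x i))"
  using x
proof (induction I rule: infinite_finite_induct)
  case (insert j I)
  have "(\<Sum>i\<in>I. a i *\<^sub>R x i) \<in> V" "a j *\<^sub>R x j \<in> V" "x j \<in> V"
    using insert.prems V by (auto intro!: subspace_sum subspace_scale)
  then show ?case using insert by (simp add: linear_onD[OF f])
qed (simp_all add: linear_on_0[OF f V])

lemma linear_on_compose:
  "linear_on V f \<Longrightarrow> linear_on W g \<Longrightarrow> f ` V \<subseteq> W \<Longrightarrow> linear_on V (\<lambda>x. g (f x))"
  unfolding linear_on_def by (simp add: image_subset_iff)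

lemma lin_isoI:
  assumes V: "subspace V" and W: "subspace W" and f: "linear_on V f" and im: "\<And>v. v \<in> V \<Longrightarrow> f v \<in> W"
    and inj: "\<And>v. v \<in> V \<Longrightarrow> f v = 0 \<Longrightarrow> v = 0" and surj: "\<And>w. w \<in> W \<Longrightarrow> \<exists>v\<in>V. f v = w"
  shows "lin_iso V W f"
proof -
  have "inj_on f V"
  proof (rule inj_onI)
    fix x y assume xy: "x \<in> V" "y \<in> V" "f x = f y"
    have "f (x + (-1) *\<^sub>R y) = f x + (-1) *\<^sub>R f y"
      using xy V by (simp only: linear_onD[OF f] subspace_scale)
    also have "\<dots> = 0" by (simp add: xy)
    finally have "f (x + (-1) *\<^sub>R y) = 0" .
    then have "x + (-1) *\<^sub>R y = 0" using inj xy V by (blast intro: subspace_add subspace_scale)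
    then show "x = y" by simp
  qed
  moreover have "f ` V = W" using im surj by blast
  ultimately show ?thesis using V W f by (simp add: lin_iso_def bij_betw_def)
qed

lemma lin_iso_induced:
  assumes f: "lin_iso V W f" and g: "linear_on V g"
  shows "\<exists>r. linear_on W r \<and> (\<forall>v\<in>V. r (f v) = g v)"
proof -
  have V: "subspace V" and lf: "linear_on V f" and inj: "inj_on f V" and im: "f ` V = W"
    using f by (auto simp: lin_iso_def bij_betw_def)
  let ?r = "\<lambda>w. g (inv_into V f w)"
  have r: "?r (f v) = g v" if "v \<in> V" for v using inv_into_f_f[OF inj that] by simp
  have "linear_on W ?r"
    unfolding linear_on_def im[symmetric]
  proof (intro conjI ballI allI)
    fix x y assume "x \<in> f ` V" "y \<in> f ` V"
    then obtain v w where v: "v \<in> V" "w \<in> V" "x = f v" "y = f w" by blast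
    then have "x + y = f (v + w)" by (simp add: linear_onD[OF lf])
    then show "?r (x + y) = ?r x + ?r y" using v by (simp only: r subspace_add[OF V] linear_onD[OF g])
  next
    fix c x assume "x \<in> f ` V"
    then obtain v where v: "v \<in> V" "x = f v" by blast
    then have "c *\<^sub>R x = f (c *\<^sub>R v)" by (simp add: linear_onD[OF lf])
    then show "?r (c *\<^sub>R x) = c *\<^sub>R ?r x" using v by (simp only: r subspace_scale[OF V] linear_onD[OF g])
  qed
  then show ?thesis using r by blast
qed

lemma four_complex_transport:
  assumes c: "four_complex A0 d0 A1 d1 A2 d2 A3"
    and f: "lin_iso A0 B0 f0" "lin_iso A1 B1 f1" "lin_iso A2 B2 f2" "lin_iso A3 B3 f3"
    and r: "linear_on B0 r0" "linear_on B1 r1" "linear_on B2 r2"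
      "\<forall>u\<in>A0. r0 (f0 u) = f1 (d0 u)" "\<forall>u\<in>A1. r1 (f1 u) = f2 (d1 u)" "\<forall>u\<in>A2. r2 (f2 u) = f3 (d2 u)"
  shows "four_complex B0 r0 B1 r1 B2 r2 B3"
proof -
  have im: "f0 ` A0 = B0" "f1 ` A1 = B1" "f2 ` A2 = B2" "f3 ` A3 = B3"
    using f by (auto simp: lin_iso_def bij_betw_def)
  have sub: "subspace B0" "subspace B1" "subspace B2" "subspace B3" "subspace A2" "subspace A3" "linear_on A2 f2" "linear_on A3 f3"
    using f by (auto simp: lin_iso_def)
  have d: "\<And>u. u \<in> A0 \<Longrightarrow> d0 u \<in> A1" "\<And>u. u \<in> A1 \<Longrightarrow> d1 u \<in> A2" "\<And>u. u \<in> A2 \<Longrightarrow> d2 u \<in> A3"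
    "\<And>u. u \<in> A0 \<Longrightarrow> d1 (d0 u) = 0" "\<And>u. u \<in> A1 \<Longrightarrow> d2 (d1 u) = 0"
    using c by (auto simp: four_complex_def)
  have z: "f2 0 = 0" "f3 0 = 0" using linear_on_0 sub by blast+
  have "r0 ` B0 \<subseteq> B1" "r1 ` B1 \<subseteq> B2" "r2 ` B2 \<subseteq> B3"
    unfolding im[symmetric] using r d by auto
  moreover have "\<forall>x\<in>B0. r1 (r0 x) = 0" "\<forall>x\<in>B1. r2 (r1 x) = 0"
    unfolding im[symmetric] using r d z by auto
  ultimately show ?thesis using sub r by (simp add: four_complex_def)
qed

lemma subspace_sums:
  assumes lin: "\<And>i. linear (\<lambda>a. f a i)"
  shows "subspace {\<Sum>i\<in>I. f (a i) i | a. True}"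
proof (rule subspaceI)
  have "0 = (\<Sum>i\<in>I. f 0 i)" by (simp add: linear_0[OF lin])
  then show "0 \<in> {\<Sum>i\<in>I. f (a i) i | a. True}" by (simp only: mem_Collect_eq) (rule exI[of _ "\<lambda>i. 0"], simp)
next
  fix x y assume "x \<in> {\<Sum>i\<in>I. f (a i) i | a. True}" "y \<in> {\<Sum>i\<in>I. f (a i) i | a. True}"
  then obtain a b where "x = (\<Sum>i\<in>I. f (a i) i)" "y = (\<Sum>i\<in>I. f (b i) i)" by blast
  then have "x + y = (\<Sum>i\<in>I. f (a i + b i) i)" by (simp add: linear_add[OF lin] sum.distrib)
  then show "x + y \<in> {\<Sum>i\<in>I. f (a i) i | a. True}" by (simp only: mem_Collect_eq) (rule exI[of _ "\<lambda>i. a i + b i"], simp)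
next
  fix c x assume "x \<in> {\<Sum>i\<in>I. f (a i) i | a. True}"
  then obtain a where "x = (\<Sum>i\<in>I. f (a i) i)" by blast
  then have "c *\<^sub>R x = (\<Sum>i\<in>I. f (c *\<^sub>R a i) i)" by (simp add: linear_scale[OF lin] scaleR_sum_right)
  then show "c *\<^sub>R x \<in> {\<Sum>i\<in>I. f (a i) i | a. True}" by (simp only: mem_Collect_eq) (rule exI[of _ "\<lambda>i. c *\<^sub>R a i"], simp)
qed

lemma the_coefficients:
  assumes lin: "\<And>i. linear (\<lambda>a. f a i)" and ind: "\<And>a i. (\<Sum>i\<in>I. f (a i) i) = 0 \<Longrightarrow> i \<in> I \<Longrightarrow> a i = 0"
  shows "(THE a. (\<forall>i. i \<notin> I \<longrightarrow> a i = 0) \<and> (\<Sum>i\<in>I. f (b i) i) = (\<Sum>i\<in>I. f (a i) i)) = (\<lambda>i. if i \<in> I then b i else 0)"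
proof (rule the_equality)
  show "(\<forall>i. i \<notin> I \<longrightarrow> (if i \<in> I then b i else 0) = 0) \<and> (\<Sum>i\<in>I. f (b i) i) = (\<Sum>i\<in>I. f (if i \<in> I then b i else 0) i)"
    by simp
next
  fix a assume a: "(\<forall>i. i \<notin> I \<longrightarrow> a i = 0) \<and> (\<Sum>i\<in>I. f (b i) i) = (\<Sum>i\<in>I. f (a i) i)"
  then have "(\<Sum>i\<in>I. f (a i - b i) i) = 0" by (simp add: linear_diff[OF lin] sum_subtractf)
  then have "a i - b i = 0" if "i \<in> I" for i using ind[of "\<lambda>i. a i - b i"] that by blast
  then show "a = (\<lambda>i. if i \<in> I then b i else 0)" using a by (auto simp: fun_eq_iff)
qed

lemma linear_scaleR_elem: "linear (\<lambda>a. a *\<^sub>R v)"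
  by (rule linearI) (simp_all add: scaleR_add_left)

lemma linear_pt_delta: "linear (\<lambda>a. pt_delta a y)"
  by (rule linearI) (auto simp: pt_delta_def fun_eq_iff scaleR_fun_def inner_add_left)

lemma linear_vtx_chain: "linear (\<lambda>a. vtx_chain a y)"
  by (rule linearI) (auto simp: vtx_chain_def fun_eq_iff scaleR_fun_def)

lemma linear_vtx_dual: "linear (\<lambda>a. vtx_dual K a y)"
  by (rule linearI) (auto simp: vtx_dual_def fun_eq_iff scaleR_fun_def inner_add_left)

lemma sum_single:
  assumes lin: "\<And>i. linear (\<lambda>a. f a i)" and I: "finite I" "j \<in> I"
  shows "(\<Sum>i\<in>I. f (if i = j then a else 0) i) = f a j"
proof -
  have "f (if i = j then a else 0) i = (if i = j then f a j else 0)" for i by (simp add: linear_0[OF lin])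
  then show ?thesis using I by simp
qed

context oriented_mesh
begin

subsection \<open>Vertex chains and co-chains\<close>

lemma vtx_chain_sum: "(\<Sum>z\<in>mesh_vertices K. vtx_chain (b z) z) = (\<lambda>z. if z \<in> mesh_vertices K then b z else 0)"
  using finite_mesh_vertices by (auto simp: fun_eq_iff sum_fun_apply vtx_chain_def)

lemma vtx_chain_in: "y \<in> mesh_vertices K \<Longrightarrow> vtx_chain L y \<in> chains0V K"
  using sum_single[of vtx_chain, OF linear_vtx_chain finite_mesh_vertices, of y L]
  unfolding chains0V_def mem_Collect_eq by (intro exI[of _ "\<lambda>z. if z = y then L else 0"]) simp

lemma vtx_dual_sum_apply:
  assumes "y \<in> mesh_vertices K"
  shows "(\<Sum>z\<in>mesh_vertices K. vtx_dual K (c z) z) (vtx_chain L y) = L \<bullet> c y"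
proof -
  have "(\<Sum>z\<in>mesh_vertices K. vtx_dual K (c z) z) (vtx_chain L y) = (\<Sum>z\<in>mesh_vertices K. if z = y then c z \<bullet> L else 0)"
  proof -
    have "vtx_dual K (c z) z (vtx_chain L y) = c z \<bullet> vtx_chain L y z" for z
      by (simp add: vtx_dual_def vtx_chain_in[OF assms])
    then show ?thesis unfolding sum_fun_apply by (intro sum.cong) (simp_all add: vtx_chain_def)
  qed
  then show ?thesis using assms finite_mesh_vertices by (simp add: inner_commute)
qed

lemma J0_eq: "J0 K u = (\<Sum>y\<in>mesh_vertices K. vtx_dual K (u y) y)"
  unfolding J0_def
proof (rule the_equality)
  show "(\<Sum>y\<in>mesh_vertices K. vtx_dual K (u y) y) \<in> cochains0V K \<and>
    (\<forall>y\<in>mesh_vertices K. \<forall>L. (\<Sum>y\<in>mesh_vertices K. vtx_dual K (u y) y) (vtx_chain L y) = L \<bullet> u y)"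
    using vtx_dual_sum_apply by (auto simp: cochains0V_def)
next
  fix c assume c: "c \<in> cochains0V K \<and> (\<forall>y\<in>mesh_vertices K. \<forall>L. c (vtx_chain L y) = L \<bullet> u y)"
  then obtain b where b: "c = (\<Sum>y\<in>mesh_vertices K. vtx_dual K (b y) y)" by (auto simp: cochains0V_def)
  have "b y = u y" if y: "y \<in> mesh_vertices K" for y
  proof -
    have "L \<bullet> b y = L \<bullet> u y" for L using c y vtx_dual_sum_apply[OF y, of b L] b by simp
    then show ?thesis using vector_eq_ldot by blast
  qed
  then show "c = (\<Sum>y\<in>mesh_vertices K. vtx_dual K (u y) y)" unfolding b by simp
qed

lemma J0_iso: "lin_iso (X0 K) (cochains0V K) (J0 K)"
proof (rule lin_isoI)
  show "subspace (X0 K)" unfolding X0_def by (rule subspace_pw_linear)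
  show "subspace (cochains0V K)" unfolding cochains0V_def by (rule subspace_sums[OF linear_vtx_dual])
  show "linear_on (X0 K) (J0 K)"
    by (simp add: linear_on_def J0_eq plus_fun_def[of "_ :: pt \<Rightarrow> pt"] scaleR_fun_def[of _ "_ :: pt \<Rightarrow> pt"]
      linear_add[OF linear_vtx_dual] linear_scale[OF linear_vtx_dual] sum.distrib scaleR_sum_right)
  show "J0 K v \<in> cochains0V K" for v by (auto simp: J0_eq cochains0V_def)
  show "v = 0" if v: "v \<in> X0 K" "J0 K v = 0" for v
  proof (rule pw_linear_eqI)
    show "v \<in> pw_linear K" "0 \<in> pw_linear K" using v subspace_pw_linear subspace_0 by (auto simp: X0_def)
    fix y assume y: "y \<in> mesh_vertices K"
    have "L \<bullet> v y = 0" for L using vtx_dual_sum_apply[OF y, of v L] v(2) by (simp add: J0_eq)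
    then have "v y = 0" using inner_eq_zero_iff by blast
    then show "v y = 0 y" by simp
  qed
  show "\<exists>v\<in>X0 K. J0 K v = w" if "w \<in> cochains0V K" for w
  proof -
    obtain b where b: "w = (\<Sum>y\<in>mesh_vertices K. vtx_dual K (b y) y)" using \<open>w \<in> cochains0V K\<close> by (auto simp: cochains0V_def)
    obtain u where u: "u \<in> pw_linear K" "\<forall>y\<in>mesh_vertices K. u y = b y" using pw_linear_exists[of b] by blast
    then have "J0 K u = w" by (simp add: J0_eq b)
    then show ?thesis using u by (auto simp: X0_def)
  qed
qed

lemma coef3_eq: "coef3 K (\<Sum>y\<in>mesh_vertices K. pt_delta (a y) y) = (\<lambda>y. if y \<in> mesh_vertices K then a y else 0)"
  unfolding coef3_def by (rule the_coefficients[OF linear_pt_delta]) (rule pt_delta_independent)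

lemma J3_eq: "J3 K (\<Sum>y\<in>mesh_vertices K. pt_delta (a y) y) = (\<Sum>y\<in>mesh_vertices K. vtx_chain (a y) y)"
proof -
  let ?w = "\<Sum>y\<in>mesh_vertices K. pt_delta (a y) y"
  have p: "pair3 K ?w (\<lambda>x. hat K y x *\<^sub>R L) = L \<bullet> a y" if y: "y \<in> mesh_vertices K" for y L
  proof -
    have "pair3 K ?w (\<lambda>x. hat K y x *\<^sub>R L) = (\<Sum>z\<in>mesh_vertices K. if z = y then a z \<bullet> L else 0)"
      unfolding pair3_def coef3_eq by (rule sum.cong) (simp_all add: hat_props(2)[OF y])
    then show ?thesis using y finite_mesh_vertices by (simp add: inner_commute)
  qed
  show ?thesis unfolding J3_def
  proof (rule the_equality)
    show "(\<Sum>y\<in>mesh_vertices K. vtx_chain (a y) y) \<in> chains0V K \<and>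
      (\<forall>y\<in>mesh_vertices K. \<forall>L. vtx_dual K L y (\<Sum>y\<in>mesh_vertices K. vtx_chain (a y) y) = pair3 K ?w (\<lambda>x. hat K y x *\<^sub>R L))"
    proof (intro conjI ballI allI)
      show c: "(\<Sum>y\<in>mesh_vertices K. vtx_chain (a y) y) \<in> chains0V K" by (auto simp: chains0V_def)
      show "vtx_dual K L y (\<Sum>y\<in>mesh_vertices K. vtx_chain (a y) y) = pair3 K ?w (\<lambda>x. hat K y x *\<^sub>R L)"
        if "y \<in> mesh_vertices K" for y L
        using c that by (simp add: vtx_dual_def vtx_chain_sum p)
    qed
  next
    fix b assume b: "b \<in> chains0V K \<and> (\<forall>y\<in>mesh_vertices K. \<forall>L. vtx_dual K L y b = pair3 K ?w (\<lambda>x. hat K y x *\<^sub>R L))"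
    then obtain c where c: "b = (\<Sum>y\<in>mesh_vertices K. vtx_chain (c y) y)" by (auto simp: chains0V_def)
    have "c y = a y" if y: "y \<in> mesh_vertices K" for y
    proof -
      have "L \<bullet> b y = L \<bullet> a y" for L using conjunct2[OF b] y by (simp add: vtx_dual_def p conjunct1[OF b])
      then have "b y = a y" using vector_eq_ldot by blast
      then show ?thesis using y by (simp add: c vtx_chain_sum)
    qed
    then show "b = (\<Sum>y\<in>mesh_vertices K. vtx_chain (a y) y)" unfolding c by simp
  qed
qed

lemma J3_iso: "lin_iso (X3 K) (chains0V K) (J3 K)"
proof (rule lin_isoI)
  show "subspace (X3 K)" unfolding X3_def by (rule subspace_sums[OF linear_pt_delta])
  show "subspace (chains0V K)" unfolding chains0V_def by (rule subspace_sums[OF linear_vtx_chain])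
  show "J3 K v \<in> chains0V K" if "v \<in> X3 K" for v using that by (auto simp: X3_def J3_eq chains0V_def)
  show "\<exists>v\<in>X3 K. J3 K v = w" if "w \<in> chains0V K" for w
  proof -
    obtain b where "w = (\<Sum>y\<in>mesh_vertices K. vtx_chain (b y) y)" using \<open>w \<in> chains0V K\<close> by (auto simp: chains0V_def)
    then have "J3 K (\<Sum>y\<in>mesh_vertices K. pt_delta (b y) y) = w" by (simp add: J3_eq)
    then show ?thesis by (auto simp: X3_def)
  qed
  show "v = 0" if v: "v \<in> X3 K" "J3 K v = 0" for v
  proof -
    obtain a where a: "v = (\<Sum>y\<in>mesh_vertices K. pt_delta (a y) y)" using v(1) by (auto simp: X3_def)
    have "a y = 0" if "y \<in> mesh_vertices K" for y
      using fun_cong[OF v(2), of y] that by (simp add: a J3_eq vtx_chain_sum)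
    then show ?thesis by (simp add: a linear_0[OF linear_pt_delta])
  qed
  show "linear_on (X3 K) (J3 K)"
    unfolding linear_on_def
  proof (intro conjI ballI allI)
    fix v w assume "v \<in> X3 K" "w \<in> X3 K"
    then obtain a b where v: "v = (\<Sum>y\<in>mesh_vertices K. pt_delta (a y) y)" "w = (\<Sum>y\<in>mesh_vertices K. pt_delta (b y) y)"
      by (auto simp: X3_def)
    have s: "v + w = (\<Sum>y\<in>mesh_vertices K. pt_delta (a y + b y) y)"
      by (simp add: v linear_add[OF linear_pt_delta] sum.distrib)
    show "J3 K (v + w) = J3 K v + J3 K w"
      unfolding s unfolding v by (simp only: J3_eq linear_add[OF linear_vtx_chain] sum.distrib)
  next
    fix c v assume "v \<in> X3 K"
    then obtain a where v: "v = (\<Sum>y\<in>mesh_vertices K. pt_delta (a y) y)" by (auto simp: X3_def)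
    have s: "c *\<^sub>R v = (\<Sum>y\<in>mesh_vertices K. pt_delta (c *\<^sub>R a y) y)"
      by (simp add: v linear_scale[OF linear_pt_delta] scaleR_sum_right)
    show "J3 K (c *\<^sub>R v) = c *\<^sub>R J3 K v"
      unfolding s unfolding v by (simp only: J3_eq linear_scale[OF linear_vtx_chain] scaleR_sum_right)
  qed
qed

subsection \<open>Edge chains and co-chains\<close>

lemma edge_chain_sum:
  assumes g: "g \<in> E"
  shows "(\<Sum>e\<in>E. a e *\<^sub>R edge_chain e) g = a g"
proof -
  have "edge_chain e g = (if e = g then 1 else 0)" if e: "e \<in> E" for e
    using E_rev_iff[OF E_edges[OF e]] e g by (auto simp: edge_chain_def)
  then have "(\<Sum>e\<in>E. a e *\<^sub>R edge_chain e) g = (\<Sum>e\<in>E. if e = g then a e else 0)"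
    unfolding sum_fun_apply by (intro sum.cong) (simp_all add: scaleR_fun_def)
  then show ?thesis using g finite_E by simp
qed

lemma edge_chain_in: "e \<in> E \<Longrightarrow> edge_chain e \<in> chains1 E"
  using sum_single[of "\<lambda>a e. a *\<^sub>R edge_chain e", OF linear_scaleR_elem finite_E, of e 1]
  unfolding chains1_def mem_Collect_eq by (intro exI[of _ "\<lambda>g. if g = e then 1 else 0"]) simp

lemma subspace_chains1: "subspace (chains1 E)"
  unfolding chains1_def by (rule subspace_sums[of "\<lambda>a e. a *\<^sub>R edge_chain e", OF linear_scaleR_elem])

lemma edge_dual_cochain: "edge_dual E e \<in> cochains1 E"
  using subspace_chains1
  by (auto simp: cochains1_def edge_dual_def linear_on_def scaleR_fun_def[of _ "_ :: edge \<Rightarrow> real"] subspace_add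
    dest: subspace_scale)

lemma subspace_cochains1: "subspace (cochains1 E)"
proof (rule subspaceI)
  show "0 \<in> cochains1 E" by (simp add: cochains1_def linear_on_def)
  show "x + y \<in> cochains1 E" if "x \<in> cochains1 E" "y \<in> cochains1 E" for x y
    using that by (simp add: cochains1_def linear_on_def distrib_left)
  show "c *\<^sub>R x \<in> cochains1 E" if "x \<in> cochains1 E" for c x
    using that by (simp add: cochains1_def linear_on_def scaleR_fun_def[of _ "_ :: (edge \<Rightarrow> real) \<Rightarrow> real"] distrib_left mult.left_commute)
qed

lemma edge_dual_sum_in: "(\<Sum>e\<in>E. a e *\<^sub>R edge_dual E e) \<in> cochains1 E"
  by (intro subspace_sum subspace_scale subspace_cochains1 edge_dual_cochain)

lemma edge_dual_sum_apply:
  assumes "g \<in> E"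
  shows "(\<Sum>e\<in>E. a e *\<^sub>R edge_dual E e) (edge_chain g) = a g"
proof -
  have "a e * edge_chain g e = (if e = g then a e else 0)" if "e \<in> E" for e
    using that E_rev_iff[OF E_edges[OF assms]] assms by (auto simp: edge_chain_def)
  then have "(\<Sum>e\<in>E. a e *\<^sub>R edge_dual E e) (edge_chain g) = (\<Sum>e\<in>E. if e = g then a e else 0)"
    unfolding sum_fun_apply by (intro sum.cong) (simp_all add: scaleR_fun_def edge_dual_def edge_chain_in[OF assms])
  then show ?thesis using assms finite_E by simp
qed

lemma cochain_expand:
  assumes \<phi>: "\<phi> \<in> cochains1 E"
  shows "\<phi> = (\<Sum>e\<in>E. \<phi> (edge_chain e) *\<^sub>R edge_dual E e)"
proof
  fix c
  show "\<phi> c = (\<Sum>e\<in>E. \<phi> (edge_chain e) *\<^sub>R edge_dual E e) c"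
  proof (cases "c \<in> chains1 E")
    case True
    then obtain a where a: "c = (\<Sum>e\<in>E. a e *\<^sub>R edge_chain e)" by (auto simp: chains1_def)
    have "linear_on (chains1 E) \<phi>" using \<phi> by (simp add: cochains1_def)
    then have "\<phi> c = (\<Sum>e\<in>E. a e *\<^sub>R \<phi> (edge_chain e))"
      unfolding a by (rule linear_on_sum[OF _ subspace_chains1 edge_chain_in])
    also have "\<dots> = (\<Sum>e\<in>E. \<phi> (edge_chain e) *\<^sub>R edge_dual E e c)"
      by (rule sum.cong) (use True in \<open>simp_all add: edge_dual_def a edge_chain_sum\<close>)
    finally show ?thesis by (simp add: sum_fun_apply scaleR_fun_def)
  next
    case False
    then show ?thesis using \<phi> by (simp add: cochains1_def sum_fun_apply scaleR_fun_def edge_dual_def)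
  qed
qed

lemma J1_eq: "J1 K E u = (\<Sum>e\<in>E. edge_moment K u e *\<^sub>R edge_dual E e)"
  unfolding J1_def
proof (rule the_equality)
  show "(\<Sum>e\<in>E. edge_moment K u e *\<^sub>R edge_dual E e) \<in> cochains1 E \<and>
    (\<forall>e\<in>E. (\<Sum>e\<in>E. edge_moment K u e *\<^sub>R edge_dual E e) (edge_chain e) = edge_moment K u e)"
    using edge_dual_sum_in edge_dual_sum_apply by blast
next
  fix \<phi> assume \<phi>: "\<phi> \<in> cochains1 E \<and> (\<forall>e\<in>E. \<phi> (edge_chain e) = edge_moment K u e)"
  then have "\<phi> = (\<Sum>e\<in>E. \<phi> (edge_chain e) *\<^sub>R edge_dual E e)" using cochain_expand by blast
  also have "\<dots> = (\<Sum>e\<in>E. edge_moment K u e *\<^sub>R edge_dual E e)" using \<phi> by simp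
  finally show "\<phi> = (\<Sum>e\<in>E. edge_moment K u e *\<^sub>R edge_dual E e)" .
qed

lemma edge_moment_linear:
  assumes e: "e \<in> E" and m: "m \<in> X1 K"
  shows "m' \<in> X1 K \<Longrightarrow> edge_moment K (m + m') e = edge_moment K m e + edge_moment K m' e"
    "edge_moment K (c *\<^sub>R m) e = c * edge_moment K m e"
proof -
  obtain x z where xz: "e = (x, z)" by force
  have ed: "(x, z) \<in> edges K" using E_edges[OF e] xz by simp
  obtain T where T: "T \<in> tets K" "closed_segment x z face_of T" using edge_face_tet ed edges_iff by blast
  note em = edge_moment_eq[OF _ ed T]
  show "edge_moment K (c *\<^sub>R m) e = c * edge_moment K m e"
    by (simp add: xz em[OF m] em[OF X1_scaleR(1)[OF m]] X1_scaleR(2)[OF m T(1)] edge_form_scaleR)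
  show "edge_moment K (m + m') e = edge_moment K m e + edge_moment K m' e" if m': "m' \<in> X1 K"
    by (simp add: xz em[OF m] em[OF m'] em[OF X1_add(1)[OF m m']] X1_add(2)[OF m m' T(1)] edge_form_add add_divide_distrib)
qed

lemma J1_iso: "lin_iso (X1 K) (cochains1 E) (J1 K E)"
proof (rule lin_isoI[OF subspace_X1 subspace_cochains1])
  show "linear_on (X1 K) (J1 K E)"
    by (simp add: linear_on_def J1_eq edge_moment_linear scaleR_add_left sum.distrib scaleR_sum_right)
  show "J1 K E v \<in> cochains1 E" for v unfolding J1_eq by (rule edge_dual_sum_in)
  show "v = 0" if v: "v \<in> X1 K" "J1 K E v = 0" for v
  proof (rule X1_eq_moments[OF v(1) subspace_0[OF subspace_X1]])
    fix e assume e: "e \<in> E"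
    have "edge_moment K 0 e = 0" using edge_moment_linear(2)[OF e v(1), of 0] by simp
    then show "edge_moment K v e = edge_moment K 0 e" using edge_dual_sum_apply[OF e, of "edge_moment K v"] v(2) by (simp add: J1_eq)
  qed
  show "\<exists>v\<in>X1 K. J1 K E v = w" if w: "w \<in> cochains1 E" for w
  proof -
    obtain m where m: "m \<in> X1 K" "\<forall>e\<in>E. edge_moment K m e = w (edge_chain e)"
      using X1_exists[of "\<lambda>e. w (edge_chain e)"] by blast
    have "J1 K E m = (\<Sum>e\<in>E. w (edge_chain e) *\<^sub>R edge_dual E e)" using m(2) by (simp add: J1_eq)
    then show ?thesis using cochain_expand[OF w] m(1) by metis
  qed
qed

lemma coef2_eq: "coef2 E (\<Sum>e\<in>E. a e *\<^sub>R edge_delta e) = (\<lambda>e. if e \<in> E then a e else 0)"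
  unfolding coef2_def by (rule the_coefficients[of "\<lambda>a e. a *\<^sub>R edge_delta e", OF linear_scaleR_elem]) (rule edge_delta_independent)

lemma J2_eq: "J2 K E (\<Sum>e\<in>E. a e *\<^sub>R edge_delta e) = (\<Sum>e\<in>E. a e *\<^sub>R edge_chain e)"
proof -
  let ?w = "\<Sum>e\<in>E. a e *\<^sub>R edge_delta e"
  have p: "pair2 K E ?w (psi K e) = a e" if e: "e \<in> E" for e
  proof -
    have "pair2 K E ?w (psi K e) = (\<Sum>g\<in>E. if g = e then a g else 0)"
      unfolding pair2_def coef2_eq by (rule sum.cong) (simp_all add: psi_props(2)[OF e])
    then show ?thesis using e finite_E by simp
  qed
  show ?thesis unfolding J2_def
  proof (rule the_equality)
    show "(\<Sum>e\<in>E. a e *\<^sub>R edge_chain e) \<in> chains1 E \<and> (\<forall>e\<in>E. edge_dual E e (\<Sum>e\<in>E. a e *\<^sub>R edge_chain e) = pair2 K E ?w (psi K e))"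
    proof (intro conjI ballI)
      show c: "(\<Sum>e\<in>E. a e *\<^sub>R edge_chain e) \<in> chains1 E" by (auto simp: chains1_def)
      show "edge_dual E e (\<Sum>e\<in>E. a e *\<^sub>R edge_chain e) = pair2 K E ?w (psi K e)" if "e \<in> E" for e
        using c that by (simp add: edge_dual_def edge_chain_sum p)
    qed
  next
    fix c assume c: "c \<in> chains1 E \<and> (\<forall>e\<in>E. edge_dual E e c = pair2 K E ?w (psi K e))"
    then obtain b where b: "c = (\<Sum>e\<in>E. b e *\<^sub>R edge_chain e)" by (auto simp: chains1_def)
    have "b e = a e" if e: "e \<in> E" for e
      using conjunct2[OF c] e edge_chain_sum[OF e, of b] by (simp add: edge_dual_def p conjunct1[OF c, unfolded b] b)
    then show "c = (\<Sum>e\<in>E. a e *\<^sub>R edge_chain e)" unfolding b by simp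
  qed
qed

lemma subspace_X2: "subspace (X2 E)"
  unfolding X2_def by (rule subspace_sums[of "\<lambda>a e. a *\<^sub>R edge_delta e", OF linear_scaleR_elem])

lemma X2_cases:
  assumes "w \<in> X2 E"
  obtains a where "w = (\<Sum>e\<in>E. a e *\<^sub>R edge_delta e)"
  using assms by (auto simp: X2_def)

lemma X2_add: "(\<Sum>e\<in>E. a e *\<^sub>R edge_delta e) + (\<Sum>e\<in>E. b e *\<^sub>R edge_delta e) = (\<Sum>e\<in>E. (a e + b e) *\<^sub>R edge_delta e)"
  by (simp add: scaleR_add_left sum.distrib)

lemma X2_scaleR: "c *\<^sub>R (\<Sum>e\<in>E. a e *\<^sub>R edge_delta e) = (\<Sum>e\<in>E. (c * a e) *\<^sub>R edge_delta e)"
  by (simp add: scaleR_sum_right)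

lemma J2_iso: "lin_iso (X2 E) (chains1 E) (J2 K E)"
proof (rule lin_isoI[OF subspace_X2 subspace_chains1])
  show "J2 K E v \<in> chains1 E" if "v \<in> X2 E" for v using that by (auto simp: X2_def J2_eq chains1_def)
  show "\<exists>v\<in>X2 E. J2 K E v = w" if "w \<in> chains1 E" for w
  proof -
    obtain b where "w = (\<Sum>e\<in>E. b e *\<^sub>R edge_chain e)" using \<open>w \<in> chains1 E\<close> by (auto simp: chains1_def)
    then have "J2 K E (\<Sum>e\<in>E. b e *\<^sub>R edge_delta e) = w" by (simp add: J2_eq)
    then show ?thesis by (auto simp: X2_def)
  qed
  show "v = 0" if v: "v \<in> X2 E" "J2 K E v = 0" for v
  proof -
    obtain a where a: "v = (\<Sum>e\<in>E. a e *\<^sub>R edge_delta e)" by (rule X2_cases[OF v(1)])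
    have "a e = 0" if e: "e \<in> E" for e
      using edge_chain_sum[OF e, of a] v(2) by (simp add: a J2_eq)
    then show ?thesis by (simp add: a)
  qed
  show "linear_on (X2 E) (J2 K E)"
    unfolding linear_on_def
  proof (intro conjI ballI allI)
    fix v w assume v: "v \<in> X2 E" and w: "w \<in> X2 E"
    obtain a where a: "v = (\<Sum>e\<in>E. a e *\<^sub>R edge_delta e)" by (rule X2_cases[OF v])
    obtain b where b: "w = (\<Sum>e\<in>E. b e *\<^sub>R edge_delta e)" by (rule X2_cases[OF w])
    show "J2 K E (v + w) = J2 K E v + J2 K E w"
      unfolding a b X2_add J2_eq by (simp add: scaleR_add_left sum.distrib)
  next
    fix c v assume v: "v \<in> X2 E"
    obtain a where a: "v = (\<Sum>e\<in>E. a e *\<^sub>R edge_delta e)" by (rule X2_cases[OF v])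
    show "J2 K E (c *\<^sub>R v) = c *\<^sub>R J2 K E v"
      unfolding a X2_scaleR J2_eq by (simp add: scaleR_sum_right)
  qed
qed

section \<open>The complex\<close>

lemma adj_tets:
  assumes "x \<noteq> z" "F \<in> tri_star (closed_segment x z)"
  shows "adj_tet K F x (n_vec (x, z) F) \<in> tets K" "F face_of adj_tet K F x (n_vec (x, z) F)"
    "adj_tet K F x (- n_vec (x, z) F) \<in> tets K" "F face_of adj_tet K F x (- n_vec (x, z) F)"
proof -
  obtain r where r: "F = convex hull {x, z, r}" "nrm3 x z r \<noteq> 0"
    and n: "n_vec (x, z) F \<bullet> (z - x) = 0" "n_vec (x, z) F \<bullet> (r - x) = 0" "n_vec (x, z) F \<noteq> 0"
    using tri_star_frame[OF assms] by metis
  have F: "F \<in> subsimps K 2" using assms(2) by simp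
  show "adj_tet K F x (n_vec (x, z) F) \<in> tets K" "F face_of adj_tet K F x (n_vec (x, z) F)"
    using adj_tet_props(1,2)[OF F r n] by blast+
  show "adj_tet K F x (- n_vec (x, z) F) \<in> tets K" "F face_of adj_tet K F x (- n_vec (x, z) F)"
    using adj_tet_props(1,2)[OF F r, of "- n_vec (x, z) F"] n by simp_all
qed

lemma jump_linear:
  assumes m: "m \<in> X1 K" and e: "fst e \<noteq> snd e"
  shows "m' \<in> X1 K \<Longrightarrow> jump K (m + m') e = jump K m e + jump K m' e" "jump K (c *\<^sub>R m) e = c * jump K m e"
proof -
  obtain x z where xz: "e = (x, z)" by force
  note T = adj_tets[of x z]
  have ne: "x \<noteq> z" using e xz by simp
  show "jump K (m + m') e = jump K m e + jump K m' e" if m': "m' \<in> X1 K"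
    unfolding jump_def sum.distrib[symmetric]
  proof (rule sum.cong[OF refl])
    fix F assume "F \<in> {F \<in> subsimps K 2. seg e face_of F}"
    then have F: "F \<in> tri_star (closed_segment x z)" by (simp add: xz seg_def)
    have "face_jump K (m + m') e F = face_jump K m e F + face_jump K m' e F"
      using T(1,3)[OF ne F] by (simp add: face_jump_def xz X1_add(2)[OF m m'])
    then show "m_vec e F \<bullet> (face_jump K (m + m') e F *v n_vec e F) =
      m_vec e F \<bullet> (face_jump K m e F *v n_vec e F) + m_vec e F \<bullet> (face_jump K m' e F *v n_vec e F)"
      by (simp add: matrix_vector_mult_add_rdistrib inner_add_right)
  qed
  show "jump K (c *\<^sub>R m) e = c * jump K m e"
    unfolding jump_def sum_distrib_left
  proof (rule sum.cong[OF refl])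
    fix F assume "F \<in> {F \<in> subsimps K 2. seg e face_of F}"
    then have F: "F \<in> tri_star (closed_segment x z)" by (simp add: xz seg_def)
    have "face_jump K (c *\<^sub>R m) e F = c *\<^sub>R face_jump K m e F"
      using T(1,3)[OF ne F] by (simp add: face_jump_def xz X1_scaleR(2)[OF m] scaleR_diff_right)
    then show "m_vec e F \<bullet> (face_jump K (c *\<^sub>R m) e F *v n_vec e F) =
      c * (m_vec e F \<bullet> (face_jump K m e F *v n_vec e F))"
      by (simp add: scaleR_matrix_vector_assoc[symmetric])
  qed
qed

text \<open>The coefficient of \<open>div (edge_delta e)\<close> at the vertex \<open>y\<close>.\<close>

definition end_force :: "edge \<Rightarrow> pt \<Rightarrow> pt"
  where "end_force e y = (if head e = y then tangent e else 0) - (if tail e = y then tangent e else 0)"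

lemma div_distr_eq:
  "div_distr E (\<Sum>e\<in>E. a e *\<^sub>R edge_delta e) =
    (\<Sum>y\<in>mesh_vertices K. pt_delta (\<Sum>e\<in>E. a e *\<^sub>R end_force e y) y)"
proof -
  have s: "(\<Sum>y\<in>mesh_vertices K. pt_delta (end_force e y) y) = pt_delta (tangent e) (head e) - pt_delta (tangent e) (tail e)"
    if "e \<in> E" for e
    using sum_single[of pt_delta, OF linear_pt_delta finite_mesh_vertices head_tail_vertices(1)[OF E_edges[OF that]], of "tangent e"]
      sum_single[of pt_delta, OF linear_pt_delta finite_mesh_vertices head_tail_vertices(2)[OF E_edges[OF that]], of "tangent e"]
    by (simp only: end_force_def linear_diff[OF linear_pt_delta] sum_subtractf eq_commute[of "head e"] eq_commute[of "tail e"])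
  have "div_distr E (\<Sum>e\<in>E. a e *\<^sub>R edge_delta e) = (\<Sum>e\<in>E. a e *\<^sub>R (\<Sum>y\<in>mesh_vertices K. pt_delta (end_force e y) y))"
    unfolding div_distr_def coef2_eq by (rule sum.cong) (simp_all add: s)
  also have "\<dots> = (\<Sum>y\<in>mesh_vertices K. \<Sum>e\<in>E. a e *\<^sub>R pt_delta (end_force e y) y)"
    unfolding scaleR_sum_right by (rule sum.swap)
  also have "\<dots> = (\<Sum>y\<in>mesh_vertices K. pt_delta (\<Sum>e\<in>E. a e *\<^sub>R end_force e y) y)"
    by (simp only: linear_sum[OF linear_pt_delta] linear_scale[OF linear_pt_delta])
  finally show ?thesis .
qed

text \<open>By the jump formula both versions of \<open>inc\<close> are given by the coefficients \<open>\<sigma> * jump\<close>.\<close>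

lemma christiansen_complex:
  assumes inc: "(inc = inc_jump K E \<and> \<sigma> = 1) \<or> (inc = inc_distr \<and> \<sigma> = -1)"
  shows "four_complex (X0 K) eps (X1 K) inc (X2 E) (div_distr E) (X3 K)"
    "\<And>m. m \<in> X1 K \<Longrightarrow> inc m = (\<Sum>e\<in>E. (\<sigma> * jump K m e) *\<^sub>R edge_delta e)"
proof -
  show i: "inc m = (\<Sum>e\<in>E. (\<sigma> * jump K m e) *\<^sub>R edge_delta e)" if m: "m \<in> X1 K" for m
    using inc inc_distr_eq_jump[OF m] by (auto simp: inc_jump_def sum_negf)
  have eF: "fst e \<noteq> snd e" if "e \<in> E" for e using E_subsimp[OF that] by blast
  have lin1: "linear_on (X1 K) inc"
    unfolding linear_on_def
  proof (intro conjI ballI allI)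
    fix m m' assume m: "m \<in> X1 K" "m' \<in> X1 K"
    show "inc (m + m') = inc m + inc m'"
      unfolding i[OF m(1)] i[OF m(2)] i[OF X1_add(1)[OF m]] X2_add
      by (rule sum.cong) (simp_all add: jump_linear(1)[OF m(1) eF m(2)] distrib_left)
  next
    fix c m assume m: "m \<in> X1 K"
    show "inc (c *\<^sub>R m) = c *\<^sub>R inc m"
      unfolding i[OF m] i[OF X1_scaleR(1)[OF m]] X2_scaleR
      by (rule sum.cong) (simp_all add: jump_linear(2)[OF m eF] mult.left_commute)
  qed
  have lin2: "linear_on (X2 E) (div_distr E)"
    unfolding linear_on_def
  proof (intro conjI ballI allI)
    fix v w assume v: "v \<in> X2 E" and w: "w \<in> X2 E"
    obtain a where a: "v = (\<Sum>e\<in>E. a e *\<^sub>R edge_delta e)" by (rule X2_cases[OF v])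
    obtain b where b: "w = (\<Sum>e\<in>E. b e *\<^sub>R edge_delta e)" by (rule X2_cases[OF w])
    show "div_distr E (v + w) = div_distr E v + div_distr E w"
      unfolding a b X2_add div_distr_eq
      by (simp only: scaleR_add_left sum.distrib linear_add[OF linear_pt_delta])
  next
    fix c v assume v: "v \<in> X2 E"
    obtain a where a: "v = (\<Sum>e\<in>E. a e *\<^sub>R edge_delta e)" by (rule X2_cases[OF v])
    show "div_distr E (c *\<^sub>R v) = c *\<^sub>R div_distr E v"
      unfolding a X2_scaleR div_distr_eq
      by (simp only: scaleR_scaleR[symmetric] scaleR_sum_right[symmetric] linear_scale[OF linear_pt_delta])
  qed
  have "inc (eps u) = 0" if u: "u \<in> X0 K" for u
  proof -
    have "jump K (eps u) e = 0" if "e \<in> E" for e using jump_eps[OF u, of "fst e" "snd e"] eF[OF that] by simp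
    then show ?thesis by (simp add: i[OF eps_X1(1)[OF u]])
  qed
  moreover have "div_distr E (inc m) = 0" if m: "m \<in> X1 K" for m
  proof -
    have "(\<Sum>e\<in>E. (\<sigma> * jump K m e) *\<^sub>R end_force e y) = 0" if "y \<in> mesh_vertices K" for y
      using jump_equilibrium[OF m that]
      by (simp only: scaleR_scaleR[symmetric] scaleR_sum_right[symmetric] end_force_def scaleR_zero_right)
    then show ?thesis by (simp add: i[OF m] div_distr_eq linear_0[OF linear_pt_delta])
  qed
  moreover have "eps ` X0 K \<subseteq> X1 K" using eps_X1(1) by blast
  moreover have "inc ` X1 K \<subseteq> X2 E" using i by (auto simp: X2_def)
  moreover have "div_distr E ` X2 E \<subseteq> X3 K" by (auto simp: X2_def X3_def div_distr_eq)
  ultimately show "four_complex (X0 K) eps (X1 K) inc (X2 E) (div_distr E) (X3 K)"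
    using J0_iso J3_iso subspace_X1 subspace_X2 linear_on_eps lin1 lin2 by (simp add: four_complex_def lin_iso_def)
qed

subsection \<open>The explicit maps\<close>

lemma hat_field: "y \<in> mesh_vertices K \<Longrightarrow> (\<lambda>x. hat K y x *\<^sub>R L) \<in> X0 K"
proof -
  assume y: "y \<in> mesh_vertices K"
  note h = hat_props(1)[OF y, unfolded pw_linear_def mem_Collect_eq]
  have "\<exists>A b. linear A \<and> (\<forall>x\<in>T. hat K y x *\<^sub>R L = A x + b)" if "T \<in> K" for T
  proof -
    obtain A b where A: "linear A" "\<forall>x\<in>T. hat K y x = A x + b" using h \<open>T \<in> K\<close> by blast
    have "linear (\<lambda>x. A x *\<^sub>R L)" by (rule linearI) (simp_all add: linear_add[OF A(1)] linear_scale[OF A(1)] scaleR_add_left)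
    then show ?thesis using A(2) by (intro exI[of _ "\<lambda>x. A x *\<^sub>R L"] exI[of _ "b *\<^sub>R L"]) (simp add: scaleR_add_left)
  qed
  moreover have "continuous_on UNIV (\<lambda>x. hat K y x *\<^sub>R L)" using h by (intro continuous_on_scaleR continuous_on_const) blast
  ultimately show ?thesis using h by (auto simp: X0_def pw_linear_def periodic_def)
qed

lemma J0_hat: 
  assumes y: "y \<in> mesh_vertices K"
  shows "J0 K (\<lambda>x. hat K y x *\<^sub>R L) = vtx_dual K L y"
proof -
  have "J0 K (\<lambda>x. hat K y x *\<^sub>R L) = (\<Sum>z\<in>mesh_vertices K. vtx_dual K (if z = y then L else 0) z)"
    unfolding J0_eq by (rule sum.cong) (simp_all add: hat_props(2)[OF y])
  also have "\<dots> = vtx_dual K L y" by (rule sum_single[of "vtx_dual K", OF linear_vtx_dual finite_mesh_vertices y])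
  finally show ?thesis .
qed

lemma J1_psi:
  assumes e: "e \<in> E"
  shows "J1 K E (psi K e) = edge_dual E e"
proof -
  have "J1 K E (psi K e) = (\<Sum>g\<in>E. (if g = e then 1 else 0) *\<^sub>R edge_dual E g)"
    unfolding J1_eq by (rule sum.cong) (simp_all add: psi_props(2)[OF e])
  also have "\<dots> = 1 *\<^sub>R edge_dual E e" by (rule sum_single[of "\<lambda>a e. a *\<^sub>R edge_dual E e", OF linear_scaleR_elem finite_E e])
  finally show ?thesis by simp
qed

lemma edge_delta_sum: "e \<in> E \<Longrightarrow> (\<Sum>g\<in>E. (if g = e then 1 else 0) *\<^sub>R edge_delta g) = edge_delta e"
  using sum_single[of "\<lambda>a e. a *\<^sub>R edge_delta e", OF linear_scaleR_elem finite_E, of e 1] by simp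

lemma J2_edge_delta: "e \<in> E \<Longrightarrow> J2 K E (edge_delta e) = edge_chain e"
  using J2_eq[of "\<lambda>g. if g = e then 1 else 0"] edge_delta_sum[of e]
    sum_single[of "\<lambda>a e. a *\<^sub>R edge_chain e", OF linear_scaleR_elem finite_E, of e 1] by simp

lemma J3_div_edge_delta:
  assumes e: "e \<in> E"
  shows "J3 K (div_distr E (edge_delta e)) = vtx_chain (tangent e) (head e) - vtx_chain (tangent e) (tail e)"
proof -
  have "(\<Sum>g\<in>E. (if g = e then 1 else 0) *\<^sub>R end_force g y) = end_force e y" for y
    using sum_single[of "\<lambda>a g. a *\<^sub>R end_force g y", OF linear_scaleR_elem finite_E e, of 1] by simp
  then have "J3 K (div_distr E (edge_delta e)) = (\<Sum>y\<in>mesh_vertices K. vtx_chain (end_force e y) y)"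
    using div_distr_eq[of "\<lambda>g. if g = e then 1 else 0"] J3_eq[of "end_force e"] edge_delta_sum[OF e] by simp
  then have "J3 K (div_distr E (edge_delta e)) = (\<lambda>z. if z \<in> mesh_vertices K then end_force e z else 0)"
    by (simp only: vtx_chain_sum)
  then show ?thesis using head_tail_vertices[OF E_edges[OF e]]
    by (auto simp: fun_eq_iff vtx_chain_def end_force_def)
qed

text \<open>All edge forms of the value vanish, since the edges of the tetrahedron are represented by other
  elements of \<open>E\<close>.\<close>

lemma psi_val_0:
  assumes e: "e \<in> E" and T: "T \<in> tets K" and n: "\<And>k. k \<in> int_lattice \<Longrightarrow> \<not> ((+) k ` seg e) face_of T"
  shows "val K (psi K e) T = 0"
proof (rule tet_matrix_eqI[OF tets_simplex[OF T]])
  show "transpose (val K (psi K e) T) = val K (psi K e) T"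
    using reggeD(1)[OF X1_props(2)[OF psi_props(1)[OF e]] T] .
  show "transpose 0 = (0 :: mat3)" by (simp add: transpose_def vec_eq_iff)
  fix x z :: pt assume xz: "x \<noteq> z" "closed_segment x z face_of T"
  have "edge_rep E x z \<noteq> e"
  proof
    assume er: "edge_rep E x z = e"
    obtain k where k: "k \<in> int_lattice" "seg e = (+) k ` closed_segment x z" using edge_rep_seg[of x z] er by blast
    have "(+) (- k) ` seg e = closed_segment x z" unfolding k(2) by (rule translation_minus)
    then show False using n[OF lattice_minus[OF k(1)]] xz(2) by simp
  qed
  then have "edge_moment K (psi K e) (edge_rep E x z) = 0"
    using psi_props(2)[OF e edge_rep_in_E[OF xz(1) face_segment_subsimp[OF T xz]]] by simp
  then show "edge_form (val K (psi K e) T) x z = edge_form 0 x z"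
    using edge_form_moment[OF psi_props(1)[OF e] T xz] by (simp add: edge_form_def)
qed

text \<open>The tetrahedra around the edge \<open>g\<close> do not have \<open>e\<close> as an edge.\<close>

lemma jump_outside_patch:
  assumes e: "e \<in> E" and g: "g \<in> E" "g \<notin> patch K E e"
  shows "jump K (psi K e) g = 0"
proof -
  obtain x z where xz: "g = (x, z)" by force
  have ne: "x \<noteq> z" using E_subsimp[OF g(1)] xz by simp
  have v: "val K (psi K e) T = 0" if T: "T \<in> tets K" "seg g face_of T" for T
  proof (rule psi_val_0[OF e T(1)])
    fix k assume k: "k \<in> int_lattice"
    obtain l T0 where l: "l \<in> int_lattice" "T0 \<in> K" "T = (+) l ` T0" using T(1) by (auto simp: tets_def)
    show "\<not> ((+) k ` seg e) face_of T"
    proof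
      assume "((+) k ` seg e) face_of T"
      then have "((+) (- l + k) ` seg e) face_of T0" "((+) (- l) ` seg g) face_of T0"
        using T(2) by (simp_all only: l(3) face_of_translation_left translation_translation)
      then show False using g l k unfolding patch_def by (blast intro: lattice_add lattice_minus)
    qed
  qed
  have "face_jump K (psi K e) g F = 0" if F: "F \<in> subsimps K 2" "seg g face_of F" for F
  proof -
    have F': "F \<in> tri_star (closed_segment x z)" using F by (simp add: xz seg_def)
    note A = adj_tets[OF ne F']
    have "val K (psi K e) (adj_tet K F x (n_vec g F)) = 0" "val K (psi K e) (adj_tet K F x (- n_vec g F)) = 0"
      using v A face_of_trans[OF F(2)] by (simp_all add: xz)
    then show ?thesis by (simp add: face_jump_def xz)
  qed
  then show ?thesis by (simp add: jump_def)
qed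

lemma tangent_rev_edge: "tangent (rev_edge e) = - tangent e"
proof -
  obtain x z where "e = (x, z)" by force
  then show ?thesis using sgn_minus[of "z - x"] by (simp add: rev_edge_def tangent_def)
qed

lemma r0_explicit:
  assumes y: "y \<in> mesh_vertices K" and r: "\<forall>u\<in>X0 K. r (J0 K u) = J1 K E (eps u)"
  shows "r (vtx_dual K L y) = (\<Sum>e | e \<in> E \<and> (head e = y \<or> tail e = y). (L \<bullet> tangent_to y e) *\<^sub>R edge_dual E e)"
    "e \<in> E \<Longrightarrow> r (vtx_dual K L y) (edge_chain e) = (L \<bullet> tangent e) * (hat K y (head e) - hat K y (tail e))"
proof -
  let ?u = "\<lambda>x. hat K y x *\<^sub>R L"
  let ?a = "\<lambda>e. (L \<bullet> tangent e) * (hat K y (head e) - hat K y (tail e))"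
  have "edge_moment K (eps ?u) e = ?a e" if "e \<in> E" for e
    unfolding edge_moment_eps[OF hat_field[OF y] E_edges[OF that]]
    by (simp add: inner_diff_right inner_commute right_diff_distrib mult.commute)
  then have eq: "r (vtx_dual K L y) = (\<Sum>e\<in>E. ?a e *\<^sub>R edge_dual E e)"
    using r hat_field[OF y, of L] by (simp add: J0_hat[OF y, symmetric] J1_eq)
  show "r (vtx_dual K L y) (edge_chain e) = ?a e" if "e \<in> E"
    unfolding eq by (rule edge_dual_sum_apply[OF that])
  have a: "?a e = (if head e = y \<or> tail e = y then L \<bullet> tangent_to y e else 0)" if "e \<in> E" for e
    using head_neq_tail[OF E_edges[OF that]] head_tail_vertices[OF E_edges[OF that]]
    by (auto simp: hat_props(2)[OF y] tangent_to_def tangent_rev_edge)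
  have "(\<Sum>e\<in>E. ?a e *\<^sub>R edge_dual E e) =
      (\<Sum>e | e \<in> E \<and> (head e = y \<or> tail e = y). (L \<bullet> tangent_to y e) *\<^sub>R edge_dual E e)"
    by (rule sum.mono_neutral_cong_right) (use finite_E a in auto)
  then show "r (vtx_dual K L y) = (\<Sum>e | e \<in> E \<and> (head e = y \<or> tail e = y). (L \<bullet> tangent_to y e) *\<^sub>R edge_dual E e)"
    by (simp only: eq)
qed

lemma r1_explicit:
  assumes e: "e \<in> E" and r: "\<forall>u\<in>X1 K. r (J1 K E u) = J2 K E (inc u)"
    and i: "\<And>m. m \<in> X1 K \<Longrightarrow> inc m = (\<Sum>e\<in>E. (\<sigma> * jump K m e) *\<^sub>R edge_delta e)"
  shows "r (edge_dual E e) = \<sigma> *\<^sub>R (\<Sum>g\<in>patch K E e. jump K (psi K e) g *\<^sub>R edge_chain g)"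
    "g \<in> E \<Longrightarrow> edge_dual E g (r (edge_dual E e)) = \<sigma> * jump K (psi K e) g"
proof -
  have eq: "r (edge_dual E e) = (\<Sum>g\<in>E. (\<sigma> * jump K (psi K e) g) *\<^sub>R edge_chain g)"
    using r psi_props(1)[OF e] by (simp add: J1_psi[OF e, symmetric] i J2_eq)
  have "(\<Sum>g\<in>E. (\<sigma> * jump K (psi K e) g) *\<^sub>R edge_chain g) = (\<Sum>g\<in>patch K E e. (\<sigma> * jump K (psi K e) g) *\<^sub>R edge_chain g)"
    by (rule sum.mono_neutral_right) (use finite_E jump_outside_patch[OF e] in \<open>auto simp: patch_def\<close>)
  then show "r (edge_dual E e) = \<sigma> *\<^sub>R (\<Sum>g\<in>patch K E e. jump K (psi K e) g *\<^sub>R edge_chain g)"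
    by (simp add: eq scaleR_sum_right)
  have "(\<Sum>g\<in>E. (\<sigma> * jump K (psi K e) g) *\<^sub>R edge_chain g) \<in> chains1 E"
    by (intro subspace_sum subspace_scale subspace_chains1 edge_chain_in)
  then show "edge_dual E g (r (edge_dual E e)) = \<sigma> * jump K (psi K e) g" if "g \<in> E"
    unfolding eq by (simp add: edge_dual_def edge_chain_sum[OF that])
qed

lemma r2_explicit:
  assumes e: "e \<in> E" and r: "\<forall>w\<in>X2 E. r (J2 K E w) = J3 K (div_distr E w)"
  shows "r (edge_chain e) = vtx_chain (tangent e) (head e) - vtx_chain (tangent e) (tail e)"
proof -
  have "edge_delta e \<in> X2 E" unfolding X2_def edge_delta_sum[OF e, symmetric] by (rule CollectI) (rule exI[of _ "\<lambda>g. if g = e then 1 else 0"], simp)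
  then show ?thesis using r by (simp add: J2_edge_delta[OF e, symmetric] J3_div_edge_delta[OF e])
qed

end

theorem mainTheorem1:
  fixes K :: "pt set set" and E :: "edge set"
    and inc :: "mat3 field_class \<Rightarrow> (pt \<Rightarrow> mat3) \<Rightarrow> real" and \<sigma> :: real
  assumes mesh: "torus_mesh K"
    and orient: "orientation K E"
    and inc: "(inc = inc_jump K E \<and> \<sigma> = 1) \<or> (inc = inc_distr \<and> \<sigma> = -1)"
  shows
    "lin_iso (X0 K) (cochains0V K) (J0 K) \<and>
     lin_iso (X1 K) (cochains1 E) (J1 K E) \<and>
     lin_iso (X2 E) (chains1 E) (J2 K E) \<and>
     lin_iso (X3 K) (chains0V K) (J3 K) \<and>
     four_complex (X0 K) eps (X1 K) inc (X2 E) (div_distr E) (X3 K) \<and>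
     (\<exists>r0 r1 r2. linear_on (cochains0V K) r0 \<and> linear_on (cochains1 E) r1 \<and>
        linear_on (chains1 E) r2 \<and>
        (\<forall>u\<in>X0 K. r0 (J0 K u) = J1 K E (eps u)) \<and>
        (\<forall>u\<in>X1 K. r1 (J1 K E u) = J2 K E (inc u)) \<and>
        (\<forall>w\<in>X2 E. r2 (J2 K E w) = J3 K (div_distr E w))) \<and>
     (\<forall>r0 r1 r2. linear_on (cochains0V K) r0 \<and> linear_on (cochains1 E) r1 \<and>
        linear_on (chains1 E) r2 \<and>
        (\<forall>u\<in>X0 K. r0 (J0 K u) = J1 K E (eps u)) \<and>
        (\<forall>u\<in>X1 K. r1 (J1 K E u) = J2 K E (inc u)) \<and>
        (\<forall>w\<in>X2 E. r2 (J2 K E w) = J3 K (div_distr E w)) \<longrightarrow>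
        four_complex (cochains0V K) r0 (cochains1 E) r1 (chains1 E) r2 (chains0V K) \<and>
        (\<forall>y\<in>mesh_vertices K. \<forall>L.
           r0 (vtx_dual K L y) =
             (\<Sum>e | e \<in> E \<and> (head e = y \<or> tail e = y). (L \<bullet> tangent_to y e) *\<^sub>R edge_dual E e) \<and>
           (\<forall>e\<in>E. r0 (vtx_dual K L y) (edge_chain e) =
              (L \<bullet> tangent e) * (hat K y (head e) - hat K y (tail e)))) \<and>
        (\<forall>e\<in>E.
           r1 (edge_dual E e) = \<sigma> *\<^sub>R (\<Sum>g\<in>patch K E e. jump K (psi K e) g *\<^sub>R edge_chain g) \<and>
           (\<forall>g\<in>E. edge_dual E g (r1 (edge_dual E e)) = \<sigma> * jump K (psi K e) g)) \<and>
        (\<forall>e\<in>E. r2 (edge_chain e) =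
           vtx_chain (tangent e) (head e) - vtx_chain (tangent e) (tail e)))"
proof -
  interpret oriented_mesh K E by unfold_locales (fact mesh orient)+
  note iso = J0_iso J1_iso J2_iso J3_iso
  note cx = christiansen_complex[OF inc]
  note c = cx(1)[unfolded four_complex_def]
  have lin: "linear_on (X0 K) (\<lambda>u. J1 K E (eps u))" "linear_on (X1 K) (\<lambda>u. J2 K E (inc u))"
    "linear_on (X2 E) (\<lambda>w. J3 K (div_distr E w))"
    by (rule linear_on_compose[of _ eps "X1 K" "J1 K E"] linear_on_compose[of _ inc "X2 E" "J2 K E"]
      linear_on_compose[of _ "div_distr E" "X3 K" "J3 K"], use c iso in \<open>simp_all add: lin_iso_def\<close>)+
  obtain r0 where r0: "linear_on (cochains0V K) r0" "\<forall>u\<in>X0 K. r0 (J0 K u) = J1 K E (eps u)"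
    using lin_iso_induced[OF iso(1) lin(1)] by blast
  obtain r1 where r1: "linear_on (cochains1 E) r1" "\<forall>u\<in>X1 K. r1 (J1 K E u) = J2 K E (inc u)"
    using lin_iso_induced[OF iso(2) lin(2)] by blast
  obtain r2 where r2: "linear_on (chains1 E) r2" "\<forall>w\<in>X2 E. r2 (J2 K E w) = J3 K (div_distr E w)"
    using lin_iso_induced[OF iso(3) lin(3)] by blast
  show ?thesis
    apply (intro conjI iso cx(1))
    subgoal using r0 r1 r2 by blast
    subgoal
    proof (intro allI impI, elim conjE, intro conjI ballI allI)
      fix r0 r1 r2
      assume r: "linear_on (cochains0V K) r0" "linear_on (cochains1 E) r1" "linear_on (chains1 E) r2"
        "\<forall>u\<in>X0 K. r0 (J0 K u) = J1 K E (eps u)" "\<forall>u\<in>X1 K. r1 (J1 K E u) = J2 K E (inc u)"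
        "\<forall>w\<in>X2 E. r2 (J2 K E w) = J3 K (div_distr E w)"
      show "four_complex (cochains0V K) r0 (cochains1 E) r1 (chains1 E) r2 (chains0V K)"
        by (rule four_complex_transport[OF cx(1) iso]) (fact r)+
      show "r0 (vtx_dual K L y) =
             (\<Sum>e | e \<in> E \<and> (head e = y \<or> tail e = y). (L \<bullet> tangent_to y e) *\<^sub>R edge_dual E e)"
        if "y \<in> mesh_vertices K" for y L by (rule r0_explicit(1)[OF that r(4)])
      show "r0 (vtx_dual K L y) (edge_chain e) = (L \<bullet> tangent e) * (hat K y (head e) - hat K y (tail e))"
        if "y \<in> mesh_vertices K" "e \<in> E" for y L e by (rule r0_explicit(2)[OF that(1) r(4) that(2)])
      show "r1 (edge_dual E e) = \<sigma> *\<^sub>R (\<Sum>g\<in>patch K E e. jump K (psi K e) g *\<^sub>R edge_chain g)"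
        if "e \<in> E" for e by (rule r1_explicit(1)[OF that r(5) cx(2)])
      show "edge_dual E g (r1 (edge_dual E e)) = \<sigma> * jump K (psi K e) g"
        if "e \<in> E" "g \<in> E" for e g by (rule r1_explicit(2)[OF that(1) r(5) cx(2) that(2)])
      show "r2 (edge_chain e) = vtx_chain (tangent e) (head e) - vtx_chain (tangent e) (tail e)"
        if "e \<in> E" for e by (rule r2_explicit[OF that r(6)])
    qed
    done
qed

end
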